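(* Let $l,m\in\mathbb N^+$ be relatively prime and let $M^{m:l}(s,\kappa)$ be the Melnikov function of the system $\dot x=f(x)+\varepsilon g(x,t;T,\varepsilon)$, depending on a scalar parameter $\kappa$ which is either a parameter of the vector fields or the parameter $\lambda$ of the family $\mathcal P$ of $m$-normal periodic orbits of the conservative limit. Assume that $M^{m:l}$ has a quadratic zero at $(s_0,\kappa_0)$, i.e. $$M^{m:l}(s_0,\kappa_0)=D_sM^{m:l}(s_0,\kappa_0)=0,\qquad D^2_{ss}M^{m:l}(s_0,\kappa_0)\neq0 .$$ If $D_\kappa M^{m:l}(s_0,\kappa_0)\neq0$, then, for small $\varepsilon>0$, there is a bifurcation value $\kappa_{sn}=\kappa_0+O(\varepsilon)$ at which a saddle-node bifurcation of periodic orbits occurs. If $D_\kappa M^{m:l}(s_0,\kappa_0)=0$ and $\det\big(D^2M^{m:l}(s_0,\kappa_0)\big)>0$ (resp. $<0$), where $D^2M^{m:l}$ is the Hessian in $(s,\kappa)$, then isola births (resp. simple bifurcations) arise for small $\varepsilon>0$.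
   Context: **Mechanical system.** Let $N\ge1$, $n=2N$, $U\subset\mathbb R^N$ open, $q\in U$ generalised coordinates. The energy is $H(q,\dot q)=E(q,\dot q)+V(q)=\tfrac12\langle\dot q,\mathbf M(q)\dot q\rangle+V(q)$, with $\mathbf M(q)$ a symmetric positive definite mass matrix. The equations of motion are $\mathbf M(q)\ddot q+G(q,\dot q)+DV(q)=\varepsilon Q(q,\dot q,t;T,\varepsilon)$, where $\varepsilon\ge0$ is the perturbation parameter, $G(q,\dot q)=D_t(\mathbf M(q))\dot q-D_qE(q,\dot q)$, and $Q$ is $T$-periodic in $t$. With $x=(q,\dot q)\in\mathbb R^n$ this reads $\dot x=f(x)+\varepsilon g(x,t;T,\varepsilon)$, where $$f(x)=\begin{pmatrix}\dot q\\-\mathbf M^{-1}(q)(DV(q)+G(q,\dot q))\end{pmatrix},\qquad g(x,t;T,\varepsilon)=\begin{pmatrix}0\\ \mathbf M^{-1}(q)Q(q,\dot q,t;T,\varepsilon)\end{pmatrix}.$$ $f$ is $C^r$, and $g$ is $C^{r-1}$ in $t$ and $C^r$ in the other arguments; any further parameter dependence is $C^r$; $r$ is large enough ($r\ge3$) for the second derivatives used to exist and be continuous. $x(t;\xi,T,\varepsilon)$ is the trajectory starting from $\xi$ at $t=0$, and $x_0(t;\xi)=x(t;\xi,T,0)$; $H$ is conserved along $x_0$. **$m$-normality.** For a periodic orbit $\mathcal Z$ of $\dot x=f(x)$ of minimal period $\tau>0$ and $p\in\mathcal Z$, let $\Pi(p)=Y(\tau;p)$ be the monodromy matrix, where $\dot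 Y=Df(x_0(t;p))Y$, $Y(0)=I$. Let $\mu_{g,m}$ be the geometric multiplicity of the eigenvalue $+1$ of $\Pi^m(p)$. $\mathcal Z$ is $m$-normal if either (a) $\mu_{g,m}=1$, or (b) $\mu_{g,m}=2$ and $f(p)\notin\mathrm{range}(\Pi^m(p)-I)$. An $m$-normal orbit belongs to a one-parameter family $\mathcal P$ of $m$-normal periodic orbits, with family parameter $\lambda\in\mathbb R$. **Parametrisation $L$.** The family parameter is given by a $C^r$ scalar mapping $\lambda=L(\xi,\cdot)$ depending on the initial condition and on a period, invariant under translations of $\xi$ along the orbit. Locally there are smooth maps $\lambda\mapsto\vartheta(\lambda)$ (initial condition on a Poincaré section) and $\lambda\mapsto\mathcal T(\lambda)$ (minimal period) parametrising the family, with $L(x_0(t;\vartheta(\lambda)),m\mathcal T(\lambda))=\lambda$ for all $t$. **Melnikov function with parameter.** For $\kappa$ near $\kappa_0$ let $\mathcal Z_\kappa$ be the unperturbed $m$-normal orbit under consideration (if $\kappa=\lambda$: the member of $\mathcal P$ with parameter $\lambda=\kappa$; if $\kappa$ is a parameter of the vector fields: the orbit with the fixed value of $\lambda$), with base point $p(\kappa)$, minimal period $\tau(\kappa)$ and family parameter value $\lambda(\kappa)$, all depending smoothly on $\kappa$. Then $$M^{m:l}(s,\kappa)=\int_0^{m\tau}\big\langle DH(x_0(t+s;p)),\,g(x_0(t+s;p),t;\tau m/l,0)\big\rangle\,dt ,$$ with $p,\tau,H,g,x_0$ evaluated at $\kappa$. **Perturbed solutions.** For $\varepsilon>0$, perturbed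 periodic orbits are the solutions $(\xi,T)$ of $$x(lT;\xi,T,\varepsilon)=\xi,\qquad L(\xi,lT)=\lambda(\kappa)$$ of the form $\xi=z+\varepsilon\delta$, with $z=x_0(s;p(\kappa))$, $\langle\delta,f(z)\rangle=0$, and $lT=m\tau(\kappa)+\varepsilon\sigma$, where $(\delta,\sigma)$ is bounded uniformly in $\varepsilon$. Let $S_\varepsilon$ be the set of $(s,\kappa)$ in a sufficiently small fixed neighbourhood of $(s_0,\kappa_0)$ for which such a perturbed solution exists. **Bifurcation terminology** (local near $(s_0,\kappa_0)$, for small $\varepsilon>0$). - *Saddle-node bifurcation at $\kappa_{sn}$* (limit or fold): there are two perturbed periodic orbits for $\kappa$ on one side of $\kappa_{sn}$; they merge into a locally unique one at $\kappa=\kappa_{sn}$; there are none on the other side. - *Isola birth*: for each small $\varepsilon>0$, $S_\varepsilon$ is either empty, or a single point, or a closed curve (an isola). - *Simple bifurcation*: for each small $\varepsilon>0$, $S_\varepsilon$ is either two curves crossing at one point (node singularity), or two disjoint arcs that both continue across all nearby $\kappa$ (bottleneck), or two disjoint arcs separated by a gap in $\kappa$, each having a fold in $\kappa$ (isola detachment). At leading order these last two correspond to the germ $M^{m:l}$ at $(s_0,\kappa_0)$ having normal form $s^2+\kappa^2$ and $s^2-\kappa^2$, respectively, up to sign. *)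

theory Defs
  imports "HOL-Analysis.Analysis" "HOL-Library.Landau_Symbols"
begin

section \<open>Regularity\<close>

text \<open>
  \<open>Ck_on k f S\<close>: all iterated directional derivatives of \<open>f\<close> up to order \<open>k\<close> exist and are
  continuous on \<open>S\<close>. Derivatives are taken within \<open>S\<close>, so that one-sided derivatives are used at
  the boundary point \<open>0\<close> of the perturbation parameter. The sets used below are open, or products
  of open sets with \<open>{0..<\<epsilon>\<^sub>m}\<close>, so derivatives within \<open>S\<close> are unique.
\<close>

primrec Ck_on :: "nat \<Rightarrow> ('a::euclidean_space \<Rightarrow> 'b::real_normed_vector) \<Rightarrow> 'a set \<Rightarrow> bool" where
  "Ck_on 0 f S \<longleftrightarrow> continuous_on S f"
| "Ck_on (Suc k) f S \<longleftrightarrow> f differentiable_on S \<and>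
     (\<forall>v. Ck_on k (\<lambda>x. frechet_derivative f (at x within S) v) S)"

text \<open>
  \<open>G y t\<close> is \<open>k\<close> times differentiable in \<open>y\<close>, with all these \<open>y\<close>-derivatives continuous in
  \<open>(y, t)\<close> jointly.
\<close>

primrec Ck_fst_on :: "nat \<Rightarrow> ('a::euclidean_space \<Rightarrow> 't::euclidean_space \<Rightarrow> 'b::real_normed_vector)
    \<Rightarrow> 'a set \<Rightarrow> 't set \<Rightarrow> bool" where
  "Ck_fst_on 0 G Y I \<longleftrightarrow> continuous_on (Y \<times> I) (\<lambda>(y, t). G y t)"
| "Ck_fst_on (Suc k) G Y I \<longleftrightarrow> continuous_on (Y \<times> I) (\<lambda>(y, t). G y t) \<and>
     (\<forall>t\<in>I. (\<lambda>y. G y t) differentiable_on Y) \<and>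
     (\<forall>v. Ck_fst_on k (\<lambda>y t. frechet_derivative (\<lambda>y. G y t) (at y within Y) v) Y I)"

definition grad :: "('a::euclidean_space \<Rightarrow> real) \<Rightarrow> 'a \<Rightarrow> 'a" where
  "grad h x = (\<Sum>b\<in>Basis. frechet_derivative h (at x) b *\<^sub>R b)"


section \<open>Mechanical systems\<close>

type_synonym 'n state = "(real^'n) \<times> (real^'n)"

definition kinetic :: "(real^'n \<Rightarrow> real^'n^'n) \<Rightarrow> 'n state \<Rightarrow> real" where
  "kinetic M = (\<lambda>(q, v). 1/2 * (v \<bullet> (M q *v v)))"

definition energy :: "(real^'n \<Rightarrow> real^'n^'n) \<Rightarrow> (real^'n \<Rightarrow> real) \<Rightarrow> 'n state \<Rightarrow> real" where
  "energy M V = (\<lambda>(q, v). kinetic M (q, v) + V q)"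

text \<open>The time derivative of \<open>M (q t)\<close> along a motion with velocity \<open>v\<close> is \<open>DM(q)[v]\<close>.\<close>

definition inertial :: "(real^'n \<Rightarrow> real^'n^'n) \<Rightarrow> 'n state \<Rightarrow> real^'n" where
  "inertial M = (\<lambda>(q, v). frechet_derivative M (at q) v *v v - grad (\<lambda>q'. kinetic M (q', v)) q)"

definition conservative_field ::
    "(real^'n \<Rightarrow> real^'n^'n) \<Rightarrow> (real^'n \<Rightarrow> real) \<Rightarrow> 'n state \<Rightarrow> 'n state" where
  "conservative_field M V =
     (\<lambda>(q, v). (v, - (matrix_inv (M q) *v (grad V q + inertial M (q, v)))))"

text \<open>The arguments of the force \<open>Q\<close> are: state, time \<open>t\<close>, period \<open>T\<close>, \<open>\<epsilon>\<close>.\<close>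

definition perturbation_field ::
    "(real^'n \<Rightarrow> real^'n^'n) \<Rightarrow> ('n state \<Rightarrow> real \<Rightarrow> real \<Rightarrow> real \<Rightarrow> real^'n)
      \<Rightarrow> 'n state \<Rightarrow> real \<Rightarrow> real \<Rightarrow> real \<Rightarrow> 'n state" where
  "perturbation_field M Q = (\<lambda>(q, v) t T \<epsilon>. (0, matrix_inv (M q) *v Q (q, v) t T \<epsilon>))"

text \<open>
  All data carry a leading scalar parameter \<open>\<kappa>\<close> ranging over \<open>K\<close>. The perturbation field is
  jointly of class \<open>C^(r-1)\<close> and of class \<open>C^r\<close> in all arguments other than \<open>t\<close>.
\<close>

definition mechanical_system ::
    "nat \<Rightarrow> real set \<Rightarrow> (real^'n) set \<Rightarrow> real \<Rightarrow> (real \<Rightarrow> real^'n \<Rightarrow> real^'n^'n)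
      \<Rightarrow> (real \<Rightarrow> real^'n \<Rightarrow> real) \<Rightarrow> (real \<Rightarrow> 'n state \<Rightarrow> real \<Rightarrow> real \<Rightarrow> real \<Rightarrow> real^'n) \<Rightarrow> bool" where
  "mechanical_system r K U \<epsilon>\<^sub>m M V Q \<longleftrightarrow>
     open K \<and> open U \<and> 0 < \<epsilon>\<^sub>m \<and>
     (\<forall>\<kappa>\<in>K. \<forall>q\<in>U. transpose (M \<kappa> q) = M \<kappa> q \<and> (\<forall>v. v \<noteq> 0 \<longrightarrow> 0 < v \<bullet> (M \<kappa> q *v v))) \<and>
     Ck_on r (\<lambda>(\<kappa>, q). M \<kappa> q) (K \<times> U) \<and>
     Ck_on r (\<lambda>(\<kappa>, q). V \<kappa> q) (K \<times> U) \<and>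
     Ck_on r (\<lambda>(\<kappa>, x). conservative_field (M \<kappa>) (V \<kappa>) x) (K \<times> (U \<times> UNIV)) \<and>
     Ck_on (r - 1) (\<lambda>((\<kappa>, x, T, \<epsilon>), t). perturbation_field (M \<kappa>) (Q \<kappa>) x t T \<epsilon>)
       ((K \<times> (U \<times> UNIV) \<times> {0<..} \<times> {0..<\<epsilon>\<^sub>m}) \<times> UNIV) \<and>
     Ck_fst_on r (\<lambda>(\<kappa>, x, T, \<epsilon>) t. perturbation_field (M \<kappa>) (Q \<kappa>) x t T \<epsilon>)
       (K \<times> (U \<times> UNIV) \<times> {0<..} \<times> {0..<\<epsilon>\<^sub>m}) UNIV \<and>
     (\<forall>\<kappa>\<in>K. \<forall>x\<in>U \<times> UNIV. \<forall>t. \<forall>T>0. \<forall>\<epsilon>\<in>{0..<\<epsilon>\<^sub>m}. Q \<kappa> x (t + T) T \<epsilon> = Q \<kappa> x t T \<epsilon>)"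


section \<open>Trajectories, periodic orbits and m-normality\<close>

text \<open>
  Some solution in \<open>D\<close> of \<open>x' = F t x\<close>, defined between the times \<open>0\<close> and \<open>t\<close> (of either sign),
  leads from \<open>\<xi>\<close> at time \<open>0\<close> to \<open>y\<close> at time \<open>t\<close>.
\<close>

definition flows_to ::
    "(real \<Rightarrow> 'a::real_normed_vector \<Rightarrow> 'a) \<Rightarrow> 'a set \<Rightarrow> 'a \<Rightarrow> real \<Rightarrow> 'a \<Rightarrow> bool" where
  "flows_to F D \<xi> t y \<longleftrightarrow> (\<exists>x. x 0 = \<xi> \<and> x t = y \<and>
     (\<forall>u\<in>closed_segment 0 t. x u \<in> D \<and>
        (x has_vector_derivative F u (x u)) (at u within closed_segment 0 t)))"

definition traj :: "('a::real_normed_vector \<Rightarrow> 'a) \<Rightarrow> 'a set \<Rightarrow> 'a \<Rightarrow> real \<Rightarrow> 'a" where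
  "traj f D \<xi> t = (THE y. flows_to (\<lambda>_. f) D \<xi> t y)"

definition periodic_orbit ::
    "('a::real_normed_vector \<Rightarrow> 'a) \<Rightarrow> 'a set \<Rightarrow> 'a \<Rightarrow> real \<Rightarrow> bool" where
  "periodic_orbit f D p \<tau> \<longleftrightarrow> 0 < \<tau> \<and> flows_to (\<lambda>_. f) D p \<tau> p \<and>
     (\<forall>t\<in>{0<..<\<tau>}. \<not> flows_to (\<lambda>_. f) D p t p)"

text \<open>Matrices over the state space are represented by bounded linear operators.\<close>

definition monodromy ::
    "('a::euclidean_space \<Rightarrow> 'a) \<Rightarrow> 'a set \<Rightarrow> 'a \<Rightarrow> real \<Rightarrow> ('a \<Rightarrow>\<^sub>L 'a) \<Rightarrow> bool" where
  "monodromy f D p \<tau> P \<longleftrightarrow> (\<exists>Y. Y 0 = id_blinfun \<and> Y \<tau> = P \<and>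
     (\<forall>t\<in>{0..\<tau>}. (Y has_vector_derivative
        Blinfun (frechet_derivative f (at (traj f D p t))) o\<^sub>L Y t) (at t within {0..\<tau>})))"

definition m_normal ::
    "nat \<Rightarrow> ('a::euclidean_space \<Rightarrow> 'a) \<Rightarrow> 'a set \<Rightarrow> 'a \<Rightarrow> real \<Rightarrow> bool" where
  "m_normal m f D p \<tau> \<longleftrightarrow> (\<exists>P. monodromy f D p \<tau> P \<and>
     (dim {v. (blinfun_apply P ^^ m) v = v} = 1 \<or>
      dim {v. (blinfun_apply P ^^ m) v = v} = 2 \<and>
        f p \<notin> range (\<lambda>v. (blinfun_apply P ^^ m) v - v)))"

text \<open>
  For each \<open>\<kappa>\<close>, a one-parameter family of m-normal orbits, parametrised by \<open>\<mu>\<close> in the open set \<open>\<Lambda>\<close>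
  through initial conditions \<open>\<theta> \<kappa> \<mu>\<close> on a Poincare section (a hyperplane with normal \<open>\<nu>\<close>) and
  minimal periods \<open>Per \<kappa> \<mu>\<close>; \<open>L \<kappa> \<xi> T\<close> recovers the family parameter \<open>\<mu>\<close> at each point of
  the orbit.
\<close>

definition orbit_family ::
    "nat \<Rightarrow> nat \<Rightarrow> real set \<Rightarrow> (real \<Rightarrow> 'a::euclidean_space \<Rightarrow> 'a) \<Rightarrow> 'a set
      \<Rightarrow> (real \<Rightarrow> 'a \<Rightarrow> real \<Rightarrow> real) \<Rightarrow> real set \<Rightarrow> (real \<Rightarrow> real \<Rightarrow> 'a) \<Rightarrow> (real \<Rightarrow> real \<Rightarrow> real) \<Rightarrow> bool" where
  "orbit_family r m K f D L \<Lambda> \<theta> Per \<longleftrightarrow>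
     open \<Lambda> \<and>
     Ck_on r (\<lambda>(\<kappa>, \<xi>, T). L \<kappa> \<xi> T) (K \<times> D \<times> {0<..}) \<and>
     (\<forall>\<kappa>\<in>K.
        Ck_on r (\<theta> \<kappa>) \<Lambda> \<and> Ck_on r (Per \<kappa>) \<Lambda> \<and>
        (\<exists>\<nu> c. \<forall>\<mu>\<in>\<Lambda>. \<nu> \<bullet> \<theta> \<kappa> \<mu> = c \<and> \<nu> \<bullet> f \<kappa> (\<theta> \<kappa> \<mu>) \<noteq> 0) \<and>
        (\<forall>\<mu>\<in>\<Lambda>. periodic_orbit (f \<kappa>) D (\<theta> \<kappa> \<mu>) (Per \<kappa> \<mu>) \<and>
           m_normal m (f \<kappa>) D (\<theta> \<kappa> \<mu>) (Per \<kappa> \<mu>) \<and>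
           (\<forall>t. L \<kappa> (traj (f \<kappa>) D (\<theta> \<kappa> \<mu>) t) (real m * Per \<kappa> \<mu>) = \<mu>)))"

text \<open>
  The orbit under consideration for the parameter value \<open>\<kappa>\<close> is the member of the family with
  parameter \<open>lam \<kappa>\<close>; \<open>p \<kappa>\<close> is a base point on it and \<open>\<tau> \<kappa>\<close> its minimal period.
\<close>

definition selected_orbit ::
    "nat \<Rightarrow> real set \<Rightarrow> (real \<Rightarrow> 'a::euclidean_space \<Rightarrow> 'a) \<Rightarrow> 'a set
      \<Rightarrow> real set \<Rightarrow> (real \<Rightarrow> real \<Rightarrow> 'a) \<Rightarrow> (real \<Rightarrow> real \<Rightarrow> real)
      \<Rightarrow> (real \<Rightarrow> 'a) \<Rightarrow> (real \<Rightarrow> real) \<Rightarrow> (real \<Rightarrow> real) \<Rightarrow> bool" where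
  "selected_orbit r K f D \<Lambda> \<theta> Per p \<tau> lam \<longleftrightarrow>
     Ck_on r p K \<and> Ck_on r \<tau> K \<and> Ck_on r lam K \<and>
     (\<forall>\<kappa>\<in>K. lam \<kappa> \<in> \<Lambda> \<and> \<tau> \<kappa> = Per \<kappa> (lam \<kappa>) \<and>
        (\<exists>t. flows_to (\<lambda>_. f \<kappa>) D (\<theta> \<kappa> (lam \<kappa>)) t (p \<kappa>)))"


section \<open>Melnikov function and perturbed solutions\<close>

definition melnikov ::
    "('a::euclidean_space \<Rightarrow> 'a) \<Rightarrow> ('a \<Rightarrow> real \<Rightarrow> real \<Rightarrow> real \<Rightarrow> 'a) \<Rightarrow> ('a \<Rightarrow> real) \<Rightarrow> 'a set
      \<Rightarrow> 'a \<Rightarrow> real \<Rightarrow> nat \<Rightarrow> nat \<Rightarrow> real \<Rightarrow> real" where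
  "melnikov f g H D p \<tau> m l s =
     integral {0..real m * \<tau>} (\<lambda>t. grad H (traj f D p (t + s)) \<bullet>
       g (traj f D p (t + s)) t (\<tau> * real m / real l) 0)"

definition D1 :: "(real \<Rightarrow> real \<Rightarrow> real) \<Rightarrow> real \<Rightarrow> real \<Rightarrow> real" where
  "D1 F s \<kappa> = deriv (\<lambda>s. F s \<kappa>) s"

definition D2 :: "(real \<Rightarrow> real \<Rightarrow> real) \<Rightarrow> real \<Rightarrow> real \<Rightarrow> real" where
  "D2 F s \<kappa> = deriv (\<lambda>\<kappa>. F s \<kappa>) \<kappa>"

definition hessian :: "(real \<Rightarrow> real \<Rightarrow> real) \<Rightarrow> real \<Rightarrow> real \<Rightarrow> real^2^2" where
  "hessian F s \<kappa> = vector [vector [D1 (D1 F) s \<kappa>, D2 (D1 F) s \<kappa>],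
                          vector [D1 (D2 F) s \<kappa>, D2 (D2 F) s \<kappa>]]"

text \<open>
  Solutions \<open>(\<xi>, T)\<close> of the periodicity problem with phase \<open>s\<close>; \<open>C\<close> is the bound on \<open>(\<delta>, \<sigma>)\<close>,
  to be chosen independently of \<open>\<epsilon>\<close>.
\<close>

definition perturbed_solutions ::
    "('a::euclidean_space \<Rightarrow> 'a) \<Rightarrow> ('a \<Rightarrow> real \<Rightarrow> real \<Rightarrow> real \<Rightarrow> 'a) \<Rightarrow> ('a \<Rightarrow> real \<Rightarrow> real) \<Rightarrow> 'a set
      \<Rightarrow> 'a \<Rightarrow> real \<Rightarrow> real \<Rightarrow> nat \<Rightarrow> nat \<Rightarrow> real \<Rightarrow> real \<Rightarrow> real \<Rightarrow> ('a \<times> real) set" where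
  "perturbed_solutions f g L D p \<tau> lam m l C \<epsilon> s = {(\<xi>, T). 0 < T \<and>
     flows_to (\<lambda>t x. f x + \<epsilon> *\<^sub>R g x t T \<epsilon>) D \<xi> (real l * T) \<xi> \<and>
     L \<xi> (real l * T) = lam \<and>
     (\<exists>\<delta> \<sigma>. \<xi> = traj f D p s + \<epsilon> *\<^sub>R \<delta> \<and> \<delta> \<bullet> f (traj f D p s) = 0 \<and>
        real l * T = real m * \<tau> + \<epsilon> * \<sigma> \<and> norm (\<delta>, \<sigma>) \<le> C)}"


section \<open>Local bifurcations\<close>

text \<open>
  \<open>P \<kappa>\<close> is the set of periodic orbits at parameter value \<open>\<kappa>\<close>. On one side of \<open>\<kappa>\<^sub>s\<^sub>n\<close> it consists of
  two continuous branches, which merge at \<open>\<kappa>\<^sub>s\<^sub>n\<close>; \<open>d\<close> tells on which side.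
\<close>

definition saddle_node :: "(real \<Rightarrow> 'b::topological_space set) \<Rightarrow> real set \<Rightarrow> real \<Rightarrow> bool" where
  "saddle_node P J \<kappa>\<^sub>s\<^sub>n \<longleftrightarrow> \<kappa>\<^sub>s\<^sub>n \<in> interior J \<and>
     (\<exists>d\<in>{1, -1}. \<exists>x1 x2.
        continuous_on {\<kappa>\<in>J. 0 \<le> d * (\<kappa> - \<kappa>\<^sub>s\<^sub>n)} x1 \<and>
        continuous_on {\<kappa>\<in>J. 0 \<le> d * (\<kappa> - \<kappa>\<^sub>s\<^sub>n)} x2 \<and>
        (\<forall>\<kappa>\<in>J. 0 < d * (\<kappa> - \<kappa>\<^sub>s\<^sub>n) \<longrightarrow> x1 \<kappa> \<noteq> x2 \<kappa> \<and> P \<kappa> = {x1 \<kappa>, x2 \<kappa>}) \<and>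
        x1 \<kappa>\<^sub>s\<^sub>n = x2 \<kappa>\<^sub>s\<^sub>n \<and> P \<kappa>\<^sub>s\<^sub>n = {x1 \<kappa>\<^sub>s\<^sub>n} \<and>
        (\<forall>\<kappa>\<in>J. d * (\<kappa> - \<kappa>\<^sub>s\<^sub>n) < 0 \<longrightarrow> P \<kappa> = {}))"

text \<open>In the following, \<open>S\<close> is a set of pairs \<open>(s, \<kappa>)\<close> with \<open>\<kappa>\<close> in the interval \<open>{k0..k1}\<close>.\<close>

definition isola_birth :: "(real \<times> real) set \<Rightarrow> bool" where
  "isola_birth S \<longleftrightarrow> S = {} \<or> (\<exists>c. S = {c}) \<or>
     (\<exists>\<gamma>. simple_path \<gamma> \<and> pathfinish \<gamma> = pathstart \<gamma> \<and> path_image \<gamma> = S)"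

definition spanning_arc :: "real \<Rightarrow> real \<Rightarrow> (real \<Rightarrow> real \<times> real) \<Rightarrow> bool" where
  "spanning_arc k0 k1 \<gamma> \<longleftrightarrow> arc \<gamma> \<and> snd ` path_image \<gamma> = {k0..k1}"

text \<open>Crossing means that the tangents at the common point are linearly independent.\<close>

definition node_singularity :: "real \<Rightarrow> real \<Rightarrow> (real \<times> real) set \<Rightarrow> bool" where
  "node_singularity k0 k1 S \<longleftrightarrow> (\<exists>\<gamma>1 \<gamma>2. spanning_arc k0 k1 \<gamma>1 \<and> spanning_arc k0 k1 \<gamma>2 \<and>
     S = path_image \<gamma>1 \<union> path_image \<gamma>2 \<and>
     (\<exists>t1\<in>{0<..<1}. \<exists>t2\<in>{0<..<1}. \<exists>v1 v2.
        path_image \<gamma>1 \<inter> path_image \<gamma>2 = {\<gamma>1 t1} \<and> \<gamma>1 t1 = \<gamma>2 t2 \<and>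
        (\<gamma>1 has_vector_derivative v1) (at t1) \<and> (\<gamma>2 has_vector_derivative v2) (at t2) \<and>
        fst v1 * snd v2 \<noteq> snd v1 * fst v2))"

definition bottleneck :: "real \<Rightarrow> real \<Rightarrow> (real \<times> real) set \<Rightarrow> bool" where
  "bottleneck k0 k1 S \<longleftrightarrow> (\<exists>\<gamma>1 \<gamma>2. spanning_arc k0 k1 \<gamma>1 \<and> spanning_arc k0 k1 \<gamma>2 \<and>
     path_image \<gamma>1 \<inter> path_image \<gamma>2 = {} \<and> S = path_image \<gamma>1 \<union> path_image \<gamma>2)"

text \<open>
  An arc with both ends at \<open>\<kappa> = ke\<close> along which \<open>\<kappa>\<close> is strictly monotone up to the fold value
  \<open>kf\<close> and strictly monotone in the opposite direction afterwards.
\<close>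

definition folded_arc :: "real \<Rightarrow> real \<Rightarrow> (real \<Rightarrow> real \<times> real) \<Rightarrow> bool" where
  "folded_arc ke kf \<gamma> \<longleftrightarrow> arc \<gamma> \<and> snd (\<gamma> 0) = ke \<and> snd (\<gamma> 1) = ke \<and>
     (\<exists>t\<in>{0<..<1}. snd (\<gamma> t) = kf \<and> (\<exists>d\<in>{1, -1}.
        strict_mono_on {0..t} (\<lambda>u. d * snd (\<gamma> u)) \<and>
        strict_mono_on {t..1} (\<lambda>u. - d * snd (\<gamma> u))))"

definition isola_detachment :: "real \<Rightarrow> real \<Rightarrow> (real \<times> real) set \<Rightarrow> bool" where
  "isola_detachment k0 k1 S \<longleftrightarrow> (\<exists>\<gamma>1 \<gamma>2 f1 f2. k0 < f1 \<and> f1 < f2 \<and> f2 < k1 \<and>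
     folded_arc k0 f1 \<gamma>1 \<and> folded_arc k1 f2 \<gamma>2 \<and>
     path_image \<gamma>1 \<inter> path_image \<gamma>2 = {} \<and> S = path_image \<gamma>1 \<union> path_image \<gamma>2)"

definition simple_bifurcation :: "real \<Rightarrow> real \<Rightarrow> (real \<times> real) set \<Rightarrow> bool" where
  "simple_bifurcation k0 k1 S \<longleftrightarrow>
     node_singularity k0 k1 S \<or> bottleneck k0 k1 S \<or> isola_detachment k0 k1 S"

end

theory Submission
  imports Defs
begin

text \<open>
  Write \<open>\<epsilon> = \<eta>\<^sup>2\<close>. Integrating the equations of motion together with the power of the perturbing force, for
  an arbitrary initial condition and an arbitrary return time, gives two functions of class C2: the
  return map, and the energy transfer, which is the change of energy divided by \<open>\<epsilon>\<close>. At \<open>\<epsilon> = 0\<close> the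
  transfer over an unperturbed orbit is the Melnikov function.

  A perturbed orbit has to satisfy the return condition, the phase condition and the condition on
  the family parameter. Conservation of energy makes the return condition degenerate at \<open>\<epsilon> = 0\<close> in the
  direction of the gradient of the energy. When this direction is left out, the implicit function
  theorem applies: m-normality says that the linearised system has trivial kernel
  (\<open>m_normal_nondegenerate\<close>). For each phase \<open>s\<close> this leaves one candidate, and the candidate is
  periodic exactly if the transfer vanishes, because between states of equal energy the displacement
  along the gradient must be zero. So perturbed orbits correspond to the zeros of a C2 function
  \<open>B (\<eta>, s, \<kappa>)\<close> that is even in \<open>\<eta>\<close> and equals the Melnikov function at \<open>\<eta> = 0\<close>
  (\<open>melnikov_reduction\<close>). Evenness makes the error of order \<open>\<epsilon>\<close>.

  Up to a sign, \<open>B\<close> is strictly convex in \<open>s\<close>. Hence for each \<open>\<kappa>\<close> there are at most two zeros \<open>s\<close>, they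
  depend continuously on \<open>\<kappa>\<close>, and they exist for those \<open>\<kappa>\<close> for which \<open>B\<close> takes a nonpositive value. If
  \<open>B\<close> is monotone in \<open>\<kappa>\<close>, these \<open>\<kappa>\<close> form a half-line, and its end is the saddle-node. If the Hessian is
  definite, \<open>B\<close> is convex in \<open>(s, \<kappa>)\<close> jointly, they form a compact interval, and the two branches close
  up to an isola. If it is indefinite, \<open>B\<close> is concave along the lines of one direction, and the \<open>\<kappa>\<close>
  for which \<open>B\<close> takes no negative value form an interval: empty for a bottleneck, a point for a node,
  and nondegenerate for a detachment (\<open>saddle_node_zeros\<close>, \<open>isola_birth_zeros\<close>,
  \<open>simple_bifurcation_zeros\<close>). In the lemmas \<open>\<kappa>\<close> is written \<open>kp\<close>.
\<close>

section \<open>Calculus of k times continuously differentiable maps\<close>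

lemma linear_eq_sum_Basis:
  fixes h :: "'a::euclidean_space => 'b::real_vector"
  assumes "linear h"
  shows "h w = (\<Sum>b\<in>Basis. (w \<bullet> b) *\<^sub>R h b)"
proof -
  have "h (\<Sum>b\<in>Basis. (w \<bullet> b) *\<^sub>R b) = (\<Sum>b\<in>Basis. (w \<bullet> b) *\<^sub>R h b)"
    by (simp add: linear_sum[OF assms] linear_cmul[OF assms])
  then show ?thesis by (simp add: euclidean_representation)
qed

lemma frechet_derivative_within_cong:
  assumes "x \<in> S" and "\<And>y. y \<in> S ==> f y = g y"
  shows "frechet_derivative f (at x within S) = frechet_derivative g (at x within S)"
proof -
  have "(f has_derivative f') (at x within S) \<longleftrightarrow> (g has_derivative f') (at x within S)" for f'
    using has_derivative_transform[of x S f g f'] has_derivative_transform[of x S g f f'] assms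
    by auto
  then show ?thesis unfolding frechet_derivative_def by simp
qed

lemma Ck_on_cong:
  assumes "\<And>x. x \<in> S ==> f x = g x"
  shows "Ck_on k f S \<longleftrightarrow> Ck_on k g S"
  using assms
proof (induction k arbitrary: f g)
  case 0
  then show ?case by (auto cong: continuous_on_cong)
next
  case (Suc k)
  have "f differentiable_on S \<longleftrightarrow> g differentiable_on S"
    unfolding differentiable_on_def differentiable_def
    using has_derivative_transform[of _ S f g] has_derivative_transform[of _ S g f] Suc.prems
    by metis
  moreover have "Ck_on k (%x. frechet_derivative f (at x within S) v) S \<longleftrightarrow>
      Ck_on k (%x. frechet_derivative g (at x within S) v) S" for v
    by (rule Suc.IH) (metis frechet_derivative_within_cong Suc.prems)
  ultimately show ?case by simp
qed

lemma Ck_on_imp_continuous_on: "Ck_on k f S ==> continuous_on S f"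
  by (cases k) (auto intro: differentiable_imp_continuous_on)

lemma Ck_on_SucD: "Ck_on (Suc k) f S ==> Ck_on k f S"
  by (induction k arbitrary: f) (auto intro: differentiable_imp_continuous_on)

lemma Ck_on_mono: "Ck_on k f S ==> j \<le> k ==> Ck_on j f S"
proof (induction k)
  case (Suc k)
  then show ?case using Ck_on_SucD[OF Suc.prems(1)] by (cases "j = Suc k") auto
qed simp

lemma Ck_on_SucI:
  assumes "open S"
    and "\<And>x. x \<in> S ==> (f has_derivative f' x) (at x)"
    and "\<And>v. Ck_on k (%x. f' x v) S"
  shows "Ck_on (Suc k) f S"
proof -
  have "frechet_derivative f (at x within S) v = f' x v" if "x \<in> S" for x v
    by (metis assms(1,2) at_within_open frechet_derivative_at that)
  then have "Ck_on k (%x. frechet_derivative f (at x within S) v) S" for v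
    using assms(3)[of v] by (subst Ck_on_cong[where g = "%x. f' x v"]) auto
  moreover have "f differentiable_on S"
    using assms(2) unfolding differentiable_on_def differentiable_def
    by (blast intro: has_derivative_at_withinI)
  ultimately show ?thesis by simp
qed

lemma Ck_on_has_derivative:
  assumes "Ck_on (Suc k) f S" "x \<in> S"
  shows "(f has_derivative frechet_derivative f (at x within S)) (at x within S)"
  using assms(1) assms(2) unfolding Ck_on.simps differentiable_on_def frechet_derivative_works by blast

lemma Ck_on_has_derivative_open:
  assumes "Ck_on (Suc k) f S" "open S" "x \<in> S"
  shows "(f has_derivative frechet_derivative f (at x)) (at x)"
  using Ck_on_has_derivative[OF assms(1,3)] by (simp add: at_within_open[OF assms(3,2)])

lemma Ck_on_derivative_open:
  assumes "Ck_on (Suc k) f S" "open S"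
  shows "Ck_on k (%x. frechet_derivative f (at x) v) S"
proof -
  have "Ck_on k (%x. frechet_derivative f (at x within S) v) S" using assms(1) by simp
  then show ?thesis
    by (subst (asm) Ck_on_cong[where g = "%x. frechet_derivative f (at x) v"])
      (simp_all add: at_within_open[OF _ assms(2)])
qed

lemma Ck_on_const [simp]: "open S ==> Ck_on k (%x. c) S"
proof (induction k arbitrary: c)
  case (Suc k)
  show ?case by (rule Ck_on_SucI[where f' = "%_ _. 0"]) (use Suc in auto)
qed auto

lemma Ck_on_bounded_linear:
  assumes "bounded_linear f" "open S"
  shows "Ck_on k f S"
proof (cases k)
  case 0
  then show ?thesis using assms(1) by (simp add: linear_continuous_on)
next
  case (Suc j)
  show ?thesis unfolding Suc
    by (rule Ck_on_SucI[where f' = "%_. f"])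
      (use assms in \<open>auto intro: bounded_linear_imp_has_derivative\<close>)
qed

lemma Ck_on_ident [simp]: "open S ==> Ck_on k (%x. x) S"
  by (rule Ck_on_bounded_linear) auto

lemma Ck_on_add:
  "open S ==> Ck_on k f S ==> Ck_on k g S ==> Ck_on k (%x. f x + g x) S"
proof (induction k arbitrary: f g)
  case 0
  then show ?case by (auto intro: continuous_on_add)
next
  case (Suc k)
  show ?case
  proof (rule Ck_on_SucI[OF Suc.prems(1)])
    fix x assume "x \<in> S"
    then show "((%x. f x + g x) has_derivative
        (%v. frechet_derivative f (at x) v + frechet_derivative g (at x) v)) (at x)"
      using Suc.prems by (intro has_derivative_add Ck_on_has_derivative_open)
  qed (intro Suc.IH Suc.prems Ck_on_derivative_open)
qed

lemma Ck_on_sum: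
  assumes "open S" "\<And>i. i \<in> I ==> Ck_on k (f i) S"
  shows "Ck_on k (%x. \<Sum>i\<in>I. f i x) S"
proof (cases "finite I")
  case True
  then show ?thesis using assms(2) by (induction I) (auto intro!: Ck_on_add simp: assms(1))
qed (use assms(1) in simp)

lemma (in bounded_bilinear) Ck_on_prod:
  assumes "open S"
  shows "Ck_on k f S ==> Ck_on k g S ==> Ck_on k (%x. prod (f x) (g x)) S"
proof (induction k arbitrary: f g)
  case 0
  then show ?case by (auto intro: continuous_on)
next
  case (Suc k)
  show ?case
  proof (rule Ck_on_SucI[OF assms])
    fix x assume "x \<in> S"
    then show "((%x. prod (f x) (g x)) has_derivative
        (%v. prod (f x) (frechet_derivative g (at x) v) + prod (frechet_derivative f (at x) v) (g x)))
        (at x)"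
      using Suc.prems assms by (intro FDERIV Ck_on_has_derivative_open)
  next
    show "Ck_on k (%x. prod (f x) (frechet_derivative g (at x) v) +
        prod (frechet_derivative f (at x) v) (g x)) S" for v
      by (intro Ck_on_add Suc.IH assms Ck_on_derivative_open Suc.prems Ck_on_SucD[OF Suc.prems(1)]
          Ck_on_SucD[OF Suc.prems(2)])
  qed
qed

text \<open>Only differentiability within \<open>S\<close> is needed of the outer map, so \<open>S\<close> may have a boundary:
  this is how fields defined for nonnegative perturbation parameters are pulled back to open sets.\<close>

text \<open>The set \<open>S\<close> need not be open, as derivatives are taken within it. This covers the one-sided
  derivatives at the boundary of the range of the perturbation parameter.\<close>

lemma Ck_on_compose:
  assumes "open T" "g ` T \<subseteq> S"
  shows "Ck_on k f S ==> Ck_on k g T ==> Ck_on k (%x. f (g x)) T"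
  using assms(2)
proof (induction k arbitrary: f g)
  case 0
  then show ?case by (auto intro: continuous_on_compose2)
next
  case (Suc k)
  let ?f' = "%x. frechet_derivative f (at x within S)"
  let ?g' = "%x. frechet_derivative g (at x)"
  show ?case
  proof (rule Ck_on_SucI[OF assms(1), where f' = "%x v. \<Sum>b\<in>Basis. (?g' x v \<bullet> b) *\<^sub>R ?f' (g x) b"])
    fix x assume x: "x \<in> T"
    have dg: "(g has_derivative ?g' x) (at x within T)"
      by (rule has_derivative_at_withinI, rule Ck_on_has_derivative_open[OF Suc.prems(2) assms(1) x])
    have df: "(f has_derivative ?f' (g x)) (at (g x) within S)"
      using Suc.prems x by (intro Ck_on_has_derivative) auto
    have "((%x. f (g x)) has_derivative (%v. ?f' (g x) (?g' x v))) (at x within T)"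
      by (rule has_derivative_in_compose2[OF _ Suc.prems(3) x dg])
        (rule Ck_on_has_derivative[OF Suc.prems(1)])
    moreover have "(%v. ?f' (g x) (?g' x v)) =
        (%v. \<Sum>b\<in>Basis. (?g' x v \<bullet> b) *\<^sub>R ?f' (g x) b)"
      by (rule ext, rule linear_eq_sum_Basis[OF has_derivative_linear[OF df]])
    ultimately show "((%x. f (g x)) has_derivative
        (%v. \<Sum>b\<in>Basis. (?g' x v \<bullet> b) *\<^sub>R ?f' (g x) b)) (at x)"
      by (simp add: at_within_open[OF x assms(1)])
  next
    fix v
    have "Ck_on k (%x. ?g' x v) T"
      by (intro Ck_on_derivative_open Suc.prems assms(1))
    then have "Ck_on k (%x. ?g' x v \<bullet> b) T" for b
      by (intro bounded_bilinear.Ck_on_prod[OF bounded_bilinear_inner] assms(1) Ck_on_const)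
    moreover have "Ck_on k (%x. ?f' (g x) b) T" for b
      by (rule Suc.IH[OF _ Ck_on_SucD[OF Suc.prems(2)] Suc.prems(3)]) (use Suc.prems(1) in simp)
    ultimately show "Ck_on k (%x. \<Sum>b\<in>Basis. (?g' x v \<bullet> b) *\<^sub>R ?f' (g x) b) T"
      by (intro Ck_on_sum assms(1) bounded_bilinear.Ck_on_prod[OF bounded_bilinear_scaleR])
  qed
qed

lemma Ck_on_open_subset: "Ck_on k f S ==> open T ==> T \<subseteq> S ==> Ck_on k f T"
  using Ck_on_compose[of T "%x. x" S k f] by simp

lemma Ck_on_linear_compose:
  fixes f :: "'a::euclidean_space => 'b::euclidean_space"
  shows "bounded_linear h ==> open S ==> Ck_on k f S ==> Ck_on k (%x. h (f x)) S"
  by (rule Ck_on_compose[of S f UNIV]) (auto intro: Ck_on_bounded_linear)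

lemmas Ck_on_scaleR = bounded_bilinear.Ck_on_prod[OF bounded_bilinear_scaleR]
lemmas Ck_on_inner = bounded_bilinear.Ck_on_prod[OF bounded_bilinear_inner]
lemmas Ck_on_mult = bounded_bilinear.Ck_on_prod[OF bounded_bilinear_mult]
lemmas Ck_on_fst = Ck_on_linear_compose[OF bounded_linear_fst]
lemmas Ck_on_snd = Ck_on_linear_compose[OF bounded_linear_snd]
lemmas Ck_on_minus = Ck_on_linear_compose[OF bounded_linear_minus[OF bounded_linear_ident]]

lemma Ck_on_diff:
  fixes f :: "'a::euclidean_space => 'b::euclidean_space"
  shows "open S ==> Ck_on k f S ==> Ck_on k g S ==> Ck_on k (%x. f x - g x) S"
  using Ck_on_add[of S k f "%x. - g x"] Ck_on_minus[of S k g] by simp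

lemma Ck_on_Pair:
  fixes f :: "'a::euclidean_space => 'b::euclidean_space" and g :: "'a => 'c::euclidean_space"
  assumes "open S" "Ck_on k f S" "Ck_on k g S"
  shows "Ck_on k (%x. (f x, g x)) S"
proof -
  have "bounded_linear (%x. (x :: 'b, 0 :: 'c))" "bounded_linear (%x. (0 :: 'b, x :: 'c))"
    by (simp_all add: bounded_linear_Pair)
  from Ck_on_add[OF assms(1) Ck_on_linear_compose[OF this(1) assms(1,2)]
      Ck_on_linear_compose[OF this(2) assms(1,3)]]
  show ?thesis by simp
qed

lemma Ck_on_local:
  assumes "open S" and "\<And>x. x \<in> S ==> \<exists>N. open N \<and> x \<in> N \<and> Ck_on k f N"
  shows "Ck_on k f S"
  using assms(2)
proof (induction k arbitrary: f)
  case 0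
  then show ?case
    by (metis Ck_on.simps(1) assms(1) continuous_on_eq_continuous_at)
next
  case (Suc k)
  show ?case
  proof (rule Ck_on_SucI[OF assms(1), where f' = "%x. frechet_derivative f (at x)"])
    show "(f has_derivative frechet_derivative f (at x)) (at x)" if "x \<in> S" for x
      using Suc.prems[OF that] Ck_on_has_derivative_open[of k f] by metis
    show "Ck_on k (%x. frechet_derivative f (at x) v) S" for v
    proof (rule Suc.IH)
      fix x assume "x \<in> S"
      then obtain N where "open N" "x \<in> N" "Ck_on (Suc k) f N" using Suc.prems by blast
      then show "\<exists>N. open N \<and> x \<in> N \<and> Ck_on k (%x. frechet_derivative f (at x) v) N"
        using Ck_on_derivative_open[of k f N v] by metis
    qed
  qed
qed

lemma Ck_on_tangent:
  fixes f :: "'a::euclidean_space => 'b::real_normed_vector"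
  assumes "open S" "Ck_on (Suc k) f S"
  shows "Ck_on k (%(x, v). frechet_derivative f (at x) v) (S \<times> UNIV)"
proof -
  have op: "open (S \<times> (UNIV :: 'a set))" using assms(1) by (simp add: open_Times)
  have "Ck_on k (%y. \<Sum>b\<in>Basis. (snd y \<bullet> b) *\<^sub>R frechet_derivative f (at (fst y)) b) (S \<times> UNIV)"
  proof (intro Ck_on_sum Ck_on_scaleR Ck_on_inner Ck_on_const op Ck_on_snd Ck_on_ident)
    fix b :: 'a
    have "fst ` (S \<times> (UNIV :: 'a set)) \<subseteq> S" by auto
    then show "Ck_on k (%y. frechet_derivative f (at (fst y)) b) (S \<times> (UNIV :: 'a set))"
      by (rule Ck_on_compose[OF op _ Ck_on_derivative_open[OF assms(2,1)]
            Ck_on_bounded_linear[OF bounded_linear_fst op]])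
  qed
  moreover have "(\<Sum>b\<in>Basis. (v \<bullet> b) *\<^sub>R frechet_derivative f (at x) b) = frechet_derivative f (at x) v"
    if "x \<in> S" for x v
  proof -
    have "linear (frechet_derivative f (at x))"
      using Ck_on_has_derivative_open[OF assms(2,1) that] by (rule has_derivative_linear)
    then show ?thesis by (rule linear_eq_sum_Basis[symmetric])
  qed
  ultimately show ?thesis
    by (subst Ck_on_cong[where g = "%y. \<Sum>b\<in>Basis. (snd y \<bullet> b) *\<^sub>R frechet_derivative f (at (fst y)) b"])
      auto
qed

lemma Ck_on_SucI_tangent:
  assumes "open S" "\<And>x. x \<in> S ==> (f has_derivative f' x) (at x)"
    and "Ck_on k (%(x, v). f' x v) (S \<times> UNIV)"
  shows "Ck_on (Suc k) f S"
proof (rule Ck_on_SucI[OF assms(1,2)])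
  show "Ck_on k (%x. f' x v) S" for v
    using Ck_on_compose[OF assms(1) _ assms(3), of "%x. (x, v)"]
      Ck_on_Pair[OF assms(1) Ck_on_ident[OF assms(1)] Ck_on_const[OF assms(1), of k v]] by auto
qed

lemma Ck_on_blinfun_derivative:
  fixes f :: "'a::euclidean_space => 'b::real_normed_vector"
  assumes "open S" "Ck_on (Suc k) f S"
  defines "A \<equiv> %x. Blinfun (frechet_derivative f (at x))"
  shows "\<And>x. x \<in> S ==> (f has_derivative blinfun_apply (A x)) (at x)"
    and "\<And>x v. x \<in> S ==> blinfun_apply (A x) v = frechet_derivative f (at x) v"
    and "continuous_on S A"
proof -
  have bl: "bounded_linear (frechet_derivative f (at x))" if "x \<in> S" for x
    using Ck_on_has_derivative_open[OF assms(2,1) that] by (rule has_derivative_bounded_linear)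
  show A: "blinfun_apply (A x) v = frechet_derivative f (at x) v" if "x \<in> S" for x v
    unfolding A_def by (simp add: bounded_linear_Blinfun_apply[OF bl[OF that]])
  show "(f has_derivative blinfun_apply (A x)) (at x)" if "x \<in> S" for x
    using Ck_on_has_derivative_open[OF assms(2,1) that] unfolding A_def
    by (simp add: bounded_linear_Blinfun_apply[OF bl[OF that]])
  show "continuous_on S A"
  proof (rule continuous_on_blinfun_componentwise)
    fix i :: 'a
    have "continuous_on S (%x. frechet_derivative f (at x) i)"
      using Ck_on_derivative_open[OF assms(2,1)] Ck_on_imp_continuous_on by blast
    then show "continuous_on S (%x. blinfun_apply (A x) i)"
      by (rule continuous_on_eq) (simp add: A)
  qed
qed

lemma Ck_on_local_lipschitz:
  assumes "open S" "Ck_on (Suc k) f S" "x \<in> S"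
  obtains d B where "0 < d" "cball x d \<subseteq> S" "B-lipschitz_on (cball x d) f"
proof -
  define A where "A x = Blinfun (frechet_derivative f (at x))" for x
  note A = Ck_on_blinfun_derivative[OF assms(1,2), folded A_def]
  obtain d where d: "0 < d" "cball x d \<subseteq> S" using assms(1,3) open_contains_cball by blast
  have "continuous_on (cball x d) A" using A(3) d(2) continuous_on_subset by blast
  then have "compact (A ` cball x d)" by (intro compact_continuous_image) auto
  then obtain B where B: "\<And>y. y \<in> cball x d ==> norm (A y) \<le> B"
    using compact_imp_bounded bounded_iff by (metis imageI)
  have "x \<in> cball x d" using d(1) by simp
  then have B0: "0 \<le> B" using B norm_ge_zero order_trans by blast
  have "B-lipschitz_on (cball x d) f"
  proof (rule lipschitz_onI[OF _ B0])
    fix y z assume yz: "y \<in> cball x d" "z \<in> cball x d"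
    have "(f has_derivative blinfun_apply (A w)) (at w within cball x d)" if "w \<in> cball x d" for w
      by (rule has_derivative_at_withinI, rule A) (use d(2) that in blast)
    moreover have "onorm (blinfun_apply (A w)) \<le> B" if "w \<in> cball x d" for w
      using B[OF that] by (simp add: norm_blinfun.rep_eq)
    ultimately show "dist (f y) (f z) \<le> B * dist y z"
      unfolding dist_norm by (rule differentiable_bound[OF convex_cball _ _ yz])
  qed
  with d show thesis by (rule that)
qed

section \<open>Inverse and implicit functions of class C2\<close>

text \<open>The differential of the inverse is the inverse of the differential of \<open>f\<close>, taken along the inverse;
  by this formula it is again differentiable.\<close>

theorem Ck_on_inverse_function:
  fixes f :: "'a::euclidean_space => 'a"
  assumes "open U" and f: "Ck_on 2 f U" and "x0 \<in> U"
    and inj: "\<And>v. frechet_derivative f (at x0) v = 0 ==> v = 0"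
  obtains U' V g where "open U'" "U' \<subseteq> U" "x0 \<in> U'" "open V" "f x0 \<in> V"
    "homeomorphism U' V f g" "Ck_on 2 g V"
proof -
  have f2: "Ck_on (Suc (Suc 0)) f U" using f by (simp add: numeral_2_eq_2)
  define A where "A x = Blinfun (frechet_derivative f (at x))" for x
  note A = Ck_on_blinfun_derivative[OF assms(1) f2, folded A_def]
  have "linear (blinfun_apply (A x0))" "inj (blinfun_apply (A x0))"
    using A(2)[OF assms(3)] inj
    by (auto intro!: bounded_linear.linear blinfun.bounded_linear_right
        simp: linear_injective_0[OF bounded_linear.linear[OF blinfun.bounded_linear_right]])
  then obtain h where h: "linear h" "h \<circ> blinfun_apply (A x0) = id"
    using linear_injective_left_inverse by blast
  define invf where "invf = Blinfun h"
  have "invf o\<^sub>L A x0 = id_blinfun"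
    using h bounded_linear_Blinfun_apply[of h] unfolding invf_def
    by (intro blinfun_eqI) (auto simp: linear_conv_bounded_linear fun_eq_iff)
  then obtain U' V g g' where U': "open U'" "U' \<subseteq> U" "x0 \<in> U'" and V: "open V" "f x0 \<in> V"
    and hom: "homeomorphism U' V f g"
    and g: "\<And>y. y \<in> V ==> (g has_derivative (g' y)) (at y)"
    and g': "\<And>y. y \<in> V ==> g' y = inv (blinfun_apply (A (g y)))"
    and bij: "\<And>y. y \<in> V ==> bij (blinfun_apply (A (g y)))"
    using inverse_function_theorem[OF assms(1) A(1) A(3) assms(3)] by metis
  have fg: "f x \<in> V" "g (f x) = x" if "x \<in> U'" for x
    using hom that by (auto simp: homeomorphism_def)
  have gf: "g y \<in> U'" "f (g y) = y" if "y \<in> V" for y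
    using hom that by (auto simp: homeomorphism_def)
  have g'A: "g' (f x) (blinfun_apply (A x) v) = v" if "x \<in> U'" for x v
    using g'[OF fg(1)[OF that]] bij[OF fg(1)[OF that]] fg(2)[OF that]
    by (simp add: bij_is_inj inv_f_f)
  have Ag': "blinfun_apply (A (g y)) (g' y w) = w" if "y \<in> V" for y w
    using g'[OF that] bij[OF that] by (simp add: bij_is_surj surj_f_inv_f)
  have lin: "linear (g' y)" if "y \<in> V" for y using g[OF that] by (rule has_derivative_linear)

  \<comment> \<open>The second derivative of the inverse comes from the inverse of the tangent map
    \<open>(x, v) \<mapsto> (f x, Df(x) v)\<close>, whose derivative is block triangular.\<close>
  define T where "T = (%(x, v). blinfun_apply (A x) v)"
  have opU: "open (U \<times> (UNIV :: 'a set))" and opV: "open (V \<times> (UNIV :: 'a set))"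
    using assms(1) V(1) by (auto intro: open_Times)
  have "Ck_on (Suc 0) (%(x, v). frechet_derivative f (at x) v) (U \<times> UNIV)"
    by (rule Ck_on_tangent[OF assms(1) f2])
  then have T1: "Ck_on (Suc 0) T (U \<times> UNIV)"
    by (subst Ck_on_cong[where g = "%(x, v). frechet_derivative f (at x) v"]) (auto simp: T_def A(2))
  define Q where "Q p = frechet_derivative T (at p)" for p
  have Q: "(T has_derivative Q p) (at p)" if "fst p \<in> U" for p
    unfolding Q_def using that by (intro Ck_on_has_derivative_open[OF T1 opU]) (auto simp: mem_Times_iff)
  have Qlin: "linear (Q p)" if "fst p \<in> U" for p using Q[OF that] by (rule has_derivative_linear)
  have Q0: "Q (x, v) (0, k) = blinfun_apply (A x) k" if "x \<in> U" for x v k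
  proof -
    have "((%v. T (x, v)) has_derivative (%k. Q (x, v) (0, k))) (at v)"
      by (rule has_derivative_compose[of "%v. (x, v)" "%k. (0, k)" v UNIV T "Q (x, v)", simplified])
        (use Q[of "(x, v)"] that in \<open>auto intro!: derivative_eq_intros\<close>)
    moreover have "((%v. T (x, v)) has_derivative blinfun_apply (A x)) (at v)"
      unfolding T_def by (auto intro!: derivative_eq_intros)
    ultimately have "(%k. Q (x, v) (0, k)) = blinfun_apply (A x)" by (rule has_derivative_unique)
    then show ?thesis by metis
  qed
  define G where "G y w = (%(a, b). (g' y a, g' y (b - Q (g y, g' y w) (g' y a, 0))))" for y w
  have TG: "((%(y, w). (g y, g' y w)) has_derivative G y w) (at (y, w))" if y: "y \<in> V" for y w
  proof -
    let ?Tf = "%p. (f (fst p), T p)"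
    let ?x = "(g y, g' y w)"
    have gy: "g y \<in> U" using gf(1)[OF y] U'(2) by blast
    have "((%(y, w). (g y, g' y w)) has_derivative G y w) (at (?Tf ?x))"
    proof (rule has_derivative_inverse_strong[where f = ?Tf and x = ?x and S = "U' \<times> UNIV"
          and f' = "%p. (blinfun_apply (A (g y)) (fst p), Q ?x p)"])
      show "open (U' \<times> (UNIV :: 'a set))" using U'(1) by (simp add: open_Times)
      show "?x \<in> U' \<times> (UNIV :: 'a set)" using gf(1)[OF y] by simp
      have "continuous_on (U' \<times> UNIV) T"
        by (rule continuous_on_subset[OF Ck_on_imp_continuous_on[OF T1]]) (use U'(2) in auto)
      moreover have "continuous_on U f" using f by (rule Ck_on_imp_continuous_on)
      then have "continuous_on (U' \<times> UNIV) (%p. f (fst p))"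
        by (rule continuous_on_compose2) (use U'(2) in \<open>auto intro!: continuous_intros\<close>)
      ultimately show "continuous_on (U' \<times> UNIV) ?Tf" by (intro continuous_on_Pair)
      show "(%(y, w). (g y, g' y w)) (?Tf p) = p" if "p \<in> U' \<times> (UNIV :: 'a set)" for p
        using that fg g'A by (auto simp: T_def)
      have "((%p. f (fst p)) has_derivative (%p. blinfun_apply (A (g y)) (fst p))) (at ?x)"
        by (rule has_derivative_compose[of fst fst ?x UNIV f, simplified])
          (use A(1)[OF gy] in \<open>auto intro!: derivative_eq_intros\<close>)
      then show "(?Tf has_derivative (%p. (blinfun_apply (A (g y)) (fst p), Q ?x p))) (at ?x)"
        using Q[of ?x] gy by (intro has_derivative_Pair) auto
      show "(%p. (blinfun_apply (A (g y)) (fst p), Q ?x p)) \<circ> G y w = id"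
      proof (rule ext, clarify)
        fix a b
        let ?h = "g' y a" and ?k = "g' y (b - Q (g y, g' y w) (g' y a, 0))"
        have "Q ?x (?h, ?k) = Q ?x (?h, 0) + Q ?x (0, ?k)"
          using linear_add[OF Qlin[of ?x], of "(?h, 0)" "(0, ?k)"] gy by simp
        also have "\<dots> = b" using Q0[OF gy] Ag'[OF y] by simp
        finally show "((%p. (blinfun_apply (A (g y)) (fst p), Q ?x p)) \<circ> G y w) (a, b) = id (a, b)"
          by (simp add: G_def Ag'[OF y])
      qed
    qed
    moreover have "?Tf ?x = (y, w)" using gf(2)[OF y] Ag'[OF y] by (simp add: T_def)
    ultimately show ?thesis by simp
  qed
  have g'der: "((%(y, w). g' y w) has_derivative (%p. snd (G (fst q) (snd q) p))) (at q)"
    if "q \<in> V \<times> UNIV" for q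
    using has_derivative_snd[OF TG[of "fst q" "snd q"]] that by (simp add: split_beta' mem_Times_iff)
  then have g'cont: "continuous_on (V \<times> UNIV) (%(y, w). g' y w)"
    by (intro has_derivative_continuous_on) (rule has_derivative_at_withinI)
  have gcont: "continuous_on V g" using hom by (simp add: homeomorphism_def)
  have Qcont: "continuous_on ((U \<times> UNIV) \<times> UNIV) (%(p, q). Q p q)"
    using Ck_on_tangent[OF opU T1] by (simp add: Q_def)
  have "Ck_on (Suc 0) (%(y, w). g' y w) (V \<times> UNIV)"
  proof (rule Ck_on_SucI[OF opV g'der])
    fix p :: "'a \<times> 'a"
    obtain a b where p: "p = (a, b)" by fastforce
    have "continuous_on (V \<times> (UNIV :: 'a set)) (%q. (%(y, w). g' y w) (fst q, a))"
      by (rule continuous_on_compose2[OF g'cont]) (auto intro!: continuous_intros)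
    then have 1: "continuous_on (V \<times> (UNIV :: 'a set)) (%q. g' (fst q) a)" by simp
    have 2: "continuous_on (V \<times> (UNIV :: 'a set)) (%q. g (fst q))"
      by (rule continuous_on_compose2[OF gcont]) (auto intro!: continuous_intros)
    have 3: "continuous_on (V \<times> (UNIV :: 'a set))
        (%q. ((g (fst q), g' (fst q) (snd q)), (g' (fst q) a, 0 :: 'a)))"
      using g'cont 1 2 by (intro continuous_on_Pair continuous_on_const) (simp_all add: split_beta')
    have "continuous_on (V \<times> (UNIV :: 'a set)) (%q. (%(p, q). Q p q)
        ((g (fst q), g' (fst q) (snd q)), (g' (fst q) a, 0)))"
      by (rule continuous_on_compose2[OF Qcont 3]) (use gf(1) U'(2) in auto)
    then have 4: "continuous_on (V \<times> (UNIV :: 'a set))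
        (%q. (fst q, b - Q (g (fst q), g' (fst q) (snd q)) (g' (fst q) a, 0)))"
      by (simp, intro continuous_intros)
    have "continuous_on (V \<times> (UNIV :: 'a set)) (%q. (%(y, w). g' y w)
        (fst q, b - Q (g (fst q), g' (fst q) (snd q)) (g' (fst q) a, 0)))"
      by (rule continuous_on_compose2[OF g'cont 4]) auto
    then show "Ck_on 0 (%q. snd (G (fst q) (snd q) p)) (V \<times> UNIV)"
      by (simp add: G_def p)
  qed simp
  then have "Ck_on 2 g V"
    unfolding numeral_2_eq_2 by (rule Ck_on_SucI_tangent[OF V(1) g, rotated]) simp
  with U' V hom show thesis by (rule that)
qed

text \<open>The inverse function theorem is applied to \<open>(u, y) \<mapsto> (F (u, y), y)\<close>, whose differential is
  injective exactly under the kernel condition.\<close>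

theorem Ck_on_implicit_function:
  fixes F :: "'u::euclidean_space \<times> 'y::euclidean_space => 'u"
  assumes "open N" and F: "Ck_on 2 F N" and "(u0, y0) \<in> N" and zero: "F (u0, y0) = 0"
    and inj: "\<And>h. frechet_derivative F (at (u0, y0)) (h, 0) = 0 ==> h = 0"
  obtains Nu Ny g where "open Nu" "open Ny" "u0 \<in> Nu" "y0 \<in> Ny" "Nu \<times> Ny \<subseteq> N"
    "Ck_on 2 g Ny" "\<And>y. y \<in> Ny ==> g y \<in> Nu"
    "\<And>u y. u \<in> Nu ==> y \<in> Ny ==> F (u, y) = 0 \<longleftrightarrow> u = g y"
proof -
  let ?G = "%p. (F p, snd p)"
  have dF: "(F has_derivative frechet_derivative F (at (u0, y0))) (at (u0, y0))"
    using F unfolding numeral_2_eq_2 by (rule Ck_on_has_derivative_open[OF _ assms(1,3)])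
  have "(?G has_derivative (%p. (frechet_derivative F (at (u0, y0)) p, snd p))) (at (u0, y0))"
    by (intro has_derivative_Pair dF) (auto intro!: derivative_eq_intros)
  then have dG: "frechet_derivative ?G (at (u0, y0)) =
      (%p. (frechet_derivative F (at (u0, y0)) p, snd p))"
    by (rule frechet_derivative_at[symmetric])
  obtain U' V g where U': "open U'" "U' \<subseteq> N" "(u0, y0) \<in> U'" and V: "open V" "?G (u0, y0) \<in> V"
    and hom: "homeomorphism U' V ?G g" and g: "Ck_on 2 g V"
  proof (rule Ck_on_inverse_function[OF assms(1) _ assms(3), of ?G])
    show "Ck_on 2 ?G N" by (intro Ck_on_Pair assms(1) F Ck_on_snd Ck_on_ident)
    show "v = 0" if "frechet_derivative ?G (at (u0, y0)) v = 0" for v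
      using that inj[of "fst v"] unfolding dG by (cases v) (auto simp: zero_prod_def)
  qed (use that in blast)
  obtain Nu N2 where Nu: "open Nu" "u0 \<in> Nu" and N2: "open N2" "y0 \<in> N2" and sub: "Nu \<times> N2 \<subseteq> U'"
    using open_prod_elim[OF U'(1,3)] by (metis SigmaE2)
  define V0 where "V0 = (%y. (0 :: 'u, y)) -` V"
  have V0: "open V0" unfolding V0_def
    by (rule open_vimage[OF V(1)]) (auto intro!: continuous_intros)
  let ?h = "%y. fst (g (0, y))"
  have h2: "Ck_on 2 ?h V0"
    by (rule Ck_on_fst[OF V0], rule Ck_on_compose[OF V0 _ g])
      (auto simp: V0_def[symmetric] V0 intro!: Ck_on_Pair Ck_on_const Ck_on_ident, auto simp: V0_def)
  define Ny where "Ny = N2 \<inter> (V0 \<inter> ?h -` Nu)"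
  have Ny: "open Ny" unfolding Ny_def
    using continuous_open_preimage[OF Ck_on_imp_continuous_on[OF h2] V0 Nu(1)] N2(1) by auto
  have eq: "F (u, y) = 0 \<longleftrightarrow> u = ?h y" if "u \<in> Nu" "y \<in> Ny" for u y
  proof
    assume "F (u, y) = 0"
    then have "?G (u, y) = (0, y)" by simp
    moreover have "(u, y) \<in> U'" using that sub by (auto simp: Ny_def)
    ultimately show "u = ?h y" using hom unfolding homeomorphism_def by (metis fst_conv)
  next
    assume u: "u = ?h y"
    have "(0, y) \<in> V" using that by (simp add: Ny_def V0_def)
    then have "?G (g (0, y)) = (0, y)" using hom unfolding homeomorphism_def by blast
    then show "F (u, y) = 0" using u by (metis Pair_inject prod.collapse)
  qed
  have "(u0, y0) \<in> U'" "?G (u0, y0) = (0, y0)" using U'(3) zero by auto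
  then have "g (0, y0) = (u0, y0)" using hom unfolding homeomorphism_def by metis
  then have "y0 \<in> Ny" using N2(2) Nu(2) V(2) zero by (simp add: Ny_def V0_def)
  moreover have "Ck_on 2 ?h Ny" using h2 Ny by (rule Ck_on_open_subset) (auto simp: Ny_def)
  moreover have "Nu \<times> Ny \<subseteq> N" using sub U'(2) by (auto simp: Ny_def)
  ultimately show thesis using that[of Nu Ny ?h] Nu Ny eq by (auto simp: Ny_def)
qed

section \<open>Ordinary differential equations\<close>

definition solves :: "(real => 'a::real_normed_vector => 'a) => 'a set => (real => 'a) => bool" where
  "solves F D x \<longleftrightarrow> (\<forall>u\<in>{0..1}. x u \<in> D \<and> (x has_vector_derivative F u (x u)) (at u within {0..1}))"

lemma solvesD:
  assumes "solves F D x" "u \<in> {0..1}"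
  shows "x u \<in> D" "(x has_vector_derivative F u (x u)) (at u within {0..1})"
  using assms by (auto simp: solves_def)

lemma solves_continuous: "solves F D x ==> continuous_on {0..1} x"
  unfolding solves_def continuous_on_eq_continuous_within
  using has_vector_derivative_continuous by blast

lemma gronwall:
  fixes z :: "real => 'a::euclidean_space"
  assumes z: "\<And>u. u \<in> {0..1} ==> (z has_vector_derivative z' u) (at u within {0..1})"
    and bound: "\<And>u. u \<in> {0..1} ==> norm (z' u) \<le> L * norm (z u) + e"
    and "0 \<le> L" "0 \<le> e" "u \<in> {0..1}"
  shows "norm (z u) \<le> (norm (z 0) + e) * exp (L + 1)"
proof -
  \<comment> \<open>The square of the norm is differentiable also where \<open>z\<close> vanishes.\<close>
  define v where "v r = (z r \<bullet> z r + e\<^sup>2) * exp (- ((2 * L + 1) * r))" for r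
  define v' where "v' r = (2 * (z r \<bullet> z' r) - (2 * L + 1) * (z r \<bullet> z r + e\<^sup>2)) * exp (- ((2 * L + 1) * r))" for r
  have vd: "(v has_real_derivative v' r) (at r within {0..1})" if "r \<in> {0..1}" for r
  proof -
    have "((%r. z r \<bullet> z r) has_derivative (%h. z r \<bullet> (h *\<^sub>R z' r) + (h *\<^sub>R z' r) \<bullet> z r)) (at r within {0..1})"
      using z[OF that] unfolding has_vector_derivative_def by (intro has_derivative_inner)
    then have "((%r. z r \<bullet> z r) has_real_derivative 2 * (z r \<bullet> z' r)) (at r within {0..1})"
      unfolding has_field_derivative_def
      by (rule has_derivative_eq_rhs) (auto simp: inner_commute algebra_simps)
    then show ?thesis
      unfolding v_def v'_def by (auto intro!: derivative_eq_intros simp: algebra_simps)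
  qed
  have neg: "v' r \<le> 0" if "r \<in> {0..1}" for r
  proof -
    have "z r \<bullet> z' r \<le> norm (z r) * norm (z' r)" by (rule norm_cauchy_schwarz)
    also have "\<dots> \<le> norm (z r) * (L * norm (z r) + e)"
      using bound[OF that] by (intro mult_left_mono) auto
    finally have "2 * (z r \<bullet> z' r) \<le> 2 * L * (norm (z r))\<^sup>2 + 2 * (norm (z r) * e)"
      by (simp add: power2_eq_square algebra_simps)
    also have "2 * (norm (z r) * e) \<le> (norm (z r))\<^sup>2 + e\<^sup>2"
      using sum_squares_bound[of "norm (z r)" e] by (simp add: mult.assoc)
    finally have "2 * (z r \<bullet> z' r) \<le> (2 * L + 1) * (norm (z r))\<^sup>2 + e\<^sup>2" by (simp add: algebra_simps)
    moreover have "(2 * L + 1) * (z r \<bullet> z r + e\<^sup>2) = (2 * L + 1) * (norm (z r))\<^sup>2 + e\<^sup>2 + 2 * L * e\<^sup>2"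
      by (simp add: power2_norm_eq_inner algebra_simps)
    moreover have "0 \<le> 2 * L * e\<^sup>2" using assms(3) by simp
    ultimately have "2 * (z r \<bullet> z' r) - (2 * L + 1) * (z r \<bullet> z r + e\<^sup>2) \<le> 0" by linarith
    then show ?thesis unfolding v'_def by (simp add: mult_nonpos_nonneg)
  qed
  have "v u \<le> v 0"
  proof (rule DERIV_nonpos_imp_decreasing_open[where a = 0 and b = u and f = v])
    show "0 \<le> u" using assms(5) by simp
    show "\<exists>y. DERIV v r :> y \<and> y \<le> 0" if "0 < r" "r < u" for r
      using vd[of r] neg[of r] that assms(5) at_within_Icc_at[of 0 r 1] by auto
    have "continuous_on {0..1} v" using vd by (rule DERIV_continuous_on)
    then show "continuous_on {0..u} v" by (rule continuous_on_subset) (use assms(5) in auto)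
  qed
  then have "(norm (z u))\<^sup>2 + e\<^sup>2 \<le> ((norm (z 0))\<^sup>2 + e\<^sup>2) * exp ((2 * L + 1) * u)"
  proof -
    have "(norm (z u))\<^sup>2 + e\<^sup>2 = v u * exp ((2 * L + 1) * u)"
      by (simp add: v_def power2_norm_eq_inner mult.assoc flip: exp_add)
    also have "\<dots> \<le> v 0 * exp ((2 * L + 1) * u)" using \<open>v u \<le> v 0\<close> by (intro mult_right_mono) auto
    finally show ?thesis by (simp add: v_def power2_norm_eq_inner)
  qed
  also have "\<dots> \<le> ((norm (z 0) + e)\<^sup>2) * exp (2 * (L + 1))"
  proof (rule mult_mono)
    show "(norm (z 0))\<^sup>2 + e\<^sup>2 \<le> (norm (z 0) + e)\<^sup>2" using assms(4) by (simp add: power2_sum)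
    have "(2 * L + 1) * u \<le> (2 * L + 1) * 1" using assms(3,5) by (intro mult_left_mono) auto
    then show "exp ((2 * L + 1) * u) \<le> exp (2 * (L + 1))" by simp
  qed auto
  also have "\<dots> = ((norm (z 0) + e) * exp (L + 1))\<^sup>2"
    by (simp only: power_mult_distrib exp_double)
  finally have "(norm (z u))\<^sup>2 + e\<^sup>2 \<le> ((norm (z 0) + e) * exp (L + 1))\<^sup>2" .
  moreover have "(norm (z u))\<^sup>2 \<le> (norm (z u))\<^sup>2 + e\<^sup>2" by simp
  ultimately have "(norm (z u))\<^sup>2 \<le> ((norm (z 0) + e) * exp (L + 1))\<^sup>2" by (rule order_trans[rotated])
  then show ?thesis by (rule power2_le_imp_le) (use assms(4) in auto)
qed

lemma picard:
  fixes F :: "real => 'a::euclidean_space => 'a"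
  assumes F: "continuous_on ({0..1} \<times> UNIV) (%(t, x). F t x)"
    and L: "0 \<le> L" "\<And>t. t \<in> {0..1} ==> L-lipschitz_on UNIV (F t)"
  obtains x where "x 0 = w" "solves F UNIV x"
proof -
  define c where "c u = max 0 (min 1 u)" for u :: real
  define l where "l = L + 1"
  have l: "0 < l" using L(1) by (simp add: l_def)
  have c: "c u \<in> {0..1}" "u \<in> {0..1} ==> c u = u" for u by (auto simp: c_def)
  define X where "X z r = exp (2 * l * r) *\<^sub>R apply_bcontfun z r" for z :: "real \<Rightarrow>\<^sub>C 'a" and r
  define I where "I z u = w + integral {0..u} (%r. F r (X z r))" for z u
  define P where "P z u = exp (- (2 * l * c u)) *\<^sub>R I z (c u)" for z u
  have FX: "continuous_on {0..1} (%r. F r (X z r))" for z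
  proof -
    have "continuous_on {0..1} (%r. (%(t, x). F t x) (r, X z r))"
      by (rule continuous_on_compose2[OF F]) (auto simp: X_def intro!: continuous_intros)
    then show ?thesis by simp
  qed
  have Ic: "continuous_on {0..1} (I z)" for z
    unfolding I_def by (intro continuous_intros indefinite_integral_continuous_1
        integrable_continuous_real FX)
  have "P z \<in> bcontfun" for z
  proof -
    have cc: "continuous_on UNIV c" unfolding c_def by (intro continuous_intros)
    have "continuous_on UNIV (%u. I z (c u))"
      by (rule continuous_on_compose2[OF Ic cc]) (use c in auto)
    then have "continuous_on UNIV (P z)" unfolding P_def by (intro continuous_intros cc)
    moreover have "bounded (range (P z))"
    proof -
      have "continuous_on {0..1} (%u. exp (- (2 * l * u)) *\<^sub>R I z u)" by (intro continuous_intros Ic)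
      then have "compact ((%u. exp (- (2 * l * u)) *\<^sub>R I z u) ` {0..1})"
        by (rule compact_continuous_image) simp
      then show ?thesis
        by (rule bounded_subset[OF compact_imp_bounded]) (use c in \<open>auto simp: P_def\<close>)
    qed
    ultimately show ?thesis by (simp add: bcontfun_def)
  qed
  then have Papp: "apply_bcontfun (Bcontfun (P z)) = P z" for z by (simp add: Bcontfun_inverse)
  have "\<exists>!z. Bcontfun (P z) = z"
  proof (rule banach_fix_type[of "1/2"])
    have "dist (Bcontfun (P z)) (Bcontfun (P z')) \<le> 1/2 * dist z z'" for z z'
    proof (rule dist_bound)
      fix u
      let ?h = "%r. l * exp (2 * l * r) * dist z z'"
      have "((%r. exp (2 * l * r) / 2 * dist z z') has_vector_derivative ?h r) (at r within {0..c u})" for r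
        unfolding has_real_derivative_iff_has_vector_derivative[symmetric]
        by (auto intro!: derivative_eq_intros)
      then have h: "(?h has_integral
          (exp (2 * l * c u) / 2 * dist z z' - exp (2 * l * 0) / 2 * dist z z')) {0..c u}"
        using c by (intro fundamental_theorem_of_calculus) auto
      have int: "(%r. F r (X z r)) integrable_on {0..c u}" for z
        using c[of u] by (intro integrable_continuous_real continuous_on_subset[OF FX]) auto
      have "norm (I z (c u) - I z' (c u)) = norm (integral {0..c u} (%r. F r (X z r) - F r (X z' r)))"
        by (simp add: I_def Henstock_Kurzweil_Integration.integral_diff[OF int int])
      also have "\<dots> \<le> integral {0..c u} ?h"
      proof (rule integral_norm_bound_integral)
        show "(%r. F r (X z r) - F r (X z' r)) integrable_on {0..c u}"
          by (intro integrable_diff int)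
        show "?h integrable_on {0..c u}" using h by blast
        fix r assume "r \<in> {0..c u}"
        then have r: "r \<in> {0..1}" using c(1)[of u] by auto
        have "norm (F r (X z r) - F r (X z' r)) \<le> L * norm (X z r - X z' r)"
          using lipschitz_onD[OF L(2)[OF r]] by (auto simp: dist_norm)
        also have "norm (X z r - X z' r) = exp (2 * l * r) * dist (apply_bcontfun z r) (apply_bcontfun z' r)"
          by (simp add: X_def dist_norm flip: scaleR_right_diff_distrib)
        also have "L * (exp (2 * l * r) * dist (apply_bcontfun z r) (apply_bcontfun z' r))
            \<le> l * (exp (2 * l * r) * dist z z')"
          using L(1) by (intro mult_mono mult_left_mono dist_bounded) (auto simp: l_def)
        finally show "norm (F r (X z r) - F r (X z' r)) \<le> ?h r" by (simp add: mult.assoc)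
      qed
      also have "\<dots> = (exp (2 * l * c u) - 1) / 2 * dist z z'"
        unfolding integral_unique[OF h] by (simp add: algebra_simps diff_divide_distrib)
      also have "\<dots> \<le> exp (2 * l * c u) / 2 * dist z z'" by (intro mult_right_mono) auto
      finally have "exp (- (2 * l * c u)) * norm (I z (c u) - I z' (c u))
          \<le> exp (- (2 * l * c u)) * (exp (2 * l * c u) / 2 * dist z z')" by (intro mult_left_mono) auto
      also have "\<dots> = 1/2 * dist z z'" by (simp add: exp_minus)
      finally show "dist (apply_bcontfun (Bcontfun (P z)) u) (apply_bcontfun (Bcontfun (P z')) u)
          \<le> 1/2 * dist z z'"
        by (simp add: Papp P_def dist_norm flip: scaleR_right_diff_distrib)
    qed
    then show "\<forall>z z'. dist (Bcontfun (P z)) (Bcontfun (P z')) \<le> 1/2 * dist z z'" by blast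
  qed auto
  then obtain z where z: "Bcontfun (P z) = z" by blast
  have X: "X z u = I z u" if "u \<in> {0..1}" for u
  proof -
    have "apply_bcontfun z u = P z u" using Papp[of z] z by simp
    then show ?thesis by (simp add: X_def P_def c(2)[OF that] flip: exp_add)
  qed
  have "(I z has_vector_derivative F u (I z u)) (at u within {0..1})" if "u \<in> {0..1}" for u
  proof -
    have "((%u. integral {0..u} (%r. F r (X z r))) has_vector_derivative F u (X z u)) (at u within {0..1})"
      by (rule integral_has_vector_derivative[OF FX that])
    then show ?thesis
      unfolding X[OF that] unfolding I_def by (auto intro!: derivative_eq_intros)
  qed
  then have "solves F UNIV (I z)" by (simp add: solves_def)
  moreover have "I z 0 = w" by (simp add: I_def)
  ultimately show thesis using that by blast
qed

lemma Ck_on_lipschitz_on_compact: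
  assumes "open W" "Ck_on (Suc k) X W" "compact C" "C \<subseteq> W"
  obtains L where "0 \<le> L" "L-lipschitz_on C X"
proof -
  have "local_lipschitz {0 :: real} C (%_. X)"
  proof (rule local_lipschitzI)
    fix x assume "x \<in> C"
    then have "x \<in> W" using assms(4) by blast
    obtain d B where d: "0 < d" and B: "B-lipschitz_on (cball x d) X"
      by (rule Ck_on_local_lipschitz[OF assms(1,2) \<open>x \<in> W\<close>])
    have "B-lipschitz_on (cball x d \<inter> C) X" by (rule lipschitz_on_subset[OF B]) simp
    then show "\<exists>u>0. \<exists>L. \<forall>t\<in>cball t u \<inter> {0}. L-lipschitz_on (cball x u \<inter> C) X" for t :: real
      using d by blast
  qed
  then obtain L where "L-lipschitz_on C X"
    using local_lipschitz_compact_implies_lipschitz[of "{0 :: real}" C "%_. X"] assms(3)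
    by auto
  then show thesis using that lipschitz_on_nonneg by blast
qed

lemma compact_tube:
  fixes C :: "'a::euclidean_space set"
  assumes "compact C" "open W" "C \<subseteq> W"
  obtains \<rho> where "0 < \<rho>" "compact (\<Union>x\<in>C. cball x \<rho>)" "(\<Union>x\<in>C. cball x \<rho>) \<subseteq> W"
proof -
  obtain e where e: "0 < e" "(\<Union>x\<in>C. ball x e) \<subseteq> W"
    by (rule compact_subset_open_imp_ball_epsilon_subset[OF assms])
  have "(\<Union>x\<in>C. cball x (e / 2)) = {x + y | x y. x \<in> C \<and> y \<in> cball 0 (e / 2)}" (is "?T = _")
  proof (intro equalityI subsetI)
    fix z assume "z \<in> ?T"
    then obtain x where "x \<in> C" "dist x z \<le> e / 2" by auto
    then have "z = x + (z - x)" "z - x \<in> cball 0 (e / 2)" by (simp_all add: dist_norm norm_minus_commute)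
    then show "z \<in> {x + y | x y. x \<in> C \<and> y \<in> cball 0 (e / 2)}" using \<open>x \<in> C\<close> by blast
  next
    fix z assume "z \<in> {x + y | x y. x \<in> C \<and> y \<in> cball 0 (e / 2)}"
    then obtain x y where "z = x + y" "x \<in> C" "norm y \<le> e / 2" by (auto simp del: norm_le_zero_iff)
    then have "dist x z \<le> e / 2" by (simp add: dist_norm)
    then show "z \<in> ?T" using \<open>x \<in> C\<close> by auto
  qed
  moreover have "compact {x + y | x y. x \<in> C \<and> y \<in> cball (0 :: 'a) (e / 2)}"
    by (rule compact_sums[OF assms(1) compact_cball])
  ultimately have "compact ?T" by (simp only:)
  moreover have "cball x (e / 2) \<subseteq> ball x e" for x
    using e(1) by (intro subsetI) simp
  then have "?T \<subseteq> (\<Union>x\<in>C. ball x e)" by (rule UN_mono[OF order_refl])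
  then have "?T \<subseteq> W" using e(2) by (rule order_trans)
  ultimately show thesis using that[of "e / 2"] e(1) by simp
qed

lemma uniformly_differentiable_on_compact:
  fixes X :: "'a::euclidean_space => 'b::real_normed_vector"
  assumes "open W" and der: "\<And>x. x \<in> W ==> (X has_derivative blinfun_apply (A x)) (at x)"
    and A: "continuous_on W A" and C: "compact C" "C \<subseteq> W" and "0 < e"
  obtains d where "0 < d"
    "\<And>x y. x \<in> C ==> dist x y < d ==> norm (X y - X x - blinfun_apply (A x) (y - x)) \<le> e * norm (y - x)"
proof -
  obtain \<rho> where \<rho>: "0 < \<rho>" "compact (\<Union>x\<in>C. cball x \<rho>)" "(\<Union>x\<in>C. cball x \<rho>) \<subseteq> W"
    using compact_tube[OF C(1) assms(1) C(2)] by blast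
  let ?T = "\<Union>x\<in>C. cball x \<rho>"
  have "uniformly_continuous_on ?T A"
    using continuous_on_subset[OF A \<rho>(3)] \<rho>(2) by (rule compact_uniformly_continuous)
  then obtain d where d: "0 < d" "\<And>x y. x \<in> ?T ==> y \<in> ?T ==> dist y x < d ==> dist (A y) (A x) < e"
    using \<open>0 < e\<close> unfolding uniformly_continuous_on_def by metis
  show thesis
  proof (rule that[of "min d \<rho>"])
    show "0 < min d \<rho>" using d(1) \<rho>(1) by simp
    fix x y assume x: "x \<in> C" and xy: "dist x y < min d \<rho>"
    let ?S = "ball x (min d \<rho>)"
    have S: "?S \<subseteq> ?T" using x by auto
    have xT: "x \<in> ?S" using \<rho>(1) d(1) by simp
    then have xT: "x \<in> ?S" "x \<in> ?T" using S by blast+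
    have "norm (X y - X x - blinfun_apply (A x) (y - x)) \<le> norm (y - x) * e"
    proof (rule differentiable_bound_linearization[where S = ?S])
      show "x + t *\<^sub>R (y - x) \<in> ?S" if "t \<in> {0..1}" for t
      proof -
        have "norm (t *\<^sub>R (y - x)) \<le> norm (y - x)" using that by (simp add: mult_left_le_one_le)
        then show ?thesis using xy by (simp add: dist_norm norm_minus_commute)
      qed
      fix z assume z: "z \<in> ?S"
      then have zT: "z \<in> ?T" using S by blast
      show "(X has_derivative blinfun_apply (A z)) (at z within ?S)"
        by (rule has_derivative_at_withinI, rule der) (use zT \<rho>(3) in blast)
      have "dist (A z) (A x) < e" using d(2)[OF xT(2) zT] z by (simp add: dist_commute)
      then show "onorm (blinfun_apply (A z) - blinfun_apply (A x)) \<le> e"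
        by (simp add: dist_norm norm_blinfun.rep_eq minus_blinfun.rep_eq fun_diff_def)
    qed (use xT in auto)
    then show "norm (X y - X x - blinfun_apply (A x) (y - x)) \<le> e * norm (y - x)"
      by (simp add: mult.commute)
  qed
qed

lemma solves_unique:
  assumes "open W" "Ck_on (Suc k) X W"
    and x: "solves (%_. X) W x" and y: "solves (%_. X) W y" and "x 0 = y 0" and u: "u \<in> {0..1}"
  shows "x u = y u"
proof -
  let ?C = "x ` {0..1} \<union> y ` {0..1}"
  have "compact ?C"
    using solves_continuous[OF x] solves_continuous[OF y]
    by (intro compact_Un compact_continuous_image) auto
  moreover have "?C \<subseteq> W" using solvesD(1)[OF x] solvesD(1)[OF y] by auto
  ultimately obtain L where L: "0 \<le> L" "L-lipschitz_on ?C X"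
    using Ck_on_lipschitz_on_compact[OF assms(1,2)] by blast
  have "norm (x u - y u) \<le> (norm (x 0 - y 0) + 0) * exp (L + 1)"
  proof (rule gronwall[where z' = "%u. X (x u) - X (y u)", OF _ _ L(1) _ u])
    fix r :: real assume r: "r \<in> {0..1}"
    show "((%u. x u - y u) has_vector_derivative X (x r) - X (y r)) (at r within {0..1})"
      by (intro has_vector_derivative_diff solvesD(2)[OF x r] solvesD(2)[OF y r])
    show "norm (X (x r) - X (y r)) \<le> L * norm (x r - y r) + 0"
      using lipschitz_onD[OF L(2), of "x r" "y r"] r by (simp add: dist_norm)
  qed simp
  then show ?thesis using assms(5) by simp
qed

lemma linear_solves_unique:
  fixes B :: "real => 'a::euclidean_space \<Rightarrow>\<^sub>L 'a"
  assumes N: "\<And>u. u \<in> {0..1} ==> norm (B u) \<le> N"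
    and "solves (%u. blinfun_apply (B u)) UNIV \<psi>" "solves (%u. blinfun_apply (B u)) UNIV \<phi>"
    and "\<psi> 0 = \<phi> 0" and u: "u \<in> {0..1}"
  shows "\<psi> u = \<phi> u"
proof -
  have N0: "0 \<le> N" using N[OF u] norm_ge_zero order_trans by blast
  have "norm (\<psi> u - \<phi> u) \<le> (norm (\<psi> 0 - \<phi> 0) + 0) * exp (N + 1)"
  proof (rule gronwall[where z' = "%u. B u (\<psi> u) - B u (\<phi> u)", OF _ _ N0 _ u])
    fix r :: real assume r: "r \<in> {0..1}"
    show "((%u. \<psi> u - \<phi> u) has_vector_derivative B r (\<psi> r) - B r (\<phi> r)) (at r within {0..1})"
      by (intro has_vector_derivative_diff solvesD(2)[OF assms(2) r] solvesD(2)[OF assms(3) r])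
    have "norm (B r (\<psi> r - \<phi> r)) \<le> norm (B r) * norm (\<psi> r - \<phi> r)" by (rule norm_blinfun)
    also have "\<dots> \<le> N * norm (\<psi> r - \<phi> r)" using N[OF r] by (intro mult_right_mono) auto
    finally show "norm (B r (\<psi> r) - B r (\<phi> r)) \<le> N * norm (\<psi> r - \<phi> r) + 0"
      by (simp add: blinfun.diff_right)
  qed simp
  then show ?thesis using assms(4) by simp
qed

lemma linear_solves_exists:
  fixes B :: "real => 'a::euclidean_space \<Rightarrow>\<^sub>L 'a"
  assumes "continuous_on {0..1} B"
  obtains \<psi> where "\<psi> 0 = v" "solves (%u. blinfun_apply (B u)) UNIV \<psi>"
proof -
  have "compact (B ` {0..1})" using assms by (intro compact_continuous_image) auto
  then obtain N where N: "0 < N" "\<And>u. u \<in> {0..1} ==> norm (B u) \<le> N"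
    using compact_imp_bounded bounded_pos by (metis imageI)
  have c: "continuous_on ({0..1} \<times> (UNIV :: 'a set)) (%p. B (fst p))"
    by (rule continuous_on_compose2[OF assms]) (auto intro!: continuous_intros)
  have "continuous_on ({0..1} \<times> (UNIV :: 'a set)) (%p. B (fst p) (snd p))"
    by (intro bounded_bilinear.continuous_on[OF bounded_bilinear_blinfun_apply] c continuous_intros)
  then have "continuous_on ({0..1} \<times> (UNIV :: 'a set)) (%(t, x). B t x)" by (simp add: split_beta')
  moreover have "N-lipschitz_on UNIV (blinfun_apply (B t))" if "t \<in> {0..1}" for t
  proof (rule lipschitz_onI)
    show "dist (B t x) (B t y) \<le> N * dist x y" for x y
    proof -
      have "dist (B t x) (B t y) \<le> norm (B t) * norm (x - y)"
        by (simp add: dist_norm norm_blinfun flip: blinfun.diff_right)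
      also have "\<dots> \<le> N * norm (x - y)" using N(2)[OF that] by (intro mult_right_mono) auto
      finally show ?thesis by (simp add: dist_norm)
    qed
  qed (use N(1) in simp)
  ultimately show thesis
    using picard[of "%u. blinfun_apply (B u)" N v] N(1) that by (metis less_imp_le)
qed

text \<open>Near a given solution the field is replaced by a globally Lipschitz one, which agrees with it
  on a tube around the solution; nearby solutions of the modified equation never leave the tube.\<close>

theorem local_flow:
  fixes X :: "'a::euclidean_space => 'a"
  assumes W: "open W" and X: "Ck_on (Suc 0) X W" and xb: "solves (%_. X) W xb"
  obtains \<delta> \<phi> D where "0 < \<delta>"
    "\<And>w. w \<in> ball (xb 0) \<delta> ==> \<phi> w 0 = w" "\<And>w. w \<in> ball (xb 0) \<delta> ==> solves (%_. X) W (\<phi> w)"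
    "\<And>w. w \<in> ball (xb 0) \<delta> ==> ((%w. \<phi> w 1) has_derivative D w) (at w)"
    "\<And>v. continuous_on (ball (xb 0) \<delta>) (%w. D w v)"
    "\<And>w \<psi>. w \<in> ball (xb 0) \<delta> ==> solves (%u. frechet_derivative X (at (\<phi> w u))) UNIV \<psi> ==> D w (\<psi> 0) = \<psi> 1"
proof -
  define A where "A x = Blinfun (frechet_derivative X (at x))" for x
  note A = Ck_on_blinfun_derivative[OF W X, folded A_def]
  let ?K = "xb ` {0..1}"
  have "compact ?K" by (intro compact_continuous_image solves_continuous[OF xb]) auto
  moreover have "?K \<subseteq> W" using solvesD(1)[OF xb] by auto
  ultimately obtain \<rho> where \<rho>: "0 < \<rho>" "compact (\<Union>x\<in>?K. cball x \<rho>)" "(\<Union>x\<in>?K. cball x \<rho>) \<subseteq> W"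
    using compact_tube[OF _ W] by metis
  define T where "T = (\<Union>x\<in>?K. cball x \<rho>)"
  have T: "compact T" "T \<subseteq> W" using \<rho> by (auto simp: T_def)
  have inT: "x \<in> T" if "norm (x - xb u) \<le> \<rho>" "u \<in> {0..1}" for x u
    using that by (auto simp: T_def dist_norm norm_minus_commute)
  obtain L where L: "0 \<le> L" "L-lipschitz_on T X"
    using Ck_on_lipschitz_on_compact[OF W X T] by blast
  define P where "P = closest_point (cball (0 :: 'a) \<rho>)"
  have P: "norm (P y) \<le> \<rho>" "dist (P x) (P y) \<le> dist x y" "norm y \<le> \<rho> ==> P y = y" for x y
    using closest_point_in_set[of "cball (0 :: 'a) \<rho>" y] closest_point_lipschitz[of "cball (0 :: 'a) \<rho>"]
      closest_point_self[of y "cball 0 \<rho>"] \<rho>(1)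
    unfolding P_def by auto
  have P0: "P 0 = 0" using P(3)[of 0] \<rho>(1) by simp
  have Pcont: "continuous_on UNIV P"
    unfolding continuous_on_iff using P(2) order_le_less_trans by blast
  define F where "F u w = X (xb u + P (w - xb u))" for u w
  have Farg: "xb u + P (w - xb u) \<in> T" if "u \<in> {0..1}" for u w using P(1) that by (intro inT) auto
  have Fcont: "continuous_on ({0..1} \<times> UNIV) (%(u, w). F u w)"
  proof -
    have c1: "continuous_on ({0..1} \<times> (UNIV :: 'a set)) (%p. xb (fst p))"
      by (rule continuous_on_compose2[OF solves_continuous[OF xb]]) (auto intro!: continuous_intros)
    have c2: "continuous_on ({0..1} \<times> UNIV) (%p. P (snd p - xb (fst p)))"
      by (rule continuous_on_compose2[OF Pcont]) (auto intro!: continuous_intros c1)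
    have "continuous_on T X" using L(2) by (rule lipschitz_on_continuous_on)
    then have "continuous_on ({0..1} \<times> UNIV) (%p. X (xb (fst p) + P (snd p - xb (fst p))))"
      by (rule continuous_on_compose2) (use Farg in \<open>auto intro!: continuous_intros c1 c2\<close>)
    then show ?thesis by (simp add: F_def split_beta')
  qed
  have Flip: "dist (F u w) (F u w') \<le> L * dist w w'" if "u \<in> {0..1}" for u w w'
  proof -
    have "dist (F u w) (F u w') \<le> L * dist (xb u + P (w - xb u)) (xb u + P (w' - xb u))"
      unfolding F_def by (rule lipschitz_onD[OF L(2) Farg[OF that] Farg[OF that]])
    also have "\<dots> \<le> L * dist (w - xb u) (w' - xb u)"
      using P(2) L(1) by (intro mult_left_mono) auto
    finally show ?thesis by (simp add: dist_norm)
  qed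
  have "\<exists>x. x 0 = w \<and> solves F UNIV x" for w
    using picard[OF Fcont L(1), of w] Flip L(1) by (metis lipschitz_onI)
  then obtain \<phi> where \<phi>: "\<And>w. \<phi> w 0 = w" "\<And>w. solves F UNIV (\<phi> w)" by metis
  define M where "M = exp (L + 1)"
  define \<delta> where "\<delta> = \<rho> / (2 * M)"
  have M: "0 < M" by (simp add: M_def)
  have \<delta>: "0 < \<delta>" using \<rho>(1) M by (simp add: \<delta>_def)
  have FXb: "F u (xb u) = X (xb u)" for u by (simp add: F_def P0)
  have close: "norm (\<phi> w u - xb u) \<le> \<rho> / 2" if "w \<in> ball (xb 0) \<delta>" "u \<in> {0..1}" for w u
  proof -
    have "norm (\<phi> w u - xb u) \<le> (norm (\<phi> w 0 - xb 0) + 0) * exp (L + 1)"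
    proof (rule gronwall[where z' = "%u. F u (\<phi> w u) - X (xb u)", OF _ _ L(1) _ that(2)])
      fix r :: real assume r: "r \<in> {0..1}"
      show "((%u. \<phi> w u - xb u) has_vector_derivative F r (\<phi> w r) - X (xb r)) (at r within {0..1})"
        by (intro has_vector_derivative_diff solvesD(2)[OF \<phi>(2) r] solvesD(2)[OF xb r])
      show "norm (F r (\<phi> w r) - X (xb r)) \<le> L * norm (\<phi> w r - xb r) + 0"
        using Flip[OF r, of "\<phi> w r" "xb r"] by (simp add: dist_norm FXb)
    qed simp
    also have "\<dots> \<le> \<delta> * M"
      using that(1) M by (intro mult_mono) (auto simp: M_def \<phi>(1) dist_norm norm_minus_commute less_imp_le[OF \<delta>])
    finally show ?thesis using M by (simp add: \<delta>_def)
  qed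
  have near: "norm (\<phi> w u - \<phi> w' u) \<le> M * norm (w - w')" if "u \<in> {0..1}" for w w' u
  proof -
    have "norm (\<phi> w u - \<phi> w' u) \<le> (norm (\<phi> w 0 - \<phi> w' 0) + 0) * exp (L + 1)"
    proof (rule gronwall[where z' = "%u. F u (\<phi> w u) - F u (\<phi> w' u)", OF _ _ L(1) _ that])
      fix r :: real assume r: "r \<in> {0..1}"
      show "((%u. \<phi> w u - \<phi> w' u) has_vector_derivative F r (\<phi> w r) - F r (\<phi> w' r)) (at r within {0..1})"
        by (intro has_vector_derivative_diff solvesD(2)[OF \<phi>(2) r])
      show "norm (F r (\<phi> w r) - F r (\<phi> w' r)) \<le> L * norm (\<phi> w r - \<phi> w' r) + 0"
        using Flip[OF r, of "\<phi> w r" "\<phi> w' r"] by (simp add: dist_norm)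
    qed simp
    then show ?thesis by (simp add: M_def \<phi>(1) mult.commute)
  qed
  have \<phi>T: "\<phi> w u \<in> T" if "w \<in> ball (xb 0) \<delta>" "u \<in> {0..1}" for w u
    using close[OF that] \<rho>(1) that(2) by (intro inT) auto
  have F\<phi>: "F u (\<phi> w u) = X (\<phi> w u)" if "w \<in> ball (xb 0) \<delta>" "u \<in> {0..1}" for w u
    using close[OF that] \<rho>(1) by (simp add: F_def P(3))
  have sol: "solves (%_. X) W (\<phi> w)" if w: "w \<in> ball (xb 0) \<delta>" for w
    unfolding solves_def
  proof (intro ballI conjI)
    fix u :: real assume u: "u \<in> {0..1}"
    show "\<phi> w u \<in> W" using \<phi>T[OF w u] T(2) by blast
    show "(\<phi> w has_vector_derivative X (\<phi> w u)) (at u within {0..1})"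
      using solvesD(2)[OF \<phi>(2)[of w] u] unfolding F\<phi>[OF w u] .
  qed

  have AT: "continuous_on T A" using A(3) T(2) by (rule continuous_on_subset)
  have "compact (A ` T)" using AT T(1) by (rule compact_continuous_image)
  then obtain N where N: "0 < N" "\<And>x. x \<in> T ==> norm (A x) \<le> N"
    using compact_imp_bounded bounded_pos by (metis imageI)
  have A\<phi>: "continuous_on {0..1} (%u. A (\<phi> w u))" if "w \<in> ball (xb 0) \<delta>" for w
    by (rule continuous_on_compose2[OF AT solves_continuous[OF \<phi>(2)]]) (use \<phi>T[OF that] in auto)
  have "\<exists>\<psi>. \<psi> 0 = v \<and> solves (%u. blinfun_apply (A (\<phi> w u))) UNIV \<psi>" if "w \<in> ball (xb 0) \<delta>" for w v
    using linear_solves_exists[OF A\<phi>[OF that]] by metis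
  then obtain \<Psi> where \<Psi>: "\<And>w v. w \<in> ball (xb 0) \<delta> ==> \<Psi> w v 0 = v"
    "\<And>w v. w \<in> ball (xb 0) \<delta> ==> solves (%u. blinfun_apply (A (\<phi> w u))) UNIV (\<Psi> w v)" by metis
  have uniq: "\<psi> u = \<phi>' u" if "w \<in> ball (xb 0) \<delta>" "solves (%u. blinfun_apply (A (\<phi> w u))) UNIV \<psi>"
    "solves (%u. blinfun_apply (A (\<phi> w u))) UNIV \<phi>'" "\<psi> 0 = \<phi>' 0" "u \<in> {0..1}" for w \<psi> \<phi>' u
    by (rule linear_solves_unique[OF _ that(2-5), of N]) (use N \<phi>T that(1) in auto)
  define D where "D w v = \<Psi> w v 1" for w v
  have D: "D w (\<psi> 0) = \<psi> 1"
    if "w \<in> ball (xb 0) \<delta>" "solves (%u. blinfun_apply (A (\<phi> w u))) UNIV \<psi>" for w \<psi>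
    unfolding D_def by (rule uniq[OF that(1) \<Psi>(2)[OF that(1)] that(2)]) (auto simp: \<Psi>(1)[OF that(1)])
  have lin: "linear (D w)" if w: "w \<in> ball (xb 0) \<delta>" for w
  proof (rule linearI)
    fix v v' :: 'a and c :: real
    have "solves (%u. blinfun_apply (A (\<phi> w u))) UNIV (%u. \<Psi> w v u + \<Psi> w v' u)"
      using solvesD(2)[OF \<Psi>(2)[OF w]] by (auto simp: solves_def blinfun.add_right intro!: has_vector_derivative_add)
    from D[OF w this] show "D w (v + v') = D w v + D w v'" by (simp add: \<Psi>(1)[OF w] D_def)
    have "((%u. c *\<^sub>R \<Psi> w v u) has_vector_derivative c *\<^sub>R A (\<phi> w u) (\<Psi> w v u)) (at u within {0..1})"
      if "u \<in> {0..1}" for u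
      using bounded_linear.has_vector_derivative[OF bounded_linear_scaleR_right solvesD(2)[OF \<Psi>(2)[OF w] that]] .
    then have "solves (%u. blinfun_apply (A (\<phi> w u))) UNIV (%u. c *\<^sub>R \<Psi> w v u)"
      by (auto simp: solves_def blinfun.scaleR_right)
    from D[OF w this] show "D w (c *\<^sub>R v) = c *\<^sub>R D w v" by (simp add: \<Psi>(1)[OF w] D_def)
  qed
  have der: "((%w. \<phi> w 1) has_derivative D w) (at w)" if w: "w \<in> ball (xb 0) \<delta>" for w
    unfolding has_derivative_at_alt
  proof (intro conjI allI impI)
    show "bounded_linear (D w)" using lin[OF w] by (simp add: linear_conv_bounded_linear)
    fix e :: real assume "0 < e"
    define e1 where "e1 = e / (M * exp (N + 1))"
    have e1: "0 < e1" using \<open>0 < e\<close> M by (simp add: e1_def)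
    obtain d where d: "0 < d" "\<And>x y. x \<in> T ==> dist x y < d ==>
        norm (X y - X x - blinfun_apply (A x) (y - x)) \<le> e1 * norm (y - x)"
      using uniformly_differentiable_on_compact[OF W A(1) A(3) T e1] by metis
    define d' where "d' = min (d / M) (\<delta> - dist (xb 0) w)"
    have "norm (\<phi> y 1 - \<phi> w 1 - D w (y - w)) \<le> e * norm (y - w)" if y: "norm (y - w) < d'" for y
    proof -
      have yb: "y \<in> ball (xb 0) \<delta>"
        using y dist_triangle[of "xb 0" y w] by (auto simp: d'_def dist_norm norm_minus_commute)
      let ?\<psi> = "\<Psi> w (y - w)"
      let ?z = "%u. \<phi> y u - \<phi> w u - ?\<psi> u"
      let ?z' = "%u. X (\<phi> y u) - X (\<phi> w u) - A (\<phi> w u) (?\<psi> u)"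
      have "norm (?z 1) \<le> (norm (?z 0) + e1 * M * norm (y - w)) * exp (N + 1)"
      proof (rule gronwall[where z = ?z and z' = ?z' and u = 1])
        fix r :: real assume r: "r \<in> {0..1}"
        show "(?z has_vector_derivative ?z' r) (at r within {0..1})"
          by (intro has_vector_derivative_diff solvesD(2)[OF sol[OF yb] r] solvesD(2)[OF sol[OF w] r]
              solvesD(2)[OF \<Psi>(2)[OF w] r])
        have eq: "?z' r = A (\<phi> w r) (?z r) + (X (\<phi> y r) - X (\<phi> w r) - A (\<phi> w r) (\<phi> y r - \<phi> w r))"
          by (simp add: blinfun.diff_right)
        have "norm (\<phi> y r - \<phi> w r) \<le> M * norm (y - w)" by (rule near[OF r])
        also have "\<dots> < d" using y M by (simp add: d'_def field_simps)
        finally have "dist (\<phi> w r) (\<phi> y r) < d" by (simp add: dist_norm norm_minus_commute)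
        from d(2)[OF \<phi>T[OF w r] this]
        have "norm (X (\<phi> y r) - X (\<phi> w r) - A (\<phi> w r) (\<phi> y r - \<phi> w r)) \<le> e1 * norm (\<phi> y r - \<phi> w r)" .
        also have "\<dots> \<le> e1 * (M * norm (y - w))" using near[OF r] e1 by (intro mult_left_mono) auto
        finally have 1: "norm (X (\<phi> y r) - X (\<phi> w r) - A (\<phi> w r) (\<phi> y r - \<phi> w r)) \<le> e1 * M * norm (y - w)"
          by (simp add: mult.assoc)
        have "norm (A (\<phi> w r) (?z r)) \<le> norm (A (\<phi> w r)) * norm (?z r)" by (rule norm_blinfun)
        also have "\<dots> \<le> N * norm (?z r)" using N(2)[OF \<phi>T[OF w r]] by (intro mult_right_mono) auto
        finally show "norm (?z' r) \<le> N * norm (?z r) + e1 * M * norm (y - w)"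
          unfolding eq using 1 by (rule norm_triangle_mono)
      qed (use N(1) M e1 in auto)
      also have "\<dots> = e * norm (y - w)" using M by (simp add: \<phi>(1) \<Psi>(1)[OF w] e1_def)
      finally show ?thesis by (simp add: D_def)
    qed
    moreover have "0 < d'" using d(1) M w by (simp add: d'_def)
    ultimately show "\<exists>d>0. \<forall>y. norm (y - w) < d -->
        norm (\<phi> y 1 - \<phi> w 1 - D w (y - w)) \<le> e * norm (y - w)" by blast
  qed
  have Dcont: "continuous_on (ball (xb 0) \<delta>) (%w. D w v)" for v
    unfolding continuous_on_iff
  proof (intro ballI allI impI)
    fix w e assume w: "w \<in> ball (xb 0) \<delta>" and e: "(0 :: real) < e"
    define B where "B = (norm v + 0) * exp (N + 1)"
    have B: "norm (\<Psi> w v r) \<le> B" if r: "r \<in> {0..1}" for r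
    proof -
      have "norm (\<Psi> w v r) \<le> (norm (\<Psi> w v 0) + 0) * exp (N + 1)"
      proof (rule gronwall[where z' = "%r. A (\<phi> w r) (\<Psi> w v r)", OF solvesD(2)[OF \<Psi>(2)[OF w]] _ _ _ r])
        fix u :: real assume u: "u \<in> {0..1}"
        show "norm (A (\<phi> w u) (\<Psi> w v u)) \<le> N * norm (\<Psi> w v u) + 0"
          using norm_blinfun[of "A (\<phi> w u)" "\<Psi> w v u"] N(2)[OF \<phi>T[OF w u]]
          by (smt (verit) mult_right_mono norm_ge_zero)
      qed (use N(1) in auto)
      then show ?thesis by (simp add: B_def \<Psi>(1)[OF w])
    qed
    have B0: "0 \<le> B" by (simp add: B_def)
    define e1 where "e1 = e / ((B + 1) * exp (N + 1))"
    have e1: "0 < e1" using e B0 by (simp add: e1_def)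
    obtain d where d: "0 < d" "\<And>x y. x \<in> T ==> y \<in> T ==> dist y x < d ==> dist (A y) (A x) < e1"
      using compact_uniformly_continuous[OF AT T(1)] e1 unfolding uniformly_continuous_on_def by metis
    have "dist (D y v) (D w v) < e" if y: "y \<in> ball (xb 0) \<delta>" "dist y w < d / M" for y
    proof -
      let ?z = "%u. \<Psi> y v u - \<Psi> w v u"
      let ?z' = "%u. A (\<phi> y u) (\<Psi> y v u) - A (\<phi> w u) (\<Psi> w v u)"
      have "norm (?z 1) \<le> (norm (?z 0) + e1 * B) * exp (N + 1)"
      proof (rule gronwall[where z = ?z and z' = ?z' and u = 1])
        fix r :: real assume r: "r \<in> {0..1}"
        show "(?z has_vector_derivative ?z' r) (at r within {0..1})"
          by (intro has_vector_derivative_diff solvesD(2)[OF \<Psi>(2)[OF w] r] solvesD(2)[OF \<Psi>(2)[OF y(1)] r])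
        have eq: "?z' r = A (\<phi> y r) (?z r) + (A (\<phi> y r) - A (\<phi> w r)) (\<Psi> w v r)"
          by (simp add: blinfun.diff_right blinfun.diff_left)
        have "dist (\<phi> y r) (\<phi> w r) \<le> M * dist y w" using near[OF r] by (simp add: dist_norm)
        also have "\<dots> < d" using y(2) M by (simp add: field_simps)
        finally have "norm (A (\<phi> y r) - A (\<phi> w r)) < e1"
          using d(2)[OF \<phi>T[OF w r] \<phi>T[OF y(1) r]] by (simp add: dist_norm)
        then have "norm ((A (\<phi> y r) - A (\<phi> w r)) (\<Psi> w v r)) \<le> e1 * B"
          using norm_blinfun[of "A (\<phi> y r) - A (\<phi> w r)" "\<Psi> w v r"] B[OF r] e1
          by (smt (verit) mult_mono norm_ge_zero)
        moreover have "norm (A (\<phi> y r) (?z r)) \<le> N * norm (?z r)"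
          using norm_blinfun[of "A (\<phi> y r)" "?z r"] N(2)[OF \<phi>T[OF y(1) r]]
          by (smt (verit) mult_right_mono norm_ge_zero)
        ultimately show "norm (?z' r) \<le> N * norm (?z r) + e1 * B"
          unfolding eq by (intro norm_triangle_mono)
      qed (use N(1) B0 e1 in auto)
      also have "\<dots> = e1 * exp (N + 1) * B" by (simp add: \<Psi>(1)[OF w] \<Psi>(1)[OF y(1)])
      also have "\<dots> < e1 * exp (N + 1) * (B + 1)" using e1 by simp
      also have "\<dots> = e" using B0 by (simp add: e1_def)
      finally show ?thesis by (simp add: D_def dist_norm)
    qed
    then show "\<exists>d>0. \<forall>y\<in>ball (xb 0) \<delta>. dist y w < d --> dist (D y v) (D w v) < e"
      using d(1) M by (metis divide_pos_pos)
  qed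
  show thesis
  proof (rule that[OF \<delta> \<phi>(1) sol der Dcont])
    fix w \<psi> assume w: "w \<in> ball (xb 0) \<delta>"
      and \<psi>: "solves (%u. frechet_derivative X (at (\<phi> w u))) UNIV \<psi>"
    have "A (\<phi> w u) v = frechet_derivative X (at (\<phi> w u)) v" if "u \<in> {0..1}" for u v
      using A(2) solvesD(1)[OF sol[OF w] that] by blast
    then have "solves (%u. blinfun_apply (A (\<phi> w u))) UNIV \<psi>" using \<psi> by (simp add: solves_def)
    then show "D w (\<psi> 0) = \<psi> 1" by (rule D[OF w])
  qed
qed

definition reach :: "('a::real_normed_vector => 'a) => 'a set => 'a set" where
  "reach X W = {w. \<exists>x. x 0 = w \<and> solves (%_. X) W x}"

definition flow1 :: "('a::real_normed_vector => 'a) => 'a set => 'a => 'a" where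
  "flow1 X W w = (THE y. \<exists>x. x 0 = w \<and> x 1 = y \<and> solves (%_. X) W x)"

lemma flow1_eq:
  assumes "open W" "Ck_on (Suc k) X W" "solves (%_. X) W x"
  shows "flow1 X W (x 0) = x 1"
  unfolding flow1_def
proof (rule the_equality)
  show "\<exists>x'. x' 0 = x 0 \<and> x' 1 = x 1 \<and> solves (%_. X) W x'" using assms(3) by blast
  fix y assume "\<exists>x'. x' 0 = x 0 \<and> x' 1 = y \<and> solves (%_. X) W x'"
  then obtain x' where "x' 0 = x 0" "x' 1 = y" "solves (%_. X) W x'" by blast
  then show "y = x 1" using solves_unique[OF assms(1,2) _ assms(3), of x' 1] by simp
qed

theorem flow1_C1:
  fixes X :: "'a::euclidean_space => 'a"
  assumes W: "open W" and X: "Ck_on (Suc 0) X W"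
  shows "open (reach X W)" and "Ck_on (Suc 0) (flow1 X W) (reach X W)"
    and "\<And>x \<psi>. solves (%_. X) W x ==> solves (%u. frechet_derivative X (at (x u))) UNIV \<psi> ==>
      frechet_derivative (flow1 X W) (at (x 0)) (\<psi> 0) = \<psi> 1"
proof -
  have main: "\<exists>\<delta>>0. ball (x 0) \<delta> \<subseteq> reach X W \<and> Ck_on (Suc 0) (flow1 X W) (ball (x 0) \<delta>) \<and>
      (\<forall>\<psi>. solves (%u. frechet_derivative X (at (x u))) UNIV \<psi> -->
        frechet_derivative (flow1 X W) (at (x 0)) (\<psi> 0) = \<psi> 1)"
    if x: "solves (%_. X) W x" for x
  proof -
    obtain \<delta> \<phi> D where \<delta>: "0 < \<delta>"
      and \<phi>: "\<And>w. w \<in> ball (x 0) \<delta> ==> \<phi> w 0 = w" "\<And>w. w \<in> ball (x 0) \<delta> ==> solves (%_. X) W (\<phi> w)"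
      and D: "\<And>w. w \<in> ball (x 0) \<delta> ==> ((%w. \<phi> w 1) has_derivative D w) (at w)"
      and Dc: "\<And>v. continuous_on (ball (x 0) \<delta>) (%w. D w v)"
      and var: "\<And>w \<psi>. w \<in> ball (x 0) \<delta> ==>
        solves (%u. frechet_derivative X (at (\<phi> w u))) UNIV \<psi> ==> D w (\<psi> 0) = \<psi> 1"
      by (rule local_flow[OF W X x]) (rule that)
    have eq: "flow1 X W w = \<phi> w 1" if "w \<in> ball (x 0) \<delta>" for w
      using flow1_eq[OF W X \<phi>(2)[OF that]] \<phi>(1)[OF that] by simp
    have der: "(flow1 X W has_derivative D w) (at w)" if "w \<in> ball (x 0) \<delta>" for w
      by (rule has_derivative_transform_within_open[OF D[OF that] open_ball that]) (simp add: eq)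
    have "Ck_on (Suc 0) (flow1 X W) (ball (x 0) \<delta>)"
      by (rule Ck_on_SucI[OF open_ball der]) (auto intro: Dc)
    moreover have "w \<in> reach X W" if "w \<in> ball (x 0) \<delta>" for w
      unfolding reach_def using \<phi>(1)[OF that] \<phi>(2)[OF that] by blast
    then have "ball (x 0) \<delta> \<subseteq> reach X W" by blast
    moreover have "frechet_derivative (flow1 X W) (at (x 0)) (\<psi> 0) = \<psi> 1"
      if \<psi>: "solves (%u. frechet_derivative X (at (x u))) UNIV \<psi>" for \<psi>
    proof -
      have x0: "x 0 \<in> ball (x 0) \<delta>" using \<delta> by simp
      have "\<phi> (x 0) u = x u" if "u \<in> {0..1}" for u
        by (rule solves_unique[OF W X \<phi>(2)[OF x0] x _ that]) (simp add: \<phi>(1)[OF x0])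
      then have "solves (%u. frechet_derivative X (at (\<phi> (x 0) u))) UNIV \<psi>"
        using \<psi> by (simp add: solves_def)
      from var[OF x0 this] show ?thesis by (simp flip: frechet_derivative_at[OF der[OF x0]])
    qed
    ultimately show ?thesis using \<delta> by blast
  qed
  show "open (reach X W)"
    unfolding open_contains_ball
  proof
    fix w assume "w \<in> reach X W"
    then obtain x where x: "x 0 = w" "solves (%_. X) W x" unfolding reach_def by blast
    then show "\<exists>e>0. ball w e \<subseteq> reach X W" using main[OF x(2)] by blast
  qed
  then show "Ck_on (Suc 0) (flow1 X W) (reach X W)"
  proof (rule Ck_on_local)
    fix w assume "w \<in> reach X W"
    then obtain x where x: "x 0 = w" "solves (%_. X) W x" unfolding reach_def by blast
    then show "\<exists>N. open N \<and> w \<in> N \<and> Ck_on (Suc 0) (flow1 X W) N"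
      using main[OF x(2)] by (metis open_ball centre_in_ball)
  qed
  show "frechet_derivative (flow1 X W) (at (x 0)) (\<psi> 0) = \<psi> 1"
    if "solves (%_. X) W x" "solves (%u. frechet_derivative X (at (x u))) UNIV \<psi>" for x \<psi>
    using main[OF that(1)] that(2) by blast
qed

text \<open>The derivative of the flow is itself the flow of the tangent field, which is of class C1 when
  the field is of class C2.\<close>

theorem flow1_C2:
  fixes X :: "'a::euclidean_space => 'a"
  assumes W: "open W" and X: "Ck_on 2 X W"
  shows "Ck_on 2 (flow1 X W) (reach X W)"
proof -
  have X2: "Ck_on (Suc (Suc 0)) X W" using X unfolding numeral_2_eq_2 .
  note X1 = Ck_on_SucD[OF X2]
  define A where "A x = Blinfun (frechet_derivative X (at x))" for x
  note A = Ck_on_blinfun_derivative[OF W X1, folded A_def]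
  define TX where "TX = (%(x, v). (X x, frechet_derivative X (at x) v))"
  have W2: "open (W \<times> (UNIV :: 'a set))" using W by (simp add: open_Times)
  have "Ck_on (Suc 0) (%p. X (fst p)) (W \<times> (UNIV :: 'a set))"
    by (rule Ck_on_compose[OF W2 _ X1 Ck_on_bounded_linear[OF bounded_linear_fst W2]]) auto
  from Ck_on_Pair[OF W2 this Ck_on_tangent[OF W X2]]
  have TX: "Ck_on (Suc 0) TX (W \<times> UNIV)" by (simp add: TX_def split_beta')
  have lift: "solves (%_. TX) (W \<times> UNIV) (%u. (x u, \<psi> u))"
    if "solves (%_. X) W x" "solves (%u. frechet_derivative X (at (x u))) UNIV \<psi>" for x \<psi>
    using that unfolding solves_def TX_def by (auto intro!: has_vector_derivative_Pair)
  have ex: "\<exists>\<psi>. \<psi> 0 = v \<and> solves (%u. frechet_derivative X (at (x u))) UNIV \<psi>"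
    if x: "solves (%_. X) W x" for x v
  proof -
    have "continuous_on {0..1} (%u. A (x u))"
      by (rule continuous_on_compose2[OF A(3) solves_continuous[OF x]]) (use solvesD(1)[OF x] in auto)
    then obtain \<psi> where \<psi>: "\<psi> 0 = v" "solves (%u. blinfun_apply (A (x u))) UNIV \<psi>"
      by (rule linear_solves_exists)
    moreover have "A (x u) v = frechet_derivative X (at (x u)) v" if "u \<in> {0..1}" for u v
      by (rule A(2)[OF solvesD(1)[OF x that]])
    ultimately show ?thesis by (auto simp: solves_def)
  qed
  have sub: "reach X W \<times> UNIV \<subseteq> reach TX (W \<times> UNIV)"
  proof clarify
    fix w v :: 'a assume "w \<in> reach X W"
    then obtain x where x: "x 0 = w" "solves (%_. X) W x" unfolding reach_def by blast
    obtain \<psi> where \<psi>: "\<psi> 0 = v" "solves (%u. frechet_derivative X (at (x u))) UNIV \<psi>"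
      using ex[OF x(2)] by blast
    show "(w, v) \<in> reach TX (W \<times> UNIV)"
      using lift[OF x(2) \<psi>(2)] x(1) \<psi>(1) unfolding reach_def by force
  qed
  have eq: "frechet_derivative (flow1 X W) (at w) v = snd (flow1 TX (W \<times> UNIV) (w, v))"
    if w: "w \<in> reach X W" for w v
  proof -
    obtain x where x: "x 0 = w" "solves (%_. X) W x" using w unfolding reach_def by blast
    obtain \<psi> where \<psi>: "\<psi> 0 = v" "solves (%u. frechet_derivative X (at (x u))) UNIV \<psi>"
      using ex[OF x(2)] by blast
    show ?thesis
      using flow1_eq[OF W2 TX lift[OF x(2) \<psi>(2)]] flow1_C1(3)[OF W X1 x(2) \<psi>(2)] x(1) \<psi>(1) by simp
  qed
  have R: "open (reach X W)" by (rule flow1_C1(1)[OF W X1])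
  have R2: "open (reach X W \<times> (UNIV :: 'a set))" using R by (simp add: open_Times)
  have "Ck_on (Suc 0) (%p. snd (flow1 TX (W \<times> UNIV) p)) (reach X W \<times> UNIV)"
    by (rule Ck_on_snd[OF R2 Ck_on_open_subset[OF flow1_C1(2)[OF W2 TX] R2 sub]])
  then have tangent:
    "Ck_on (Suc 0) (%(w, v). frechet_derivative (flow1 X W) (at w) v) (reach X W \<times> UNIV)"
    by (subst Ck_on_cong[where g = "%p. snd (flow1 TX (W \<times> UNIV) p)"]) (auto simp: eq)
  show ?thesis
    unfolding numeral_2_eq_2
  proof (rule Ck_on_SucI_tangent[OF R _ tangent])
    show "(flow1 X W has_derivative frechet_derivative (flow1 X W) (at w)) (at w)"
      if "w \<in> reach X W" for w
      by (rule Ck_on_has_derivative_open[OF flow1_C1(2)[OF W X1] R that])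
  qed
qed

section \<open>Zero sets of perturbed planar germs\<close>

lemma has_derivative_strict_convex:
  fixes \<phi> :: "real => real"
  assumes 1: "\<And>t. 0 \<le> t ==> t \<le> 1 ==> DERIV \<phi> t :> \<phi>' t"
    and 2: "\<And>t. 0 \<le> t ==> t \<le> 1 ==> DERIV \<phi>' t :> \<phi>'' t"
    and 3: "\<And>t. 0 \<le> t ==> t \<le> 1 ==> 0 < \<phi>'' t" and t: "0 < t" "t < 1"
  shows "\<phi> t < (1 - t) * \<phi> 0 + t * \<phi> 1"
proof -
  obtain x where x: "0 < x" "x < t" "\<phi> t - \<phi> 0 = (t - 0) * \<phi>' x"
    using MVT2[of 0 t \<phi> \<phi>'] 1 t by (metis less_imp_le order.trans)
  obtain y where y: "t < y" "y < 1" "\<phi> 1 - \<phi> t = (1 - t) * \<phi>' y"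
    using MVT2[of t 1 \<phi> \<phi>'] 1 t by (metis less_imp_le order.trans)
  have "\<phi>' x < \<phi>' y"
  proof (rule DERIV_pos_imp_increasing[where f = \<phi>'])
    show "x < y" using x y by simp
    show "\<exists>z. DERIV \<phi>' r :> z \<and> 0 < z" if "x \<le> r" "r \<le> y" for r
      using 2[of r] 3[of r] that x y by (intro exI[of _ "\<phi>'' r"]) auto
  qed
  then have "t * (1 - t) * \<phi>' x < t * (1 - t) * \<phi>' y" using t by simp
  moreover have "(1 - t) * \<phi> 0 + t * \<phi> 1 - \<phi> t = t * (\<phi> 1 - \<phi> t) - (1 - t) * (\<phi> t - \<phi> 0)"
    by (simp add: algebra_simps)
  then have "(1 - t) * \<phi> 0 + t * \<phi> 1 - \<phi> t = t * ((1 - t) * \<phi>' y) - (1 - t) * (t * \<phi>' x)"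
    unfolding x(3) y(3) by simp
  ultimately show ?thesis by (simp add: mult.assoc mult.left_commute)
qed

lemma second_derivative_sign:
  fixes \<phi> :: "real => real"
  assumes "0 < r" and 1: "\<And>t. \<bar>t\<bar> < r ==> DERIV \<phi> t :> \<phi>' t" and 2: "DERIV \<phi>' 0 :> c"
    and zero: "\<phi> 0 = 0" "\<phi>' 0 = 0" and c: "0 < c"
  obtains d where "0 < d" "\<And>t. t \<noteq> 0 ==> \<bar>t\<bar> < d ==> 0 < \<phi> t"
proof -
  obtain d1 where d1: "0 < d1" "\<And>h. 0 < h ==> h < d1 ==> \<phi>' 0 < \<phi>' (0 + h)"
    using DERIV_pos_inc_right[OF 2 c] by blast
  obtain d2 where d2: "0 < d2" "\<And>h. 0 < h ==> h < d2 ==> \<phi>' (0 - h) < \<phi>' 0"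
    using DERIV_pos_inc_left[OF 2 c] by blast
  show thesis
  proof (rule that[of "min r (min d1 d2)"])
    show "0 < min r (min d1 d2)" using assms(1) d1(1) d2(1) by simp
    fix t :: real assume t: "t \<noteq> 0" "\<bar>t\<bar> < min r (min d1 d2)"
    show "0 < \<phi> t"
    proof (cases "0 < t")
      case True
      obtain x where "0 < x" "x < t" "\<phi> t - \<phi> 0 = (t - 0) * \<phi>' x"
        using MVT2[of 0 t \<phi> \<phi>'] 1 True t by auto
      then show ?thesis using d1(2)[of x] zero t by auto
    next
      case False
      then have "t < 0" using t by simp
      then obtain x where "t < x" "x < 0" "\<phi> 0 - \<phi> t = (0 - t) * \<phi>' x"
        using MVT2[of t 0 \<phi> \<phi>'] 1 t by auto
      moreover have "\<phi>' x < 0" using d2(2)[of "- x"] zero t \<open>t < x\<close> \<open>x < 0\<close> by simp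
      ultimately show ?thesis using \<open>t < 0\<close> zero by (simp add: mult_neg_neg)
    qed
  qed
qed

text \<open>A germ with a quadratic zero in \<open>s\<close>, normalised to be convex, and its perturbations by \<open>\<eta>\<close>. Joint
  continuity in \<open>\<eta>\<close> is what carries strict inequalities at \<open>\<eta> = 0\<close> over to small \<open>\<eta>\<close>.\<close>

locale convex_germ =
  fixes b bs bk bss bsk bkk :: "real => real => real => real" and s0 k0 R :: real
  assumes R: "0 < R"
    and cont: "continuous_on ({-R<..<R} \<times> {s0-R<..<s0+R} \<times> {k0-R<..<k0+R}) (%(\<eta>, s, kp). b \<eta> s kp)"
      "continuous_on ({-R<..<R} \<times> {s0-R<..<s0+R} \<times> {k0-R<..<k0+R}) (%(\<eta>, s, kp). bs \<eta> s kp)"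
      "continuous_on ({-R<..<R} \<times> {s0-R<..<s0+R} \<times> {k0-R<..<k0+R}) (%(\<eta>, s, kp). bk \<eta> s kp)"
    and b_der: "\<And>\<eta> s kp. \<bar>\<eta>\<bar> < R ==> \<bar>s - s0\<bar> < R ==> \<bar>kp - k0\<bar> < R ==>
      ((%(s, kp). b \<eta> s kp) has_derivative (%(h, k). bs \<eta> s kp * h + bk \<eta> s kp * k)) (at (s, kp))"
    and bs_der: "\<And>\<eta> s kp. \<bar>\<eta>\<bar> < R ==> \<bar>s - s0\<bar> < R ==> \<bar>kp - k0\<bar> < R ==>
      ((%(s, kp). bs \<eta> s kp) has_derivative (%(h, k). bss \<eta> s kp * h + bsk \<eta> s kp * k)) (at (s, kp))"
    and bk_der: "\<And>\<eta> s kp. \<bar>\<eta>\<bar> < R ==> \<bar>s - s0\<bar> < R ==> \<bar>kp - k0\<bar> < R ==>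
      ((%(s, kp). bk \<eta> s kp) has_derivative (%(h, k). bsk \<eta> s kp * h + bkk \<eta> s kp * k)) (at (s, kp))"
    and base: "b 0 s0 k0 = 0" "bs 0 s0 k0 = 0"
    and bss: "\<And>\<eta> s kp. \<bar>\<eta>\<bar> < R ==> \<bar>s - s0\<bar> < R ==> \<bar>kp - k0\<bar> < R ==> 0 < bss \<eta> s kp"
begin

lemma line_derivative:
  assumes "\<bar>\<eta>\<bar> < R" "\<bar>s + h * t - s0\<bar> < R" "\<bar>kp + k * t - k0\<bar> < R"
  shows "DERIV (%t. b \<eta> (s + h * t) (kp + k * t)) t :>
      bs \<eta> (s + h * t) (kp + k * t) * h + bk \<eta> (s + h * t) (kp + k * t) * k"
    and "DERIV (%t. bs \<eta> (s + h * t) (kp + k * t)) t :>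
      bss \<eta> (s + h * t) (kp + k * t) * h + bsk \<eta> (s + h * t) (kp + k * t) * k"
    and "DERIV (%t. bk \<eta> (s + h * t) (kp + k * t)) t :>
      bsk \<eta> (s + h * t) (kp + k * t) * h + bkk \<eta> (s + h * t) (kp + k * t) * k"
proof -
  have line: "((%t. (s + h * t, kp + k * t)) has_derivative (%x. (h * x, k * x))) (at t)"
    by (auto intro!: derivative_eq_intros)
  have "DERIV (%t. f (s + h * t) (kp + k * t)) t :> p * h + q * k"
    if "((%(s, kp). f s kp) has_derivative (%(h, k). p * h + q * k)) (at (s + h * t, kp + k * t))"
    for f :: "real => real => real" and p q
  proof -
    have "((%t. f (s + h * t) (kp + k * t)) has_derivative (%x. p * (h * x) + q * (k * x))) (at t)"
      using has_derivative_compose[OF line that] by simp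
    then show ?thesis unfolding has_field_derivative_def
      by (rule has_derivative_eq_rhs) (simp add: fun_eq_iff algebra_simps)
  qed
  from this[OF b_der[OF assms]] this[OF bs_der[OF assms]] this[OF bk_der[OF assms]]
  show "DERIV (%t. b \<eta> (s + h * t) (kp + k * t)) t :>
      bs \<eta> (s + h * t) (kp + k * t) * h + bk \<eta> (s + h * t) (kp + k * t) * k"
    and "DERIV (%t. bs \<eta> (s + h * t) (kp + k * t)) t :>
      bss \<eta> (s + h * t) (kp + k * t) * h + bsk \<eta> (s + h * t) (kp + k * t) * k"
    and "DERIV (%t. bk \<eta> (s + h * t) (kp + k * t)) t :>
      bsk \<eta> (s + h * t) (kp + k * t) * h + bkk \<eta> (s + h * t) (kp + k * t) * k" by auto
qed

lemma partial_derivatives: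
  assumes "\<bar>\<eta>\<bar> < R" "\<bar>s - s0\<bar> < R" "\<bar>kp - k0\<bar> < R"
  shows "DERIV (%s. b \<eta> s kp) s :> bs \<eta> s kp" "DERIV (%s. bs \<eta> s kp) s :> bss \<eta> s kp"
    "DERIV (%kp. b \<eta> s kp) kp :> bk \<eta> s kp"
  using line_derivative(1,2)[of \<eta> 0 1 s kp 0] line_derivative(1)[of \<eta> s 0 kp 0 1] assms by simp_all

definition quadratic :: "real => real => real => real => real => real" where
  "quadratic \<eta> s kp h k = bss \<eta> s kp * h\<^sup>2 + 2 * bsk \<eta> s kp * h * k + bkk \<eta> s kp * k\<^sup>2"

lemma line_second_derivative:
  assumes "\<bar>\<eta>\<bar> < R" "\<bar>s + h * t - s0\<bar> < R" "\<bar>kp + k * t - k0\<bar> < R"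
  shows "DERIV (%t. bs \<eta> (s + h * t) (kp + k * t) * h + bk \<eta> (s + h * t) (kp + k * t) * k) t :>
    quadratic \<eta> (s + h * t) (kp + k * t) h k"
  by (rule DERIV_cong[OF DERIV_add[OF DERIV_cmult_right[OF line_derivative(2)[OF assms]]
          DERIV_cmult_right[OF line_derivative(3)[OF assms]]]])
    (simp add: quadratic_def power2_eq_square algebra_simps)

lemma segment_bound:
  fixes x y c :: real
  assumes "\<bar>x - c\<bar> < r" "\<bar>y - c\<bar> < r" "0 \<le> t" "t \<le> 1"
  shows "\<bar>x + (y - x) * t - c\<bar> < r"
proof -
  have "x + (y - x) * t - c = (1 - t) * (x - c) + t * (y - c)" by (simp add: algebra_simps)
  also have "\<bar>\<dots>\<bar> \<le> (1 - t) * \<bar>x - c\<bar> + t * \<bar>y - c\<bar>"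
    using assms(3,4) abs_triangle_ineq[of "(1 - t) * (x - c)" "t * (y - c)"] by (simp add: abs_mult)
  also have "\<dots> < r" using convex_bound_lt[OF assms(1,2), of "1 - t" t] assms(3,4) by simp
  finally show ?thesis .
qed

lemma strict_convex_on_segment:
  assumes \<eta>: "\<bar>\<eta>\<bar> < R" and x: "\<bar>s1 - s0\<bar> < R" "\<bar>k1 - k0\<bar> < R" and y: "\<bar>s2 - s0\<bar> < R" "\<bar>k2 - k0\<bar> < R"
    and pos: "\<And>s kp. \<bar>s - s0\<bar> < R ==> \<bar>kp - k0\<bar> < R ==> 0 < c * quadratic \<eta> s kp (s2 - s1) (k2 - k1)"
    and t: "0 < t" "t < 1"
  shows "c * b \<eta> (s1 + (s2 - s1) * t) (k1 + (k2 - k1) * t) < (1 - t) * (c * b \<eta> s1 k1) + t * (c * b \<eta> s2 k2)"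
proof -
  let ?\<phi> = "%t. c * b \<eta> (s1 + (s2 - s1) * t) (k1 + (k2 - k1) * t)"
  have in_box: "\<bar>s1 + (s2 - s1) * t - s0\<bar> < R" "\<bar>k1 + (k2 - k1) * t - k0\<bar> < R" if "0 \<le> t" "t \<le> 1" for t
    using segment_bound x y that by blast+
  have "?\<phi> t < (1 - t) * ?\<phi> 0 + t * ?\<phi> 1"
    by (rule has_derivative_strict_convex[OF DERIV_cmult[OF line_derivative(1)]
          DERIV_cmult[OF line_second_derivative]])
      (use \<eta> in_box pos t in auto)
  then show ?thesis by simp
qed

lemma bs_strict_mono:
  assumes "\<bar>\<eta>\<bar> < R" "\<bar>kp - k0\<bar> < R" "\<bar>s - s0\<bar> < R" "\<bar>s' - s0\<bar> < R" "s < s'"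
  shows "bs \<eta> s kp < bs \<eta> s' kp"
proof (rule DERIV_pos_imp_increasing[OF assms(5)])
  fix r assume "s \<le> r" "r \<le> s'"
  then have r: "\<bar>r - s0\<bar> < R" using assms(3,4) by linarith
  show "\<exists>y. DERIV (%s. bs \<eta> s kp) r :> y \<and> 0 < y"
    using partial_derivatives(2)[OF assms(1) r assms(2)] bss[OF assms(1) r assms(2)] by blast
qed

text \<open>Convexity in \<open>s\<close> makes a critical point a strict minimum.\<close>

lemma critical_min:
  assumes "\<bar>\<eta>\<bar> < R" "\<bar>kp - k0\<bar> < R" "\<bar>c - s0\<bar> < R" "bs \<eta> c kp = 0"
  shows "\<And>s s'. \<bar>s - s0\<bar> < R ==> s < s' ==> s' \<le> c ==> b \<eta> s' kp < b \<eta> s kp"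
    and "\<And>s s'. \<bar>s' - s0\<bar> < R ==> s < s' ==> c \<le> s ==> b \<eta> s kp < b \<eta> s' kp"
proof -
  fix s s' assume s: "\<bar>s - s0\<bar> < R" "s < s'" "s' \<le> c"
  show "b \<eta> s' kp < b \<eta> s kp"
  proof (rule DERIV_neg_imp_decreasing_open[OF s(2)])
    fix r assume r: "s < r" "r < s'"
    then have r': "\<bar>r - s0\<bar> < R" using s assms(3) by linarith
    show "\<exists>y. DERIV (%s. b \<eta> s kp) r :> y \<and> y < 0"
      using partial_derivatives(1)[OF assms(1) r' assms(2)]
        bs_strict_mono[OF assms(1,2) r' assms(3)] r s assms(4) by auto
  next
    show "continuous_on {s..s'} (%s. b \<eta> s kp)"
      by (rule DERIV_continuous_on, rule has_field_derivative_at_within, rule partial_derivatives(1))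
        (use assms s in auto)
  qed
next
  fix s s' assume s: "\<bar>s' - s0\<bar> < R" "s < s'" "c \<le> s"
  show "b \<eta> s kp < b \<eta> s' kp"
  proof (rule DERIV_pos_imp_increasing_open[OF s(2)])
    fix r assume r: "s < r" "r < s'"
    then have r': "\<bar>r - s0\<bar> < R" using s assms(3) by linarith
    show "\<exists>y. DERIV (%s. b \<eta> s kp) r :> y \<and> 0 < y"
      using partial_derivatives(1)[OF assms(1) r' assms(2)]
        bs_strict_mono[OF assms(1,2) assms(3) r'] r s assms(4) by auto
  next
    show "continuous_on {s..s'} (%s. b \<eta> s kp)"
      by (rule DERIV_continuous_on, rule has_field_derivative_at_within, rule partial_derivatives(1))
        (use assms s in auto)
  qed
qed

text \<open>\<open>z1\<close> and \<open>z2\<close> are the zeros of \<open>b \<eta> _ kp\<close> in the interval of radius \<open>a\<close>, told apart by the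
  sign of the derivative.\<close>

definition roots :: "real => real => real => real => real => bool" where
  "roots \<eta> a kp z1 z2 \<longleftrightarrow> s0 - a < z1 \<and> z1 \<le> z2 \<and> z2 < s0 + a \<and>
     (\<forall>s\<in>{s0-a..s0+a}. (b \<eta> s kp = 0 \<longleftrightarrow> s = z1 \<or> s = z2) \<and> (b \<eta> s kp < 0 \<longleftrightarrow> z1 < s \<and> s < z2) \<and>
       (b \<eta> s kp = 0 \<and> bs \<eta> s kp \<le> 0 \<longleftrightarrow> s = z1) \<and> (b \<eta> s kp = 0 \<and> 0 \<le> bs \<eta> s kp \<longleftrightarrow> s = z2))"

lemma roots_zeros:
  assumes "roots \<eta> a kp z1 z2"
  shows "s \<in> {s0-a..s0+a} \<and> b \<eta> s kp = 0 \<longleftrightarrow> s = z1 \<or> s = z2"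
proof -
  have "z1 \<in> {s0-a..s0+a}" "z2 \<in> {s0-a..s0+a}" using assms by (auto simp: roots_def)
  then show ?thesis using assms unfolding roots_def by blast
qed

text \<open>There is one zero on each side of the minimum, by the intermediate value theorem.\<close>

lemma roots_exist:
  assumes \<eta>: "\<bar>\<eta>\<bar> < R" and kp: "\<bar>kp - k0\<bar> < R" and a: "0 < a" "a < R"
    and ends: "0 < b \<eta> (s0 - a) kp" "0 < b \<eta> (s0 + a) kp" and c: "c \<in> {s0-a..s0+a}" "b \<eta> c kp \<le> 0"
  shows "\<exists>z1 z2. roots \<eta> a kp z1 z2"
proof -
  let ?I = "{s0-a..s0+a}" and ?\<phi> = "%s. b \<eta> s kp"
  have inR: "\<bar>s - s0\<bar> < R" if "s \<in> ?I" for s using that a by (auto simp: abs_less_iff)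
  have cont\<phi>: "continuous_on ?I ?\<phi>"
    by (rule DERIV_continuous_on, rule has_field_derivative_at_within, rule partial_derivatives(1)[OF \<eta> inR kp])
  obtain m where m: "m \<in> ?I" "\<And>s. s \<in> ?I ==> ?\<phi> m \<le> ?\<phi> s"
    using continuous_attains_inf[OF compact_Icc _ cont\<phi>] c by auto
  have "?\<phi> m \<le> 0" using m(2)[OF c(1)] c(2) by simp
  then have "m \<noteq> s0 - a" "m \<noteq> s0 + a" using ends by auto
  then have mi: "s0 - a < m" "m < s0 + a" using m(1) by auto
  have "bs \<eta> m kp = 0"
  proof (rule DERIV_local_min[OF partial_derivatives(1)[OF \<eta> inR[OF m(1)] kp]])
    show "0 < min (m - (s0 - a)) (s0 + a - m)" using mi by simp
    show "\<forall>y. \<bar>m - y\<bar> < min (m - (s0 - a)) (s0 + a - m) --> ?\<phi> m \<le> ?\<phi> y"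
      using m(2) by (auto simp: abs_less_iff)
  qed
  note mon = critical_min[OF \<eta> kp inR[OF m(1)] this] and bsm = this
  obtain z1 where z1: "s0 - a \<le> z1" "z1 \<le> m" "?\<phi> z1 = 0"
    using IVT2'[of ?\<phi> m 0 "s0 - a"] \<open>?\<phi> m \<le> 0\<close> ends mi continuous_on_subset[OF cont\<phi>, of "{s0-a..m}"] by auto
  obtain z2 where z2: "m \<le> z2" "z2 \<le> s0 + a" "?\<phi> z2 = 0"
    using IVT'[of ?\<phi> m 0 "s0 + a"] \<open>?\<phi> m \<le> 0\<close> ends mi continuous_on_subset[OF cont\<phi>, of "{m..s0+a}"] by auto
  have zI: "z1 \<in> ?I" "z2 \<in> ?I" using z1 z2 mi by auto
  have left: "s < m ==> bs \<eta> s kp < 0" and right: "m < s ==> 0 < bs \<eta> s kp" if "s \<in> ?I" for s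
    using bs_strict_mono[OF \<eta> kp inR[OF that] inR[OF m(1)]] bs_strict_mono[OF \<eta> kp inR[OF m(1)] inR[OF that]] bsm
    by auto
  have z12: "z1 = m \<longleftrightarrow> z2 = m"
  proof
    assume "z1 = m" then show "z2 = m" using mon(2)[of z2 m] inR[OF zI(2)] z1 z2 by force
  next
    assume "z2 = m" then show "z1 = m" using mon(1)[of z1 m] inR[OF zI(1)] z1 z2 by force
  qed
  have sgn: "(?\<phi> s = 0 \<longleftrightarrow> s = z1 \<or> s = z2) \<and> (?\<phi> s < 0 \<longleftrightarrow> z1 < s \<and> s < z2)" if s: "s \<in> ?I" for s
  proof -
    consider "s < z1" | "s = z1" | "z1 < s" "s \<le> m" | "m < s" "s < z2" | "s = z2" | "z2 < s" by linarith
    then show ?thesis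
    proof cases
      case 1
      then have "?\<phi> z1 < ?\<phi> s" using mon(1)[of s z1] inR[OF s] z1 by auto
      then show ?thesis using 1 z1 z2 by auto
    next
      case 3
      then have "?\<phi> s < ?\<phi> z1" using mon(1)[of z1 s] inR[OF zI(1)] by auto
      moreover have "s < z2" using 3 z12 z2 by (cases "z2 = m") auto
      ultimately show ?thesis using 3 z1 by auto
    next
      case 4
      then have "?\<phi> s < ?\<phi> z2" using mon(2)[of z2 s] inR[OF zI(2)] by auto
      then show ?thesis using 4 z1 z2 by auto
    next
      case 6
      then have "?\<phi> z2 < ?\<phi> s" using mon(2)[of s z2] inR[OF s] z2 by auto
      then show ?thesis using 6 z1 z2 by auto
    qed (use z1 z2 in auto)
  qed
  have "(?\<phi> s = 0 \<and> bs \<eta> s kp \<le> 0 \<longleftrightarrow> s = z1) \<and> (?\<phi> s = 0 \<and> 0 \<le> bs \<eta> s kp \<longleftrightarrow> s = z2)"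
    if s: "s \<in> ?I" for s
  proof -
    have "bs \<eta> z1 kp \<le> 0" "0 \<le> bs \<eta> z2 kp"
      using left[OF zI(1)] right[OF zI(2)] z1 z2 bsm by (auto simp: le_less)
    moreover have "z1 \<noteq> z2 ==> bs \<eta> z1 kp < 0 \<and> 0 < bs \<eta> z2 kp"
      using left[OF zI(1)] right[OF zI(2)] z1 z2 z12 by (auto simp: le_less)
    ultimately show ?thesis using sgn[OF s] by force
  qed
  moreover have "s0 - a \<noteq> z1" "z2 \<noteq> s0 + a" using ends z1(3) z2(3) by auto
  ultimately have "roots \<eta> a kp z1 z2" unfolding roots_def using sgn z1 z2 by auto
  then show ?thesis by blast
qed

lemma slice_continuous:
  assumes "\<bar>\<eta>\<bar> < R" "T \<subseteq> {k0-R<..<k0+R} \<times> {s0-R<..<s0+R}"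
  shows "continuous_on T (%(kp, s). b \<eta> s kp)" "continuous_on T (%(kp, s). bs \<eta> s kp)"
    "continuous_on T (%(kp, s). bk \<eta> s kp)"
proof -
  have c: "continuous_on T (%p. (\<eta>, snd p, fst p))" by (intro continuous_intros)
  have im: "(%p. (\<eta>, snd p, fst p)) ` T \<subseteq> {-R<..<R} \<times> {s0-R<..<s0+R} \<times> {k0-R<..<k0+R}"
    using assms by (auto simp: abs_less_iff)
  show "continuous_on T (%(kp, s). b \<eta> s kp)"
    using continuous_on_compose2[OF cont(1) c im] by (simp add: split_beta')
  show "continuous_on T (%(kp, s). bs \<eta> s kp)"
    using continuous_on_compose2[OF cont(2) c im] by (simp add: split_beta')
  show "continuous_on T (%(kp, s). bk \<eta> s kp)"
    using continuous_on_compose2[OF cont(3) c im] by (simp add: split_beta')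
qed

lemma closed_slice:
  assumes "\<bar>\<eta>\<bar> < R" "closed J" "J \<subseteq> {k0-R<..<k0+R}" "a < R" and C: "closed (C :: (real \<times> real) set)"
  shows "closed {(kp, s). kp \<in> J \<and> s \<in> {s0-a..s0+a} \<and> (b \<eta> s kp, bs \<eta> s kp) \<in> C}"
proof -
  let ?T = "J \<times> {s0-a..s0+a}"
  have T: "closed ?T" "?T \<subseteq> {k0-R<..<k0+R} \<times> {s0-R<..<s0+R}"
    using assms by (auto intro: closed_Times)
  have "continuous_on ?T (%p. (case p of (kp, s) => b \<eta> s kp, case p of (kp, s) => bs \<eta> s kp))"
    by (intro continuous_on_Pair slice_continuous[OF assms(1) T(2)])
  from continuous_closed_preimage[OF this T(1) C] show ?thesis
    by (rule back_subst[of closed]) auto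
qed

text \<open>The two branches are told apart by the sign of the derivative. As this is a closed condition, their
  graphs are closed, and a bounded function with closed graph is continuous.\<close>

lemma branches:
  assumes \<eta>: "\<bar>\<eta>\<bar> < R" and a: "0 < a" "a < R" and J: "closed J" "J \<subseteq> {k0-R<..<k0+R}"
    and ends: "\<And>kp. kp \<in> J ==> 0 < b \<eta> (s0 - a) kp \<and> 0 < b \<eta> (s0 + a) kp"
    and ex: "\<And>kp. kp \<in> J ==> \<exists>c\<in>{s0-a..s0+a}. b \<eta> c kp \<le> 0"
  obtains z1 z2 where "continuous_on J z1" "continuous_on J z2" "\<And>kp. kp \<in> J ==> roots \<eta> a kp (z1 kp) (z2 kp)"
proof -
  have "\<exists>z1 z2. roots \<eta> a kp z1 z2" if "kp \<in> J" for kp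
  proof -
    have "\<bar>kp - k0\<bar> < R" using that J(2) by (auto simp: abs_less_iff)
    then show ?thesis using roots_exist[OF \<eta> _ a] ends[OF that] ex[OF that] by blast
  qed
  then obtain z1 z2 where z: "\<And>kp. kp \<in> J ==> roots \<eta> a kp (z1 kp) (z2 kp)" by metis
  have zI: "z1 kp \<in> {s0-a..s0+a}" "z2 kp \<in> {s0-a..s0+a}" if "kp \<in> J" for kp
    using z[OF that] by (auto simp: roots_def)
  have "s \<in> {s0-a..s0+a} \<and> b \<eta> s kp = 0 \<and> bs \<eta> s kp \<le> 0 \<longleftrightarrow> s = z1 kp" if "kp \<in> J" for kp s
    using z[OF that] zI[OF that] unfolding roots_def by metis
  then have "(%kp. (kp, z1 kp)) ` J = {(kp, s). kp \<in> J \<and> s \<in> {s0-a..s0+a} \<and> (b \<eta> s kp, bs \<eta> s kp) \<in> {0} \<times> {..0}}"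
    by (auto simp: image_iff)
  then have 1: "closed ((%kp. (kp, z1 kp)) ` J)"
    using closed_slice[OF \<eta> J a(2), of "{0} \<times> {..0}"] by (simp add: closed_Times)
  have "s \<in> {s0-a..s0+a} \<and> b \<eta> s kp = 0 \<and> 0 \<le> bs \<eta> s kp \<longleftrightarrow> s = z2 kp" if "kp \<in> J" for kp s
    using z[OF that] zI[OF that] unfolding roots_def by metis
  then have "(%kp. (kp, z2 kp)) ` J = {(kp, s). kp \<in> J \<and> s \<in> {s0-a..s0+a} \<and> (b \<eta> s kp, bs \<eta> s kp) \<in> {0} \<times> {0..}}"
    by (auto simp: image_iff)
  then have 2: "closed ((%kp. (kp, z2 kp)) ` J)"
    using closed_slice[OF \<eta> J a(2), of "{0} \<times> {0..}"] by (simp add: closed_Times)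
  show thesis
    by (rule that[OF continuous_from_closed_graph[OF compact_Icc[of "s0 - a" "s0 + a"] _ 1]
          continuous_from_closed_graph[OF compact_Icc[of "s0 - a" "s0 + a"] _ 2] z])
      (use zI in auto)
qed

lemma positive_near_compact:
  assumes K: "compact K" "K \<subseteq> {s0-R<..<s0+R} \<times> {k0-R<..<k0+R}" and pos: "\<And>s kp. (s, kp) \<in> K ==> 0 < c * b 0 s kp"
  shows "\<exists>e>0. \<forall>\<eta> s kp kp'. (s, kp) \<in> K --> \<bar>\<eta>\<bar> < e --> \<bar>kp' - kp\<bar> < e -->
    \<bar>\<eta>\<bar> < R \<and> \<bar>kp' - k0\<bar> < R \<and> 0 < c * b \<eta> s kp'"
proof -
  let ?O = "{-R<..<R} \<times> {s0-R<..<s0+R} \<times> {k0-R<..<k0+R}"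
  let ?f = "%p. c * (case p of (\<eta>, s, kp) => b \<eta> s kp)"
  define G where "G = ?O \<inter> ?f -` {0<..}"
  have "open ?O" by (intro open_Times open_greaterThanLessThan)
  then have G: "open G" unfolding G_def
    by (intro continuous_open_preimage continuous_on_mult_left cont(1)) auto
  have cK: "compact ({0 :: real} \<times> K)" using K(1) by (intro compact_Times) auto
  have KG: "{0} \<times> K \<subseteq> G" using pos K(2) R by (auto simp: G_def)
  obtain e where e: "0 < e" "(\<Union>x\<in>{0} \<times> K. ball x e) \<subseteq> G"
    by (rule compact_subset_open_imp_ball_epsilon_subset[OF cK G KG])
  show ?thesis
  proof (intro exI[of _ "e / 2"] conjI[of "0 < e / 2"] allI impI)
    fix \<eta> s kp kp' :: real assume h: "(s, kp) \<in> K" "\<bar>\<eta>\<bar> < e / 2" "\<bar>kp' - kp\<bar> < e / 2"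
    have "dist (0, s, kp) (\<eta>, s, kp') = norm (- \<eta>, 0 :: real, kp - kp')" by (simp add: dist_norm)
    also have "\<dots> \<le> norm (- \<eta>) + norm (0 :: real, kp - kp')" by (rule norm_Pair_le)
    also have "norm (0 :: real, kp - kp') \<le> norm (0 :: real) + norm (kp - kp')" by (rule norm_Pair_le)
    finally have "dist (0, s, kp) (\<eta>, s, kp') < e" using h(2,3) by (simp add: abs_minus_commute)
    then have "(\<eta>, s, kp') \<in> (\<Union>x\<in>{0} \<times> K. ball x e)" using h(1) by auto
    then have "(\<eta>, s, kp') \<in> G" using e(2) by blast
    then show "\<bar>\<eta>\<bar> < R \<and> \<bar>kp' - k0\<bar> < R \<and> 0 < c * b \<eta> s kp'"
      by (auto simp: G_def abs_less_iff)
  qed (use e(1) in simp)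
qed

lemma base_positive:
  assumes "\<bar>s - s0\<bar> < R" "s \<noteq> s0"
  shows "0 < b 0 s k0"
proof -
  have z: "\<bar>0 :: real\<bar> < R" "\<bar>k0 - k0\<bar> < R" "\<bar>s0 - s0\<bar> < R" using R by auto
  show ?thesis
    using critical_min(1)[OF z base(2) assms(1), of s0] critical_min(2)[OF z base(2) assms(1), of s0]
      assms(2) base(1) by (cases s s0 rule: linorder_cases) auto
qed

lemma critical_nonneg:
  assumes "\<bar>\<eta>\<bar> < R" "\<bar>kp - k0\<bar> < R" "\<bar>c - s0\<bar> < R" "bs \<eta> c kp = 0" "\<bar>s - s0\<bar> < R"
  shows "b \<eta> c kp \<le> b \<eta> s kp"
  using critical_min(1)[OF assms(1-4), of s c] critical_min(2)[OF assms(1-4), of s c] assms(5)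
  by (cases s c rule: linorder_cases) auto

lemma continuous_in_kappa:
  assumes "\<bar>\<eta>\<bar> < R" "\<bar>s - s0\<bar> < R" "J \<subseteq> {k0-R<..<k0+R}"
  shows "continuous_on J (%kp. b \<eta> s kp)"
  by (rule DERIV_continuous_on, rule has_field_derivative_at_within, rule partial_derivatives(3)[OF assms(1,2)])
    (use assms(3) in \<open>auto simp: abs_less_iff\<close>)

lemma closed_nonpos:
  assumes "\<bar>\<eta>\<bar> < R" "compact J" "J \<subseteq> {k0-R<..<k0+R}" "a < R"
  shows "closed {kp\<in>J. \<exists>s\<in>{s0-a..s0+a}. b \<eta> s kp \<le> 0}"
proof -
  let ?T = "{(kp, s). kp \<in> J \<and> s \<in> {s0-a..s0+a} \<and> (b \<eta> s kp, bs \<eta> s kp) \<in> {..0} \<times> UNIV}"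
  have "closed ?T"
    by (rule closed_slice[OF assms(1) compact_imp_closed[OF assms(2)] assms(3,4)]) (simp add: closed_Times)
  moreover have "compact (J \<times> {s0-a..s0+a})" using assms(2) by (intro compact_Times) auto
  ultimately have "compact ((J \<times> {s0-a..s0+a}) \<inter> ?T)" by (rule compact_Int_closed[rotated])
  then have "compact (fst ` ((J \<times> {s0-a..s0+a}) \<inter> ?T))"
    by (intro compact_continuous_image continuous_on_fst continuous_on_id)
  moreover have "fst ` ((J \<times> {s0-a..s0+a}) \<inter> ?T) = {kp\<in>J. \<exists>s\<in>{s0-a..s0+a}. b \<eta> s kp \<le> 0}"
  proof (intro equalityI subsetI)
    fix kp assume "kp \<in> {kp\<in>J. \<exists>s\<in>{s0-a..s0+a}. b \<eta> s kp \<le> 0}"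
    then obtain s where s: "kp \<in> J" "s \<in> {s0-a..s0+a}" "b \<eta> s kp \<le> 0" by blast
    show "kp \<in> fst ` ((J \<times> {s0-a..s0+a}) \<inter> ?T)"
      by (rule image_eqI[where x = "(kp, s)"]) (use s in simp_all)
  next
    fix kp assume "kp \<in> fst ` ((J \<times> {s0-a..s0+a}) \<inter> ?T)"
    then obtain s where "kp \<in> J" "s \<in> {s0-a..s0+a}" "b \<eta> s kp \<le> 0" by auto
    then show "kp \<in> {kp\<in>J. \<exists>s\<in>{s0-a..s0+a}. b \<eta> s kp \<le> 0}" by blast
  qed
  ultimately have "compact {kp\<in>J. \<exists>s\<in>{s0-a..s0+a}. b \<eta> s kp \<le> 0}" by (simp only:)
  then show ?thesis by (rule compact_imp_closed)
qed

lemma closed_nonneg: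
  assumes "\<bar>\<eta>\<bar> < R" "closed J" "J \<subseteq> {k0-R<..<k0+R}" "0 < a" "a < R"
  shows "closed {kp\<in>J. \<forall>s\<in>{s0-a..s0+a}. 0 \<le> b \<eta> s kp}"
proof -
  have "closed (J \<inter> (%kp. b \<eta> s kp) -` {0..})" if "s \<in> {s0-a..s0+a}" for s
    by (rule continuous_closed_preimage[OF continuous_in_kappa[OF assms(1) _ assms(3)] assms(2)])
      (use that assms(5) in \<open>auto simp: abs_less_iff\<close>)
  then have "closed (\<Inter>s\<in>{s0-a..s0+a}. J \<inter> (%kp. b \<eta> s kp) -` {0..})" by blast
  moreover have "(\<Inter>s\<in>{s0-a..s0+a}. J \<inter> (%kp. b \<eta> s kp) -` {0..}) = {kp\<in>J. \<forall>s\<in>{s0-a..s0+a}. 0 \<le> b \<eta> s kp}"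
    using assms(4) by auto
  ultimately show ?thesis by simp
qed

text \<open>Positivity at the ends of the \<open>s\<close>-interval persists, so that zeros neither enter nor leave through
  the ends.\<close>

lemma ends_positive:
  assumes "0 < a" "a < R"
  obtains e where "0 < e" "e \<le> R"
    "\<And>\<eta> kp. \<bar>\<eta>\<bar> < e ==> \<bar>kp - k0\<bar> < e ==> 0 < b \<eta> (s0 - a) kp \<and> 0 < b \<eta> (s0 + a) kp"
proof -
  have 1: "compact {(s0 - a, k0), (s0 + a, k0)}" by (intro finite_imp_compact) simp
  have 2: "{(s0 - a, k0), (s0 + a, k0)} \<subseteq> {s0-R<..<s0+R} \<times> {k0-R<..<k0+R}" using assms R by auto
  have 3: "0 < 1 * b 0 s kp" if "(s, kp) \<in> {(s0 - a, k0), (s0 + a, k0)}" for s kp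
    using base_positive[of "s0 - a"] base_positive[of "s0 + a"] assms that by auto
  obtain e where e: "0 < e" "\<And>\<eta> s kp kp'. (s, kp) \<in> {(s0 - a, k0), (s0 + a, k0)} ==> \<bar>\<eta>\<bar> < e ==>
      \<bar>kp' - kp\<bar> < e ==> \<bar>\<eta>\<bar> < R \<and> \<bar>kp' - k0\<bar> < R \<and> 0 < 1 * b \<eta> s kp'"
    using positive_near_compact[OF 1 2 3] by blast
  show thesis by (rule that[of "min e R"]) (use e R in auto)
qed

text \<open>Monotonicity in \<open>kp\<close> makes the set of \<open>kp\<close> with a nonpositive value one-sided. Its end is the fold;
  since the slope in \<open>kp\<close> is bounded away from 0, an error of order \<open>\<eta>\<^sup>2\<close> in \<open>b\<close> moves it by the
  same order.\<close>

theorem saddle_node_zeros: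
  assumes d: "d \<in> {1, -1}"
    and bk: "\<And>\<eta> s kp. \<bar>\<eta>\<bar> < R ==> \<bar>s - s0\<bar> < R ==> \<bar>kp - k0\<bar> < R ==> d * bk \<eta> s kp < 0"
    and close: "\<And>\<eta> s kp. \<bar>\<eta>\<bar> < R ==> \<bar>s - s0\<bar> < R ==> \<bar>kp - k0\<bar> < R ==>
      \<bar>b \<eta> s kp - b 0 s kp\<bar> \<le> C * \<eta>\<^sup>2"
  obtains ks A where "\<forall>\<^sub>F \<eta> in at_right 0. \<bar>ks \<eta> - k0\<bar> \<le> A * \<eta>\<^sup>2"
    "\<forall>\<^sub>F a in at_right 0. \<forall>\<^sub>F \<beta> in at_right 0. \<forall>\<^sub>F \<eta> in at_right 0.
      saddle_node (%kp. {s\<in>{s0-a..s0+a}. b \<eta> s kp = 0}) {k0-\<beta>..k0+\<beta>} (ks \<eta>)"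
proof -
  have dd: "d * d = 1" "\<bar>d\<bar> = 1" using d by auto
  have slope: "\<exists>kp''. \<bar>kp'' - k0\<bar> < r \<and> b \<eta> s kp' - b \<eta> s kp = (d * bk \<eta> s kp'') * (d * (kp' - kp))"
    if "\<bar>\<eta>\<bar> < R" "\<bar>s - s0\<bar> < R" "\<bar>kp - k0\<bar> < r" "\<bar>kp' - k0\<bar> < r" "r \<le> R" for \<eta> s kp kp' r
  proof -
    let ?\<phi> = "%t. b \<eta> (s + 0 * t) (kp + (kp' - kp) * t)"
    have box: "\<bar>kp + (kp' - kp) * t - k0\<bar> < r" if "0 \<le> t" "t \<le> 1" for t
      using segment_bound that \<open>\<bar>kp - k0\<bar> < r\<close> \<open>\<bar>kp' - k0\<bar> < r\<close> by blast
    have "DERIV ?\<phi> t :> bs \<eta> (s + 0 * t) (kp + (kp' - kp) * t) * 0 + bk \<eta> (s + 0 * t) (kp + (kp' - kp) * t) * (kp' - kp)"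
      if "0 \<le> t" "t \<le> 1" for t
      by (rule line_derivative(1)) (use box[OF that] \<open>\<bar>\<eta>\<bar> < R\<close> \<open>\<bar>s - s0\<bar> < R\<close> \<open>r \<le> R\<close> in auto)
    from MVT2[OF zero_less_one this] obtain t where t: "0 < t" "t < 1"
      "?\<phi> 1 - ?\<phi> 0 = (1 - 0) * (bs \<eta> (s + 0 * t) (kp + (kp' - kp) * t) * 0 + bk \<eta> (s + 0 * t) (kp + (kp' - kp) * t) * (kp' - kp))"
      by auto
    then have "b \<eta> s kp' - b \<eta> s kp = (d * d) * (bk \<eta> s (kp + (kp' - kp) * t) * (kp' - kp))"
      by (simp add: dd)
    then show ?thesis using box[of t] t by (intro exI[of _ "kp + (kp' - kp) * t"]) (simp add: ac_simps)
  qed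
  have mono: "b \<eta> s kp' < b \<eta> s kp"
    if h: "\<bar>\<eta>\<bar> < R" "\<bar>s - s0\<bar> < R" "\<bar>kp - k0\<bar> < R" "\<bar>kp' - k0\<bar> < R" "0 < d * (kp' - kp)" for \<eta> s kp kp'
  proof -
    obtain kp'' where "\<bar>kp'' - k0\<bar> < R" "b \<eta> s kp' - b \<eta> s kp = (d * bk \<eta> s kp'') * (d * (kp' - kp))"
      using slope[OF h(1-4)] by auto
    with mult_neg_pos[OF bk[OF h(1,2), of kp''] h(5)] show ?thesis by linarith
  qed
  define fold where "fold \<eta> s kp \<longleftrightarrow> \<bar>s - s0\<bar> < R / 2 \<and> \<bar>kp - k0\<bar> < R / 2 \<and> b \<eta> s kp = 0 \<and> bs \<eta> s kp = 0" for \<eta> s kp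
  have fold_le: "\<not> 0 < d * (kp' - kp)" if "\<bar>\<eta>\<bar> < R" "fold \<eta> s kp" "fold \<eta> s' kp'" for \<eta> s kp s' kp'
  proof
    assume *: "0 < d * (kp' - kp)"
    have "b \<eta> s kp' < b \<eta> s kp" by (rule mono) (use that * R in \<open>auto simp: fold_def\<close>)
    moreover have "b \<eta> s' kp' \<le> b \<eta> s kp'" by (rule critical_nonneg) (use that R in \<open>auto simp: fold_def\<close>)
    ultimately show False using that by (simp add: fold_def)
  qed
  have fold_unique: "kp' = kp" if "\<bar>\<eta>\<bar> < R" "fold \<eta> s kp" "fold \<eta> s' kp'" for \<eta> s kp s' kp'
    using fold_le[OF that] fold_le[OF that(1,3,2)] d by auto
  define ks where "ks \<eta> = (SOME kp. \<exists>s. fold \<eta> s kp)" for \<eta>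
  have ks: "ks \<eta> = kp" if "\<bar>\<eta>\<bar> < R" "fold \<eta> s kp" for \<eta> s kp
  proof -
    have "\<exists>s. fold \<eta> s (ks \<eta>)" unfolding ks_def by (rule someI[of _ kp]) (use that in blast)
    then show ?thesis using fold_unique[OF that] by blast
  qed
  have main: "\<exists>e>0. \<forall>\<beta>. 0 < \<beta> \<and> \<beta> < e --> (\<exists>e2>0. \<forall>\<eta>. \<bar>\<eta>\<bar> < e2 --> \<bar>\<eta>\<bar> < R \<and> (\<exists>s. fold \<eta> s (ks \<eta>)) \<and>
      saddle_node (%kp. {s\<in>{s0-a..s0+a}. b \<eta> s kp = 0}) {k0-\<beta>..k0+\<beta>} (ks \<eta>))"
    if a: "0 < a" "a < R / 2" for a
  proof -
    have aR: "a < R" using a by simp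
    obtain e where e: "0 < e" "e \<le> R"
      "\<And>\<eta> kp. \<bar>\<eta>\<bar> < e ==> \<bar>kp - k0\<bar> < e ==> 0 < b \<eta> (s0 - a) kp \<and> 0 < b \<eta> (s0 + a) kp"
      using ends_positive[OF a(1) aR] by metis
    show ?thesis
    proof (rule exI[of _ "min e (R / 2)"], intro conjI allI impI)
      show "0 < min e (R / 2)" using e(1) R by simp
      fix \<beta> assume "0 < \<beta> \<and> \<beta> < min e (R / 2)"
      then have \<beta>: "0 < \<beta>" "\<beta> < e" "\<beta> < R / 2" by auto
      let ?I = "{s0-a..s0+a}" and ?J = "{k0-\<beta>..k0+\<beta>}"
      have J: "?J \<subseteq> {k0-R<..<k0+R}" "compact ?J" using \<beta> R by auto
      have inR: "\<bar>s - s0\<bar> < R / 2" if "s \<in> ?I" for s using that a unfolding atLeastAtMost_iff by linarith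
      have inRk: "\<bar>kp - k0\<bar> < R / 2" "\<bar>kp - k0\<bar> < e" if "kp \<in> ?J" for kp using that \<beta> unfolding atLeastAtMost_iff by linarith+
      have endk: "k0 - d * \<beta> \<in> ?J" "k0 + d * \<beta> \<in> ?J" using d \<beta> by auto
      have c1: "compact (?I \<times> {k0 - d * \<beta>})" by (intro compact_Times) auto
      have s1: "?I \<times> {k0 - d * \<beta>} \<subseteq> {s0-R<..<s0+R} \<times> {k0-R<..<k0+R}"
        using a R subsetD[OF J(1) endk(1)] by auto
      have p1: "0 < 1 * b 0 s kp" if "(s, kp) \<in> ?I \<times> {k0 - d * \<beta>}" for s kp
      proof -
        have s: "\<bar>s - s0\<bar> < R" using that inR[of s] R by auto
        have "b 0 s k0 < b 0 s (k0 - d * \<beta>)"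
          by (rule mono) (use R s inRk(1)[OF endk(1)] dd \<beta> in \<open>auto simp flip: mult.assoc\<close>)
        moreover have "0 \<le> b 0 s k0" using base_positive[OF s] base(1) by (cases "s = s0") auto
        ultimately show ?thesis using that by auto
      qed
      obtain e1 where e1: "0 < e1" "\<And>\<eta> s kp kp'. (s, kp) \<in> ?I \<times> {k0 - d * \<beta>} ==> \<bar>\<eta>\<bar> < e1 ==> \<bar>kp' - kp\<bar> < e1 ==>
          \<bar>\<eta>\<bar> < R \<and> \<bar>kp' - k0\<bar> < R \<and> 0 < 1 * b \<eta> s kp'"
        using positive_near_compact[OF c1 s1 p1] by blast
      have s2: "{(s0, k0 + d * \<beta>)} \<subseteq> {s0-R<..<s0+R} \<times> {k0-R<..<k0+R}"
        using R subsetD[OF J(1) endk(2)] by simp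
      have low: "b 0 s0 (k0 + d * \<beta>) < b 0 s0 k0"
        by (rule mono) (use R inRk(1)[OF endk(2)] dd \<beta> in \<open>auto simp flip: mult.assoc\<close>)
      have p2: "0 < (-1) * b 0 s kp" if "(s, kp) \<in> {(s0, k0 + d * \<beta>)}" for s kp
      proof -
        have "s = s0" "kp = k0 + d * \<beta>" using that by auto
        then show ?thesis using low base(1) by simp
      qed
      obtain e2 where e2: "0 < e2" "\<And>\<eta> s kp kp'. (s, kp) \<in> {(s0, k0 + d * \<beta>)} ==> \<bar>\<eta>\<bar> < e2 ==> \<bar>kp' - kp\<bar> < e2 ==>
          \<bar>\<eta>\<bar> < R \<and> \<bar>kp' - k0\<bar> < R \<and> 0 < (-1) * b \<eta> s kp'"
        using positive_near_compact[OF _ s2 p2] by auto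
      show "\<exists>e2>0. \<forall>\<eta>. \<bar>\<eta>\<bar> < e2 --> \<bar>\<eta>\<bar> < R \<and> (\<exists>s. fold \<eta> s (ks \<eta>)) \<and>
        saddle_node (%kp. {s\<in>?I. b \<eta> s kp = 0}) ?J (ks \<eta>)"
      proof (rule exI[of _ "min e (min e1 e2)"], intro conjI allI impI)
        show "0 < min e (min e1 e2)" using e(1) e1(1) e2(1) by simp
        fix \<eta> :: real assume "\<bar>\<eta>\<bar> < min e (min e1 e2)"
        then have \<eta>: "\<bar>\<eta>\<bar> < e" "\<bar>\<eta>\<bar> < e1" "\<bar>\<eta>\<bar> < e2" "\<bar>\<eta>\<bar> < R" using e(2) by auto
        show "\<bar>\<eta>\<bar> < R" by fact
        have kpos: "0 < b \<eta> s (k0 - d * \<beta>)" if "s \<in> ?I" for s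
          using e1(2)[of s "k0 - d * \<beta>" \<eta> "k0 - d * \<beta>"] that \<eta> e1(1) by simp
        have kneg: "b \<eta> s0 (k0 + d * \<beta>) < 0"
          using e2(2)[of s0 "k0 + d * \<beta>" \<eta> "k0 + d * \<beta>"] \<eta> e2(1) by simp
        have ends: "0 < b \<eta> (s0 - a) kp \<and> 0 < b \<eta> (s0 + a) kp" if "kp \<in> ?J" for kp
          using e(3)[OF \<eta>(1) inRk(2)[OF that]] .
        let ?C1 = "{kp\<in>?J. \<exists>s\<in>?I. b \<eta> s kp \<le> 0}" and ?C2 = "{kp\<in>?J. \<forall>s\<in>?I. 0 \<le> b \<eta> s kp}"
        have "closed ?C1" by (rule closed_nonpos[OF \<eta>(4) J(2,1) aR])
        moreover have "closed ?C2" by (rule closed_nonneg[OF \<eta>(4) _ J(1) a(1) aR]) simp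
        moreover have "?J \<subseteq> ?C1 \<union> ?C2"
        proof
          fix kp assume "kp \<in> ?J"
          then show "kp \<in> ?C1 \<union> ?C2"
            by (cases "\<exists>s\<in>?I. b \<eta> s kp \<le> 0") (auto simp: not_le less_imp_le)
        qed
        moreover have "k0 - d * \<beta> \<in> ?C2" using endk kpos by (auto intro: less_imp_le)
        moreover have "k0 + d * \<beta> \<in> ?C1" using endk kneg a(1) by (auto intro!: bexI[of _ s0])
        moreover have "connected ?J" by simp
        ultimately have "?C1 \<inter> ?C2 \<inter> ?J \<noteq> {}"
          using endk unfolding connected_closed by (metis (no_types, lifting) IntI empty_iff)
        then obtain kf sf where kf: "kf \<in> ?J" and nn: "\<And>s. s \<in> ?I ==> 0 \<le> b \<eta> s kf"
          and sf: "sf \<in> ?I" "b \<eta> sf kf \<le> 0" by blast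
        have sf0: "b \<eta> sf kf = 0" using nn[OF sf(1)] sf(2) by simp
        have kfR: "\<bar>kf - k0\<bar> < R" using inRk[OF kf] R by simp
        have rf: "\<exists>z1 z2. roots \<eta> a kf z1 z2"
          by (rule roots_exist[OF \<eta>(4) kfR a(1) aR _ _ sf]) (use ends[OF kf] in simp_all)
        then obtain z1 z2 where r: "roots \<eta> a kf z1 z2" by blast
        have eqf: "z1 = z2" if "roots \<eta> a kf z1 z2" for z1 z2
        proof (rule ccontr)
          assume "z1 \<noteq> z2"
          then have "(z1 + z2) / 2 \<in> ?I" "b \<eta> ((z1 + z2) / 2) kf < 0" using that by (auto simp: roots_def)
          then show False using nn by (metis not_le)
        qed
        have "bs \<eta> sf kf = 0" using r eqf[OF r] sf(1) sf0 unfolding roots_def by (metis antisym)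
        then have foldf: "fold \<eta> sf kf"
          using inR[OF sf(1)] inRk(1)[OF kf] sf0 by (simp add: fold_def)
        then have ksf: "ks \<eta> = kf" by (rule ks[OF \<eta>(4)])
        show "\<exists>s. fold \<eta> s (ks \<eta>)" using foldf ksf by auto
        let ?Jd = "{kp\<in>?J. 0 \<le> d * (kp - kf)}"
        have "closed (?J \<inter> (%kp. d * (kp - kf)) -` {0..})"
          by (intro continuous_closed_preimage continuous_intros)
        then have Jd: "closed ?Jd" by (rule back_subst[of closed]) auto
        have below: "b \<eta> s kp' < b \<eta> s kp" if "s \<in> ?I" "kp \<in> ?J" "kp' \<in> ?J" "0 < d * (kp' - kp)" for s kp kp'
          by (rule mono[OF \<eta>(4) _ _ _ that(4)]) (use inR[OF that(1)] inRk[OF that(2)] inRk[OF that(3)] R in auto)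
        have exJ: "\<exists>c\<in>?I. b \<eta> c kp \<le> 0" if "kp \<in> ?Jd" for kp
        proof (cases "kp = kf")
          case False
          then have "0 < d * (kp - kf)" using that d by auto
          moreover have "kp \<in> ?J" using that by blast
          ultimately have "b \<eta> sf kp < 0" using below[OF sf(1) kf] sf0 by simp
          then show ?thesis using sf(1) by (blast intro: less_imp_le)
        qed (use sf in blast)
        obtain z1 z2 where z: "continuous_on ?Jd z1" "continuous_on ?Jd z2"
          "\<And>kp. kp \<in> ?Jd ==> roots \<eta> a kp (z1 kp) (z2 kp)"
        proof (rule branches[OF \<eta>(4) a(1) aR Jd])
          show "?Jd \<subseteq> {k0-R<..<k0+R}" using J(1) by auto
        qed (use ends exJ in auto)
        have zeros: "{s\<in>?I. b \<eta> s kp = 0} = {z1 kp, z2 kp}" if "kp \<in> ?Jd" for kp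
          using roots_zeros[OF z(3)[OF that]] by blast
        have kfJd: "kf \<in> ?Jd" using kf by simp
        have "kf \<noteq> k0 - d * \<beta>" using kpos[OF sf(1)] sf0 by auto
        moreover have "kf \<noteq> k0 + d * \<beta>" using kneg nn[of s0] a(1) by auto
        ultimately have "kf \<noteq> k0 - \<beta>" "kf \<noteq> k0 + \<beta>" using d by auto
        then have int: "kf \<in> interior ?J" using kf by simp
        have two: "z1 kp \<noteq> z2 kp \<and> {s\<in>?I. b \<eta> s kp = 0} = {z1 kp, z2 kp}" if "kp \<in> ?J" "0 < d * (kp - kf)" for kp
        proof -
          have kp: "kp \<in> ?Jd" using that by auto
          have "b \<eta> sf kp < 0" using below[OF sf(1) kf that] sf0 by simp
          then have "z1 kp < sf" "sf < z2 kp" using z(3)[OF kp] sf(1) unfolding roots_def by blast+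
          then show ?thesis using zeros[OF kp] by simp
        qed
        have none: "{s\<in>?I. b \<eta> s kp = 0} = {}" if "kp \<in> ?J" "d * (kp - kf) < 0" for kp
        proof -
          have "0 < b \<eta> s kp" if "s \<in> ?I" for s
            using below[OF that \<open>kp \<in> ?J\<close> kf] nn[OF that] \<open>d * (kp - kf) < 0\<close> by (auto simp: algebra_simps)
          then show ?thesis by force
        qed
        show "saddle_node (%kp. {s\<in>?I. b \<eta> s kp = 0}) ?J (ks \<eta>)"
          unfolding saddle_node_def ksf
          using int d z(1,2) two none eqf[OF z(3)[OF kfJd]] zeros[OF kfJd]
          by (intro conjI bexI[of _ d] exI[of _ z1] exI[of _ z2]) auto
      qed
    qed
  qed
  have cB: "compact ({0 :: real} \<times> {s0-R/2..s0+R/2} \<times> {k0-R/2..k0+R/2})" (is "compact ?B")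
    by (intro compact_Times) auto
  have sub: "?B \<subseteq> {-R<..<R} \<times> {s0-R<..<s0+R} \<times> {k0-R<..<k0+R}" using R by auto
  have fB: "continuous_on ?B (%p. - d * (case p of (\<eta>, s, kp) => bk \<eta> s kp))"
    by (intro continuous_on_mult_left continuous_on_subset[OF cont(3) sub])
  have "(0, s0, k0) \<in> ?B" using R by simp
  then have "?B \<noteq> {}" by blast
  from continuous_attains_inf[OF cB this fB] obtain pm where pm: "pm \<in> ?B"
    "\<And>p. p \<in> ?B ==> - d * (case pm of (\<eta>, s, kp) => bk \<eta> s kp) \<le> - d * (case p of (\<eta>, s, kp) => bk \<eta> s kp)"
    by blast
  define c where "c = - d * (case pm of (\<eta>, s, kp) => bk \<eta> s kp)"
  obtain sm km where "pm = (0, sm, km)" "\<bar>sm - s0\<bar> < R" "\<bar>km - k0\<bar> < R" using pm(1) R by (auto simp: abs_less_iff)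
  then have c: "0 < c" using bk[of 0 sm km] R by (simp add: c_def)
  have c_le: "c \<le> - (d * bk 0 s kp)" if "\<bar>s - s0\<bar> < R / 2" "\<bar>kp - k0\<bar> < R / 2" for s kp
  proof -
    have "s0 - R / 2 \<le> s \<and> s \<le> s0 + R / 2 \<and> k0 - R / 2 \<le> kp \<and> kp \<le> k0 + R / 2"
      using that by linarith
    then have "(0, s, kp) \<in> ?B" by simp
    from pm(2)[OF this] show ?thesis by (simp add: c_def)
  qed
  have drop: "b 0 s kp' \<le> b 0 s kp - c * \<bar>kp' - kp\<bar>"
    if h: "\<bar>s - s0\<bar> < R / 2" "\<bar>kp - k0\<bar> < R / 2" "\<bar>kp' - k0\<bar> < R / 2" "0 \<le> d * (kp' - kp)" for s kp kp'
  proof -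
    have "\<bar>0 :: real\<bar> < R" "\<bar>s - s0\<bar> < R" "R / 2 \<le> R" using h R by auto
    from slope[OF this(1,2) h(2,3) this(3)]
    obtain kp'' where k: "\<bar>kp'' - k0\<bar> < R / 2" "b 0 s kp' - b 0 s kp = (d * bk 0 s kp'') * (d * (kp' - kp))"
      by blast
    have "d * (kp' - kp) = \<bar>kp' - kp\<bar>" using h(4) d by auto
    then have "b 0 s kp' - b 0 s kp = - (- (d * bk 0 s kp'') * \<bar>kp' - kp\<bar>)" using k(2) by simp
    also have "\<dots> \<le> - (c * \<bar>kp' - kp\<bar>)" using mult_right_mono[OF c_le[OF h(1) k(1)] abs_ge_zero[of "kp' - kp"]] by linarith
    finally show ?thesis by simp
  qed
  have est: "\<bar>kp - k0\<bar> \<le> C / c * \<eta>\<^sup>2" if "\<bar>\<eta>\<bar> < R" "fold \<eta> s kp" for \<eta> s kp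
  proof -
    have s: "\<bar>s - s0\<bar> < R / 2" "\<bar>s - s0\<bar> < R" and kp: "\<bar>kp - k0\<bar> < R / 2" "\<bar>kp - k0\<bar> < R"
      and z: "b \<eta> s kp = 0" "bs \<eta> s kp = 0" using that(2) R by (auto simp: fold_def)
    have "c * \<bar>kp - k0\<bar> \<le> C * \<eta>\<^sup>2"
    proof (cases "0 \<le> d * (k0 - kp)")
      case True
      have "b 0 s k0 \<le> b 0 s kp - c * \<bar>k0 - kp\<bar>" by (rule drop[OF s(1) kp(1) _ True]) (use R in simp)
      moreover have "0 \<le> b 0 s k0" using base_positive[OF s(2)] base(1) by (cases "s = s0") auto
      moreover have "\<bar>b \<eta> s kp - b 0 s kp\<bar> \<le> C * \<eta>\<^sup>2" by (rule close[OF that(1) s(2) kp(2)])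
      ultimately show ?thesis using z(1) by (simp add: abs_minus_commute abs_le_iff)
    next
      case False
      then have *: "0 \<le> d * (kp - k0)" by (simp add: algebra_simps)
      have "b 0 s0 kp \<le> b 0 s0 k0 - c * \<bar>kp - k0\<bar>" by (rule drop[OF _ _ kp(1) *]) (use R in auto)
      moreover have "b \<eta> s kp \<le> b \<eta> s0 kp" by (rule critical_nonneg[OF that(1) kp(2) s(2) z(2)]) (use R in simp)
      moreover have "\<bar>b \<eta> s0 kp - b 0 s0 kp\<bar> \<le> C * \<eta>\<^sup>2" by (rule close[OF that(1) _ kp(2)]) (use R in simp)
      ultimately show ?thesis using z(1) base(1) by (simp add: abs_le_iff)
    qed
    then show ?thesis using c by (simp add: field_simps)
  qed
  show thesis
  proof (rule that[of ks "C / c"])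
    obtain e where e: "0 < e" "\<And>\<beta>. 0 < \<beta> \<and> \<beta> < e ==> (\<exists>e2>0. \<forall>\<eta>. \<bar>\<eta>\<bar> < e2 --> \<bar>\<eta>\<bar> < R \<and> (\<exists>s. fold \<eta> s (ks \<eta>)) \<and>
      saddle_node (%kp. {s\<in>{s0-R/3..s0+R/3}. b \<eta> s kp = 0}) {k0-\<beta>..k0+\<beta>} (ks \<eta>))"
      using main[of "R / 3"] R by auto
    have "0 < e / 2 \<and> e / 2 < e" using e(1) by simp
    from e(2)[OF this] obtain e2 where
      "0 < e2" "\<And>\<eta>. \<bar>\<eta>\<bar> < e2 ==> \<bar>\<eta>\<bar> < R \<and> (\<exists>s. fold \<eta> s (ks \<eta>))" by blast
    note e2 = this
    show "\<forall>\<^sub>F \<eta> in at_right 0. \<bar>ks \<eta> - k0\<bar> \<le> C / c * \<eta>\<^sup>2"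
    proof (rule eventually_at_rightI[OF _ e2(1)])
      fix \<eta> assume "\<eta> \<in> {0<..<e2}"
      then have "\<bar>\<eta>\<bar> < e2" by simp
      with e2(2) est show "\<bar>ks \<eta> - k0\<bar> \<le> C / c * \<eta>\<^sup>2" by blast
    qed
  next
    show "\<forall>\<^sub>F a in at_right 0. \<forall>\<^sub>F \<beta> in at_right 0. \<forall>\<^sub>F \<eta> in at_right 0.
      saddle_node (%kp. {s\<in>{s0-a..s0+a}. b \<eta> s kp = 0}) {k0-\<beta>..k0+\<beta>} (ks \<eta>)"
    proof (rule eventually_at_rightI[of 0 "R / 2"])
      fix a assume "a \<in> {0<..<R/2}"
      then obtain e where e: "0 < e" "\<And>\<beta>. 0 < \<beta> \<and> \<beta> < e ==> (\<exists>e2>0. \<forall>\<eta>. \<bar>\<eta>\<bar> < e2 --> \<bar>\<eta>\<bar> < R \<and> (\<exists>s. fold \<eta> s (ks \<eta>)) \<and>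
          saddle_node (%kp. {s\<in>{s0-a..s0+a}. b \<eta> s kp = 0}) {k0-\<beta>..k0+\<beta>} (ks \<eta>))"
        using main[of a] by auto
      show "\<forall>\<^sub>F \<beta> in at_right 0. \<forall>\<^sub>F \<eta> in at_right 0.
          saddle_node (%kp. {s\<in>{s0-a..s0+a}. b \<eta> s kp = 0}) {k0-\<beta>..k0+\<beta>} (ks \<eta>)"
      proof (rule eventually_at_rightI[OF _ e(1)])
        fix \<beta> assume "\<beta> \<in> {0<..<e}"
        then obtain e2 where e2: "0 < e2" "\<And>\<eta>. \<bar>\<eta>\<bar> < e2 ==>
            saddle_node (%kp. {s\<in>{s0-a..s0+a}. b \<eta> s kp = 0}) {k0-\<beta>..k0+\<beta>} (ks \<eta>)"
          using e(2)[of \<beta>] by auto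
        show "\<forall>\<^sub>F \<eta> in at_right 0.
            saddle_node (%kp. {s\<in>{s0-a..s0+a}. b \<eta> s kp = 0}) {k0-\<beta>..k0+\<beta>} (ks \<eta>)"
          by (rule eventually_at_rightI[OF _ e2(1)]) (use e2(2) in auto)
      qed
    qed (use R in simp)
  qed
qed

end

section \<open>Folded curves, isolas and crossings\<close>

text \<open>Runs along one branch from \<open>ke\<close> to the fold at \<open>kf\<close> and back along the other.\<close>

definition fold_path :: "(real => real) => (real => real) => real => real => real => real \<times> real" where
  "fold_path z1 z2 ke kf t = (let kp = kf + (ke - kf) * \<bar>1 - 2 * t\<bar> in (if t \<le> 1 / 2 then z1 kp else z2 kp, kp))"

lemma fold_path_param:
  fixes ke kf t :: real
  assumes "t \<in> {0..1}"
  shows "kf + (ke - kf) * \<bar>1 - 2 * t\<bar> \<in> closed_segment ke kf"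
proof -
  have "kf + (ke - kf) * \<bar>1 - 2 * t\<bar> = (1 - (1 - \<bar>1 - 2 * t\<bar>)) *\<^sub>R ke + (1 - \<bar>1 - 2 * t\<bar>) *\<^sub>R kf"
    by (simp add: algebra_simps)
  moreover have "0 \<le> 1 - \<bar>1 - 2 * t\<bar>" "1 - \<bar>1 - 2 * t\<bar> \<le> 1" using assms by auto
  ultimately show ?thesis unfolding closed_segment_def by blast
qed

lemma fold_path_continuous:
  assumes "continuous_on (closed_segment ke kf) z1" "continuous_on (closed_segment ke kf) z2" "z1 kf = z2 kf"
  shows "path (fold_path z1 z2 ke kf)"
proof -
  let ?k = "%t. kf + (ke - kf) * \<bar>1 - 2 * t\<bar>"
  have k: "continuous_on S ?k" for S by (intro continuous_intros)
  have "continuous_on {0..1} (%t. if t \<le> 1 / 2 then z1 (?k t) else z2 (?k t))"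
  proof (rule continuous_on_cases_le)
    show "continuous_on {t \<in> {0..1}. t \<le> 1 / 2} (%t. z1 (?k t))"
      by (rule continuous_on_compose2[OF assms(1) k]) (use fold_path_param in blast)
    show "continuous_on {t \<in> {0..1}. 1 / 2 \<le> t} (%t. z2 (?k t))"
      by (rule continuous_on_compose2[OF assms(2) k]) (use fold_path_param in blast)
    fix t :: real assume "t = 1 / 2"
    then have "\<bar>1 - 2 * t\<bar> = 0" by simp
    then show "z1 (?k t) = z2 (?k t)" using assms(3) by simp
  qed (rule continuous_on_id)
  then show ?thesis unfolding path_def fold_path_def Let_def by (intro continuous_on_Pair k)
qed

lemma fold_path_image:
  assumes "z1 kf = z2 kf"
  shows "path_image (fold_path z1 z2 ke kf) = {(s, kp). kp \<in> closed_segment ke kf \<and> (s = z1 kp \<or> s = z2 kp)}"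
proof (intro equalityI subsetI)
  fix p assume "p \<in> path_image (fold_path z1 z2 ke kf)"
  then obtain t where t: "t \<in> {0..1}" "p = fold_path z1 z2 ke kf t" by (auto simp: path_image_def)
  then show "p \<in> {(s, kp). kp \<in> closed_segment ke kf \<and> (s = z1 kp \<or> s = z2 kp)}"
    using fold_path_param[OF t(1)] by (auto simp: fold_path_def Let_def)
next
  fix p assume "p \<in> {(s, kp). kp \<in> closed_segment ke kf \<and> (s = z1 kp \<or> s = z2 kp)}"
  then obtain s kp where p: "p = (s, kp)" "kp \<in> closed_segment ke kf" "s = z1 kp \<or> s = z2 kp" by blast
  then obtain u where u: "0 \<le> u" "u \<le> 1" "kp = (1 - u) * ke + u * kf" by (auto simp: closed_segment_def)
  have k: "kp = kf + (ke - kf) * (1 - u)" using u(3) by (simp add: algebra_simps)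
  have 1: "fold_path z1 z2 ke kf (u / 2) = (z1 kp, kp)"
    using u(1,2) k by (simp add: fold_path_def Let_def)
  have 2: "fold_path z1 z2 ke kf (1 - u / 2) = (z2 kp, kp)"
  proof (cases "u = 1")
    case True
    then show ?thesis using k assms by (simp add: fold_path_def Let_def)
  next
    case False
    then have "\<not> 1 - u / 2 \<le> 1 / 2" "\<bar>1 - 2 * (1 - u / 2)\<bar> = 1 - u" using u(1,2) by auto
    then show ?thesis using k by (simp add: fold_path_def Let_def)
  qed
  have "u / 2 \<in> {0..1}" "1 - u / 2 \<in> {0..1}" using u(1,2) by auto
  then show "p \<in> path_image (fold_path z1 z2 ke kf)"
    using p(1,3) 1 2 unfolding path_image_def by (metis imageI)
qed

lemma fold_path_inj:
  assumes "ke \<noteq> kf" and ne: "\<And>kp. kp \<in> closed_segment ke kf ==> kp \<noteq> kf ==> kp \<noteq> ke ==> z1 kp \<noteq> z2 kp"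
    and t: "t \<in> {0..1}" "t' \<in> {0..1}" "t < t'" and eq: "fold_path z1 z2 ke kf t = fold_path z1 z2 ke kf t'"
  shows "t = 0 \<and> t' = 1 \<and> z1 ke = z2 ke"
proof -
  let ?k = "%t. kf + (ke - kf) * \<bar>1 - 2 * t\<bar>"
  have "?k t = ?k t'" using eq by (simp add: fold_path_def Let_def)
  then have "\<bar>1 - 2 * t\<bar> = \<bar>1 - 2 * t'\<bar>" using assms(1) by simp
  then have t': "t' = 1 - t" using t by auto
  then have "t < 1 / 2" using t by simp
  then have zz: "z1 (?k t) = z2 (?k t)" using eq t' by (simp add: fold_path_def Let_def)
  have "?k t \<noteq> kf" using assms(1) \<open>t < 1 / 2\<close> by simp
  then have "?k t = ke" using ne[OF fold_path_param[OF t(1)]] zz by blast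
  then have "(ke - kf) * \<bar>1 - 2 * t\<bar> = ke - kf" by linarith
  then have "\<bar>1 - 2 * t\<bar> = 1" using assms(1) by (metis eq_iff_diff_eq_0 mult_cancel_left1)
  then show ?thesis using t t' zz \<open>?k t = ke\<close> \<open>t < 1 / 2\<close> by auto
qed

lemma fold_path_closed_curve:
  assumes "ke \<noteq> kf" "continuous_on (closed_segment ke kf) z1" "continuous_on (closed_segment ke kf) z2"
    and "z1 kf = z2 kf" "z1 ke = z2 ke"
    and ne: "\<And>kp. kp \<in> closed_segment ke kf ==> kp \<noteq> kf ==> kp \<noteq> ke ==> z1 kp \<noteq> z2 kp"
  shows "simple_path (fold_path z1 z2 ke kf)"
    "pathfinish (fold_path z1 z2 ke kf) = pathstart (fold_path z1 z2 ke kf)"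
proof -
  have "t = t' \<or> t = 0 \<and> t' = 1 \<or> t = 1 \<and> t' = 0"
    if "t \<in> {0..1}" "t' \<in> {0..1}" "fold_path z1 z2 ke kf t = fold_path z1 z2 ke kf t'" for t t'
    using fold_path_inj[OF assms(1) ne that(1,2) _ that(3)]
      fold_path_inj[OF assms(1) ne that(2,1) _ that(3)[symmetric]] by (cases t t' rule: linorder_cases) auto
  then show "simple_path (fold_path z1 z2 ke kf)"
    unfolding simple_path_def loop_free_def using fold_path_continuous[OF assms(2-4)] by blast
  show "pathfinish (fold_path z1 z2 ke kf) = pathstart (fold_path z1 z2 ke kf)"
    using assms(5) by (simp add: fold_path_def pathfinish_def pathstart_def Let_def)
qed

lemma fold_path_folded_arc:
  assumes "ke \<noteq> kf" "continuous_on (closed_segment ke kf) z1" "continuous_on (closed_segment ke kf) z2"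
    and "z1 kf = z2 kf"
    and ne: "\<And>kp. kp \<in> closed_segment ke kf ==> kp \<noteq> kf ==> z1 kp \<noteq> z2 kp"
  shows "folded_arc ke kf (fold_path z1 z2 ke kf)"
proof -
  let ?\<gamma> = "fold_path z1 z2 ke kf"
  have ke: "z1 ke \<noteq> z2 ke" using ne[of ke] assms(1) by simp
  have "t = t'" if "t \<in> {0..1}" "t' \<in> {0..1}" "?\<gamma> t = ?\<gamma> t'" for t t'
    using fold_path_inj[OF assms(1) ne that(1,2) _ that(3)] ke
      fold_path_inj[OF assms(1) ne that(2,1) _ that(3)[symmetric]] by (cases t t' rule: linorder_cases) auto
  then have arc: "arc ?\<gamma>"
    unfolding arc_def inj_on_def using fold_path_continuous[OF assms(2-4)] by blast
  have snd: "snd (?\<gamma> t) = kf + (ke - kf) * \<bar>1 - 2 * t\<bar>" for t by (simp add: fold_path_def Let_def)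
  define d :: real where "d = (if ke < kf then 1 else -1)"
  have dk: "d * (kf - ke) > 0" using assms(1) by (auto simp: d_def)
  have 1: "strict_mono_on {0..1/2} (%u. d * snd (?\<gamma> u))"
  proof (rule strict_mono_onI)
    fix r s :: real assume "r \<in> {0..1/2}" "s \<in> {0..1/2}" "r < s"
    then have "\<bar>1 - 2 * r\<bar> = 1 - 2 * r" "\<bar>1 - 2 * s\<bar> = 1 - 2 * s" by auto
    then have "d * snd (?\<gamma> s) - d * snd (?\<gamma> r) = (d * (kf - ke)) * (2 * (s - r))"
      unfolding snd by (simp add: algebra_simps)
    also have "\<dots> > 0" using dk \<open>r < s\<close> by simp
    finally show "d * snd (?\<gamma> r) < d * snd (?\<gamma> s)" by simp
  qed
  have 2: "strict_mono_on {1/2..1} (%u. - d * snd (?\<gamma> u))"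
  proof (rule strict_mono_onI)
    fix r s :: real assume "r \<in> {1/2..1}" "s \<in> {1/2..1}" "r < s"
    then have "\<bar>1 - 2 * r\<bar> = 2 * r - 1" "\<bar>1 - 2 * s\<bar> = 2 * s - 1" by auto
    then have "- d * snd (?\<gamma> s) - - d * snd (?\<gamma> r) = (d * (kf - ke)) * (2 * (s - r))"
      unfolding snd by (simp add: algebra_simps)
    also have "\<dots> > 0" using dk \<open>r < s\<close> by simp
    finally show "- d * snd (?\<gamma> r) < - d * snd (?\<gamma> s)" by simp
  qed
  have "d \<in> {1, -1}" by (simp add: d_def)
  then show ?thesis
    unfolding folded_arc_def using arc 1 2
    by (intro conjI bexI[of _ "1/2"] bexI[of _ d]) (simp_all add: snd)
qed

definition graph_path :: "(real => real) => real => real => real => real \<times> real" where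
  "graph_path y k0 \<beta> t = (y (k0 + \<beta> * (2 * t - 1)), k0 + \<beta> * (2 * t - 1))"

lemma graph_path:
  assumes "0 < \<beta>" "continuous_on {k0-\<beta>..k0+\<beta>} y"
  shows "spanning_arc (k0 - \<beta>) (k0 + \<beta>) (graph_path y k0 \<beta>)"
    and "path_image (graph_path y k0 \<beta>) = {(s, kp). kp \<in> {k0-\<beta>..k0+\<beta>} \<and> s = y kp}"
proof -
  have in_J: "k0 + \<beta> * (2 * t - 1) \<in> {k0-\<beta>..k0+\<beta>}" if "t \<in> {0..1}" for t
  proof -
    have "\<bar>\<beta> * (2 * t - 1)\<bar> \<le> \<beta> * 1"
      unfolding abs_mult using assms(1) that by (intro mult_mono) auto
    then show ?thesis by (auto simp: abs_le_iff)
  qed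
  show img: "path_image (graph_path y k0 \<beta>) = {(s, kp). kp \<in> {k0-\<beta>..k0+\<beta>} \<and> s = y kp}"
  proof (intro equalityI subsetI)
    fix p assume "p \<in> path_image (graph_path y k0 \<beta>)"
    then show "p \<in> {(s, kp). kp \<in> {k0-\<beta>..k0+\<beta>} \<and> s = y kp}"
      using in_J by (auto simp: path_image_def graph_path_def)
  next
    fix p assume "p \<in> {(s, kp). kp \<in> {k0-\<beta>..k0+\<beta>} \<and> s = y kp}"
    then obtain kp where kp: "kp \<in> {k0-\<beta>..k0+\<beta>}" "p = (y kp, kp)" by auto
    let ?t = "((kp - k0) / \<beta> + 1) / 2"
    have "2 * ((u + 1) / 2) - 1 = u" for u :: real by (simp add: field_simps)
    then have "2 * ?t - 1 = (kp - k0) / \<beta>" .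
    then have "k0 + \<beta> * (2 * ?t - 1) = kp" using assms(1) by simp
    then have "p = graph_path y k0 \<beta> ?t" using kp(2) unfolding graph_path_def by (simp only:)
    moreover have "?t \<in> {0..1}" using kp(1) assms(1) by (simp add: field_simps)
    ultimately show "p \<in> path_image (graph_path y k0 \<beta>)" by (auto simp: path_image_def)
  qed
  have "continuous_on {0..1} (%t. y (k0 + \<beta> * (2 * t - 1)))"
    by (rule continuous_on_compose2[OF assms(2)]) (auto intro!: continuous_intros in_J[simplified])
  then have "path (graph_path y k0 \<beta>)"
    unfolding path_def graph_path_def by (intro continuous_intros)
  moreover have "inj_on (graph_path y k0 \<beta>) {0..1}"
    using assms(1) by (auto simp: inj_on_def graph_path_def)
  moreover have "snd ` path_image (graph_path y k0 \<beta>) = {k0-\<beta>..k0+\<beta>}" unfolding img by force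
  ultimately show "spanning_arc (k0 - \<beta>) (k0 + \<beta>) (graph_path y k0 \<beta>)"
    by (simp add: spanning_arc_def arc_def)
qed

lemma graph_path_derivative:
  assumes "0 < \<beta>" "DERIV y f :> r" "f = k0 + \<beta> * (2 * t - 1)"
  shows "(graph_path y k0 \<beta> has_vector_derivative (r * (2 * \<beta>), 2 * \<beta>)) (at t)"
proof -
  have 1: "((%t. k0 + \<beta> * (2 * t - 1)) has_real_derivative 2 * \<beta>) (at t)"
    by (auto intro!: derivative_eq_intros)
  have "((%t. y (k0 + \<beta> * (2 * t - 1))) has_real_derivative r * (2 * \<beta>)) (at t)"
    using DERIV_chain2[OF _ 1, of y r] assms(2,3) by simp
  with 1 show ?thesis
    unfolding graph_path_def has_real_derivative_iff_has_vector_derivative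
    by (intro has_vector_derivative_Pair)
qed

text \<open>The branches are known only as zeros: the sign of the germ on two nearby lines traps them between
  the slopes of these lines.\<close>

lemma has_derivative_between_slopes:
  fixes y :: "real => real"
  assumes "\<And>e. 0 < e ==> e < e0 ==> \<exists>d>0. \<forall>t. t \<noteq> 0 --> \<bar>t\<bar> < d --> \<bar>y (f + t) - y f - r * t\<bar> \<le> e * \<bar>t\<bar>" "0 < e0"
  shows "DERIV y f :> r"
  unfolding has_field_derivative_def has_derivative_at_alt
proof (intro conjI allI impI)
  show "bounded_linear ((*) r)" by (rule bounded_linear_mult_right)
  fix e :: real assume "0 < e"
  then have "0 < min e (e0 / 2)" "min e (e0 / 2) < e0" using assms(2) by linarith+
  from assms(1)[OF this]
  obtain d where d: "0 < d" "\<And>t. t \<noteq> 0 ==> \<bar>t\<bar> < d ==> \<bar>y (f + t) - y f - r * t\<bar> \<le> min e (e0 / 2) * \<bar>t\<bar>"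
    by blast
  show "\<exists>d>0. \<forall>x. norm (x - f) < d --> norm (y x - y f - r * (x - f)) \<le> e * norm (x - f)"
  proof (intro exI[of _ d] conjI allI impI)
    fix x assume x: "norm (x - f) < d"
    show "norm (y x - y f - r * (x - f)) \<le> e * norm (x - f)"
    proof (cases "x = f")
      case False
      then have "\<bar>y x - y f - r * (x - f)\<bar> \<le> min e (e0 / 2) * \<bar>x - f\<bar>" using d(2)[of "x - f"] x by simp
      also have "\<dots> \<le> e * \<bar>x - f\<bar>" by (intro mult_right_mono) auto
      finally show ?thesis by simp
    qed simp
  qed (rule d(1))
qed

context convex_germ
begin

text \<open>The value and the gradient vanish at the base point, so the second derivative along the segment
  from there decides the sign.\<close>

lemma base_sign:
  assumes hk: "\<bar>h\<bar> < R" "\<bar>k\<bar> < R" and bk0: "bk 0 s0 k0 = 0"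
    and pos: "\<And>s kp. \<bar>s - s0\<bar> < R ==> \<bar>kp - k0\<bar> < R ==> 0 < c * quadratic 0 s kp h k"
  shows "0 < c * b 0 (s0 + h) (k0 + k)"
proof -
  let ?\<phi> = "%t. c * b 0 (s0 + h * t) (k0 + k * t)"
  have box: "\<bar>s0 + h * t - s0\<bar> < R" "\<bar>k0 + k * t - k0\<bar> < R" if "\<bar>t\<bar> < 1" for t
  proof -
    have "\<bar>h\<bar> * \<bar>t\<bar> \<le> \<bar>h\<bar> * 1" "\<bar>k\<bar> * \<bar>t\<bar> \<le> \<bar>k\<bar> * 1" using that by (intro mult_left_mono; simp)+
    then show "\<bar>s0 + h * t - s0\<bar> < R" "\<bar>k0 + k * t - k0\<bar> < R" using hk by (simp_all add: abs_mult)
  qed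
  have R0: "\<bar>0 :: real\<bar> < R" using R by simp
  have D0: "DERIV (%t. c * (bs 0 (s0 + h * t) (k0 + k * t) * h + bk 0 (s0 + h * t) (k0 + k * t) * k)) 0 :>
      c * quadratic 0 s0 k0 h k"
    using DERIV_cmult[OF line_second_derivative[OF R0 box[of 0]], of c] by simp
  obtain d where d: "0 < d" "\<And>t. t \<noteq> 0 ==> \<bar>t\<bar> < d ==> 0 < ?\<phi> t"
  proof (rule second_derivative_sign[OF zero_less_one DERIV_cmult[OF line_derivative(1)[OF R0 box]] D0])
    show "0 < c * quadratic 0 s0 k0 h k" using pos[of s0 k0] R by simp
  qed (auto simp: base bk0)
  define t where "t = min (1/2) (d / 2)"
  have t: "0 < t" "t < 1" "\<bar>t\<bar> < d" using d(1) by (auto simp: t_def)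
  have "c * b 0 (s0 + (s0 + h - s0) * t) (k0 + (k0 + k - k0) * t) <
      (1 - t) * (c * b 0 s0 k0) + t * (c * b 0 (s0 + h) (k0 + k))"
    by (rule strict_convex_on_segment) (use R hk pos t in auto)
  then have "0 < t * (c * b 0 (s0 + h) (k0 + k))" using d(2)[of t] t base(1) by simp
  then show ?thesis using t(1) by (simp add: zero_less_mult_iff)
qed

lemma negative_nearby:
  assumes "\<bar>\<eta>\<bar> < R" "\<bar>s - s0\<bar> < R" "\<bar>f - k0\<bar> < R" "b \<eta> s f < 0"
  obtains d where "0 < d" "\<And>kp. \<bar>kp - f\<bar> < d ==> b \<eta> s kp < 0"
proof -
  have "isCont (%kp. b \<eta> s kp) f" using partial_derivatives(3)[OF assms(1-3)] by (rule DERIV_isCont)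
  then have "((%kp. b \<eta> s kp) \<longlongrightarrow> b \<eta> s f) (at f)" by (simp add: isCont_def)
  from order_tendstoD(2)[OF this assms(4)]
  obtain d where d: "0 < d" "\<forall>kp. kp \<noteq> f \<and> dist kp f < d --> b \<eta> s kp < 0"
    unfolding eventually_at by auto
  show thesis
  proof (rule that[OF d(1)])
    fix kp assume "\<bar>kp - f\<bar> < d"
    then show "b \<eta> s kp < 0" using d(2) assms(4) by (cases "kp = f") (simp_all add: dist_real_def)
  qed
qed

lemma roots_negative:
  assumes "roots \<eta> a kp z1 z2" "s \<in> {s0-a..s0+a}"
  shows "b \<eta> s kp < 0 \<longleftrightarrow> z1 < s \<and> s < z2"
  using assms unfolding roots_def by blast

lemma roots_eq_iff:
  assumes "roots \<eta> a kp z1 z2"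
  shows "z1 = z2 \<longleftrightarrow> (\<forall>s\<in>{s0-a..s0+a}. 0 \<le> b \<eta> s kp)"
proof
  assume eq: "z1 = z2"
  show "\<forall>s\<in>{s0-a..s0+a}. 0 \<le> b \<eta> s kp"
  proof
    fix s assume "s \<in> {s0-a..s0+a}"
    from roots_negative[OF assms this] eq have "\<not> b \<eta> s kp < 0" by auto
    then show "0 \<le> b \<eta> s kp" by simp
  qed
next
  assume nn: "\<forall>s\<in>{s0-a..s0+a}. 0 \<le> b \<eta> s kp"
  show "z1 = z2"
  proof (rule ccontr)
    assume "z1 \<noteq> z2"
    moreover have "s0 - a < z1" "z1 \<le> z2" "z2 < s0 + a" using assms unfolding roots_def by blast+
    ultimately have m: "(z1 + z2) / 2 \<in> {s0-a..s0+a}" "z1 < (z1 + z2) / 2" "(z1 + z2) / 2 < z2" by auto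
    then have "b \<eta> ((z1 + z2) / 2) kp < 0" using roots_negative[OF assms m(1)] by blast
    moreover have "0 \<le> b \<eta> ((z1 + z2) / 2) kp" using nn m(1) by blast
    ultimately show False by simp
  qed
qed

lemma eventually_right_nested:
  fixes P :: "real => real => real => bool"
  assumes "0 < r" and "\<And>a. 0 < a ==> a < r ==> \<exists>e>0. \<forall>\<beta>. 0 < \<beta> \<and> \<beta> < e --> (\<exists>e2>0. \<forall>\<eta>. \<bar>\<eta>\<bar> < e2 --> P a \<beta> \<eta>)"
  shows "\<forall>\<^sub>F a in at_right 0. \<forall>\<^sub>F \<beta> in at_right 0. \<forall>\<^sub>F \<eta> in at_right (0 :: real). P a \<beta> \<eta>"
proof (rule eventually_at_rightI[OF _ assms(1)])
  fix a :: real assume "a \<in> {0<..<r}"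
  then obtain e where e: "0 < e" "\<And>\<beta>. 0 < \<beta> \<and> \<beta> < e ==> (\<exists>e2>0. \<forall>\<eta>. \<bar>\<eta>\<bar> < e2 --> P a \<beta> \<eta>)"
    using assms(2)[of a] by auto
  show "\<forall>\<^sub>F \<beta> in at_right 0. \<forall>\<^sub>F \<eta> in at_right (0 :: real). P a \<beta> \<eta>"
  proof (rule eventually_at_rightI[OF _ e(1)])
    fix \<beta> assume "\<beta> \<in> {0<..<e}"
    then obtain e2 where e2: "0 < e2" "\<And>\<eta>. \<bar>\<eta>\<bar> < e2 ==> P a \<beta> \<eta>" using e(2)[of \<beta>] by auto
    show "\<forall>\<^sub>F \<eta> in at_right (0 :: real). P a \<beta> \<eta>"
      by (rule eventually_at_rightI[OF _ e2(1)]) (use e2(2) in auto)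
  qed
qed

text \<open>Strict convexity in \<open>(s, kp)\<close> makes the \<open>kp\<close> with a nonpositive value a compact interval, which is empty,
  a point, or carries two branches that meet at both ends only.\<close>

theorem isola_birth_zeros:
  assumes bk0: "bk 0 s0 k0 = 0"
    and det: "\<And>\<eta> s kp. \<bar>\<eta>\<bar> < R ==> \<bar>s - s0\<bar> < R ==> \<bar>kp - k0\<bar> < R ==>
      (bsk \<eta> s kp)\<^sup>2 < bss \<eta> s kp * bkk \<eta> s kp"
  shows "\<forall>\<^sub>F a in at_right 0. \<forall>\<^sub>F \<beta> in at_right 0. \<forall>\<^sub>F \<eta> in at_right 0.
    isola_birth {(s, kp). s \<in> {s0-a..s0+a} \<and> kp \<in> {k0-\<beta>..k0+\<beta>} \<and> b \<eta> s kp = 0}"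
proof (rule eventually_right_nested[OF R])
  have quad: "0 < 1 * quadratic \<eta> s kp h k"
    if "\<bar>\<eta>\<bar> < R" "\<bar>s - s0\<bar> < R" "\<bar>kp - k0\<bar> < R" "h \<noteq> 0 \<or> k \<noteq> 0" for \<eta> s kp h k
  proof (cases "k = 0")
    case True
    then show ?thesis using that bss by (simp add: quadratic_def)
  next
    case False
    have "bss \<eta> s kp * quadratic \<eta> s kp h k = (bss \<eta> s kp * h + bsk \<eta> s kp * k)\<^sup>2 +
        (bss \<eta> s kp * bkk \<eta> s kp - (bsk \<eta> s kp)\<^sup>2) * k\<^sup>2"
      by (simp add: quadratic_def power2_eq_square algebra_simps)
    also have "\<dots> > 0" using det[OF that(1-3)] False by (intro add_nonneg_pos mult_pos_pos) auto
    finally show ?thesis using bss[OF that(1-3)] by (simp add: zero_less_mult_iff)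
  qed
  fix a assume a: "0 < a" "a < R"
  obtain e where e: "0 < e" "e \<le> R"
    "\<And>\<eta> kp. \<bar>\<eta>\<bar> < e ==> \<bar>kp - k0\<bar> < e ==> 0 < b \<eta> (s0 - a) kp \<and> 0 < b \<eta> (s0 + a) kp"
    using ends_positive[OF a] by metis
  let ?I = "{s0-a..s0+a}"
  have inR: "\<bar>s - s0\<bar> < R" if "s \<in> ?I" for s using that a unfolding atLeastAtMost_iff by linarith
  have "\<exists>e2>0. \<forall>\<eta>. \<bar>\<eta>\<bar> < e2 -->
      isola_birth {(s, kp). s \<in> ?I \<and> kp \<in> {k0-\<beta>..k0+\<beta>} \<and> b \<eta> s kp = 0}"
    if \<beta>: "0 < \<beta>" "\<beta> < e" for \<beta>
  proof -
    let ?J = "{k0-\<beta>..k0+\<beta>}"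
    have J: "?J \<subseteq> {k0-R<..<k0+R}" "compact ?J" using \<beta> e(2) by auto
    have inRk: "\<bar>kp - k0\<bar> < R" "\<bar>kp - k0\<bar> < e" if "kp \<in> ?J" for kp
      using that \<beta> e(2) unfolding atLeastAtMost_iff by linarith+
    have c1: "compact (?I \<times> {k0 - \<beta>, k0 + \<beta>})" by (rule compact_Times[OF compact_Icc finite_imp_compact]) simp
    have s1: "?I \<times> {k0 - \<beta>, k0 + \<beta>} \<subseteq> {s0-R<..<s0+R} \<times> {k0-R<..<k0+R}" using a \<beta> e(2) by auto
    have p1: "0 < 1 * b 0 s kp" if h: "(s, kp) \<in> ?I \<times> {k0 - \<beta>, k0 + \<beta>}" for s kp
    proof -
      have s: "\<bar>s - s0\<bar> < R" and k: "\<bar>kp - k0\<bar> < R" "kp - k0 \<noteq> 0"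
        using h inR[of s] inRk(1)[of kp] \<beta>(1) by auto
      show ?thesis using base_sign[OF s k(1) bk0, of 1] quad[of 0] R k(2) by simp
    qed
    obtain e1 where e1: "0 < e1" "\<And>\<eta> s kp kp'. (s, kp) \<in> ?I \<times> {k0 - \<beta>, k0 + \<beta>} ==> \<bar>\<eta>\<bar> < e1 ==>
        \<bar>kp' - kp\<bar> < e1 ==> \<bar>\<eta>\<bar> < R \<and> \<bar>kp' - k0\<bar> < R \<and> 0 < 1 * b \<eta> s kp'"
      using positive_near_compact[OF c1 s1 p1] by blast
    have "isola_birth {(s, kp). s \<in> ?I \<and> kp \<in> ?J \<and> b \<eta> s kp = 0}" (is "isola_birth ?Z") if "\<bar>\<eta>\<bar> < min e e1" for \<eta>
    proof -
      have \<eta>: "\<bar>\<eta>\<bar> < e" "\<bar>\<eta>\<bar> < e1" "\<bar>\<eta>\<bar> < R" using that e(2) by auto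
      have ends: "0 < b \<eta> (s0 - a) kp \<and> 0 < b \<eta> (s0 + a) kp" if "kp \<in> ?J" for kp
        using e(3)[OF \<eta>(1) inRk(2)[OF that]] .
      define N where "N = {kp\<in>?J. \<exists>s\<in>?I. b \<eta> s kp \<le> 0}"
      have N: "closed N" unfolding N_def by (rule closed_nonpos[OF \<eta>(3) J(2,1) a(2)])
      have NJ: "N \<subseteq> ?J" by (auto simp: N_def)
      have "kp \<in> N" if "s \<in> ?I" "kp \<in> ?J" "b \<eta> s kp = 0" for s kp
        unfolding N_def using that eq_refl[OF that(3)] by blast
      then have ZN: "?Z \<subseteq> {(s, kp). s \<in> ?I \<and> kp \<in> N}" by blast
      show ?thesis
      proof (cases "N = {}")
        case True
        then show ?thesis using ZN unfolding isola_birth_def by blast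
      next
        case False
        note bdd = bdd_below_mono[OF bdd_below_Icc NJ] bdd_above_mono[OF bdd_above_Icc NJ]
        define f1 where "f1 = Inf N"
        define f2 where "f2 = Sup N"
        have f: "f1 \<in> N" "f2 \<in> N" unfolding f1_def f2_def
          using closed_contains_Inf[OF False bdd(1) N] closed_contains_Sup[OF False bdd(2) N] by auto
        have le: "f1 \<le> kp" "kp \<le> f2" if "kp \<in> N" for kp
          unfolding f1_def f2_def using that bdd by (auto intro: cInf_lower cSup_upper)
        have edge: "k0 - \<beta> \<notin> N" "k0 + \<beta> \<notin> N"
          using e1(2)[of _ "k0 - \<beta>" \<eta> "k0 - \<beta>"] e1(2)[of _ "k0 + \<beta>" \<eta> "k0 + \<beta>"] e1(1) \<eta>(2)
          by (fastforce simp: N_def)+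
        have fJ: "k0 - \<beta> < f1" "f2 < k0 + \<beta>" using edge f NJ by (force simp: le_less)+
        have mid: "\<exists>s\<in>?I. b \<eta> s kp < 0" if kp: "f1 < kp" "kp < f2" for kp
        proof -
          obtain s1 s2 where s: "s1 \<in> ?I" "b \<eta> s1 f1 \<le> 0" "s2 \<in> ?I" "b \<eta> s2 f2 \<le> 0"
            using f by (auto simp: N_def)
          define t where "t = (kp - f1) / (f2 - f1)"
          have t: "0 < t" "t < 1" "f1 + (f2 - f1) * t = kp" using kp by (auto simp: t_def)
          have "1 * b \<eta> (s1 + (s2 - s1) * t) (f1 + (f2 - f1) * t) < (1 - t) * (1 * b \<eta> s1 f1) + t * (1 * b \<eta> s2 f2)"
          proof (rule strict_convex_on_segment[OF \<eta>(3) inR[OF s(1)] _ inR[OF s(3)] _ _ t(1,2)])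
            show "\<bar>f1 - k0\<bar> < R" "\<bar>f2 - k0\<bar> < R" using inRk(1) f NJ by blast+
            show "0 < 1 * quadratic \<eta> s kp (s2 - s1) (f2 - f1)" if "\<bar>s - s0\<bar> < R" "\<bar>kp - k0\<bar> < R" for s kp
              using quad[OF \<eta>(3) that] less_trans[OF kp] by simp
          qed
          also have "\<dots> \<le> 0" using t(1,2) s(2,4) by (simp add: add_nonpos_nonpos mult_nonneg_nonpos)
          finally have "b \<eta> (s1 + (s2 - s1) * t) kp < 0" using t(3) by simp
          moreover have "s1 + (s2 - s1) * t \<in> ?I"
          proof -
            have "s1 + (s2 - s1) * t = (1 - t) *\<^sub>R s1 + t *\<^sub>R s2" by (simp add: algebra_simps)
            also have "\<dots> \<in> ?I" by (rule convexD[OF convex_real_interval(5) s(1,3)]) (use t in auto)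
            finally show ?thesis .
          qed
          ultimately show ?thesis by blast
        qed
        have N_eq: "N = {f1..f2}"
        proof
          show "N \<subseteq> {f1..f2}" using le by auto
          show "{f1..f2} \<subseteq> N"
          proof
            fix kp assume k: "kp \<in> {f1..f2}"
            then have "kp \<in> ?J" using fJ by auto
            show "kp \<in> N"
            proof (cases "kp = f1 \<or> kp = f2")
              case False
              then have "\<exists>s\<in>?I. b \<eta> s kp < 0" using mid[of kp] k by auto
              then show ?thesis using \<open>kp \<in> ?J\<close> unfolding N_def by (blast intro: less_imp_le)
            qed (use f in auto)
          qed
        qed
        obtain z1 z2 where z: "continuous_on N z1" "continuous_on N z2"
          "\<And>kp. kp \<in> N ==> roots \<eta> a kp (z1 kp) (z2 kp)"
        proof (rule branches[OF \<eta>(3) a N])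
          show "N \<subseteq> {k0-R<..<k0+R}" using NJ J(1) by blast
          show "0 < b \<eta> (s0 - a) kp \<and> 0 < b \<eta> (s0 + a) kp" if "kp \<in> N" for kp
            using ends that NJ by blast
          show "\<exists>c\<in>?I. b \<eta> c kp \<le> 0" if "kp \<in> N" for kp using that by (simp add: N_def)
        qed (use that in blast)
        have tip: "z1 kp = z2 kp" if "kp = f1 \<or> kp = f2" for kp
        proof -
          have kpN: "kp \<in> N" using that f by auto
          have "0 \<le> b \<eta> s kp" if s: "s \<in> ?I" for s
          proof (rule ccontr)
            assume "\<not> 0 \<le> b \<eta> s kp"
            then have "b \<eta> s kp < 0" by simp
            from negative_nearby[OF \<eta>(3) inR[OF s] inRk(1) this] kpN NJ
            obtain d where d: "0 < d" "\<And>kp'. \<bar>kp' - kp\<bar> < d ==> b \<eta> s kp' < 0" by blast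
            show False
            proof (cases "kp = f1")
              case True
              define kp' where "kp' = max (k0 - \<beta>) (f1 - d / 2)"
              have k': "kp' < f1" "\<bar>kp' - kp\<bar> < d" "kp' \<in> ?J" using True d(1) fJ(1) kpN NJ by (auto simp: kp'_def)
              then have "kp' \<in> N" using d(2)[of kp'] s unfolding N_def by (blast intro: less_imp_le)
              then show False using le(1) k'(1) by force
            next
              case False
              then have kf: "kp = f2" using that \<open>kp = f1 \<or> kp = f2\<close> by blast
              define kp' where "kp' = min (k0 + \<beta>) (f2 + d / 2)"
              have k': "f2 < kp'" "\<bar>kp' - kp\<bar> < d" "kp' \<in> ?J" using kf d(1) fJ(2) kpN NJ by (auto simp: kp'_def)
              then have "kp' \<in> N" using d(2)[of kp'] s unfolding N_def by (blast intro: less_imp_le)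
              then show False using le(2) k'(1) by force
            qed
          qed
          then show ?thesis using roots_eq_iff[OF z(3)[OF kpN]] by blast
        qed
        have Z: "?Z = {(s, kp). kp \<in> N \<and> (s = z1 kp \<or> s = z2 kp)}"
        proof -
          have "s \<in> ?I \<and> b \<eta> s kp = 0 \<longleftrightarrow> s = z1 kp \<or> s = z2 kp" if "kp \<in> N" for s kp
            by (rule roots_zeros[OF z(3)[OF that]])
          then show ?thesis using ZN NJ by blast
        qed
        show ?thesis
        proof (cases "f1 = f2")
          case True
          then have "?Z = {(z1 f1, f1)}" using Z N_eq tip[of f1] by auto
          then show ?thesis unfolding isola_birth_def by blast
        next
          case False
          then have seg: "closed_segment f1 f2 = N"
            using le(1)[OF f(2)] by (simp add: N_eq closed_segment_eq_real_ivl)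
          have ne: "z1 kp \<noteq> z2 kp" if "kp \<in> closed_segment f1 f2" "kp \<noteq> f2" "kp \<noteq> f1" for kp
          proof -
            have "kp \<in> N" "f1 < kp" "kp < f2" using that seg N_eq by auto
            then show ?thesis using mid[of kp] roots_eq_iff[OF z(3)[of kp]] by force
          qed
          have "path_image (fold_path z1 z2 f1 f2) = ?Z"
            unfolding Z using fold_path_image[of z1 f2 z2 f1] tip[of f2] by (simp add: seg)
          moreover note fold_path_closed_curve[OF False z(1,2)[folded seg] tip tip ne]
          ultimately show ?thesis unfolding isola_birth_def by blast
        qed
      qed
    qed
    then show ?thesis using e(1) e1(1) by (intro exI[of _ "min e e1"]) auto
  qed
  then show "\<exists>e>0. \<forall>\<beta>. 0 < \<beta> \<and> \<beta> < e --> (\<exists>e2>0. \<forall>\<eta>. \<bar>\<eta>\<bar> < e2 -->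
      isola_birth {(s, kp). s \<in> ?I \<and> kp \<in> {k0-\<beta>..k0+\<beta>} \<and> b \<eta> s kp = 0})"
    using e(1) by blast
qed

end

lemma graphs_meet:
  assumes "\<And>kp. kp \<in> J ==> y1 kp = y2 kp \<longleftrightarrow> kp = f" "f \<in> J"
  shows "{(s, kp). kp \<in> J \<and> s = y1 kp} \<inter> {(s, kp). kp \<in> J \<and> s = y2 kp} = {(y1 f, f)}"
  using assms by auto

context convex_germ
begin

lemma line_sign:
  assumes \<eta>: "\<bar>\<eta>\<bar> < R" and s: "\<bar>s - s0\<bar> < R" and k: "\<bar>kp - k0\<bar> < R"
    and crit: "b \<eta> s kp = 0" "bs \<eta> s kp = 0" "bk \<eta> s kp = 0" and c: "0 < c * quadratic \<eta> s kp r 1"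
  obtains d where "0 < d" "\<And>t. t \<noteq> 0 ==> \<bar>t\<bar> < d ==> 0 < c * b \<eta> (s + r * t) (kp + t)"
proof -
  define w where "w = min ((R - \<bar>s - s0\<bar>) / (\<bar>r\<bar> + 1)) (R - \<bar>kp - k0\<bar>)"
  have w: "0 < w" using s k by (simp add: w_def)
  have box: "\<bar>s + r * t - s0\<bar> < R" "\<bar>kp + 1 * t - k0\<bar> < R" if "\<bar>t\<bar> < w" for t
  proof -
    have "\<bar>r * t\<bar> \<le> (\<bar>r\<bar> + 1) * \<bar>t\<bar>" by (simp add: abs_mult mult_right_mono)
    also have "\<dots> < (\<bar>r\<bar> + 1) * ((R - \<bar>s - s0\<bar>) / (\<bar>r\<bar> + 1))"
      using that by (intro mult_strict_left_mono) (auto simp: w_def)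
    also have "\<dots> = R - \<bar>s - s0\<bar>" by simp
    finally show "\<bar>s + r * t - s0\<bar> < R" by linarith
    have "\<bar>t\<bar> < R - \<bar>kp - k0\<bar>" using that by (simp add: w_def)
    then show "\<bar>kp + 1 * t - k0\<bar> < R" by linarith
  qed
  have D0: "DERIV (%t. c * (bs \<eta> (s + r * t) (kp + 1 * t) * r + bk \<eta> (s + r * t) (kp + 1 * t) * 1)) 0 :>
      c * quadratic \<eta> s kp r 1"
    using DERIV_cmult[OF line_second_derivative[OF \<eta> box[of 0]], of c] w by simp
  obtain d where "0 < d" "\<And>t. t \<noteq> 0 ==> \<bar>t\<bar> < d ==> 0 < c * b \<eta> (s + r * t) (kp + 1 * t)"
  proof (rule second_derivative_sign[OF w DERIV_cmult[OF line_derivative(1)[OF \<eta> box]] D0 _ _ c])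
  qed (use that in \<open>auto simp: crit\<close>)
  then show thesis using that by simp
qed

text \<open>At a double zero of \<open>b \<eta> _ f\<close> that splits in both directions of \<open>kp\<close>, the branches have
  the slopes at which the quadratic form vanishes.\<close>

lemma crossing_slopes:
  assumes \<eta>: "\<bar>\<eta>\<bar> < R" and a: "0 < a" "a < R" and \<beta>: "0 < \<beta>" "\<beta> < R"
    and z: "continuous_on {k0-\<beta>..k0+\<beta>} z1" "continuous_on {k0-\<beta>..k0+\<beta>} z2"
      "\<And>kp. kp \<in> {k0-\<beta>..k0+\<beta>} ==> roots \<eta> a kp (z1 kp) (z2 kp)"
    and f: "k0 - \<beta> < f" "f < k0 + \<beta>" "z1 f = z2 f"
    and ne: "\<And>kp. kp \<in> {k0-\<beta>..k0+\<beta>} ==> kp \<noteq> f ==> z1 kp \<noteq> z2 kp"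
    and neg: "quadratic \<eta> (z1 f) f \<rho> 1 < 0"
  shows "\<exists>r1 r2. r1 \<noteq> r2 \<and> DERIV (%kp. if kp \<le> f then z1 kp else z2 kp) f :> r1 \<and>
    DERIV (%kp. if kp \<le> f then z2 kp else z1 kp) f :> r2"
proof -
  let ?I = "{s0-a..s0+a}" and ?J = "{k0-\<beta>..k0+\<beta>}"
  define x where "x = z1 f"
  have fJ: "f \<in> ?J" using f by simp
  have fR: "\<bar>f - k0\<bar> < R" using f \<beta> by linarith
  note rf = z(3)[OF fJ]
  have xI: "s0 - a < x" "x < s0 + a" "x \<in> ?I" using rf f(3) by (auto simp: roots_def x_def)
  have xR: "\<bar>x - s0\<bar> < R" using xI a by linarith
  have x0: "b \<eta> x f = 0" using roots_zeros[OF rf, of x] by (simp add: x_def)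
  have "bs \<eta> x f \<le> 0" "0 \<le> bs \<eta> x f" using rf xI(3) f(3) unfolding roots_def x_def by blast+
  then have bsx: "bs \<eta> x f = 0" by simp
  have lt: "z1 kp < z2 kp" if "kp \<in> ?J" "kp \<noteq> f" for kp
    using z(3)[OF that(1)] ne[OF that] unfolding roots_def by (meson le_less)

  \<comment> \<open>Between the branches \<open>b\<close> is negative, on the line \<open>kp = f\<close> it is not; this excludes both signs
    of the \<open>kp\<close>-derivative.\<close>
  have no_sign: "\<not> 0 < c * bk \<eta> x f" if c: "c = 1 \<or> c = -1" for c
  proof
    assume pos: "0 < c * bk \<eta> x f"
    let ?O = "{k0-R<..<k0+R} \<times> {s0-R<..<s0+R}"
    have cb: "continuous_on ?O (%p. c * (case p of (kp, s) => bk \<eta> s kp))"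
      by (intro continuous_on_mult_left slice_continuous(3)[OF \<eta>]) simp
    have "open (?O \<inter> (%p. c * (case p of (kp, s) => bk \<eta> s kp)) -` {0<..})"
      by (intro continuous_open_preimage[OF cb] open_Times) auto
    moreover have "f \<in> {k0-R<..<k0+R}" "x \<in> {s0-R<..<s0+R}" using fR xR by (auto simp: abs_less_iff)
    then have "(f, x) \<in> ?O \<inter> (%p. c * (case p of (kp, s) => bk \<eta> s kp)) -` {0<..}" using pos by simp
    ultimately obtain A B where AB: "open A" "open B" "f \<in> A" "x \<in> B"
      "A \<times> B \<subseteq> ?O \<inter> (%p. c * (case p of (kp, s) => bk \<eta> s kp)) -` {0<..}"
      by (rule open_prod_elim) auto
    obtain dA where dA: "0 < dA" "\<And>kp. \<bar>kp - f\<bar> < dA ==> kp \<in> A"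
      using AB(1,3) unfolding open_dist dist_real_def by blast
    obtain dB where dB: "0 < dB" "\<And>s. \<bar>s - x\<bar> < dB ==> s \<in> B"
      using AB(2,4) unfolding open_dist dist_real_def by blast
    have intf: "f \<in> interior ?J" using f by simp
    have "isCont z1 f" "isCont z2 f"
      using continuous_on_interior[OF z(1) intf] continuous_on_interior[OF z(2) intf] by auto
    then have "isCont (%kp. (z1 kp + z2 kp) / 2) f" by (intro continuous_intros) auto
    moreover have "(z1 f + z2 f) / 2 = x" using f(3) by (simp add: x_def)
    ultimately have "((%kp. (z1 kp + z2 kp) / 2) \<longlongrightarrow> x) (at f)" by (simp add: isCont_def)
    from tendstoD[OF this dB(1)] obtain dz where dz: "0 < dz"
      "\<And>kp. kp \<noteq> f ==> \<bar>kp - f\<bar> < dz ==> \<bar>(z1 kp + z2 kp) / 2 - x\<bar> < dB"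
      unfolding eventually_at dist_real_def by auto
    define h where "h = min (min dA dz) (min (f - (k0 - \<beta>)) (k0 + \<beta> - f)) / 2"
    have h: "0 < h" "h < dA" "h < dz" "h < f - (k0 - \<beta>)" "h < k0 + \<beta> - f"
      using dA(1) dz(1) f by (auto simp: h_def)
    define kp where "kp = f + c * h"
    have kp: "\<bar>kp - f\<bar> = h" "kp \<noteq> f" "kp \<in> ?J" using c h by (auto simp: kp_def)
    define m where "m = (z1 kp + z2 kp) / 2"
    have mB: "m \<in> B" using dB(2) dz(2)[OF kp(2)] kp(1) h(3) by (simp add: m_def)
    have zI: "s0 - a < z1 kp" "z2 kp < s0 + a" using z(3)[OF kp(3)] unfolding roots_def by blast+
    have mI: "m \<in> ?I" "z1 kp < m" "m < z2 kp" using lt[OF kp(3,2)] zI by (auto simp: m_def)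
    have m1: "b \<eta> m kp < 0" using roots_negative[OF z(3)[OF kp(3)] mI(1)] mI by blast
    have m2: "0 \<le> b \<eta> m f" using roots_eq_iff[OF rf] f(3) mI(1) by blast
    have mR: "\<bar>m - s0\<bar> < R" using mI(1) a unfolding atLeastAtMost_iff by linarith
    let ?\<phi> = "%t. b \<eta> (m + 0 * t) (f + (c * h) * t)"
    have seg: "\<bar>f + c * h * t - f\<bar> < dA" "\<bar>f + c * h * t - k0\<bar> < R" if "0 \<le> t" "t \<le> 1" for t
    proof -
      have "\<bar>c * h * t\<bar> \<le> h * 1" unfolding abs_mult using that c h(1) by (intro mult_mono) auto
      then show "\<bar>f + c * h * t - f\<bar> < dA" "\<bar>f + c * h * t - k0\<bar> < R" using h f \<beta> by linarith+
    qed
    have "DERIV ?\<phi> t :> bs \<eta> (m + 0 * t) (f + (c * h) * t) * 0 + bk \<eta> (m + 0 * t) (f + (c * h) * t) * (c * h)"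
      if "0 \<le> t" "t \<le> 1" for t
      by (rule line_derivative(1)[OF \<eta>]) (use mR seg(2)[OF that] in auto)
    from MVT2[OF zero_less_one this] obtain t where t: "0 < t" "t < 1"
      "?\<phi> 1 - ?\<phi> 0 = (1 - 0) * (bs \<eta> (m + 0 * t) (f + (c * h) * t) * 0 + bk \<eta> (m + 0 * t) (f + (c * h) * t) * (c * h))"
      by auto
    have "(f + c * h * t, m) \<in> A \<times> B" using dA(2)[OF seg(1)] t(1,2) mB by simp
    from subsetD[OF AB(5) this] have "0 < c * bk \<eta> m (f + c * h * t)" by simp
    then have "0 < c * bk \<eta> m (f + c * h * t) * h" using h(1) by simp
    then have "0 < ?\<phi> 1 - ?\<phi> 0" unfolding t(3) by (simp add: ac_simps)
    then show False using m1 m2 by (simp add: kp_def)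
  qed
  have bkx: "bk \<eta> x f = 0" using no_sign[of 1] no_sign[of "-1"] by simp

  define A where "A = bss \<eta> x f"
  define B where "B = bsk \<eta> x f"
  define C where "C = bkk \<eta> x f"
  have A: "0 < A" unfolding A_def by (rule bss[OF \<eta> xR fR])
  have q: "quadratic \<eta> x f r 1 = A * r\<^sup>2 + 2 * B * r + C" for r by (simp add: quadratic_def A_def B_def C_def)
  define w where "w = sqrt (B\<^sup>2 - A * C) / A"
  have "A * (A * \<rho>\<^sup>2 + 2 * B * \<rho> + C) < 0" using neg A q[of \<rho>] by (simp add: x_def mult_pos_neg)
  moreover have "A * (A * \<rho>\<^sup>2 + 2 * B * \<rho> + C) = (A * \<rho> + B)\<^sup>2 - (B\<^sup>2 - A * C)"
    by (simp add: power2_eq_square algebra_simps)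
  ultimately have disc: "0 < B\<^sup>2 - A * C" using zero_le_power2[of "A * \<rho> + B"] by linarith
  have w: "0 < w" using disc A by (simp add: w_def)
  have "(A * w)\<^sup>2 = B\<^sup>2 - A * C" using disc A by (simp add: w_def)
  then have ww: "A * (A * w\<^sup>2) = B\<^sup>2 - A * C" by (simp add: power2_eq_square ac_simps)
  have qf: "quadratic \<eta> x f (- B / A + r) 1 = A * (r\<^sup>2 - w\<^sup>2)" for r
  proof -
    have "A * (A * (- B / A + r)\<^sup>2 + 2 * B * (- B / A + r) + C) = (A * (- B / A + r) + B)\<^sup>2 - (B\<^sup>2 - A * C)"
      by (simp add: power2_eq_square algebra_simps)
    also have "A * (- B / A + r) + B = A * r" using A by (simp add: field_simps)
    also have "(A * r)\<^sup>2 - (B\<^sup>2 - A * C) = A * (A * (r\<^sup>2 - w\<^sup>2))"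
      unfolding ww[symmetric] by (simp add: power2_eq_square algebra_simps)
    finally show ?thesis using A by (simp add: q)
  qed
  have near: "\<exists>d>0. \<forall>t. t \<noteq> 0 --> \<bar>t\<bar> < d --> f + t \<in> ?J \<and> x + p * t \<in> ?I \<and> x + n * t \<in> ?I \<and>
      0 < b \<eta> (x + p * t) (f + t) \<and> b \<eta> (x + n * t) (f + t) < 0"
    if pn: "0 < quadratic \<eta> x f p 1" "quadratic \<eta> x f n 1 < 0" for p n
  proof -
    obtain d1 where d1: "0 < d1" "\<And>t. t \<noteq> 0 ==> \<bar>t\<bar> < d1 ==> 0 < 1 * b \<eta> (x + p * t) (f + t)"
    proof (rule line_sign[OF \<eta> xR fR x0 bsx bkx, of 1 p])
      show "0 < 1 * quadratic \<eta> x f p 1" using pn(1) by simp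
    qed (use that in blast)
    obtain d2 where d2: "0 < d2" "\<And>t. t \<noteq> 0 ==> \<bar>t\<bar> < d2 ==> 0 < (-1) * b \<eta> (x + n * t) (f + t)"
    proof (rule line_sign[OF \<eta> xR fR x0 bsx bkx, of "-1" n])
      show "0 < (-1) * quadratic \<eta> x f n 1" using pn(2) by simp
    qed (use that in blast)
    define g where "g = min (x - (s0 - a)) (s0 + a - x)"
    define K where "K = \<bar>p\<bar> + \<bar>n\<bar> + 1"
    have g: "0 < g" using xI by (simp add: g_def)
    have K: "0 < K" by (simp add: K_def)
    define d where "d = min (min d1 d2) (min (g / K) (min (f - (k0 - \<beta>)) (k0 + \<beta> - f)))"
    show ?thesis
    proof (intro exI[of _ d] conjI[of "0 < d"] allI impI)
      show "0 < d" using d1(1) d2(1) g K f by (simp add: d_def)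
      fix t assume t: "t \<noteq> 0" "\<bar>t\<bar> < d"
      have tg: "\<bar>t\<bar> < g / K" and tf: "\<bar>t\<bar> < f - (k0 - \<beta>)" "\<bar>t\<bar> < k0 + \<beta> - f"
        using t(2) by (simp_all add: d_def)
      have inI: "x + r * t \<in> ?I" if r: "\<bar>r\<bar> \<le> K" for r
      proof -
        have "\<bar>r * t\<bar> \<le> K * \<bar>t\<bar>" unfolding abs_mult using r by (intro mult_right_mono) auto
        also have "\<dots> < g" using tg K by (simp add: field_simps)
        finally have "\<bar>r * t\<bar> < x - (s0 - a)" "\<bar>r * t\<bar> < s0 + a - x" by (simp_all add: g_def)
        then show ?thesis unfolding atLeastAtMost_iff by linarith
      qed
      have "\<bar>p\<bar> \<le> K" "\<bar>n\<bar> \<le> K" by (simp_all add: K_def)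
      moreover have "f + t \<in> ?J" using tf unfolding atLeastAtMost_iff by linarith
      moreover have "0 < b \<eta> (x + p * t) (f + t)" using d1(2)[OF t(1)] t(2) by (simp add: d_def)
      moreover have "b \<eta> (x + n * t) (f + t) < 0" using d2(2)[OF t(1)] t(2) by (simp add: d_def)
      ultimately show "f + t \<in> ?J \<and> x + p * t \<in> ?I \<and> x + n * t \<in> ?I \<and>
          0 < b \<eta> (x + p * t) (f + t) \<and> b \<eta> (x + n * t) (f + t) < 0" using inI by blast
    qed
  qed
  have sep: "(x + p * t < x + n * t --> x + p * t < z1 (f + t) \<and> z1 (f + t) < x + n * t) \<and>
      (x + n * t < x + p * t --> x + n * t < z2 (f + t) \<and> z2 (f + t) < x + p * t)"
    if h: "f + t \<in> ?J" "x + p * t \<in> ?I" "x + n * t \<in> ?I"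
      "0 < b \<eta> (x + p * t) (f + t)" "b \<eta> (x + n * t) (f + t) < 0" for p n t
  proof -
    note r = z(3)[OF h(1)]
    have n: "z1 (f + t) < x + n * t" "x + n * t < z2 (f + t)"
      using roots_negative[OF r h(3)] h(5) by auto
    have "\<not> (z1 (f + t) < x + p * t \<and> x + p * t < z2 (f + t))"
      using roots_negative[OF r h(2)] h(4) by auto
    moreover have "x + p * t \<noteq> z1 (f + t)" "x + p * t \<noteq> z2 (f + t)"
      using roots_zeros[OF r, of "x + p * t"] h(4) by auto
    ultimately show ?thesis using n by linarith
  qed
  have "DERIV (%kp. if kp \<le> f then z1 kp else z2 kp) f :> - B / A + w"
  proof (rule has_derivative_between_slopes[where ?e0.0 = "2 * w"])
    fix e assume e: "0 < e" "e < 2 * w"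
    let ?p = "- B / A + (w + e)" and ?n = "- B / A + (w - e)"
    have "0 < e * (2 * w + e)" "0 < e * (2 * w - e)" using e w by simp_all
    then have "w\<^sup>2 < (w + e)\<^sup>2" "(w - e)\<^sup>2 < w\<^sup>2" by (simp_all add: power2_eq_square algebra_simps)
    then have "0 < quadratic \<eta> x f ?p 1" "quadratic \<eta> x f ?n 1 < 0"
      unfolding qf using A by (simp_all add: mult_pos_neg)
    from near[OF this] obtain d where d: "0 < d" "\<And>t. t \<noteq> 0 ==> \<bar>t\<bar> < d ==>
        f + t \<in> ?J \<and> x + ?p * t \<in> ?I \<and> x + ?n * t \<in> ?I \<and> 0 < b \<eta> (x + ?p * t) (f + t) \<and> b \<eta> (x + ?n * t) (f + t) < 0"
      by blast
    have "\<bar>(if f + t \<le> f then z1 (f + t) else z2 (f + t)) - (if f \<le> f then z1 f else z2 f) - (- B / A + w) * t\<bar> \<le> e * \<bar>t\<bar>"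
      if t: "t \<noteq> 0" "\<bar>t\<bar> < d" for t
    proof (cases "0 < t")
      case True
      have "x + ?n * t < x + ?p * t" using True e(1) by simp
      then have "x + ?n * t < z2 (f + t) \<and> z2 (f + t) < x + ?p * t" using sep[of t ?p ?n] d(2)[OF t] by blast
      then show ?thesis using True by (simp add: x_def algebra_simps abs_le_iff)
    next
      case False
      then have "t < 0" using t(1) by simp
      then have "x + ?p * t < x + ?n * t" using e(1) by simp
      then have "x + ?p * t < z1 (f + t) \<and> z1 (f + t) < x + ?n * t" using sep[of t ?p ?n] d(2)[OF t] by blast
      then show ?thesis using \<open>t < 0\<close> by (simp add: x_def algebra_simps abs_le_iff)
    qed
    then show "\<exists>d>0. \<forall>t. t \<noteq> 0 --> \<bar>t\<bar> < d -->
      \<bar>(if f + t \<le> f then z1 (f + t) else z2 (f + t)) - (if f \<le> f then z1 f else z2 f) - (- B / A + w) * t\<bar> \<le> e * \<bar>t\<bar>"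
      using d(1) by (intro exI[of _ d]) simp
  qed (use w in simp)
  moreover have "DERIV (%kp. if kp \<le> f then z2 kp else z1 kp) f :> - B / A - w"
  proof (rule has_derivative_between_slopes[where ?e0.0 = "2 * w"])
    fix e assume e: "0 < e" "e < 2 * w"
    let ?p = "- B / A + (- w - e)" and ?n = "- B / A + (- w + e)"
    have "0 < e * (2 * w + e)" "0 < e * (2 * w - e)" using e w by simp_all
    then have "w\<^sup>2 < (- w - e)\<^sup>2" "(- w + e)\<^sup>2 < w\<^sup>2" by (simp_all add: power2_eq_square algebra_simps)
    then have "0 < quadratic \<eta> x f ?p 1" "quadratic \<eta> x f ?n 1 < 0"
      unfolding qf using A by (simp_all add: mult_pos_neg)
    from near[OF this] obtain d where d: "0 < d" "\<And>t. t \<noteq> 0 ==> \<bar>t\<bar> < d ==>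
        f + t \<in> ?J \<and> x + ?p * t \<in> ?I \<and> x + ?n * t \<in> ?I \<and> 0 < b \<eta> (x + ?p * t) (f + t) \<and> b \<eta> (x + ?n * t) (f + t) < 0"
      by blast
    have "\<bar>(if f + t \<le> f then z2 (f + t) else z1 (f + t)) - (if f \<le> f then z2 f else z1 f) - (- B / A - w) * t\<bar> \<le> e * \<bar>t\<bar>"
      if t: "t \<noteq> 0" "\<bar>t\<bar> < d" for t
    proof (cases "0 < t")
      case True
      have "x + ?p * t < x + ?n * t" using True e(1) by simp
      then have "x + ?p * t < z1 (f + t) \<and> z1 (f + t) < x + ?n * t" using sep[of t ?p ?n] d(2)[OF t] by blast
      then show ?thesis using True f(3) by (simp add: x_def algebra_simps abs_le_iff)
    next
      case False
      then have "t < 0" using t(1) by simp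
      then have "x + ?n * t < x + ?p * t" using e(1) by simp
      then have "x + ?n * t < z2 (f + t) \<and> z2 (f + t) < x + ?p * t" using sep[of t ?p ?n] d(2)[OF t] by blast
      then show ?thesis using \<open>t < 0\<close> f(3) by (simp add: x_def algebra_simps abs_le_iff)
    qed
    then show "\<exists>d>0. \<forall>t. t \<noteq> 0 --> \<bar>t\<bar> < d -->
      \<bar>(if f + t \<le> f then z2 (f + t) else z1 (f + t)) - (if f \<le> f then z2 f else z1 f) - (- B / A - w) * t\<bar> \<le> e * \<bar>t\<bar>"
      using d(1) by (intro exI[of _ d]) simp
  qed (use w in simp)
  ultimately show ?thesis using w by (intro exI[of _ "- B / A + w"] exI[of _ "- B / A - w"]) auto
qed

text \<open>Along lines of direction \<open>(\<rho>, 1)\<close> the germ is strictly concave. Between two values of \<open>kp\<close> at which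
  it is nonnegative for all \<open>s\<close> it is therefore positive, and the \<open>kp\<close> without negative values form an
  interval. The three alternatives are that it is empty, a point, or nondegenerate.\<close>

theorem simple_bifurcation_zeros:
  assumes bk0: "bk 0 s0 k0 = 0"
    and neg: "\<And>\<eta> s kp. \<bar>\<eta>\<bar> < R ==> \<bar>s - s0\<bar> < R ==> \<bar>kp - k0\<bar> < R ==> quadratic \<eta> s kp \<rho> 1 < 0"
  shows "\<forall>\<^sub>F a in at_right 0. \<forall>\<^sub>F \<beta> in at_right 0. \<forall>\<^sub>F \<eta> in at_right 0.
    simple_bifurcation (k0 - \<beta>) (k0 + \<beta>) {(s, kp). s \<in> {s0-a..s0+a} \<and> kp \<in> {k0-\<beta>..k0+\<beta>} \<and> b \<eta> s kp = 0}"
proof (rule eventually_right_nested[OF R])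
  have quad: "0 < (-1) * quadratic \<eta> s kp (\<rho> * k) k"
    if "\<bar>\<eta>\<bar> < R" "\<bar>s - s0\<bar> < R" "\<bar>kp - k0\<bar> < R" "k \<noteq> 0" for \<eta> s kp k
  proof -
    have "quadratic \<eta> s kp (\<rho> * k) k = k\<^sup>2 * quadratic \<eta> s kp \<rho> 1"
      by (simp add: quadratic_def power2_eq_square algebra_simps)
    also have "\<dots> < 0" using neg[OF that(1-3)] that(4) by (intro mult_pos_neg) auto
    finally show ?thesis by simp
  qed
  fix a assume a: "0 < a" "a < R"
  let ?I = "{s0-a..s0+a}" and ?K0 = "({s0-a..s0-a/2} \<union> {s0+a/2..s0+a}) \<times> {k0}"
  have inR: "\<bar>s - s0\<bar> < R" if "s \<in> ?I" for s using that a unfolding atLeastAtMost_iff by linarith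
  have c0: "compact ?K0" by (intro compact_Times compact_Un compact_Icc) simp
  have s0: "?K0 \<subseteq> {s0-R<..<s0+R} \<times> {k0-R<..<k0+R}" using a R by auto
  have p0: "0 < 1 * b 0 s kp" if h: "(s, kp) \<in> ?K0" for s kp
  proof -
    have "kp = k0" "s \<in> ?I" "s \<noteq> s0" using h a by auto
    then show ?thesis using base_positive[OF inR] by simp
  qed
  obtain e0 where e0: "0 < e0" "\<And>\<eta> s kp kp'. (s, kp) \<in> ?K0 ==> \<bar>\<eta>\<bar> < e0 ==> \<bar>kp' - kp\<bar> < e0 ==>
      \<bar>\<eta>\<bar> < R \<and> \<bar>kp' - k0\<bar> < R \<and> 0 < 1 * b \<eta> s kp'"
    using positive_near_compact[OF c0 s0 p0] by blast
  define e where "e = min e0 (min R (a / (4 * (\<bar>\<rho>\<bar> + 1))))"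
  have e: "0 < e" "e \<le> e0" "e \<le> R" "e \<le> a / (4 * (\<bar>\<rho>\<bar> + 1))" using e0(1) R a(1) by (auto simp: e_def)
  have "\<exists>e2>0. \<forall>\<eta>. \<bar>\<eta>\<bar> < e2 -->
      simple_bifurcation (k0 - \<beta>) (k0 + \<beta>) {(s, kp). s \<in> ?I \<and> kp \<in> {k0-\<beta>..k0+\<beta>} \<and> b \<eta> s kp = 0}"
    if \<beta>: "0 < \<beta>" "\<beta> < e" for \<beta>
  proof -
    let ?J = "{k0-\<beta>..k0+\<beta>}"
    have J: "?J \<subseteq> {k0-R<..<k0+R}" "compact ?J" using \<beta> e(3) by auto
    have inRk: "\<bar>kp - k0\<bar> < R" "\<bar>kp - k0\<bar> < e0" if "kp \<in> ?J" for kp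
      using that \<beta> e(2,3) unfolding atLeastAtMost_iff by linarith+
    have shift: "\<bar>\<rho> * k\<bar> \<le> a / 2" if "\<bar>k\<bar> \<le> 2 * \<beta>" for k
    proof -
      have "\<bar>\<rho> * k\<bar> \<le> (\<bar>\<rho>\<bar> + 1) * (2 * e)" unfolding abs_mult using that \<beta> by (intro mult_mono) auto
      also have "\<dots> \<le> (\<bar>\<rho>\<bar> + 1) * (2 * (a / (4 * (\<bar>\<rho>\<bar> + 1))))" using e(4) by (intro mult_left_mono) auto
      also have "\<dots> = a / 2" by (simp add: field_simps)
      finally show ?thesis .
    qed
    let ?K1 = "{(s0 + \<rho> * \<beta>, k0 + \<beta>), (s0 + \<rho> * (- \<beta>), k0 + (- \<beta>))}"
    have sh: "\<bar>\<rho> * \<beta>\<bar> < a" "\<bar>\<rho> * (- \<beta>)\<bar> < a" "\<bar>\<beta>\<bar> < R" "\<bar>- \<beta>\<bar> < R"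
      using shift[of \<beta>] shift[of "- \<beta>"] \<beta> e(3) a(1) by auto
    have corner: "s0 + \<rho> * \<beta> \<in> ?I" "s0 + \<rho> * (- \<beta>) \<in> ?I"
      using sh(1,2) unfolding atLeastAtMost_iff by linarith+
    have c1: "compact ?K1" by (rule finite_imp_compact) simp
    have s1: "?K1 \<subseteq> {s0-R<..<s0+R} \<times> {k0-R<..<k0+R}"
      using inR[OF corner(1)] inR[OF corner(2)] sh(3) by (auto simp: abs_less_iff)
    have p1: "0 < (-1) * b 0 s kp" if h: "(s, kp) \<in> ?K1" for s kp
    proof -
      have R0: "\<bar>0 :: real\<bar> < R" using R by simp
      have "0 < (-1) * b 0 (s0 + \<rho> * \<beta>) (k0 + \<beta>)"
        by (rule base_sign[OF _ sh(3) bk0 quad[OF R0]]) (use sh(1) a(2) \<beta> in auto)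
      moreover have "0 < (-1) * b 0 (s0 + \<rho> * (- \<beta>)) (k0 + (- \<beta>))"
        by (rule base_sign[OF _ sh(4) bk0 quad[OF R0]]) (use sh(2) a(2) \<beta> in auto)
      ultimately show ?thesis using h by auto
    qed
    obtain e1 where e1: "0 < e1" "\<And>\<eta> s kp kp'. (s, kp) \<in> ?K1 ==> \<bar>\<eta>\<bar> < e1 ==> \<bar>kp' - kp\<bar> < e1 ==>
        \<bar>\<eta>\<bar> < R \<and> \<bar>kp' - k0\<bar> < R \<and> 0 < (-1) * b \<eta> s kp'"
      using positive_near_compact[OF c1 s1 p1] by blast
    have "simple_bifurcation (k0 - \<beta>) (k0 + \<beta>) {(s, kp). s \<in> ?I \<and> kp \<in> ?J \<and> b \<eta> s kp = 0}"
      (is "simple_bifurcation _ _ ?Z") if \<eta>0: "\<bar>\<eta>\<bar> < min e0 (min e1 R)" for \<eta>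
    proof -
      have \<eta>: "\<bar>\<eta>\<bar> < e0" "\<bar>\<eta>\<bar> < e1" "\<bar>\<eta>\<bar> < R" using \<eta>0 by auto
      have outer: "0 < b \<eta> s kp" if h: "s \<in> ?I" "a / 2 \<le> \<bar>s - s0\<bar>" "kp \<in> ?J" for s kp
      proof -
        have "s \<in> {s0-a..s0-a/2} \<union> {s0+a/2..s0+a}"
          using h(1,2) unfolding Un_iff atLeastAtMost_iff by linarith
        then have "(s, k0) \<in> ?K0" by simp
        from e0(2)[OF this \<eta>(1) inRk(2)[OF h(3)]] show ?thesis by simp
      qed
      have ends: "0 < b \<eta> (s0 - a) kp \<and> 0 < b \<eta> (s0 + a) kp" if "kp \<in> ?J" for kp
        using outer[of "s0 - a" kp] outer[of "s0 + a" kp] that a(1) by auto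
      define N where "N = {kp\<in>?J. \<forall>s\<in>?I. 0 \<le> b \<eta> s kp}"
      define C1 where "C1 = {kp\<in>?J. \<exists>s\<in>?I. b \<eta> s kp \<le> 0}"
      have N: "closed N" unfolding N_def by (rule closed_nonneg[OF \<eta>(3) _ J(1) a]) simp
      have C1: "closed C1" unfolding C1_def by (rule closed_nonpos[OF \<eta>(3) J(2,1) a(2)])
      have NJ: "N \<subseteq> ?J" by (auto simp: N_def)
      have notN: "\<exists>s\<in>?I. b \<eta> s kp < 0" if "kp \<in> ?J" "kp \<notin> N" for kp
        using that by (auto simp: N_def not_le)
      have notN_C1: "kp \<in> C1" if "kp \<in> ?J" "kp \<notin> N" for kp
        using notN[OF that] that(1) unfolding C1_def by (blast intro: less_imp_le)
      have tr: "z1 = z2 \<longleftrightarrow> kp \<in> N" if "roots \<eta> a kp z1 z2" "kp \<in> ?J" for kp z1 z2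
        using roots_eq_iff[OF that(1)] that(2) by (simp add: N_def)
      have br: "\<exists>z1 z2. continuous_on T z1 \<and> continuous_on T z2 \<and> (\<forall>kp\<in>T. roots \<eta> a kp (z1 kp) (z2 kp))"
        if T: "closed T" "T \<subseteq> C1" for T
      proof -
        have TJ: "T \<subseteq> ?J" using T(2) by (auto simp: C1_def)
        obtain z1 z2 where "continuous_on T z1" "continuous_on T z2" "\<And>kp. kp \<in> T ==> roots \<eta> a kp (z1 kp) (z2 kp)"
        proof (rule branches[OF \<eta>(3) a T(1)])
          show "T \<subseteq> {k0-R<..<k0+R}" using TJ J(1) by blast
          show "0 < b \<eta> (s0 - a) kp \<and> 0 < b \<eta> (s0 + a) kp" if "kp \<in> T" for kp using ends that TJ by blast
          show "\<exists>c\<in>?I. b \<eta> c kp \<le> 0" if "kp \<in> T" for kp using that T(2) by (auto simp: C1_def)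
        qed (use that in blast)
        then show ?thesis by blast
      qed
      have Z_C1: "kp \<in> C1" if "s \<in> ?I" "kp \<in> ?J" "b \<eta> s kp = 0" for s kp
        unfolding C1_def using that eq_refl[OF that(3)] by blast
      have strict: "kp \<notin> C1" if k: "kp1 \<in> N" "kp2 \<in> N" "kp1 < kp" "kp < kp2" for kp1 kp kp2
      proof
        assume "kp \<in> C1"
        then obtain s where s: "s \<in> ?I" "b \<eta> s kp \<le> 0" and kp: "kp \<in> ?J" by (auto simp: C1_def)
        have sa: "\<bar>s - s0\<bar> < a / 2" using outer[OF s(1) _ kp] s(2) by force
        have kJ: "kp1 \<in> ?J" "kp2 \<in> ?J" using k(1,2) NJ by auto
        have "\<bar>kp1 - kp\<bar> \<le> 2 * \<beta>" "\<bar>kp2 - kp\<bar> \<le> 2 * \<beta>" using kJ kp unfolding atLeastAtMost_iff by linarith+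
        then have "\<bar>\<rho> * (kp1 - kp)\<bar> \<le> a / 2" "\<bar>\<rho> * (kp2 - kp)\<bar> \<le> a / 2" using shift by blast+
        then have pI: "s + \<rho> * (kp1 - kp) \<in> ?I" "s + \<rho> * (kp2 - kp) \<in> ?I"
          using sa unfolding atLeastAtMost_iff by linarith+
        define t where "t = (kp - kp1) / (kp2 - kp1)"
        have t: "0 < t" "t < 1" "(kp2 - kp1) * t = kp - kp1" using k by (auto simp: t_def)
        let ?s1 = "s + \<rho> * (kp1 - kp)" and ?s2 = "s + \<rho> * (kp2 - kp)"
        have d: "?s2 - ?s1 = \<rho> * (kp2 - kp1)" by (simp add: algebra_simps)
        have "(-1) * b \<eta> (?s1 + (?s2 - ?s1) * t) (kp1 + (kp2 - kp1) * t)
            < (1 - t) * ((-1) * b \<eta> ?s1 kp1) + t * ((-1) * b \<eta> ?s2 kp2)"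
        proof (rule strict_convex_on_segment[OF \<eta>(3) inR[OF pI(1)] inRk(1)[OF kJ(1)] inR[OF pI(2)] inRk(1)[OF kJ(2)] _ t(1,2)])
          show "0 < (-1) * quadratic \<eta> s' kp' (?s2 - ?s1) (kp2 - kp1)" if "\<bar>s' - s0\<bar> < R" "\<bar>kp' - k0\<bar> < R" for s' kp'
            unfolding d by (rule quad[OF \<eta>(3) that]) (use k in simp)
        qed
        also have "\<dots> \<le> 0"
        proof -
          have "0 \<le> b \<eta> ?s1 kp1" "0 \<le> b \<eta> ?s2 kp2" using k(1,2) pI unfolding N_def by blast+
          then have "0 \<le> (1 - t) * b \<eta> ?s1 kp1 + t * b \<eta> ?s2 kp2"
            using t(1,2) by (intro add_nonneg_nonneg mult_nonneg_nonneg) auto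
          moreover have "(1 - t) * ((-1) * x) + t * ((-1) * y) = - ((1 - t) * x + t * y)" for x y :: real
            by (simp add: algebra_simps)
          ultimately show ?thesis by simp
        qed
        finally have "(-1) * b \<eta> (?s1 + (?s2 - ?s1) * t) (kp1 + (kp2 - kp1) * t) < 0" .
        moreover have "?s1 + (?s2 - ?s1) * t = s"
        proof -
          have "(?s2 - ?s1) * t = \<rho> * ((kp2 - kp1) * t)" unfolding d by simp
          then show ?thesis unfolding t(3) by (simp add: algebra_simps)
        qed
        moreover have "kp1 + (kp2 - kp1) * t = kp" using t(3) by simp
        ultimately have "(-1) * b \<eta> s kp < 0" by (simp only:)
        then show False using s(2) by simp
      qed
      have edge: "k0 - \<beta> \<notin> N" "k0 + \<beta> \<notin> N"
      proof -
        have "b \<eta> (s0 + \<rho> * \<beta>) (k0 + \<beta>) < 0" "b \<eta> (s0 + \<rho> * (- \<beta>)) (k0 + (- \<beta>)) < 0"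
          using e1(2)[of "s0 + \<rho> * \<beta>" "k0 + \<beta>" \<eta> "k0 + \<beta>"]
            e1(2)[of "s0 + \<rho> * (- \<beta>)" "k0 + (- \<beta>)" \<eta> "k0 + (- \<beta>)"] e1(1) \<eta>(2) by auto
        then have "\<not> 0 \<le> b \<eta> (s0 + \<rho> * \<beta>) (k0 + \<beta>)" "\<not> 0 \<le> b \<eta> (s0 + \<rho> * (- \<beta>)) (k0 - \<beta>)" by auto
        then show "k0 - \<beta> \<notin> N" "k0 + \<beta> \<notin> N" using corner unfolding N_def by blast+
      qed
      show ?thesis
      proof (cases "N = {}")
        case True
        have "?J \<subseteq> C1" using notN_C1 True by blast
        with br[of ?J] obtain z1 z2 where z: "continuous_on ?J z1" "continuous_on ?J z2"
          "\<And>kp. kp \<in> ?J ==> roots \<eta> a kp (z1 kp) (z2 kp)" by auto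
        have "z1 kp \<noteq> z2 kp" if "kp \<in> ?J" for kp using tr[OF z(3)[OF that] that] True by blast
        then have "path_image (graph_path z1 k0 \<beta>) \<inter> path_image (graph_path z2 k0 \<beta>) = {}"
          unfolding graph_path(2)[OF \<beta>(1) z(1)] graph_path(2)[OF \<beta>(1) z(2)] by blast
        moreover have "?Z = path_image (graph_path z1 k0 \<beta>) \<union> path_image (graph_path z2 k0 \<beta>)"
          unfolding graph_path(2)[OF \<beta>(1) z(1)] graph_path(2)[OF \<beta>(1) z(2)]
          using roots_zeros[OF z(3)] by blast
        ultimately show ?thesis
          using graph_path(1)[OF \<beta>(1) z(1)] graph_path(1)[OF \<beta>(1) z(2)]
          unfolding simple_bifurcation_def bottleneck_def by blast
      next
        case False
        note bdd = bdd_below_mono[OF bdd_below_Icc NJ] bdd_above_mono[OF bdd_above_Icc NJ]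
        define f1 where "f1 = Inf N"
        define f2 where "f2 = Sup N"
        have f: "f1 \<in> N" "f2 \<in> N" unfolding f1_def f2_def
          using closed_contains_Inf[OF False bdd(1) N] closed_contains_Sup[OF False bdd(2) N] by auto
        have le: "f1 \<le> kp" "kp \<le> f2" if "kp \<in> N" for kp
          unfolding f1_def f2_def using that bdd by (auto intro: cInf_lower cSup_upper)
        have fJ: "k0 - \<beta> < f1" "f2 < k0 + \<beta>"
          using subsetD[OF NJ f(1)] subsetD[OF NJ f(2)] edge f by (auto simp: le_less)
        have f12: "f1 \<le> f2" by (rule le(1)[OF f(2)])
        have J1: "{k0-\<beta>..f1} \<subseteq> C1"
        proof -
          have "{k0-\<beta>..<f1} \<subseteq> C1"
          proof
            fix kp assume k: "kp \<in> {k0-\<beta>..<f1}"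
            then have "kp \<in> ?J" using f12 fJ by auto
            moreover have "kp \<notin> N" using le(1)[of kp] k by auto
            ultimately show "kp \<in> C1" by (rule notN_C1)
          qed
          then have "closure {k0-\<beta>..<f1} \<subseteq> C1" using C1 by (rule closure_minimal)
          then show ?thesis using fJ(1) by simp
        qed
        have J2: "{f2..k0+\<beta>} \<subseteq> C1"
        proof -
          have "{f2<..k0+\<beta>} \<subseteq> C1"
          proof
            fix kp assume k: "kp \<in> {f2<..k0+\<beta>}"
            then have "kp \<in> ?J" using f12 fJ by auto
            moreover have "kp \<notin> N" using le(2)[of kp] k by auto
            ultimately show "kp \<in> C1" by (rule notN_C1)
          qed
          then have "closure {f2<..k0+\<beta>} \<subseteq> C1" using C1 by (rule closure_minimal)
          then show ?thesis using fJ(2) by simp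
        qed
        let ?T = "{k0-\<beta>..f1} \<union> {f2..k0+\<beta>}"
        have "closed ?T" by (intro closed_Un closed_atLeastAtMost)
        moreover have "?T \<subseteq> C1" using J1 J2 by blast
        ultimately obtain z1 z2 where z: "continuous_on ?T z1" "continuous_on ?T z2"
          "\<And>kp. kp \<in> ?T ==> roots \<eta> a kp (z1 kp) (z2 kp)" using br by metis
        have TJ: "?T \<subseteq> ?J" using fJ f12 by auto
        have zeq: "z1 kp = z2 kp \<longleftrightarrow> kp = f1 \<or> kp = f2" if "kp \<in> ?T" for kp
        proof -
          have "kp \<in> N \<longleftrightarrow> kp = f1 \<or> kp = f2"
          proof
            assume "kp \<in> N" then show "kp = f1 \<or> kp = f2" using le[of kp] that by auto
          qed (use f in auto)
          moreover have "kp \<in> ?J" using that TJ by blast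
          ultimately show ?thesis using tr[OF z(3)[OF that]] by blast
        qed
        have "kp \<in> ?T" if "s \<in> ?I" "kp \<in> ?J" "b \<eta> s kp = 0" for s kp
        proof (rule ccontr)
          assume "kp \<notin> ?T"
          then have "f1 < kp" "kp < f2" using that(2) by auto
          then show False using strict[OF f] Z_C1[OF that] by blast
        qed
        then have Z: "?Z = {(s, kp). kp \<in> ?T \<and> (s = z1 kp \<or> s = z2 kp)}"
          using roots_zeros[OF z(3)] TJ by blast
        show ?thesis
        proof (cases "f1 = f2")
          case True
          have T: "?T = ?J" using fJ True by auto
          note zJ = z(1,2)[unfolded T] z(3)[unfolded T]
          have fin: "f1 \<in> ?J" using f(1) NJ by blast
          have z12: "z1 f1 = z2 f1" using zeq[of f1] T fin by blast
          have ne: "z1 kp \<noteq> z2 kp" if "kp \<in> ?J" "kp \<noteq> f1" for kp using zeq[of kp] T that True by blast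
          let ?y1 = "%kp. if kp \<le> f1 then z1 kp else z2 kp" and ?y2 = "%kp. if kp \<le> f1 then z2 kp else z1 kp"
          have y: "continuous_on ?J ?y1" "continuous_on ?J ?y2"
            by (rule continuous_on_cases_le; (rule continuous_on_subset[OF zJ(1)] continuous_on_subset[OF zJ(2)] continuous_on_id)?;
                force simp: z12)+
          obtain r1 r2 where r: "r1 \<noteq> r2" "DERIV ?y1 f1 :> r1" "DERIV ?y2 f1 :> r2"
          proof -
            have "z1 f1 \<in> ?I" using zJ(3)[OF fin] by (auto simp: roots_def)
            then have "quadratic \<eta> (z1 f1) f1 \<rho> 1 < 0" by (intro neg[OF \<eta>(3)] inR inRk(1) fin)
            moreover have "\<beta> < R" using \<beta> e(3) by simp
            ultimately show thesis
              using crossing_slopes[OF \<eta>(3) a \<beta>(1) _ zJ fJ(1) _ z12 ne] fJ(2) True that by blast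
          qed
          define t where "t = ((f1 - k0) / \<beta> + 1) / 2"
          have "2 * ((u + 1) / 2) - 1 = u" for u :: real by (simp add: field_simps)
          then have "2 * t - 1 = (f1 - k0) / \<beta>" unfolding t_def .
          then have ft: "f1 = k0 + \<beta> * (2 * t - 1)" using \<beta>(1) by simp
          have t: "t \<in> {0<..<1}"
          proof -
            have "- 1 < (f1 - k0) / \<beta>" "(f1 - k0) / \<beta> < 1" using fJ True \<beta>(1) by (auto simp: field_simps)
            then show ?thesis by (auto simp: t_def)
          qed
          have int: "path_image (graph_path ?y1 k0 \<beta>) \<inter> path_image (graph_path ?y2 k0 \<beta>) = {graph_path ?y1 k0 \<beta> t}"
          proof -
            have "?y1 kp = ?y2 kp \<longleftrightarrow> kp = f1" if "kp \<in> ?J" for kp using z12 ne[OF that] by auto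
            moreover have "graph_path ?y1 k0 \<beta> t = (?y1 f1, f1)" unfolding graph_path_def ft[symmetric] by simp
            ultimately show ?thesis
              unfolding graph_path(2)[OF \<beta>(1) y(1)] graph_path(2)[OF \<beta>(1) y(2)]
              using graphs_meet[of ?J ?y1 ?y2 f1, OF _ fin] by simp
          qed
          have "?Z = path_image (graph_path ?y1 k0 \<beta>) \<union> path_image (graph_path ?y2 k0 \<beta>)"
            unfolding Z T graph_path(2)[OF \<beta>(1) y(1)] graph_path(2)[OF \<beta>(1) y(2)] by auto
          moreover have "graph_path ?y1 k0 \<beta> t = graph_path ?y2 k0 \<beta> t"
            unfolding graph_path_def ft[symmetric] using z12 by simp
          moreover have "fst (r1 * (2 * \<beta>), 2 * \<beta>) * snd (r2 * (2 * \<beta>), 2 * \<beta>) \<noteq>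
              snd (r1 * (2 * \<beta>), 2 * \<beta>) * fst (r2 * (2 * \<beta>), 2 * \<beta>)"
            using r(1) \<beta>(1) by simp
          ultimately have "node_singularity (k0 - \<beta>) (k0 + \<beta>) ?Z"
            unfolding node_singularity_def
            using graph_path(1)[OF \<beta>(1) y(1)] graph_path(1)[OF \<beta>(1) y(2)] int t
              graph_path_derivative[OF \<beta>(1) r(2) ft] graph_path_derivative[OF \<beta>(1) r(3) ft] by blast
          then show ?thesis by (simp add: simple_bifurcation_def)
        next
          case False
          then have f12': "f1 < f2" using f12 by simp
          have seg: "closed_segment (k0 - \<beta>) f1 = {k0-\<beta>..f1}" "closed_segment (k0 + \<beta>) f2 = {f2..k0+\<beta>}"
            using fJ by (simp_all add: closed_segment_eq_real_ivl)
          have ends_eq: "z1 f1 = z2 f1" "z1 f2 = z2 f2" using zeq[of f1] zeq[of f2] fJ by auto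
          have ne1: "z1 kp \<noteq> z2 kp" if "kp \<in> closed_segment (k0 - \<beta>) f1" "kp \<noteq> f1" for kp
            using zeq[of kp] that f12' unfolding seg by auto
          have ne2: "z1 kp \<noteq> z2 kp" if "kp \<in> closed_segment (k0 + \<beta>) f2" "kp \<noteq> f2" for kp
            using zeq[of kp] that f12' unfolding seg by auto
          have zc: "continuous_on (closed_segment (k0 - \<beta>) f1) z1" "continuous_on (closed_segment (k0 - \<beta>) f1) z2"
            "continuous_on (closed_segment (k0 + \<beta>) f2) z1" "continuous_on (closed_segment (k0 + \<beta>) f2) z2"
            unfolding seg by (rule continuous_on_subset[OF z(1)] continuous_on_subset[OF z(2)]; simp)+
          have "folded_arc (k0 - \<beta>) f1 (fold_path z1 z2 (k0 - \<beta>) f1)"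
            by (rule fold_path_folded_arc[where ?z1.0 = z1 and ?z2.0 = z2 and kf = f1, OF _ zc(1,2) ends_eq(1) ne1]) (use fJ in auto)
          moreover have "folded_arc (k0 + \<beta>) f2 (fold_path z1 z2 (k0 + \<beta>) f2)"
            by (rule fold_path_folded_arc[where ?z1.0 = z1 and ?z2.0 = z2 and kf = f2, OF _ zc(3,4) ends_eq(2) ne2]) (use fJ in auto)
          moreover have "path_image (fold_path z1 z2 (k0 - \<beta>) f1) \<inter> path_image (fold_path z1 z2 (k0 + \<beta>) f2) = {}"
            unfolding fold_path_image[where ?z1.0 = z1 and ?z2.0 = z2 and kf = f1, OF ends_eq(1)] fold_path_image[where ?z1.0 = z1 and ?z2.0 = z2 and kf = f2, OF ends_eq(2)] seg using f12' by auto
          moreover have "?Z = path_image (fold_path z1 z2 (k0 - \<beta>) f1) \<union> path_image (fold_path z1 z2 (k0 + \<beta>) f2)"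
            unfolding Z fold_path_image[where ?z1.0 = z1 and ?z2.0 = z2 and kf = f1, OF ends_eq(1)] fold_path_image[where ?z1.0 = z1 and ?z2.0 = z2 and kf = f2, OF ends_eq(2)] seg by blast
          ultimately show ?thesis
            unfolding simple_bifurcation_def isola_detachment_def using fJ f12' by blast
        qed
      qed
    qed
    then show ?thesis using e0(1) e1(1) R by (intro exI[of _ "min e0 (min e1 R)"]) auto
  qed
  then show "\<exists>e>0. \<forall>\<beta>. 0 < \<beta> \<and> \<beta> < e --> (\<exists>e2>0. \<forall>\<eta>. \<bar>\<eta>\<bar> < e2 -->
      simple_bifurcation (k0 - \<beta>) (k0 + \<beta>) {(s, kp). s \<in> ?I \<and> kp \<in> {k0-\<beta>..k0+\<beta>} \<and> b \<eta> s kp = 0})"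
    using e(1) by blast
qed

end

section \<open>Trajectories and their linearisation\<close>

lemma solves_zero_const:
  assumes "\<And>u. u \<in> {0..1} ==> (c has_vector_derivative 0) (at u within {0..1 :: real})" "u \<in> {0..1}"
  shows "c u = c 0"
proof -
  have "(c has_derivative (%h. 0)) (at u within {0..1})" if "u \<in> {0..1}" for u
    using assms(1)[OF that] by (simp add: has_vector_derivative_def)
  from has_derivative_zero_constant[OF convex_real_interval(5) this]
  obtain k where "\<And>u. u \<in> {0..1} ==> c u = k" by auto
  then show ?thesis using assms(2) by simp
qed

text \<open>Rescaling time to the unit interval treats positive, negative and zero times alike.\<close>

lemma flows_to_iff_solves:
  "flows_to F D x t y \<longleftrightarrow> (\<exists>X. X 0 = x \<and> X 1 = y \<and> solves (%u w. t *\<^sub>R F (t * u) w) D X)"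
proof
  assume "flows_to F D x t y"
  then obtain Y where Y: "Y 0 = x" "Y t = y"
    "\<And>u. u \<in> closed_segment 0 t ==> Y u \<in> D \<and> (Y has_vector_derivative F u (Y u)) (at u within closed_segment 0 t)"
    unfolding flows_to_def by blast
  have img: "(%u. t * u) ` {0..1} = closed_segment 0 t"
    by (auto simp: closed_segment_def image_iff mult.commute)
  have "solves (%u w. t *\<^sub>R F (t * u) w) D (%u. Y (t * u))"
    unfolding solves_def
  proof (intro ballI conjI)
    fix u :: real assume u: "u \<in> {0..1}"
    then have tu: "t * u \<in> closed_segment 0 t" using img by blast
    then show "Y (t * u) \<in> D" using Y(3) by blast
    have "((%u. t * u) has_vector_derivative t) (at u within {0..1})"
      by (auto intro!: derivative_eq_intros simp flip: has_real_derivative_iff_has_vector_derivative)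
    from vector_diff_chain_within[OF this, of Y "F (t * u) (Y (t * u))"] Y(3)[OF tu]
    show "((%u. Y (t * u)) has_vector_derivative t *\<^sub>R F (t * u) (Y (t * u))) (at u within {0..1})"
      by (simp add: img o_def)
  qed
  then show "\<exists>X. X 0 = x \<and> X 1 = y \<and> solves (%u w. t *\<^sub>R F (t * u) w) D X"
    using Y(1,2) by (intro exI[of _ "%u. Y (t * u)"]) simp
next
  assume "\<exists>X. X 0 = x \<and> X 1 = y \<and> solves (%u w. t *\<^sub>R F (t * u) w) D X"
  then obtain X where X: "X 0 = x" "X 1 = y" "solves (%u w. t *\<^sub>R F (t * u) w) D X" by blast
  show "flows_to F D x t y"
  proof (cases "t = 0")
    case True
    have "X 1 = X 0"
      by (rule solves_zero_const) (use solvesD(2)[OF X(3)] True in auto)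
    moreover have "X 0 \<in> D" using solvesD(1)[OF X(3), of 0] by simp
    ultimately show ?thesis
      unfolding flows_to_def using True X(1,2)
      by (intro exI[of _ "%_. x"])
        (simp add: has_vector_derivative_def has_derivative_def bounded_linear_scaleR_left at_within_def)
  next
    case False
    have img: "(%s. s / t) ` closed_segment 0 t = {0..1}"
    proof -
      have "(%s. s / t) ` closed_segment 0 t = (%s. s / t) ` (%u. t * u) ` {0..1}"
        by (rule arg_cong) (auto simp: closed_segment_def image_iff mult.commute)
      then show ?thesis using False by (simp add: image_image)
    qed
    show ?thesis
      unfolding flows_to_def
    proof (intro exI[of _ "%s. X (s / t)"] conjI ballI)
      show "X (0 / t) = x" "X (t / t) = y" using X False by auto
      fix s assume s: "s \<in> closed_segment 0 t"
      then have st: "s / t \<in> {0..1}" using img by blast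
      then show "X (s / t) \<in> D" by (rule solvesD(1)[OF X(3)])
      have "((%s. s / t) has_vector_derivative 1 / t) (at s within closed_segment 0 t)"
        using False by (auto intro!: derivative_eq_intros simp flip: has_real_derivative_iff_has_vector_derivative)
      moreover have "(X has_vector_derivative t *\<^sub>R F s (X (s / t))) (at (s / t) within (%s. s / t) ` closed_segment 0 t)"
        unfolding img using solvesD(2)[OF X(3) st] False by simp
      ultimately have "((X \<circ> (%s. s / t)) has_vector_derivative (1 / t) *\<^sub>R t *\<^sub>R F s (X (s / t))) (at s within closed_segment 0 t)"
        by (rule vector_diff_chain_within)
      then show "((%s. X (s / t)) has_vector_derivative F s (X (s / t))) (at s within closed_segment 0 t)"
        using False by (simp add: o_def)
    qed
  qed
qed

lemma Ck_on_scaled_field: "open D ==> Ck_on k f D ==> Ck_on k (%w. (c :: real) *\<^sub>R f w) D"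
  by (intro Ck_on_scaleR Ck_on_const)

lemma flows_to_unique:
  assumes "open D" "Ck_on (Suc k) f D" "flows_to (%_. f) D x t y" "flows_to (%_. f) D x t y'"
  shows "y = y'"
proof -
  obtain X Y where X: "X 0 = x" "X 1 = y" "solves (%_ w. t *\<^sub>R f w) D X"
    and Y: "Y 0 = x" "Y 1 = y'" "solves (%_ w. t *\<^sub>R f w) D Y"
    using assms(3,4) unfolding flows_to_iff_solves by blast
  have "X 1 = Y 1"
    by (rule solves_unique[OF assms(1) Ck_on_scaled_field[OF assms(1,2)] X(3) Y(3)]) (use X Y in auto)
  then show ?thesis using X Y by simp
qed

lemma traj_eq:
  assumes "open D" "Ck_on (Suc k) f D" "flows_to (%_. f) D x t y"
  shows "traj f D x t = y"
  unfolding traj_def using assms(3) flows_to_unique[OF assms(1,2) _ assms(3)] by (rule the_equality)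

lemma traj_flows_to:
  assumes "open D" "Ck_on (Suc k) f D" "flows_to (%_. f) D x t y"
  shows "flows_to (%_. f) D x t (traj f D x t)"
  using traj_eq[OF assms] assms(3) by simp

definition orbit_curve :: "('a::real_normed_vector => 'a) => 'a set => (real => 'a) => bool" where
  "orbit_curve f D Z \<longleftrightarrow> (\<forall>t. Z t \<in> D \<and> (Z has_vector_derivative f (Z t)) (at t))"

lemma orbit_curve_flows_to:
  assumes "orbit_curve f D Z"
  shows "flows_to (%_. f) D (Z a) t (Z (a + t))"
  unfolding flows_to_def
proof (intro exI[of _ "%u. Z (a + u)"] conjI ballI)
  fix u
  have 1: "((%u. a + u) has_vector_derivative 1) (at u)"
    by (auto intro!: derivative_eq_intros simp flip: has_real_derivative_iff_has_vector_derivative)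
  have "(Z has_vector_derivative f (Z (a + u))) (at (a + u))" using assms by (simp add: orbit_curve_def)
  from vector_diff_chain_at[OF 1 this]
  have "((%u. Z (a + u)) has_vector_derivative f (Z (a + u))) (at u)" by (simp add: o_def)
  then show "((%u. Z (a + u)) has_vector_derivative f (Z (a + u))) (at u within closed_segment 0 t)"
    by (rule has_vector_derivative_at_within)
  show "Z (a + u) \<in> D" using assms by (simp add: orbit_curve_def)
qed auto

lemma orbit_curve_shift: "orbit_curve f D Z ==> orbit_curve f D (%t. Z (a + t))"
  unfolding orbit_curve_def
proof (intro allI conjI)
  fix t assume Z: "\<forall>t. Z t \<in> D \<and> (Z has_vector_derivative f (Z t)) (at t)"
  then show "Z (a + t) \<in> D" by blast
  have 1: "((%u. a + u) has_vector_derivative 1) (at t)"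
    by (auto intro!: derivative_eq_intros simp flip: has_real_derivative_iff_has_vector_derivative)
  have "(Z has_vector_derivative f (Z (a + t))) (at (a + t))" using Z by blast
  from vector_diff_chain_at[OF 1 this]
  show "((%u. Z (a + u)) has_vector_derivative f (Z (a + t))) (at t)" by (simp add: o_def)
qed

lemma glue_solutions:
  fixes x y :: "real => 'a::real_normed_vector"
  assumes "a \<le> b" "b \<le> c" "x b = y b"
    and x: "\<And>u. u \<in> {a..b} ==> (x has_vector_derivative f (x u)) (at u within {a..b})"
    and y: "\<And>u. u \<in> {b..c} ==> (y has_vector_derivative f (y u)) (at u within {b..c})"
    and u: "u \<in> {a..c}"
  defines "w \<equiv> %u. if u \<in> {a..b} then x u else y u"
  shows "(w has_vector_derivative f (w u)) (at u within {a..c})"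
proof -
  have cl: "closure {a..b} \<inter> closure {b..c} = {b}" using assms(1,2) by auto
  have S: "{a..b} \<union> {b} = {a..b}" "{b..c} \<union> {b} = {b..c}" using assms(1,2) by auto
  have "((%u. if u \<in> {a..b} then x u else y u) has_vector_derivative
      (if u \<in> {a..b} then f (x u) else f (y u))) (at u within {a..c})"
  proof (rule has_vector_derivative_If_within_closures[where S = "{a..b}" and T = "{b..c}"])
    show "u \<in> {a..b} \<union> {b..c}" "{a..c} = {a..b} \<union> {b..c}" using u assms(1,2) by auto
    show "(x has_vector_derivative f (x u)) (at u within {a..b} \<union> closure {a..b} \<inter> closure {b..c})"
      if "u \<in> {a..b} \<union> closure {a..b} \<inter> closure {b..c}"
      using x that unfolding cl S by blast
    show "(y has_vector_derivative f (y u)) (at u within {b..c} \<union> closure {a..b} \<inter> closure {b..c})"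
      if "u \<in> {b..c} \<union> closure {a..b} \<inter> closure {b..c}"
      using y that unfolding cl S by blast
    assume "u \<in> closure {a..b}" "u \<in> closure {b..c}"
    then have "u = b" using cl by blast
    then show "x u = y u" "f (x u) = f (y u)" using assms(3) by auto
  qed
  then show ?thesis unfolding w_def by (simp add: if_distrib)
qed

lemma flows_to_trans:
  assumes "flows_to (%_. f) D x s y" "flows_to (%_. f) D y t z" "0 \<le> s" "0 \<le> t"
  shows "flows_to (%_. f) D x (s + t) z"
proof -
  have seg: "closed_segment 0 s = {0..s}" "closed_segment 0 t = {0..t}" "closed_segment 0 (s + t) = {0..s + t}"
    using assms(3,4) by (simp_all add: closed_segment_eq_real_ivl)
  obtain X where X: "X 0 = x" "X s = y" "\<And>u. u \<in> {0..s} ==> X u \<in> D \<and> (X has_vector_derivative f (X u)) (at u within {0..s})"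
    using assms(1) unfolding flows_to_def seg by blast
  obtain Y where Y: "Y 0 = y" "Y t = z" "\<And>u. u \<in> {0..t} ==> Y u \<in> D \<and> (Y has_vector_derivative f (Y u)) (at u within {0..t})"
    using assms(2) unfolding flows_to_def seg by blast
  let ?Y = "%u. Y (u - s)"
  let ?w = "%u. if u \<in> {0..s} then X u else ?Y u"
  have dY: "(?Y has_vector_derivative f (?Y u)) (at u within {s..s + t})" if "u \<in> {s..s + t}" for u
  proof -
    have img: "(%u. u - s) ` {s..s + t} = {0..t}"
    proof -
      have "(%u. u - s) = (+) (- s)" by auto
      then show ?thesis by (simp add: image_add_atLeastAtMost)
    qed
    have 1: "((%u. u - s) has_vector_derivative 1) (at u within {s..s + t})"
      by (auto intro!: derivative_eq_intros simp flip: has_real_derivative_iff_has_vector_derivative)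
    have "(Y has_vector_derivative f (Y (u - s))) (at (u - s) within (%u. u - s) ` {s..s + t})"
      unfolding img using Y(3)[of "u - s"] that by auto
    from vector_diff_chain_within[OF 1 this] show ?thesis by (simp add: o_def)
  qed
  have dX: "(X has_vector_derivative f (X u)) (at u within {0..s})" if "u \<in> {0..s}" for u
    using X(3)[OF that] by (rule conjunct2)
  have dw: "(?w has_vector_derivative f (?w u)) (at u within {0..s + t})" if "u \<in> {0..s + t}" for u
    by (rule glue_solutions[where b = s, OF assms(3) _ _ dX dY that]) (simp_all add: assms(4) X(2) Y(1))
  have "X u \<in> D" if "u \<in> {0..s}" for u using X(3)[OF that] by blast
  moreover have "?Y u \<in> D" if "u \<in> {0..s + t}" "u \<notin> {0..s}" for u using Y(3)[of "u - s"] that by auto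
  moreover have "?w (s + t) = z" using X(2) Y(1,2) assms(3,4) by auto
  ultimately show ?thesis
    unfolding flows_to_def seg using dw X(1) assms(3) by (intro exI[of _ ?w]) auto
qed

lemma flows_to_reverse:
  assumes "flows_to (%_. f) D x t y"
  shows "flows_to (%_. f) D y (- t) x"
proof -
  obtain X where X: "X 0 = x" "X 1 = y" "solves (%u w. t *\<^sub>R f w) D X"
    using assms unfolding flows_to_iff_solves by blast
  have img: "(%u. 1 - u) ` {0..1} = {0..1 :: real}"
    using image_diff_atLeastAtMost[of 1 0 "1 :: real"] by simp
  have "solves (%u w. (- t) *\<^sub>R f w) D (%u. X (1 - u))"
    unfolding solves_def
  proof (intro ballI conjI)
    fix u :: real assume u: "u \<in> {0..1}"
    then have u1: "1 - u \<in> {0..1}" by simp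
    show "X (1 - u) \<in> D" by (rule solvesD(1)[OF X(3) u1])
    have 1: "((%u. 1 - u) has_vector_derivative -1) (at u within {0..1})"
      by (auto intro!: derivative_eq_intros simp flip: has_real_derivative_iff_has_vector_derivative)
    have "(X has_vector_derivative t *\<^sub>R f (X (1 - u))) (at (1 - u) within (%u. 1 - u) ` {0..1})"
      unfolding img by (rule solvesD(2)[OF X(3) u1])
    from vector_diff_chain_within[OF 1 this]
    show "((%u. X (1 - u)) has_vector_derivative (- t) *\<^sub>R f (X (1 - u))) (at u within {0..1})"
      by (simp add: o_def)
  qed
  then show ?thesis unfolding flows_to_iff_solves using X(1,2) by (intro exI[of _ "%u. X (1 - u)"]) simp
qed

text \<open>The solution over one period is continued periodically; at the seam both one-sided derivatives are
  given by the field at the base point.\<close>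

lemma periodic_orbit_curve:
  assumes "periodic_orbit f D p \<tau>"
  obtains Z where "orbit_curve f D Z" "Z 0 = p" "\<And>t. Z (t + \<tau>) = Z t"
proof -
  have \<tau>: "0 < \<tau>" and "flows_to (%_. f) D p \<tau> p" using assms by (auto simp: periodic_orbit_def)
  then obtain x where x: "x 0 = p" "x \<tau> = p"
    "\<And>u. u \<in> {0..\<tau>} ==> x u \<in> D \<and> (x has_vector_derivative f (x u)) (at u within {0..\<tau>})"
    unfolding flows_to_def by (auto simp: closed_segment_eq_real_ivl)
  define y where "y u = (if u \<in> {-\<tau>..0} then x (u + \<tau>) else x u)" for u
  have dy: "(y has_vector_derivative f (y u)) (at u)" if u: "u \<in> {-\<tau><..<\<tau>}" for u
  proof -
    have dx: "((%u. x (u + \<tau>)) has_vector_derivative f (x (u + \<tau>))) (at u within {-\<tau>..0})"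
      if "u \<in> {-\<tau>..0}" for u
    proof -
      have "(%u. u + \<tau>) = (+) \<tau>" by auto
      then have img: "(%u. u + \<tau>) ` {-\<tau>..0} = {0..\<tau>}" by (simp add: image_add_atLeastAtMost)
      have 1: "((%u. u + \<tau>) has_vector_derivative 1) (at u within {-\<tau>..0})"
        by (auto intro!: derivative_eq_intros simp flip: has_real_derivative_iff_has_vector_derivative)
      have "(x has_vector_derivative f (x (u + \<tau>))) (at (u + \<tau>) within (%u. u + \<tau>) ` {-\<tau>..0})"
        unfolding img using x(3)[of "u + \<tau>"] that by auto
      from vector_diff_chain_within[OF 1 this] show ?thesis by (simp add: o_def)
    qed
    have "(y has_vector_derivative f (y u)) (at u within {-\<tau>..\<tau>})"
      unfolding y_def[abs_def]
    proof (rule glue_solutions[OF _ _ _ dx])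
      show "(x has_vector_derivative f (x u)) (at u within {0..\<tau>})" if "u \<in> {0..\<tau>}" for u
        using x(3)[OF that] by (rule conjunct2)
    qed (use \<tau> x(1,2) u in simp_all)
    then show ?thesis using u at_within_interior[of u "{-\<tau>..\<tau>}"] by simp
  qed
  define Z where "Z t = x (t - \<tau> * \<lfloor>t / \<tau>\<rfloor>)" for t
  have frac: "t - \<tau> * \<lfloor>t / \<tau>\<rfloor> \<in> {0..<\<tau>}" for t
  proof -
    have "real_of_int \<lfloor>t / \<tau>\<rfloor> \<le> t / \<tau>" "t / \<tau> < real_of_int \<lfloor>t / \<tau>\<rfloor> + 1" by linarith+
    then have "\<lfloor>t / \<tau>\<rfloor> * \<tau> \<le> t" "t < (\<lfloor>t / \<tau>\<rfloor> + 1) * \<tau>"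
      using \<tau> by (simp_all only: pos_le_divide_eq pos_divide_less_eq of_int_add of_int_1)
    then show ?thesis by (simp add: algebra_simps)
  qed
  have Zy: "Z t = y (t - \<tau> * k)" if h: "t - \<tau> * of_int k \<in> {-\<tau><..<\<tau>}" for t k
  proof (cases "t - \<tau> * of_int k < 0")
    case True
    have "\<lfloor>t / \<tau>\<rfloor> = k - 1" using h True \<tau> by (intro floor_unique) (auto simp: field_simps)
    then have "t - \<tau> * \<lfloor>t / \<tau>\<rfloor> = t - \<tau> * k + \<tau>" by (simp add: \<open>\<lfloor>t / \<tau>\<rfloor> = k - 1\<close> algebra_simps)
    from arg_cong[OF this, of x] show ?thesis using True h unfolding Z_def y_def by simp
  next
    case False
    have "\<lfloor>t / \<tau>\<rfloor> = k" using h False \<tau> by (intro floor_unique) (auto simp: field_simps)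
    then show ?thesis using False x(1,2) by (auto simp: Z_def y_def)
  qed
  have "orbit_curve f D Z"
    unfolding orbit_curve_def
  proof (intro allI conjI)
    fix t
    show "Z t \<in> D" unfolding Z_def using x(3) frac[of t] by auto
    let ?k = "\<lfloor>t / \<tau>\<rfloor>"
    have in_ivl: "t - \<tau> * ?k \<in> {-\<tau><..<\<tau>}" using frac[of t] \<tau> by auto
    have 1: "((%t. t - \<tau> * ?k) has_vector_derivative 1) (at t)"
      by (auto intro!: derivative_eq_intros simp flip: has_real_derivative_iff_has_vector_derivative)
    from vector_diff_chain_at[OF 1 dy[OF in_ivl]]
    have d: "((%t. y (t - \<tau> * ?k)) has_vector_derivative f (y (t - \<tau> * ?k))) (at t)" by (simp add: o_def)
    have "(Z has_vector_derivative f (y (t - \<tau> * ?k))) (at t)"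
    proof (rule has_vector_derivative_transform_within_open[OF d])
      show "open {\<tau> * ?k - \<tau><..<\<tau> * ?k + \<tau>}" by simp
      show "t \<in> {\<tau> * ?k - \<tau><..<\<tau> * ?k + \<tau>}" using in_ivl by auto
      show "y (s - \<tau> * ?k) = Z s" if "s \<in> {\<tau> * ?k - \<tau><..<\<tau> * ?k + \<tau>}" for s
        using Zy[of s ?k] that by auto
    qed
    then show "(Z has_vector_derivative f (Z t)) (at t)" using Zy[OF in_ivl] by simp
  qed
  moreover have "Z 0 = p" by (simp add: Z_def x(1))
  moreover have "Z (t + \<tau>) = Z t" for t
  proof -
    have "(t + \<tau>) / \<tau> = t / \<tau> + 1" using \<tau> by (simp add: field_simps)
    then have "\<lfloor>(t + \<tau>) / \<tau>\<rfloor> = \<lfloor>t / \<tau>\<rfloor> + 1" by simp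
    then show ?thesis by (simp add: Z_def algebra_simps)
  qed
  ultimately show thesis by (rule that)
qed

lemma periodic_multiple:
  fixes Z :: "real => 'a"
  assumes "\<And>t. Z (t + \<tau>) = Z t"
  shows "Z (t + real k * \<tau>) = Z t"
proof (induction k)
  case (Suc k)
  have "Z (t + real (Suc k) * \<tau>) = Z (t + real k * \<tau> + \<tau>)" by (simp add: algebra_simps)
  then show ?case using assms Suc by simp
qed simp

text \<open>The dependence on time and on a parameter is reduced to that on the initial condition by
  making both part of the state.\<close>

theorem traj_C2:
  fixes f :: "real => 'a::euclidean_space => 'a"
  assumes K: "open K" and D: "open D" and f: "Ck_on 2 (%(kp, x). f kp x) (K \<times> D)"
  defines "\<Omega> \<equiv> {(kp, t, x). kp \<in> K \<and> (\<exists>y. flows_to (%_. f kp) D x t y)}"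
  shows "open \<Omega>" and "Ck_on 2 (%(kp, t, x). traj (f kp) D x t) \<Omega>"
    and "\<And>kp t k X \<psi>. kp \<in> K ==> solves (%_ w. t *\<^sub>R f kp w) D X ==>
      solves (%u v. t *\<^sub>R frechet_derivative (f kp) (at (X u)) v + k *\<^sub>R f kp (X u)) UNIV \<psi> ==>
      frechet_derivative (%(t, x). traj (f kp) D x t) (at (t, X 0)) (k, \<psi> 0) = \<psi> 1"
proof -
  let ?W = "K \<times> (UNIV :: real set) \<times> D"
  define F where "F = (%(kp :: real, t :: real, x). (0 :: real, 0 :: real, t *\<^sub>R f kp x))"
  have W: "open ?W" and KD: "open (K \<times> D)" using K D by (auto intro!: open_Times)
  have f1: "Ck_on (Suc 0) (%(kp, x). f kp x) (K \<times> D)" using f unfolding numeral_2_eq_2 by (rule Ck_on_SucD)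
  have slice: "Ck_on k (f kp) D" if "Ck_on k (%(kp, x). f kp x) (K \<times> D)" "kp \<in> K" for k kp
  proof -
    have "Ck_on k (%x. (kp, x)) D" by (rule Ck_on_Pair[OF D Ck_on_const[OF D] Ck_on_ident[OF D]])
    from Ck_on_compose[OF D _ that(1) this] show ?thesis using that(2) by auto
  qed
  have "Ck_on 2 (%w. (fst w, snd (snd w))) ?W"
    by (intro Ck_on_Pair Ck_on_fst Ck_on_snd Ck_on_ident W)
  from Ck_on_compose[OF W _ f this] have "Ck_on 2 (%w. f (fst w) (snd (snd w))) ?W" by fastforce
  then have "Ck_on 2 (%w. (0 :: real, 0 :: real, fst (snd w) *\<^sub>R f (fst w) (snd (snd w)))) ?W"
    by (intro Ck_on_Pair Ck_on_const Ck_on_scaleR Ck_on_fst Ck_on_snd Ck_on_ident W)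
  then have F: "Ck_on 2 F ?W" by (simp add: F_def split_beta')
  then have F1: "Ck_on (Suc 0) F ?W" unfolding numeral_2_eq_2 by (rule Ck_on_SucD)
  have lift: "solves (%_. F) ?W (%u. (kp, t, X u))" if "kp \<in> K" "solves (%_ w. t *\<^sub>R f kp w) D X" for kp t X
    using that unfolding solves_def F_def
    by (auto intro!: has_vector_derivative_Pair has_vector_derivative_const)
  have unlift: "kp \<in> K \<and> solves (%_ w. t *\<^sub>R f kp w) D (%u. snd (snd (w u)))"
    if w: "solves (%_. F) ?W w" "w 0 = (kp, t, x)" for w kp t x
  proof -
    have d: "(w has_vector_derivative (0, 0, fst (snd (w u)) *\<^sub>R f (fst (w u)) (snd (snd (w u))))) (at u within {0..1})"
      if "u \<in> {0..1}" for u using solvesD(2)[OF w(1) that] by (simp add: F_def split_beta')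
    note d1 = bounded_linear.has_vector_derivative[OF bounded_linear_fst d]
    note d2 = bounded_linear.has_vector_derivative[OF bounded_linear_snd d]
    note d3 = bounded_linear.has_vector_derivative[OF bounded_linear_fst d2]
    note d4 = bounded_linear.has_vector_derivative[OF bounded_linear_snd d2]
    have 1: "fst (w u) = kp" if "u \<in> {0..1}" for u
      using solves_zero_const[OF _ that, of "%u. fst (w u)"] d1 w(2) by simp
    have 2: "fst (snd (w u)) = t" if "u \<in> {0..1}" for u
      using solves_zero_const[OF _ that, of "%u. fst (snd (w u))"] d3 w(2) by simp
    have "w 0 \<in> ?W" by (rule solvesD(1)[OF w(1)]) simp
    then have "kp \<in> K" using w(2) by simp
    moreover have "snd (snd (w u)) \<in> D" if "u \<in> {0..1}" for u
      using solvesD(1)[OF w(1) that] by (auto simp: mem_Times_iff)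
    ultimately show ?thesis using d4 1 2 by (simp add: solves_def)
  qed
  have reach: "\<Omega> = reach F ?W"
  proof (intro equalityI subsetI)
    fix w assume "w \<in> \<Omega>"
    then obtain kp t x y where w: "w = (kp, t, x)" "kp \<in> K" "flows_to (%_. f kp) D x t y" by (auto simp: \<Omega>_def)
    then obtain X where "X 0 = x" "solves (%_ w. t *\<^sub>R f kp w) D X" unfolding flows_to_iff_solves by blast
    then show "w \<in> reach F ?W" using lift[OF w(2)] w(1) unfolding reach_def by force
  next
    fix w assume "w \<in> reach F ?W"
    then obtain Y where Y: "Y 0 = w" "solves (%_. F) ?W Y" unfolding reach_def by blast
    obtain kp t x where w: "w = (kp, t, x)" by (metis prod_cases3)
    have "kp \<in> K" "solves (%_ w. t *\<^sub>R f kp w) D (%u. snd (snd (Y u)))" using unlift[OF Y(2)] Y(1) w by blast+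
    then have "flows_to (%_. f kp) D x t (snd (snd (Y 1)))"
      unfolding flows_to_iff_solves using Y(1) w by (intro exI[of _ "%u. snd (snd (Y u))"]) simp
    then show "w \<in> \<Omega>" using w \<open>kp \<in> K\<close> by (auto simp: \<Omega>_def)
  qed
  have flow: "flow1 F ?W (kp, t, x) = (kp, t, traj (f kp) D x t)" if w: "(kp, t, x) \<in> \<Omega>" for kp t x
  proof -
    obtain y where k: "kp \<in> K" and y: "flows_to (%_. f kp) D x t y" using w by (auto simp: \<Omega>_def)
    then obtain X where X: "X 0 = x" "X 1 = y" "solves (%_ w. t *\<^sub>R f kp w) D X" unfolding flows_to_iff_solves by blast
    have "flow1 F ?W (kp, t, X 0) = (kp, t, X 1)"
      using flow1_eq[OF W F1 lift[OF k X(3)]] by simp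
    then show ?thesis using X traj_eq[OF D slice[OF f1 k] y] by simp
  qed
  show op: "open \<Omega>" unfolding reach by (rule flow1_C1(1)[OF W F1])
  have "Ck_on 2 (%w. snd (snd (flow1 F ?W w))) \<Omega>"
    using flow1_C2[OF W F] op unfolding reach by (intro Ck_on_snd)
  then show "Ck_on 2 (%(kp, t, x). traj (f kp) D x t) \<Omega>"
    by (subst Ck_on_cong[where g = "%w. snd (snd (flow1 F ?W w))"]) (auto simp: flow)
  fix kp t k X \<psi>
  assume k: "kp \<in> K" and X: "solves (%_ w. t *\<^sub>R f kp w) D X"
    and \<psi>: "solves (%u v. t *\<^sub>R frechet_derivative (f kp) (at (X u)) v + k *\<^sub>R f kp (X u)) UNIV \<psi>"
  have dF: "frechet_derivative F (at (kp, t, x)) (0, k, v) = (0, 0, t *\<^sub>R frechet_derivative (f kp) (at x) v + k *\<^sub>R f kp x)"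
    if x: "x \<in> D" for x v
  proof -
    have "(F has_derivative frechet_derivative F (at (kp, t, x))) (at (kp, t, x))"
      by (rule Ck_on_has_derivative_open[OF F1 W]) (use k x in auto)
    moreover have "((%(t, x). (kp, t, x)) has_derivative (%(k, v). (0, k, v))) (at (t, x))"
      by (auto simp: split_beta' intro!: derivative_eq_intros)
    ultimately have 1: "((%p. F (kp, p)) has_derivative (%p. frechet_derivative F (at (kp, t, x)) (0, p))) (at (t, x))"
      using has_derivative_compose[of "%(t, x). (kp, t, x)" "%(k, v). (0, k, v)" "(t, x)" UNIV F] by (simp add: split_beta')
    have dfx: "(f kp has_derivative frechet_derivative (f kp) (at x)) (at x)"
      by (rule Ck_on_has_derivative_open[OF slice[OF f1 k] D x])
    have s: "(snd has_derivative snd) (at (t, x))" by (rule has_derivative_snd[OF has_derivative_ident])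
    have "((%p. f kp (snd p)) has_derivative (%p. frechet_derivative (f kp) (at x) (snd p))) (at (t, x))"
      using has_derivative_compose[OF s, of "f kp"] dfx by simp
    then have "((%p. fst p *\<^sub>R f kp (snd p)) has_derivative
        (%p. t *\<^sub>R frechet_derivative (f kp) (at x) (snd p) + fst p *\<^sub>R f kp x)) (at (t, x))"
      using has_derivative_scaleR[OF has_derivative_fst[OF has_derivative_ident]] by fastforce
    then have "((%p. F (kp, p)) has_derivative
        (%p. (0, 0, t *\<^sub>R frechet_derivative (f kp) (at x) (snd p) + fst p *\<^sub>R f kp x))) (at (t, x))"
      unfolding F_def split_beta' fst_conv snd_conv by (intro has_derivative_Pair has_derivative_const)
    from fun_cong[OF has_derivative_unique[OF 1 this], of "(k, v)"] show ?thesis by simp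
  qed
  have "solves (%u. frechet_derivative F (at (kp, t, X u))) UNIV (%u. (0, k, \<psi> u))"
    unfolding solves_def
  proof (intro ballI conjI UNIV_I)
    fix u :: real assume u: "u \<in> {0..1}"
    show "((%u. (0, k, \<psi> u)) has_vector_derivative
        frechet_derivative F (at (kp, t, X u)) (0, k, \<psi> u)) (at u within {0..1})"
      unfolding dF[OF solvesD(1)[OF X u]]
      by (rule has_vector_derivative_Pair[OF has_vector_derivative_const
            has_vector_derivative_Pair[OF has_vector_derivative_const solvesD(2)[OF \<psi> u]]])
  qed
  from flow1_C1(3)[OF W F1 lift[OF k X] this]
  have fl: "frechet_derivative (flow1 F ?W) (at (kp, t, X 0)) (0, k, \<psi> 0) = (0, k, \<psi> 1)" .
  have in\<Omega>: "(kp, t, X 0) \<in> \<Omega>"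
    using k X unfolding \<Omega>_def flows_to_iff_solves by auto
  have "(flow1 F ?W has_derivative frechet_derivative (flow1 F ?W) (at (kp, t, X 0))) (at (kp, t, X 0))"
    by (rule Ck_on_has_derivative_open[OF flow1_C1(2)[OF W F1]]) (use op in\<Omega> reach in auto)
  moreover have "((%p. (kp, p)) has_derivative (%p. (0, p))) (at (t, X 0))"
    by (auto intro!: derivative_eq_intros)
  ultimately have "((%p. flow1 F ?W (kp, p)) has_derivative
      (%p. frechet_derivative (flow1 F ?W) (at (kp, t, X 0)) (0, p))) (at (t, X 0))"
    using has_derivative_compose[of "%p. (kp, p)" "%p. (0, p)" "(t, X 0)" UNIV "flow1 F ?W"] by simp
  from has_derivative_snd[OF has_derivative_snd[OF this]]
  have d: "((%p. snd (snd (flow1 F ?W (kp, p)))) has_derivative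
      (%p. snd (snd (frechet_derivative (flow1 F ?W) (at (kp, t, X 0)) (0, p))))) (at (t, X 0))" .
  have "((%(t, x). traj (f kp) D x t) has_derivative
      (%p. snd (snd (frechet_derivative (flow1 F ?W) (at (kp, t, X 0)) (0, p))))) (at (t, X 0))"
  proof (rule has_derivative_transform_within_open[OF d])
    show "open (Pair kp -` \<Omega>)" by (rule open_vimage[OF op]) (auto intro!: continuous_intros)
    show "(t, X 0) \<in> Pair kp -` \<Omega>" using in\<Omega> by simp
    show "snd (snd (flow1 F ?W (kp, p))) = (case p of (t, x) => traj (f kp) D x t)" if "p \<in> Pair kp -` \<Omega>" for p
      using that flow by (cases p) simp
  qed
  from frechet_derivative_at[OF this] fl
  show "frechet_derivative (%(t, x). traj (f kp) D x t) (at (t, X 0)) (k, \<psi> 0) = \<psi> 1"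
    by (metis snd_conv)
qed

section \<open>m-normality and nondegeneracy\<close>

text \<open>If the kernel of \<open>P - I\<close> is a line, it is spanned by the field; if it is a plane and the field is not
  in the range of \<open>P - I\<close>, no change of the period is possible. In both cases the solutions of the
  linearised return condition are spanned by the field and the tangent of the family, and \<open>\<phi>\<close>, the
  derivative of the parametrisation, excludes the latter.\<close>

lemma m_normal_kernel:
  fixes P :: "'a::euclidean_space => 'a" and \<phi> :: "'a \<times> real => real"
  assumes P: "linear P" and \<phi>: "linear \<phi>"
    and f0: "f0 \<noteq> 0" "P f0 = f0" "\<phi> (f0, 0) = 0"
    and d1: "P d1 + l1 *\<^sub>R f0 = d1" "\<phi> (d1, l1) = 1"
    and normal: "dim {v. P v = v} = 1 \<or> dim {v. P v = v} = 2 \<and> f0 \<notin> range (%v. P v - v)"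
    and e: "P e + k *\<^sub>R f0 = e" "\<phi> (e, k) = 0"
  shows "k = 0 \<and> (\<exists>c. e = c *\<^sub>R f0)"
proof -
  have \<phi>c: "\<phi> (c *\<^sub>R f0, 0) = 0" for c
    using linear_cmul[OF \<phi>, of c "(f0, 0)"] f0(3) by simp
  from normal show ?thesis
  proof
    assume dim1: "dim {v. P v = v} = 1"
    have ker: "\<exists>c. v = c *\<^sub>R f0" if "P v = v" for v
    proof -
      have "{v. P v = v} \<subseteq> span {f0}"
        by (rule card_ge_dim_independent) (use f0 dim1 in auto)
      then show ?thesis using that by (auto simp: span_singleton)
    qed
    have l1: "l1 \<noteq> 0"
    proof
      assume "l1 = 0"
      then obtain c where "d1 = c *\<^sub>R f0" using ker[of d1] d1(1) by auto
      then show False using \<phi>c[of c] d1(2) \<open>l1 = 0\<close> by simp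
    qed
    define v where "v = e - (k / l1) *\<^sub>R d1"
    have "P v = P e - (k / l1) *\<^sub>R P d1" by (simp add: v_def linear_diff[OF P] linear_cmul[OF P])
    also have "\<dots> = (e - k *\<^sub>R f0) - (k / l1) *\<^sub>R (d1 - l1 *\<^sub>R f0)"
      using e(1) d1(1) by (metis add_diff_cancel_right')
    also have "\<dots> = v" using l1 by (simp add: v_def algebra_simps)
    finally obtain c where c: "v = c *\<^sub>R f0" using ker by blast
    have "(e, k) = (v, 0) + (k / l1) *\<^sub>R (d1, l1)" using l1 by (simp add: v_def)
    then have "\<phi> (e, k) = \<phi> (v, 0) + (k / l1) *\<^sub>R \<phi> (d1, l1)"
      by (simp only: linear_add[OF \<phi>] linear_cmul[OF \<phi>])
    then have "k = 0" using \<phi>c[of c] c e(2) d1(2) l1 by simp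
    then show ?thesis using c by (auto simp: v_def)
  next
    assume *: "dim {v. P v = v} = 2 \<and> f0 \<notin> range (%v. P v - v)"
    have no_coeff: "k = 0" if "P v + k *\<^sub>R f0 = v" for v k
    proof (rule ccontr)
      assume k: "k \<noteq> 0"
      have "P ((- 1 / k) *\<^sub>R v) - (- 1 / k) *\<^sub>R v = (- 1 / k) *\<^sub>R (P v - v)"
        by (simp add: linear_cmul[OF P] linear_neg[OF P] scaleR_diff_right)
      also have "P v - v = - (k *\<^sub>R f0)" using that by (metis add_diff_cancel_left' minus_diff_eq)
      finally have "P ((- 1 / k) *\<^sub>R v) - (- 1 / k) *\<^sub>R v = f0" using k by simp
      from sym[OF this] have "f0 \<in> range (%v. P v - v)" by (rule range_eqI)
      then show False using * by blast
    qed
    have l1: "l1 = 0" by (rule no_coeff[OF d1(1)])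
    have k: "k = 0" by (rule no_coeff[OF e(1)])
    have dne: "d1 \<notin> span {f0}"
    proof
      assume "d1 \<in> span {f0}"
      then obtain c where "d1 = c *\<^sub>R f0" by (auto simp: span_singleton)
      then show False using \<phi>c[of c] d1(2) l1 by simp
    qed
    have "{v. P v = v} \<subseteq> span {d1, f0}"
    proof (rule card_ge_dim_independent)
      show "independent {d1, f0}" using dne f0(1) by (simp add: independent_insert)
      have "d1 \<noteq> f0" using dne by (metis insertI1 span_base)
      then show "dim {v. P v = v} \<le> card {d1, f0}" using * by simp
    qed (use d1(1) l1 f0(2) in auto)
    then have "e \<in> span {d1, f0}" using e(1) k by auto
    then obtain a c where ac: "e - a *\<^sub>R d1 = c *\<^sub>R f0" by (auto simp: span_insert span_singleton)
    have "(e, k) = (c *\<^sub>R f0, 0) + a *\<^sub>R (d1, l1)" using ac k l1 by (simp add: algebra_simps)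
    then have "\<phi> (e, k) = \<phi> (c *\<^sub>R f0, 0) + a *\<^sub>R \<phi> (d1, l1)"
      by (simp only: linear_add[OF \<phi>] linear_cmul[OF \<phi>])
    then have "a = 0" using \<phi>c[of c] e(2) d1(2) by simp
    then show ?thesis using ac k by auto
  qed
qed

locale smooth_flow =
  fixes K :: "real set" and D :: "'a::euclidean_space set" and f :: "real => 'a => 'a"
  assumes K: "open K" and D: "open D" and f_C2: "Ck_on 2 (%(kp, x). f kp x) (K \<times> D)"
begin

lemma f_slice_C1:
  assumes "kp \<in> K"
  shows "Ck_on (Suc 0) (f kp) D"
proof -
  have f1: "Ck_on (Suc 0) (%(kp, x). f kp x) (K \<times> D)" using f_C2 unfolding numeral_2_eq_2 by (rule Ck_on_SucD)
  have "Ck_on (Suc 0) (%x. (kp, x)) D" by (rule Ck_on_Pair[OF D Ck_on_const[OF D] Ck_on_ident[OF D]])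
  from Ck_on_compose[OF D _ f1 this] show ?thesis using assms by auto
qed

definition \<Omega> where "\<Omega> = {(kp, t, x). kp \<in> K \<and> (\<exists>y. flows_to (%_. f kp) D x t y)}"

lemma open_\<Omega>: "open \<Omega>"
  unfolding \<Omega>_def by (rule traj_C2(1)[OF K D f_C2])

lemma traj_C2_\<Omega>: "Ck_on 2 (%(kp, t, x). traj (f kp) D x t) \<Omega>"
  unfolding \<Omega>_def by (rule traj_C2(2)[OF K D f_C2])

lemma traj_flows: "(kp, t, x) \<in> \<Omega> ==> flows_to (%_. f kp) D x t (traj (f kp) D x t)"
  using traj_flows_to[OF D f_slice_C1] unfolding \<Omega>_def by blast

lemma flows_traj: "kp \<in> K ==> flows_to (%_. f kp) D x t y ==> traj (f kp) D x t = y \<and> (kp, t, x) \<in> \<Omega>"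
  using traj_eq[OF D f_slice_C1] unfolding \<Omega>_def by blast

lemma orbit_traj: "kp \<in> K ==> orbit_curve (f kp) D Z ==> traj (f kp) D (Z a) t = Z (a + t) \<and> (kp, t, Z a) \<in> \<Omega>"
  using flows_traj[OF _ orbit_curve_flows_to] by blast

definition dtraj where "dtraj kp t x = frechet_derivative (%(t, x). traj (f kp) D x t) (at (t, x))"

lemma dtraj:
  assumes "(kp, t, x) \<in> \<Omega>"
  shows "((%(t, x). traj (f kp) D x t) has_derivative dtraj kp t x) (at (t, x))"
proof -
  have "((%(kp, t, x). traj (f kp) D x t) has_derivative frechet_derivative (%(kp, t, x). traj (f kp) D x t) (at (kp, t, x))) (at (kp, t, x))"
    using traj_C2_\<Omega> unfolding numeral_2_eq_2 by (rule Ck_on_has_derivative_open[OF _ open_\<Omega> assms])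
  moreover have "((%p. (kp, p)) has_derivative (%p. (0, p))) (at (t, x))" by (auto intro!: derivative_eq_intros)
  ultimately have "((%(t, x). traj (f kp) D x t) has_derivative
      (%p. frechet_derivative (%(kp, t, x). traj (f kp) D x t) (at (kp, t, x)) (0, p))) (at (t, x))"
    using has_derivative_compose[of "%p. (kp, p)" "%p. (0, p)" "(t, x)" UNIV "%(kp, t, x). traj (f kp) D x t"]
    by (simp add: split_beta')
  then show ?thesis unfolding dtraj_def using frechet_derivative_at by metis
qed

lemma dtraj_linear: "(kp, t, x) \<in> \<Omega> ==> linear (dtraj kp t x)"
  using dtraj has_derivative_linear by blast

lemma dtraj_space:
  assumes "(kp, t, x) \<in> \<Omega>"
  shows "((%x. traj (f kp) D x t) has_derivative (%h. dtraj kp t x (0, h))) (at x)"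
proof -
  have "((%x. (t, x)) has_derivative (%h. (0, h))) (at x)" by (auto intro!: derivative_eq_intros)
  from has_derivative_compose[OF this dtraj[OF assms]] show ?thesis by simp
qed

context
  fixes kp :: real and Z :: "real => 'a"
  assumes kp: "kp \<in> K" and Z: "orbit_curve (f kp) D Z"
begin

lemma in_\<Omega>: "(kp, t, Z a) \<in> \<Omega>"
  using orbit_traj[OF kp Z] by blast

lemma dtraj_time: "dtraj kp t (Z a) (k, h) = k *\<^sub>R f kp (Z (a + t)) + dtraj kp t (Z a) (0, h)"
proof -
  have "((%t. (t, Z a)) has_derivative (%k. (k, 0))) (at t)" by (auto intro!: derivative_eq_intros)
  from has_derivative_compose[OF this dtraj[OF in_\<Omega>]]
  have 1: "((%t. Z (a + t)) has_derivative (%k. dtraj kp t (Z a) (k, 0))) (at t)"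
    using orbit_traj[OF kp Z] by simp
  have 2: "((%t. Z (a + t)) has_derivative (%k. k *\<^sub>R f kp (Z (a + t)))) (at t)"
    using orbit_curve_shift[OF Z, of a] by (simp add: orbit_curve_def has_vector_derivative_def)
  have "dtraj kp t (Z a) (k, h) = dtraj kp t (Z a) (k, 0) + dtraj kp t (Z a) (0, h)"
    using linear_add[OF dtraj_linear[OF in_\<Omega>], of t a "(k, 0)" "(0, h)"] by simp
  then show ?thesis using has_derivative_unique[OF 1 2] by metis
qed

lemma dtraj_field: "dtraj kp t (Z a) (0, f kp (Z a)) = f kp (Z (a + t))"
proof -
  have d: "((%s. Z (b + s)) has_derivative (%k. k *\<^sub>R f kp (Z (b + 0)))) (at 0)" for b
    using orbit_curve_shift[OF Z, of b] unfolding orbit_curve_def has_vector_derivative_def by blast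
  have "((%x. traj (f kp) D x t) has_derivative (%h. dtraj kp t (Z a) (0, h))) (at (Z (a + 0)))"
    using dtraj_space[OF in_\<Omega>, of t a] by simp
  from has_derivative_compose[OF d this]
  have 1: "((%s. Z (a + t + s)) has_derivative (%k. dtraj kp t (Z a) (0, k *\<^sub>R f kp (Z a)))) (at 0)"
    using orbit_traj[OF kp Z] by (simp add: ac_simps)
  from has_derivative_unique[OF 1 d] have "dtraj kp t (Z a) (0, 1 *\<^sub>R f kp (Z a)) = 1 *\<^sub>R f kp (Z (a + t + 0))"
    by metis
  then show ?thesis by simp
qed

lemma dtraj_semigroup:
  assumes "0 \<le> s" "0 \<le> t"
  shows "dtraj kp (s + t) (Z a) (0, h) = dtraj kp t (Z (a + s)) (0, dtraj kp s (Z a) (0, h))"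
proof -
  let ?N1 = "(%x. (kp, s, x)) -` \<Omega>"
  have N1: "open ?N1" by (rule open_vimage[OF open_\<Omega>]) (auto intro!: continuous_intros)
  have "continuous_on ?N1 (%x. traj (f kp) D x s)"
  proof (rule has_derivative_continuous_on, rule has_derivative_at_withinI, rule dtraj_space)
  qed simp
  then have "continuous_on ?N1 (%x. (kp, t, traj (f kp) D x s))" by (intro continuous_intros)
  then have N: "open (?N1 \<inter> (%x. (kp, t, traj (f kp) D x s)) -` \<Omega>)" (is "open ?N")
    by (rule continuous_open_preimage[OF _ N1 open_\<Omega>])
  have in_N: "Z a \<in> ?N" using in_\<Omega> orbit_traj[OF kp Z] by simp
  have eq: "traj (f kp) D (traj (f kp) D x s) t = traj (f kp) D x (s + t)" if "x \<in> ?N" for x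
    using flows_traj[OF kp flows_to_trans[OF traj_flows traj_flows assms]] that by auto
  have "((%x. traj (f kp) D x t) has_derivative (%h. dtraj kp t (Z (a + s)) (0, h))) (at (traj (f kp) D (Z a) s))"
    using dtraj_space[OF in_\<Omega>, of t "a + s"] orbit_traj[OF kp Z] by simp
  from has_derivative_compose[OF dtraj_space[OF in_\<Omega>] this]
  have "((%x. traj (f kp) D (traj (f kp) D x s) t) has_derivative
      (%h. dtraj kp t (Z (a + s)) (0, dtraj kp s (Z a) (0, h)))) (at (Z a))" .
  from has_derivative_transform_within_open[OF this N in_N eq]
  show ?thesis using has_derivative_unique[OF _ dtraj_space[OF in_\<Omega>, of "s + t" a]] by metis
qed

lemma dtraj_inverse: "dtraj kp (- t) (Z (a + t)) (0, dtraj kp t (Z a) (0, h)) = h"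
proof -
  let ?N = "(%x. (kp, t, x)) -` \<Omega>"
  have N: "open ?N" by (rule open_vimage[OF open_\<Omega>]) (auto intro!: continuous_intros)
  have in_N: "Z a \<in> ?N" using in_\<Omega> by simp
  have eq: "traj (f kp) D (traj (f kp) D x t) (- t) = x" if "x \<in> ?N" for x
    using flows_traj[OF kp flows_to_reverse[OF traj_flows]] that by auto
  have "((%x. traj (f kp) D x (- t)) has_derivative (%h. dtraj kp (- t) (Z (a + t)) (0, h))) (at (traj (f kp) D (Z a) t))"
    using dtraj_space[OF in_\<Omega>, of "- t" "a + t"] orbit_traj[OF kp Z] by simp
  from has_derivative_compose[OF dtraj_space[OF in_\<Omega>] this]
  have "((%x. traj (f kp) D (traj (f kp) D x t) (- t)) has_derivative
      (%h. dtraj kp (- t) (Z (a + t)) (0, dtraj kp t (Z a) (0, h)))) (at (Z a))" .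
  from has_derivative_transform_within_open[OF this N in_N eq]
  show ?thesis using has_derivative_unique[OF _ has_derivative_ident] by metis
qed

lemma monodromy_dtraj:
  assumes "monodromy (f kp) D (Z 0) \<tau> P" "0 < \<tau>"
  shows "dtraj kp \<tau> (Z 0) (0, h) = blinfun_apply P h"
proof -
  obtain Y where Y: "Y 0 = id_blinfun" "Y \<tau> = P" "\<And>t. t \<in> {0..\<tau>} ==> (Y has_vector_derivative
      Blinfun (frechet_derivative (f kp) (at (traj (f kp) D (Z 0) t))) o\<^sub>L Y t) (at t within {0..\<tau>})"
    using assms(1) unfolding monodromy_def by blast
  have ZD: "Z t \<in> D" for t using Z by (simp add: orbit_curve_def)
  have img: "(%u. \<tau> * u) ` {0..1} = {0..\<tau>}" using assms(2) by (simp add: image_mult_atLeastAtMost)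
  have lin: "((%u. \<tau> * u) has_vector_derivative \<tau>) (at u within {0..1})" for u
    by (auto intro!: derivative_eq_intros simp flip: has_real_derivative_iff_has_vector_derivative)
  have X: "solves (%_ w. \<tau> *\<^sub>R f kp w) D (%u. Z (\<tau> * u))"
    unfolding solves_def
  proof (intro ballI conjI ZD)
    fix u :: real
    have "(Z has_vector_derivative f kp (Z (\<tau> * u))) (at (\<tau> * u) within (%u. \<tau> * u) ` {0..1})"
      by (rule has_vector_derivative_at_within) (use Z in \<open>simp add: orbit_curve_def\<close>)
    from vector_diff_chain_within[OF lin this]
    show "((%u. Z (\<tau> * u)) has_vector_derivative \<tau> *\<^sub>R f kp (Z (\<tau> * u))) (at u within {0..1})" by (simp add: o_def)
  qed
  have "solves (%u v. \<tau> *\<^sub>R frechet_derivative (f kp) (at (Z (\<tau> * u))) v + 0 *\<^sub>R f kp (Z (\<tau> * u))) UNIV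
      (%u. blinfun_apply (Y (\<tau> * u)) h)"
    unfolding solves_def
  proof (intro ballI conjI UNIV_I)
    fix u :: real assume "u \<in> {0..1}"
    then have tu: "\<tau> * u \<in> {0..\<tau>}" using img by blast
    have bl: "bounded_linear (frechet_derivative (f kp) (at (Z (\<tau> * u))))"
      using Ck_on_has_derivative_open[OF f_slice_C1[OF kp] D ZD] by (rule has_derivative_bounded_linear)
    from bounded_linear.has_vector_derivative[OF blinfun.bounded_linear_left Y(3)[OF tu], of h]
    have "((%t. blinfun_apply (Y t) h) has_vector_derivative
        frechet_derivative (f kp) (at (Z (\<tau> * u))) (blinfun_apply (Y (\<tau> * u)) h)) (at (\<tau> * u) within (%u. \<tau> * u) ` {0..1})"
      using orbit_traj[OF kp Z, of 0] by (simp add: img bounded_linear_Blinfun_apply[OF bl])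
    from vector_diff_chain_within[OF lin this]
    show "((%u. blinfun_apply (Y (\<tau> * u)) h) has_vector_derivative
        \<tau> *\<^sub>R frechet_derivative (f kp) (at (Z (\<tau> * u))) (blinfun_apply (Y (\<tau> * u)) h) + 0 *\<^sub>R f kp (Z (\<tau> * u))) (at u within {0..1})"
      by (simp add: o_def)
  qed
  from traj_C2(3)[OF K D f_C2 kp X this] show ?thesis
    using Y(1,2) by (simp add: dtraj_def)
qed

text \<open>The kernel condition is transported along the orbit to the base point, where m-normality is
  formulated, by the linearised flow. The tangent of the family of orbits supplies the vector on
  which the parametrisation has derivative 1.\<close>

theorem m_normal_nondegenerate:
  fixes Lf :: "'a \<times> real => real"
  assumes \<tau>: "0 < \<tau>" "\<And>t. Z (t + \<tau>) = Z t" and f0: "f kp (Z 0) \<noteq> 0"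
    and normal: "m_normal m (f kp) D (Z 0) \<tau>" and T: "0 \<le> T"
    and \<Lambda>: "open \<Lambda>" "\<mu>0 \<in> \<Lambda>" and \<theta>: "(\<theta> has_vector_derivative \<theta>') (at \<mu>0)" "(Per has_vector_derivative Per') (at \<mu>0)"
    and base: "\<theta> \<mu>0 = Z 0" "Per \<mu>0 = \<tau>"
    and per: "\<And>\<mu>. \<mu> \<in> \<Lambda> ==> traj (f kp) D (\<theta> \<mu>) (real m * Per \<mu>) = \<theta> \<mu>"
    and Lf: "(Lf has_derivative Lf') (at (Z T, real m * \<tau>))"
    and L\<mu>: "\<And>\<mu>. \<mu> \<in> \<Lambda> ==> Lf (traj (f kp) D (\<theta> \<mu>) T, real m * Per \<mu>) = \<mu>"
    and LZ: "\<And>t. Lf (Z t, real m * \<tau>) = \<mu>0"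
    and kernel: "dtraj kp (real m * \<tau>) (Z T) (k, h) = h" "Lf' (h, k) = 0" "h \<bullet> f kp (Z T) = 0"
  shows "h = 0 \<and> k = 0"
proof -
  define M where "M t a v = dtraj kp t (Z a) (0, v)" for t a v
  have Mlin: "linear (M t a)" for t a
  proof -
    have "linear (%v :: 'a. (0 :: real, v))" by (rule linearI) auto
    from linear_compose[OF this dtraj_linear[OF in_\<Omega>, of t a]] show ?thesis by (simp add: M_def[abs_def] o_def)
  qed
  have Zm: "Z (t + real j * \<tau>) = Z t" for t j by (rule periodic_multiple[of Z, OF \<tau>(2)])
  obtain P where P: "monodromy (f kp) D (Z 0) \<tau> P"
    "dim {v. (blinfun_apply P ^^ m) v = v} = 1 \<or> dim {v. (blinfun_apply P ^^ m) v = v} = 2 \<and>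
      f kp (Z 0) \<notin> range (%v. (blinfun_apply P ^^ m) v - v)"
    using normal unfolding m_normal_def by blast
  have M0: "M 0 a v = v" for a v
  proof -
    have "((%x. traj (f kp) D x 0) has_derivative (%h. M 0 a h)) (at (Z a))"
      unfolding M_def by (rule dtraj_space[OF in_\<Omega>])
    moreover have "((%x. traj (f kp) D x 0) has_derivative (%h. h)) (at (Z a))"
    proof (rule has_derivative_transform_within_open[OF has_derivative_ident D])
      show "Z a \<in> D" using Z by (simp add: orbit_curve_def)
      fix x assume "x \<in> D"
      then have "flows_to (%_. f kp) D x 0 x"
        unfolding flows_to_def by (intro exI[of _ "%_. x"])
          (simp add: has_vector_derivative_def has_derivative_def bounded_linear_scaleR_left at_within_def)
      then show "x = traj (f kp) D x 0" using flows_traj[OF kp] by simp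
    qed
    ultimately show ?thesis using has_derivative_unique by metis
  qed
  have Mpow: "M (real j * \<tau>) 0 v = (blinfun_apply P ^^ j) v" for j v
  proof (induction j)
    case 0
    then show ?case by (simp add: M0)
  next
    case (Suc j)
    have "M (real (Suc j) * \<tau>) 0 v = M (real j * \<tau> + \<tau>) 0 v" by (simp add: algebra_simps)
    also have "\<dots> = M \<tau> (0 + real j * \<tau>) (M (real j * \<tau>) 0 v)"
      unfolding M_def by (rule dtraj_semigroup) (use \<tau>(1) in auto)
    also have "\<dots> = M \<tau> 0 (M (real j * \<tau>) 0 v)" using Zm[of 0 j] by (simp add: M_def)
    also have "\<dots> = blinfun_apply P (M (real j * \<tau>) 0 v)" unfolding M_def by (rule monodromy_dtraj[OF P(1) \<tau>(1)])
    finally show ?case using Suc by simp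
  qed
  let ?n = "real m * \<tau>"
  have n0: "0 \<le> ?n" using \<tau>(1) by simp
  let ?X = "M T 0" and ?Y = "M (- T) T"
  have YX: "?Y (?X v) = v" for v using dtraj_inverse[of T 0 v] by (simp add: M_def)
  have XY: "?X (?Y v) = v" for v using dtraj_inverse[of "- T" T v] by (simp add: M_def)
  have comm: "M ?n T (?X v) = ?X (M ?n 0 v)" for v
  proof -
    have "M ?n T (?X v) = M (T + ?n) 0 v"
      using dtraj_semigroup[OF T n0, of 0 v] by (simp add: M_def)
    also have "\<dots> = M (?n + T) 0 v" by (simp add: add.commute)
    also have "\<dots> = M T (0 + ?n) (M ?n 0 v)" unfolding M_def by (rule dtraj_semigroup[OF n0 T])
    also have "\<dots> = ?X (M ?n 0 v)" using Zm[of 0 m] by (simp add: M_def)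
    finally show ?thesis .
  qed
  have fX: "?X (f kp (Z 0)) = f kp (Z T)" using dtraj_field[of T 0] by (simp add: M_def)
  have Zn: "Z (T + ?n) = Z T" "Z (0 + ?n) = Z 0" by (rule Zm)+
  define e where "e = ?Y h"
  have h: "h = ?X e" by (simp add: e_def XY)
  have "k *\<^sub>R f kp (Z T) + M ?n T h = h"
    using kernel(1) dtraj_time[of ?n T k h] Zn by (simp add: M_def)
  then have "?X (M ?n 0 e + k *\<^sub>R f kp (Z 0)) = ?X e"
    by (simp add: h comm linear_add[OF Mlin] linear_cmul[OF Mlin] fX add.commute)
  then have e: "M ?n 0 e + k *\<^sub>R f kp (Z 0) = e" by (metis YX)
  have Lf'lin: "linear Lf'" using Lf by (rule has_derivative_linear)
  define \<phi> where "\<phi> = (%(v, r). Lf' (?X v, r))"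
  have \<phi>lin: "linear \<phi>"
  proof (rule linearI)
    fix p q :: "'a \<times> real" and c :: real
    show "\<phi> (p + q) = \<phi> p + \<phi> q"
      using linear_add[OF Lf'lin, of "(?X (fst p), snd p)" "(?X (fst q), snd q)"]
      by (simp add: \<phi>_def split_beta' linear_add[OF Mlin])
    show "\<phi> (c *\<^sub>R p) = c *\<^sub>R \<phi> p"
      using linear_cmul[OF Lf'lin, of c "(?X (fst p), snd p)"]
      by (simp add: \<phi>_def split_beta' linear_cmul[OF Mlin])
  qed
  have "k = 0 \<and> (\<exists>c. e = c *\<^sub>R f kp (Z 0))"
  proof (rule m_normal_kernel[OF Mlin \<phi>lin f0 _ _ _ _ _ e])
    show "M ?n 0 (f kp (Z 0)) = f kp (Z 0)" using dtraj_field[of ?n 0] Zn(2) by (simp add: M_def)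
    have "((%t. (Z t, ?n)) has_derivative (%r. (r *\<^sub>R f kp (Z T), 0))) (at T)"
      using Z by (intro has_derivative_Pair has_derivative_const) (simp add: orbit_curve_def has_vector_derivative_def)
    from has_derivative_compose[OF this Lf] have "((%t. \<mu>0) has_derivative (%r. Lf' (r *\<^sub>R f kp (Z T), 0))) (at T)"
      by (simp add: LZ)
    from has_derivative_unique[OF this has_derivative_const] have "Lf' (1 *\<^sub>R f kp (Z T), 0) = 0" by metis
    then show "\<phi> (f kp (Z 0), 0) = 0" by (simp add: \<phi>_def fX)
    have d\<theta>: "(\<theta> has_derivative (%r. r *\<^sub>R \<theta>')) (at \<mu>0)" "(Per has_derivative (%r. r * Per')) (at \<mu>0)"
      using \<theta> by (simp_all add: has_vector_derivative_def)
    have dn: "((%\<mu>. real m * Per \<mu>) has_derivative (%r. real m * (r * Per'))) (at \<mu>0)"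
      by (rule has_derivative_mult_right[OF d\<theta>(2)])
    have "((%\<mu>. (real m * Per \<mu>, \<theta> \<mu>)) has_derivative (%r. (real m * (r * Per'), r *\<^sub>R \<theta>'))) (at \<mu>0)"
      by (rule has_derivative_Pair[OF dn d\<theta>(1)])
    from has_derivative_compose[OF this, of "%(t, x). traj (f kp) D x t" "dtraj kp ?n (Z 0)"] dtraj[OF in_\<Omega>, of ?n 0]
    have 1: "((%\<mu>. traj (f kp) D (\<theta> \<mu>) (real m * Per \<mu>)) has_derivative
        (%r. dtraj kp ?n (Z 0) (real m * (r * Per'), r *\<^sub>R \<theta>'))) (at \<mu>0)"
      by (simp add: base)
    have "(\<theta> has_derivative (%r. dtraj kp ?n (Z 0) (real m * (r * Per'), r *\<^sub>R \<theta>'))) (at \<mu>0)"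
      by (rule has_derivative_transform_within_open[OF 1 \<Lambda> per])
    from has_derivative_unique[OF this d\<theta>(1)]
    have "dtraj kp ?n (Z 0) (real m * (1 * Per'), 1 *\<^sub>R \<theta>') = 1 *\<^sub>R \<theta>'" by metis
    then show "M ?n 0 \<theta>' + (real m * Per') *\<^sub>R f kp (Z 0) = \<theta>'"
      using dtraj_time[of ?n 0 "real m * Per'" \<theta>'] Zn(2) by (simp add: M_def add.commute)
    have "((%x. traj (f kp) D x T) has_derivative (%v. M T 0 v)) (at (\<theta> \<mu>0))"
      unfolding M_def base by (rule dtraj_space[OF in_\<Omega>])
    from has_derivative_compose[OF d\<theta>(1) this]
    have "((%\<mu>. traj (f kp) D (\<theta> \<mu>) T) has_derivative (%r. ?X (r *\<^sub>R \<theta>'))) (at \<mu>0)" .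
    from has_derivative_Pair[OF this dn]
    have 2: "((%\<mu>. (traj (f kp) D (\<theta> \<mu>) T, real m * Per \<mu>)) has_derivative (%r. (?X (r *\<^sub>R \<theta>'), real m * (r * Per')))) (at \<mu>0)" .
    have "(traj (f kp) D (\<theta> \<mu>0) T, real m * Per \<mu>0) = (Z T, ?n)" using orbit_traj[OF kp Z, of 0 T] by (simp add: base)
    then have "(Lf has_derivative Lf') (at (traj (f kp) D (\<theta> \<mu>0) T, real m * Per \<mu>0))" using Lf by (simp only:)
    from has_derivative_compose[OF 2 this]
    have 3: "((%\<mu>. Lf (traj (f kp) D (\<theta> \<mu>) T, real m * Per \<mu>)) has_derivative
        (%r. Lf' (?X (r *\<^sub>R \<theta>'), real m * (r * Per')))) (at \<mu>0)" .
    have "((%\<mu>. \<mu>) has_derivative (%r. Lf' (?X (r *\<^sub>R \<theta>'), real m * (r * Per')))) (at \<mu>0)"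
      by (rule has_derivative_transform_within_open[OF 3 \<Lambda> L\<mu>])
    from has_derivative_unique[OF this has_derivative_ident]
    have "Lf' (?X (1 *\<^sub>R \<theta>'), real m * (1 * Per')) = 1" by metis
    then show "\<phi> (\<theta>', real m * Per') = 1" by (simp add: \<phi>_def)
    have "M ?n 0 = blinfun_apply P ^^ m" by (rule ext) (rule Mpow)
    then show "dim {v. M ?n 0 v = v} = 1 \<or> dim {v. M ?n 0 v = v} = 2 \<and> f kp (Z 0) \<notin> range (%v. M ?n 0 v - v)"
      using P(2) by simp
    show "\<phi> (e, k) = 0" using kernel(2) h by (simp add: \<phi>_def)
  qed
  then obtain c where c: "k = 0" "e = c *\<^sub>R f kp (Z 0)" by blast
  then have hc: "h = c *\<^sub>R f kp (Z T)" using h by (simp add: linear_cmul[OF Mlin] fX)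
  have "f kp (Z T) \<noteq> 0"
  proof
    assume "f kp (Z T) = 0"
    then have "f kp (Z 0) = ?Y 0" using YX[of "f kp (Z 0)"] fX by simp
    then show False using f0 linear_0[OF Mlin] by simp
  qed
  then have "c = 0" using kernel(3) hc by simp
  then show ?thesis using c hc by simp
qed

end

end

section \<open>The perturbed return map and the energy transfer\<close>

text \<open>The perturbation parameter enters through its square root \<open>\<eta>\<close>, so that the fields are defined
  and smooth on both sides of \<open>\<eta> = 0\<close>; all quantities derived from them are even in \<open>\<eta>\<close>.\<close>

locale perturbed_flow = smooth_flow K D f
  for K :: "real set" and D :: "'a::euclidean_space set" and f :: "real => 'a => 'a" +
  fixes g :: "real => 'a => real => real => real => 'a" and H :: "real => 'a => real"
    and I :: "real set" and l :: nat
  assumes I: "open I" "0 \<in> I" "\<And>\<eta>. \<eta> \<in> I ==> - \<eta> \<in> I" and l: "0 < l"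
    and g_C2: "Ck_on 2 (%(kp, x, T, \<eta>, t). g kp x t T (\<eta>\<^sup>2)) (K \<times> D \<times> {0<..} \<times> I \<times> UNIV)"
    and H_der: "\<And>kp x. kp \<in> K ==> x \<in> D ==> (H kp has_derivative (%h. grad (H kp) x \<bullet> h)) (at x)"
    and gradH_C2: "Ck_on 2 (%(kp, x). grad (H kp) x) (K \<times> D)"
    and conserved: "\<And>kp x. kp \<in> K ==> x \<in> D ==> grad (H kp) x \<bullet> f kp x = 0"
begin

definition W :: "(real \<times> real \<times> real \<times> real \<times> 'a \<times> real) set" where
  "W = K \<times> I \<times> {0<..} \<times> UNIV \<times> D \<times> UNIV"

text \<open>The parameters, the time and the energy transferred by the perturbation are made part of the
  state; time is scaled so that the return takes place at time 1.\<close>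

definition X :: "real \<times> real \<times> real \<times> real \<times> 'a \<times> real => real \<times> real \<times> real \<times> real \<times> 'a \<times> real" where
  "X = (%(kp, \<eta>, T, t, x, b). (0, 0, 0, T, T *\<^sub>R (f kp x + \<eta>\<^sup>2 *\<^sub>R g kp x t (T / real l) (\<eta>\<^sup>2)),
     T * (grad (H kp) x \<bullet> g kp x t (T / real l) (\<eta>\<^sup>2))))"

lemma open_W: "open W"
  unfolding W_def by (intro open_Times K D I(1) open_UNIV open_greaterThan)

lemma X_C2: "Ck_on 2 X W"
proof -
  note o = open_W
  have p: "Ck_on 2 (%w. fst w) W" "Ck_on 2 (%w. fst (snd w)) W" "Ck_on 2 (%w. fst (snd (snd w))) W"
    "Ck_on 2 (%w. fst (snd (snd (snd w)))) W" "Ck_on 2 (%w. fst (snd (snd (snd (snd w))))) W"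
    by (intro Ck_on_fst Ck_on_snd Ck_on_ident o)+
  have pl: "Ck_on 2 (%w. fst (snd (snd w)) / real l) W"
    by (rule Ck_on_linear_compose[OF bounded_linear_divide o p(3)])
  have pf: "Ck_on 2 (%w. (fst w, fst (snd (snd (snd (snd w)))))) W" by (rule Ck_on_Pair[OF o p(1,5)])
  have im: "(%w. (fst w, fst (snd (snd (snd (snd w)))))) ` W \<subseteq> K \<times> D" by (auto simp: W_def)
  have f: "Ck_on 2 (%w. f (fst w) (fst (snd (snd (snd (snd w)))))) W"
    using Ck_on_compose[OF o im f_C2 pf] by simp
  have h: "Ck_on 2 (%w. grad (H (fst w)) (fst (snd (snd (snd (snd w)))))) W"
    using Ck_on_compose[OF o im gradH_C2 pf] by simp
  let ?q = "%w. (fst w, fst (snd (snd (snd (snd w)))), fst (snd (snd w)) / real l, fst (snd w), fst (snd (snd (snd w))))"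
  have pg: "Ck_on 2 ?q W" by (intro Ck_on_Pair o p pl)
  have ig: "?q ` W \<subseteq> K \<times> D \<times> {0<..} \<times> I \<times> UNIV" using l by (auto simp: W_def)
  have g: "Ck_on 2 (%w. g (fst w) (fst (snd (snd (snd (snd w))))) (fst (snd (snd (snd w)))) (fst (snd (snd w)) / real l) ((fst (snd w))\<^sup>2)) W"
    using Ck_on_compose[OF o ig g_C2 pg] by simp
  show ?thesis
    unfolding X_def split_beta' power2_eq_square
    using p f h g[unfolded power2_eq_square] by (intro Ck_on_Pair Ck_on_scaleR Ck_on_add Ck_on_mult Ck_on_inner Ck_on_const o)
qed

lemma X_C1: "Ck_on (Suc 0) X W"
  using X_C2 unfolding numeral_2_eq_2 by (rule Ck_on_SucD)

abbreviation "pfield kp \<eta> T \<equiv> %t x. f kp x + \<eta>\<^sup>2 *\<^sub>R g kp x t (T / real l) (\<eta>\<^sup>2)"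

definition start :: "real \<times> real \<times> real \<times> 'a => real \<times> real \<times> real \<times> real \<times> 'a \<times> real" where
  "start q = (fst q, fst (snd q), fst (snd (snd q)), 0, snd (snd (snd q)), 0)"

definition Ret where "Ret = start -` reach X W"

definition return_map :: "real \<times> real \<times> real \<times> 'a => 'a" where
  "return_map q = fst (snd (snd (snd (snd (flow1 X W (start q))))))"

definition transfer :: "real \<times> real \<times> real \<times> 'a => real" where
  "transfer q = snd (snd (snd (snd (snd (flow1 X W (start q))))))"

lemma start_linear: "bounded_linear start"
  unfolding start_def
  by (intro bounded_linear_Pair bounded_linear_fst_comp bounded_linear_snd_comp bounded_linear_ident bounded_linear_zero
      bounded_linear_fst bounded_linear_snd)

lemma open_Ret: "open Ret"
  unfolding Ret_def
  by (rule open_vimage[OF flow1_C1(1)[OF open_W X_C1] linear_continuous_on[OF start_linear]])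

lemma return_C2: "Ck_on 2 return_map Ret" "Ck_on 2 transfer Ret"
proof -
  have s: "Ck_on 2 start Ret" by (rule Ck_on_bounded_linear[OF start_linear open_Ret])
  have 1: "Ck_on 2 (%q. flow1 X W (start q)) Ret"
    by (rule Ck_on_compose[OF open_Ret _ flow1_C2[OF open_W X_C2] s]) (auto simp: Ret_def)
  show "Ck_on 2 return_map Ret" "Ck_on 2 transfer Ret"
    unfolding return_map_def[abs_def] transfer_def[abs_def] by (intro Ck_on_fst Ck_on_snd 1 open_Ret)+
qed

text \<open>The unperturbed field conserves the energy, so the integrated power of the perturbing force is
  the whole change of energy, up to the factor \<open>\<eta>\<^sup>2\<close>.\<close>

lemma return_curve:
  assumes kp: "kp \<in> K" "\<eta> \<in> I" and T: "0 < T"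
    and x: "\<And>t. t \<in> {0..T} ==> x t \<in> D \<and> (x has_vector_derivative pfield kp \<eta> T t (x t)) (at t within {0..T})"
  shows "(kp, \<eta>, T, x 0) \<in> Ret" and "return_map (kp, \<eta>, T, x 0) = x T"
    and "transfer (kp, \<eta>, T, x 0) = integral {0..T} (%t. grad (H kp) (x t) \<bullet> g kp (x t) t (T / real l) (\<eta>\<^sup>2))"
    and "\<eta>\<^sup>2 * transfer (kp, \<eta>, T, x 0) = H kp (x T) - H kp (x 0)"
proof -
  define G where "G t = grad (H kp) (x t) \<bullet> g kp (x t) t (T / real l) (\<eta>\<^sup>2)" for t
  define \<beta> where "\<beta> t = integral {0..t} G" for t
  have xc: "continuous_on {0..T} x"
    unfolding continuous_on_eq_continuous_within using x has_vector_derivative_continuous by blast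
  have xD: "x t \<in> D" if "t \<in> {0..T}" for t using x[OF that] by blast
  have "continuous_on {0..T} (%t. (kp, x t))" by (intro continuous_intros xc)
  from continuous_on_compose2[OF Ck_on_imp_continuous_on[OF gradH_C2] this] have 1: "continuous_on {0..T} (%t. grad (H kp) (x t))"
    using image_subsetI[of "{0..T}" "%t. (kp, x t)" "K \<times> D"] kp xD by simp
  have "continuous_on {0..T} (%t. (kp, x t, T / real l, \<eta>, t))" by (intro continuous_intros xc)
  from continuous_on_compose2[OF Ck_on_imp_continuous_on[OF g_C2] this]
  have 2: "continuous_on {0..T} (%t. g kp (x t) t (T / real l) (\<eta>\<^sup>2))"
    using image_subsetI[of "{0..T}" "%t. (kp, x t, T / real l, \<eta>, t)" "K \<times> D \<times> {0<..} \<times> I \<times> UNIV"] kp xD T l by simp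
  have "continuous_on {0..T} G" unfolding G_def[abs_def] by (rule continuous_on_inner[OF 1 2])
  then have \<beta>: "(\<beta> has_vector_derivative G t) (at t within {0..T})" if "t \<in> {0..T}" for t
    unfolding \<beta>_def[abs_def] using that by (rule integral_has_vector_derivative)
  have img: "(%u. T * u) ` {0..1} = {0..T}" using T by (simp add: image_mult_atLeastAtMost)
  have lin: "((%u. T * u) has_vector_derivative T) (at u within {0..1})" for u
    by (auto intro!: derivative_eq_intros simp flip: has_real_derivative_iff_has_vector_derivative)
  define w where "w u = (kp, \<eta>, T, T * u, x (T * u), \<beta> (T * u))" for u
  have w: "solves (%_. X) W w"
    unfolding solves_def
  proof (intro ballI conjI)
    fix u :: real assume u: "u \<in> {0..1}"
    then have lu: "T * u \<in> {0..T}" using img by blast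
    show "w u \<in> W" using kp T xD[OF lu] by (simp add: w_def W_def)
    have x': "(x has_vector_derivative pfield kp \<eta> T (T * u) (x (T * u))) (at (T * u) within (%u. T * u) ` {0..1})"
      unfolding img using x[OF lu] by blast
    have b': "(\<beta> has_vector_derivative G (T * u)) (at (T * u) within (%u. T * u) ` {0..1})"
      unfolding img by (rule \<beta>[OF lu])
    have eq: "X (w u) = (0, 0, 0, T, T *\<^sub>R pfield kp \<eta> T (T * u) (x (T * u)), T *\<^sub>R G (T * u))"
      by (simp add: X_def w_def G_def)
    show "(w has_vector_derivative X (w u)) (at u within {0..1})"
      unfolding eq unfolding w_def[abs_def]
      by (intro has_vector_derivative_Pair has_vector_derivative_const lin
          vector_diff_chain_within[OF lin x', unfolded o_def] vector_diff_chain_within[OF lin b', unfolded o_def])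
  qed
  have w0: "w 0 = start (kp, \<eta>, T, x 0)" by (simp add: w_def start_def \<beta>_def)
  show "(kp, \<eta>, T, x 0) \<in> Ret" unfolding Ret_def reach_def vimage_def using w w0 by blast
  have fl: "flow1 X W (start (kp, \<eta>, T, x 0)) = w 1" using flow1_eq[OF open_W X_C1 w] w0 by simp
  show "return_map (kp, \<eta>, T, x 0) = x T" by (simp add: return_map_def fl w_def)
  have tr: "transfer (kp, \<eta>, T, x 0) = \<beta> T" by (simp add: transfer_def fl w_def)
  then show "transfer (kp, \<eta>, T, x 0) = integral {0..T} (%t. grad (H kp) (x t) \<bullet> g kp (x t) t (T / real l) (\<eta>\<^sup>2))"
    by (simp add: \<beta>_def G_def[abs_def])
  have "((%t. H kp (x t) - \<eta>\<^sup>2 * \<beta> t) has_derivative (%h. 0)) (at t within {0..T})" if t: "t \<in> {0..T}" for t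
  proof -
    have "(x has_derivative (%h. h *\<^sub>R pfield kp \<eta> T t (x t))) (at t within {0..T})"
      using x[OF t] by (simp add: has_vector_derivative_def)
    from has_derivative_compose[OF this H_der[OF kp(1) xD[OF t]]]
    have "((%t. H kp (x t)) has_derivative (%h. grad (H kp) (x t) \<bullet> (h *\<^sub>R pfield kp \<eta> T t (x t)))) (at t within {0..T})" .
    moreover have "(\<beta> has_derivative (%h. h *\<^sub>R G t)) (at t within {0..T})" using \<beta>[OF t] by (simp add: has_vector_derivative_def)
    ultimately have "((%t. H kp (x t) - \<eta>\<^sup>2 * \<beta> t) has_derivative
        (%h. grad (H kp) (x t) \<bullet> (h *\<^sub>R pfield kp \<eta> T t (x t)) - \<eta>\<^sup>2 * (h *\<^sub>R G t))) (at t within {0..T})"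
      by (intro has_derivative_diff has_derivative_mult_right)
    moreover have "grad (H kp) (x t) \<bullet> (h *\<^sub>R pfield kp \<eta> T t (x t)) - \<eta>\<^sup>2 * (h *\<^sub>R G t) = 0" for h
      using conserved[OF kp(1) xD[OF t]] by (simp add: G_def inner_add_right)
    ultimately show ?thesis by (simp only:)
  qed
  from has_derivative_zero_constant[OF convex_real_interval(5) this]
  obtain c where "\<And>t. t \<in> {0..T} ==> H kp (x t) - \<eta>\<^sup>2 * \<beta> t = c" by blast
  from this[of 0] this[of T] show "\<eta>\<^sup>2 * transfer (kp, \<eta>, T, x 0) = H kp (x T) - H kp (x 0)"
    using T by (simp add: tr \<beta>_def)
qed

lemma Ret_flows:
  assumes "(kp, \<eta>, T, \<xi>) \<in> Ret"
  shows "kp \<in> K \<and> \<eta> \<in> I \<and> 0 < T \<and> \<xi> \<in> D \<and> (\<exists>y. flows_to (pfield kp \<eta> T) D \<xi> T y)"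
proof -
  obtain Y where Y: "Y 0 = (kp, \<eta>, T, 0, \<xi>, 0)" "solves (%_. X) W Y"
    using assms by (auto simp: Ret_def reach_def start_def)
  have "Y 0 \<in> W" by (rule solvesD(1)[OF Y(2)]) simp
  then have in_W: "kp \<in> K" "\<eta> \<in> I" "0 < T" "\<xi> \<in> D" using Y(1) by (auto simp: W_def)
  note d = solvesD(2)[OF Y(2)]
  have X: "fst (X w) = 0" "fst (snd (X w)) = 0" "fst (snd (snd (X w))) = 0" "fst (snd (snd (snd (X w)))) = fst (snd (snd w))"
    "fst (snd (snd (snd (snd (X w))))) = fst (snd (snd w)) *\<^sub>R pfield (fst w) (fst (snd w)) (fst (snd (snd w))) (fst (snd (snd (snd w)))) (fst (snd (snd (snd (snd w)))))" for w
    by (simp_all add: X_def split_beta')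
  note bl = bounded_linear.has_vector_derivative[OF bounded_linear_fst]
  note bs = bounded_linear.has_vector_derivative[OF bounded_linear_snd]
  note d1 = bl[OF d] and d2 = bl[OF bs[OF d]] and d3 = bl[OF bs[OF bs[OF d]]]
    and d4 = bl[OF bs[OF bs[OF bs[OF d]]]] and d5 = bl[OF bs[OF bs[OF bs[OF bs[OF d]]]]]
  have c1: "fst (Y u) = kp" if "u \<in> {0..1}" for u
    using solves_zero_const[of "%u. fst (Y u)", OF d1[unfolded X] that] Y(1) by simp
  have c2: "fst (snd (Y u)) = \<eta>" if "u \<in> {0..1}" for u
    using solves_zero_const[of "%u. fst (snd (Y u))", OF d2[unfolded X] that] Y(1) by simp
  have c3: "fst (snd (snd (Y u))) = T" if "u \<in> {0..1}" for u
    using solves_zero_const[of "%u. fst (snd (snd (Y u)))", OF d3[unfolded X] that] Y(1) by simp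
  have c4: "fst (snd (snd (snd (Y u)))) = T * u" if "u \<in> {0..1}" for u
  proof -
    have "((%u. fst (snd (snd (snd (Y u)))) - T * u) has_vector_derivative 0) (at u within {0..1})" if "u \<in> {0..1}" for u
    proof -
      have "((%u. T * u) has_vector_derivative T) (at u within {0..1})"
        by (auto intro!: derivative_eq_intros simp flip: has_real_derivative_iff_has_vector_derivative)
      from has_vector_derivative_diff[OF d4[OF that] this] show ?thesis by (simp add: X c3[OF that])
    qed
    from solves_zero_const[of "%u. fst (snd (snd (snd (Y u)))) - T * u", OF this that] Y(1) show ?thesis by simp
  qed
  have "solves (%u w. T *\<^sub>R pfield kp \<eta> T (T * u) w) D (%u. fst (snd (snd (snd (snd (Y u))))))"
    unfolding solves_def
  proof (intro ballI conjI)
    fix u :: real assume u: "u \<in> {0..1}"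
    show "fst (snd (snd (snd (snd (Y u))))) \<in> D" using solvesD(1)[OF Y(2) u] by (auto simp: W_def mem_Times_iff)
    show "((%u. fst (snd (snd (snd (snd (Y u)))))) has_vector_derivative
        T *\<^sub>R pfield kp \<eta> T (T * u) (fst (snd (snd (snd (snd (Y u))))))) (at u within {0..1})"
      using d5[OF u] unfolding X c1[OF u] c2[OF u] c3[OF u] c4[OF u] .
  qed
  then have "flows_to (pfield kp \<eta> T) D \<xi> T (fst (snd (snd (snd (snd (Y 1))))))"
    unfolding flows_to_iff_solves using Y(1) by (intro exI[of _ "%u. fst (snd (snd (snd (snd (Y u)))))"]) simp
  then show ?thesis using in_W by blast
qed

lemma flows_curve:
  assumes "0 < T" "flows_to F D \<xi> T y"
  shows "\<exists>x. x 0 = \<xi> \<and> x T = y \<and> (\<forall>t\<in>{0..T}. x t \<in> D \<and> (x has_vector_derivative F t (x t)) (at t within {0..T}))"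
  using assms unfolding flows_to_def by (simp add: closed_segment_eq_real_ivl)

lemma flows_return:
  assumes "kp \<in> K" "\<eta> \<in> I" "0 < T" "flows_to (pfield kp \<eta> T) D \<xi> T y"
  shows "(kp, \<eta>, T, \<xi>) \<in> Ret" and "return_map (kp, \<eta>, T, \<xi>) = y"
    and "\<eta>\<^sup>2 * transfer (kp, \<eta>, T, \<xi>) = H kp y - H kp \<xi>"
proof -
  from flows_curve[OF assms(3,4)] obtain x where x0: "x 0 = \<xi> \<and> x T = y \<and>
      (\<forall>t\<in>{0..T}. x t \<in> D \<and> (x has_vector_derivative pfield kp \<eta> T t (x t)) (at t within {0..T}))" ..
  then have x: "x 0 = \<xi>" "x T = y"
    "\<And>t. t \<in> {0..T} ==> x t \<in> D \<and> (x has_vector_derivative pfield kp \<eta> T t (x t)) (at t within {0..T})"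
    by simp_all
  from return_curve[OF assms(1-3) x(3)] x(1,2)
  show "(kp, \<eta>, T, \<xi>) \<in> Ret" "return_map (kp, \<eta>, T, \<xi>) = y"
    "\<eta>\<^sup>2 * transfer (kp, \<eta>, T, \<xi>) = H kp y - H kp \<xi>" by simp_all
qed

lemma Ret_return:
  assumes "(kp, \<eta>, T, \<xi>) \<in> Ret"
  shows "flows_to (pfield kp \<eta> T) D \<xi> T (return_map (kp, \<eta>, T, \<xi>))"
    and "\<eta>\<^sup>2 * transfer (kp, \<eta>, T, \<xi>) = H kp (return_map (kp, \<eta>, T, \<xi>)) - H kp \<xi>"
    and "(kp, - \<eta>, T, \<xi>) \<in> Ret" and "return_map (kp, - \<eta>, T, \<xi>) = return_map (kp, \<eta>, T, \<xi>)"
    and "transfer (kp, - \<eta>, T, \<xi>) = transfer (kp, \<eta>, T, \<xi>)"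
proof -
  obtain y where q: "kp \<in> K" "\<eta> \<in> I" "0 < T" and y: "flows_to (pfield kp \<eta> T) D \<xi> T y"
    using Ret_flows[OF assms] by blast
  note fr = flows_return[OF q y]
  show "flows_to (pfield kp \<eta> T) D \<xi> T (return_map (kp, \<eta>, T, \<xi>))" using y fr(2) by simp
  show "\<eta>\<^sup>2 * transfer (kp, \<eta>, T, \<xi>) = H kp (return_map (kp, \<eta>, T, \<xi>)) - H kp \<xi>" using fr(2,3) by simp
  from flows_curve[OF q(3) y] obtain x where x0: "x 0 = \<xi> \<and> x T = y \<and>
      (\<forall>t\<in>{0..T}. x t \<in> D \<and> (x has_vector_derivative pfield kp \<eta> T t (x t)) (at t within {0..T}))" ..
  then have x: "x 0 = \<xi>" "x T = y"
    "\<And>t. t \<in> {0..T} ==> x t \<in> D \<and> (x has_vector_derivative pfield kp \<eta> T t (x t)) (at t within {0..T})"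
    by simp_all
  have x': "x t \<in> D \<and> (x has_vector_derivative pfield kp (- \<eta>) T t (x t)) (at t within {0..T})" if "t \<in> {0..T}" for t
    using x(3)[OF that] by simp
  note r = return_curve[OF q x(3)] and r' = return_curve[OF q(1) I(3)[OF q(2)] q(3) x']
  show "(kp, - \<eta>, T, \<xi>) \<in> Ret" using r'(1) x(1) by simp
  show "return_map (kp, - \<eta>, T, \<xi>) = return_map (kp, \<eta>, T, \<xi>)" using r(2) r'(2) x(1) by simp
  show "transfer (kp, - \<eta>, T, \<xi>) = transfer (kp, \<eta>, T, \<xi>)" using r(3) r'(3) x(1) by simp
qed

lemma unperturbed_return:
  assumes "(kp, 0, T, \<xi>) \<in> Ret"
  shows "return_map (kp, 0, T, \<xi>) = traj (f kp) D \<xi> T"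
proof -
  have "flows_to (%_. f kp) D \<xi> T (return_map (kp, 0, T, \<xi>))" using Ret_return(1)[OF assms] by simp
  then show ?thesis using flows_traj Ret_flows[OF assms] by metis
qed

lemma orbit_return:
  assumes "kp \<in> K" "0 < T" "orbit_curve (f kp) D Z"
  shows "(kp, 0, T, Z s) \<in> Ret" and "return_map (kp, 0, T, Z s) = Z (s + T)"
    and "transfer (kp, 0, T, Z s) = integral {0..T} (%t. grad (H kp) (Z (s + t)) \<bullet> g kp (Z (s + t)) t (T / real l) 0)"
proof -
  have z: "Z (s + t) \<in> D \<and> ((%t. Z (s + t)) has_vector_derivative pfield kp 0 T t (Z (s + t))) (at t within {0..T})" for t
  proof
    show "Z (s + t) \<in> D" using assms(3) by (simp add: orbit_curve_def)
    have "((%t. Z (s + t)) has_vector_derivative pfield kp 0 T t (Z (s + t))) (at t)"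
      using orbit_curve_shift[OF assms(3), of s] by (simp add: orbit_curve_def)
    then show "((%t. Z (s + t)) has_vector_derivative pfield kp 0 T t (Z (s + t))) (at t within {0..T})"
      by (rule has_vector_derivative_at_within)
  qed
  from return_curve[OF assms(1) I(2) assms(2) z]
  show "(kp, 0, T, Z s) \<in> Ret" "return_map (kp, 0, T, Z s) = Z (s + T)"
    "transfer (kp, 0, T, Z s) = integral {0..T} (%t. grad (H kp) (Z (s + t)) \<bullet> g kp (Z (s + t)) t (T / real l) 0)"
    by simp_all
qed

end

section \<open>Reduction of the periodicity problem to a scalar equation\<close>

definition box3 :: "real => real => real => (real \<times> real \<times> real) set" where
  "box3 R s0 k0 = {-R<..<R} \<times> {s0-R<..<s0+R} \<times> {k0-R<..<k0+R}"

lemma box3_iff: "(\<eta>, s, kp) \<in> box3 R s0 k0 \<longleftrightarrow> \<bar>\<eta>\<bar> < R \<and> \<bar>s - s0\<bar> < R \<and> \<bar>kp - k0\<bar> < R"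
  unfolding box3_def mem_Times_iff greaterThanLessThan_iff fst_conv snd_conv by linarith

lemma open_box3: "open (box3 R s0 k0)"
  unfolding box3_def by (intro open_Times open_greaterThanLessThan)

lemma box3_mono: "R' \<le> R ==> box3 R' s0 k0 \<subseteq> box3 R s0 k0"
  unfolding subset_iff split_paired_All box3_iff by linarith

lemma eventually_box3:
  assumes "eventually P (nhds (0, s0, k0))"
  shows "\<exists>R>0. \<forall>y\<in>box3 R s0 k0. P y"
proof -
  obtain d where d: "0 < d" "\<And>y. dist y (0, s0, k0) < d ==> P y"
    using assms unfolding eventually_nhds_metric by blast
  have "P y" if "y \<in> box3 (d / 3) s0 k0" for y
  proof -
    obtain \<eta> s kp where y: "y = (\<eta>, s, kp)" by (cases y) auto
    have "dist y (0, s0, k0) \<le> \<bar>\<eta>\<bar> + sqrt (\<bar>s - s0\<bar>\<^sup>2 + \<bar>kp - k0\<bar>\<^sup>2)"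
      unfolding y dist_Pair_Pair using sqrt_sum_squares_le_sum[of "\<bar>\<eta>\<bar>" "sqrt (\<bar>s - s0\<bar>\<^sup>2 + \<bar>kp - k0\<bar>\<^sup>2)"]
      by (simp add: dist_real_def)
    also have "\<dots> \<le> \<bar>\<eta>\<bar> + (\<bar>s - s0\<bar> + \<bar>kp - k0\<bar>)"
      using sqrt_sum_squares_le_sum[of "\<bar>s - s0\<bar>" "\<bar>kp - k0\<bar>"] by simp
    also have "\<dots> < d" using that unfolding y box3_iff by linarith
    finally show ?thesis by (rule d(2))
  qed
  then show ?thesis using d(1) by (intro exI[of _ "d / 3"]) simp
qed

lemma eventually_nhds_curve:
  fixes h :: "'a::t2_space => 'b::topological_space"
  assumes "open N" "x \<in> N" "continuous_on N h" "eventually P (nhds (h x))"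
  shows "eventually (%y. P (h y)) (nhds x)"
proof -
  have "isCont h x" using assms(1-3) by (simp add: continuous_on_eq_continuous_at)
  then have "filterlim h (nhds (h x)) (nhds x)"
    unfolding isCont_def tendsto_at_iff_tendsto_nhds .
  then show ?thesis using assms(4) by (rule eventually_compose_filterlim[rotated])
qed

text \<open>The derivative of an even function vanishes at 0 and is Lipschitz continuous.\<close>

lemma even_C2_bound:
  fixes h :: "real \<times> 'y::euclidean_space => 'b::euclidean_space"
  assumes N: "open N" "(0, y0) \<in> N" and h: "Ck_on 2 h N"
    and even: "\<And>\<eta> y. (\<eta>, y) \<in> N ==> h (- \<eta>, y) = h (\<eta>, y)"
  shows "\<exists>C\<ge>0. eventually (%(\<eta>, y). norm (h (\<eta>, y) - h (0, y)) \<le> C * \<eta>\<^sup>2) (nhds (0, y0))"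
proof -
  have h2: "Ck_on (Suc (Suc 0)) h N" using h by (simp only: numeral_2_eq_2)
  define d where "d p = frechet_derivative h (at p) (1, 0)" for p
  have d1: "Ck_on (Suc 0) d N" unfolding d_def[abs_def] by (rule Ck_on_derivative_open[OF h2 N(1)])
  obtain \<delta> B where \<delta>: "0 < \<delta>" "cball (0, y0) \<delta> \<subseteq> N" "B-lipschitz_on (cball (0, y0) \<delta>) d"
    by (rule Ck_on_local_lipschitz[OF N(1) d1 N(2)])
  have B: "0 \<le> B" using \<delta>(3) by (rule lipschitz_on_nonneg)
  have in_ball: "(t, y) \<in> cball (0, y0) \<delta>" if "\<bar>t\<bar> < \<delta> / 2" "dist y y0 < \<delta> / 2" for t y
  proof -
    have "dist (t, y) (0, y0) \<le> dist t 0 + dist y y0"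
      unfolding dist_Pair_Pair by (rule sqrt_sum_squares_le_sum) simp_all
    then have "dist (t, y) (0, y0) \<le> \<delta>" using that by (simp add: dist_real_def)
    then show ?thesis by (simp add: dist_commute)
  qed
  have der: "((%t. h (t, y)) has_vector_derivative d (t, y)) (at t)" if "(t, y) \<in> N" for t y
  proof -
    have 1: "((%t. (t, y)) has_derivative (%k. (k, 0))) (at t)" by (auto intro!: derivative_eq_intros)
    have 2: "(h has_derivative frechet_derivative h (at (t, y))) (at (t, y))"
      by (rule Ck_on_has_derivative_open[OF h2 N(1) that])
    have lin: "linear (frechet_derivative h (at (t, y)))" by (rule has_derivative_linear[OF 2])
    have "frechet_derivative h (at (t, y)) (k, 0) = k *\<^sub>R d (t, y)" for k
      using linear_cmul[OF lin, of k "(1, 0)"] by (simp add: d_def)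
    with has_derivative_compose[OF 1 2] show ?thesis by (simp add: has_vector_derivative_def)
  qed
  have bound: "norm (h (\<eta>, y) - h (0, y)) \<le> B * \<eta>\<^sup>2" if \<eta>: "\<bar>\<eta>\<bar> < \<delta> / 2" and y: "dist y y0 < \<delta> / 2" for \<eta> y
  proof -
    have in_N: "(t, y) \<in> N" if "\<bar>t\<bar> < \<delta> / 2" for t using in_ball[OF that y] \<delta>(2) by blast
    have 0: "\<bar>0 :: real\<bar> < \<delta> / 2" using \<delta>(1) by simp
    have "d (0, y) = 0"
    proof -
      have neg: "((%t. - t) has_vector_derivative -1) (at (0 :: real))"
        by (auto intro!: derivative_eq_intros simp flip: has_real_derivative_iff_has_vector_derivative)
      have "((%t. h (t, y)) has_vector_derivative d (0, y)) (at (- 0))" using der[OF in_N[OF 0]] by simp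
      from vector_diff_chain_at[OF neg this]
      have m: "((%t. h (- t, y)) has_vector_derivative - d (0, y)) (at 0)" by (simp add: o_def)
      have "((%t. h (t, y)) has_vector_derivative - d (0, y)) (at 0)"
      proof (rule has_vector_derivative_transform_within_open[OF m])
        show "open {- (\<delta> / 2)<..<\<delta> / 2}" "0 \<in> {- (\<delta> / 2)<..<\<delta> / 2}" using \<delta>(1) by auto
        show "h (- t, y) = h (t, y)" if "t \<in> {- (\<delta> / 2)<..<\<delta> / 2}" for t
          using that by (intro even in_N) auto
      qed
      from vector_derivative_unique_at[OF this der[OF in_N[OF 0]]]
      have "d (0, y) + d (0, y) = 0" using left_minus[of "d (0, y)"] by (simp only:)
      then have "2 *\<^sub>R d (0, y) = 0" by (simp only: scaleR_2)
      then show ?thesis by simp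
    qed
    then have dt: "norm (d (t, y)) \<le> B * \<bar>\<eta>\<bar>" if "\<bar>t\<bar> \<le> \<bar>\<eta>\<bar>" for t
    proof -
      have "dist (d (t, y)) (d (0, y)) \<le> B * dist (t, y) (0, y)"
        using that \<eta> by (intro lipschitz_onD[OF \<delta>(3)] in_ball y) auto
      also have "dist (t, y) (0, y) = \<bar>t\<bar>" by (simp add: dist_Pair_Pair dist_real_def)
      also have "B * \<bar>t\<bar> \<le> B * \<bar>\<eta>\<bar>" using that B by (rule mult_left_mono)
      finally show ?thesis using \<open>d (0, y) = 0\<close> by simp
    qed
    have "norm (h (\<eta>, y) - h (0, y)) \<le> (B * \<bar>\<eta>\<bar>) * norm (\<eta> - 0)"
    proof (rule differentiable_bound[where S = "{- \<bar>\<eta>\<bar>..\<bar>\<eta>\<bar>}" and f' = "%t k. k *\<^sub>R d (t, y)"])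
      fix t assume t: "t \<in> {- \<bar>\<eta>\<bar>..\<bar>\<eta>\<bar>}"
      then have t': "\<bar>t\<bar> \<le> \<bar>\<eta>\<bar>" by auto
      have "\<bar>t\<bar> < \<delta> / 2" using t' \<eta> by linarith
      from der[OF in_N[OF this]]
      have "((%t. h (t, y)) has_derivative (%k. k *\<^sub>R d (t, y))) (at t)" by (simp add: has_vector_derivative_def)
      then show "((%t. h (t, y)) has_derivative (%k. k *\<^sub>R d (t, y))) (at t within {- \<bar>\<eta>\<bar>..\<bar>\<eta>\<bar>})"
        by (rule has_derivative_at_withinI)
      show "onorm (%k. k *\<^sub>R d (t, y)) \<le> B * \<bar>\<eta>\<bar>"
      proof (rule onorm_le)
        fix k :: real
        show "norm (k *\<^sub>R d (t, y)) \<le> (B * \<bar>\<eta>\<bar>) * norm k"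
          using mult_left_mono[OF dt[OF t'], of "\<bar>k\<bar>"] by (simp add: mult.commute)
      qed
    qed auto
    then show ?thesis by (simp add: power2_eq_square flip: mult.assoc)
  qed
  have "eventually (%(\<eta>, y). norm (h (\<eta>, y) - h (0, y)) \<le> B * \<eta>\<^sup>2) (nhds (0, y0))"
    unfolding eventually_nhds_metric
  proof (intro exI[of _ "\<delta> / 2"] conjI allI impI)
    fix p :: "real \<times> 'y" assume p: "dist p (0, y0) < \<delta> / 2"
    have "dist (fst p) 0 < \<delta> / 2" "dist (snd p) y0 < \<delta> / 2"
      using p dist_fst_le[of p "(0, y0)"] dist_snd_le[of p "(0, y0)"] by simp_all
    then show "case p of (\<eta>, y) => norm (h (\<eta>, y) - h (0, y)) \<le> B * \<eta>\<^sup>2"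
      using bound[of "fst p" "snd p"] by (simp add: split_beta' dist_real_def)
  qed (use \<delta>(1) in simp)
  then show ?thesis using B by blast
qed

locale melnikov_problem = perturbed_flow K D f g H I l
  for K :: "real set" and D :: "'a::euclidean_space set" and f :: "real => 'a => 'a"
    and g :: "real => 'a => real => real => real => 'a" and H :: "real => 'a => real" and I :: "real set" and l :: nat +
  fixes m :: nat and L :: "real => 'a => real => real" and p :: "real => 'a" and \<tau> lam :: "real => real"
    and Z :: "real => real => 'a" and s0 kp0 :: real
  assumes m: "0 < m" and kp0: "kp0 \<in> K"
    and L_C2: "Ck_on 2 (%(kp, \<xi>, T). L kp \<xi> T) (K \<times> D \<times> {0<..})"
    and p_C2: "Ck_on 2 p K" and \<tau>_C2: "Ck_on 2 \<tau> K" and lam_C2: "Ck_on 2 lam K"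
    and \<tau>_pos: "\<And>kp. kp \<in> K ==> 0 < \<tau> kp"
    and Z: "\<And>kp. kp \<in> K ==> orbit_curve (f kp) D (Z kp)" and Z0: "\<And>kp. kp \<in> K ==> Z kp 0 = p kp"
    and Z_periodic: "\<And>kp t. kp \<in> K ==> Z kp (t + \<tau> kp) = Z kp t"
    and L_orbit: "\<And>kp t. kp \<in> K ==> L kp (Z kp t) (real m * \<tau> kp) = lam kp"
    and critical: "\<And>x. x \<in> D ==> grad (H kp0) x = 0 ==> f kp0 x = 0"
    and f_nz: "f kp0 (Z kp0 s0) \<noteq> 0"
    and nondegenerate: "\<And>Lf' h k. ((%u. L kp0 (fst u) (snd u)) has_derivative Lf') (at (Z kp0 s0, real m * \<tau> kp0)) ==>
      dtraj kp0 (real m * \<tau> kp0) (Z kp0 s0) (k, h) = h ==> Lf' (h, k) = 0 ==> h \<bullet> f kp0 (Z kp0 s0) = 0 ==>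
      h = 0 \<and> k = 0"
begin

abbreviation "z0 \<equiv> Z kp0 s0"
abbreviation "T0 \<equiv> real m * \<tau> kp0"
definition a where "a = grad (H kp0) z0"
definition a' where "a' = (1 / (a \<bullet> a)) *\<^sub>R a"

lemma Z_in: "kp \<in> K ==> Z kp s \<in> D"
  using Z by (simp add: orbit_curve_def)

lemma traj_Z: "kp \<in> K ==> traj (f kp) D (p kp) s = Z kp s"
  using orbit_traj[OF _ Z, of kp 0 s] Z0 by simp

lemma a_nz: "a \<noteq> 0"
  using critical[OF Z_in[OF kp0]] f_nz by (auto simp: a_def)

lemma a'_a: "a' \<bullet> a = 1"
  using a_nz by (simp add: a'_def)

lemma Z_C2: "Ck_on 2 (%(s, kp). Z kp s) (UNIV \<times> K)"
proof -
  have o: "open (UNIV \<times> K :: (real \<times> real) set)" using K by (simp add: open_Times)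
  have "Ck_on 2 (%w. p (snd w)) (UNIV \<times> K :: (real \<times> real) set)"
    by (rule Ck_on_compose[OF o _ p_C2 Ck_on_snd[OF o Ck_on_ident[OF o]]]) auto
  then have 1: "Ck_on 2 (%w. (snd w, fst w, p (snd w))) (UNIV \<times> K :: (real \<times> real) set)"
    by (intro Ck_on_Pair Ck_on_fst Ck_on_snd Ck_on_ident o)
  have "(kp, s, p kp) \<in> \<Omega>" if "kp \<in> K" for s kp using orbit_traj[OF that Z[OF that], of 0 s] Z0[OF that] by simp
  then have "(%w. (snd w, fst w, p (snd w))) ` (UNIV \<times> K) \<subseteq> \<Omega>" by auto
  from Ck_on_compose[OF o this traj_C2_\<Omega> 1]
  have "Ck_on 2 (%w. traj (f (snd w)) D (p (snd w)) (fst w)) (UNIV \<times> K)" by simp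
  then show ?thesis by (subst Ck_on_cong[where g = "%w. traj (f (snd w)) D (p (snd w)) (fst w)"]) (auto simp: traj_Z)
qed

text \<open>Unknowns are the initial condition and the return time. The return condition is imposed only
  up to a multiple of the gradient of the energy; the missing component is the phase condition.\<close>

definition N :: "(('a \<times> real) \<times> real \<times> real \<times> real) set" where
  "N = {w. (snd (snd (snd w)), fst (snd w), snd (fst w), fst (fst w)) \<in> Ret}"

definition displacement :: "('a \<times> real) \<times> real \<times> real \<times> real => 'a" where
  "displacement w = return_map (snd (snd (snd w)), fst (snd w), snd (fst w), fst (fst w)) - fst (fst w)"

definition Fred :: "('a \<times> real) \<times> real \<times> real \<times> real => 'a \<times> real" where
  "Fred w = (let kp = snd (snd (snd w)); z = Z kp (fst (snd (snd w))) in
     (displacement w - (displacement w \<bullet> a') *\<^sub>R a + ((fst (fst w) - z) \<bullet> f kp z) *\<^sub>R a,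
      L kp (fst (fst w)) (snd (fst w)) - lam kp))"

lemma open_N: "open N"
proof -
  have "N = (%w. (snd (snd (snd w)), fst (snd w), snd (fst w), fst (fst w))) -` Ret" by (auto simp: N_def)
  then show ?thesis by (simp only:) (rule open_vimage[OF open_Ret]; intro continuous_intros)
qed

lemma N_D: "((\<xi>, T), \<eta>, s, kp) \<in> N ==> (kp, \<eta>, T, \<xi>) \<in> Ret \<and> kp \<in> K \<and> 0 < T \<and> \<xi> \<in> D"
  using Ret_flows unfolding N_def by auto

lemma Fred_C2: "Ck_on 2 Fred N"
proof -
  note o = open_N
  have K': "snd (snd (snd w)) \<in> K" "fst (fst w) \<in> D" "0 < snd (fst w)" if "w \<in> N" for w
    using N_D[of "fst (fst w)" "snd (fst w)" "fst (snd w)" "fst (snd (snd w))" "snd (snd (snd w))"] that by auto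
  have c: "Ck_on 2 (%w. snd (snd (snd w))) N" "Ck_on 2 (%w. fst (snd w)) N" "Ck_on 2 (%w. snd (fst w)) N"
    "Ck_on 2 (%w. fst (fst w)) N" "Ck_on 2 (%w. fst (snd (snd w))) N"
    by (intro Ck_on_fst Ck_on_snd Ck_on_ident o)+
  have "Ck_on 2 (%w. (snd (snd (snd w)), fst (snd w), snd (fst w), fst (fst w))) N" by (intro Ck_on_Pair c o)
  from Ck_on_compose[OF o _ return_C2(1) this]
  have d: "Ck_on 2 displacement N"
    unfolding displacement_def[abs_def] by (intro Ck_on_diff c o) (auto simp: N_def)
  have "Ck_on 2 (%w. (fst (snd (snd w)), snd (snd (snd w)))) N" by (intro Ck_on_Pair c o)
  from Ck_on_compose[OF o _ Z_C2 this] have z: "Ck_on 2 (%w. Z (snd (snd (snd w))) (fst (snd (snd w)))) N"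
    using K' by (simp add: image_subset_iff split_beta' mem_Times_iff)
  have "Ck_on 2 (%w. (snd (snd (snd w)), Z (snd (snd (snd w))) (fst (snd (snd w))))) N" by (intro Ck_on_Pair c z o)
  from Ck_on_compose[OF o _ f_C2 this]
  have fz: "Ck_on 2 (%w. f (snd (snd (snd w))) (Z (snd (snd (snd w))) (fst (snd (snd w))))) N"
    using K' Z_in by (simp add: image_subset_iff)
  have "Ck_on 2 (%w. (snd (snd (snd w)), fst (fst w), snd (fst w))) N" by (intro Ck_on_Pair c o)
  from Ck_on_compose[OF o _ L_C2 this] have L: "Ck_on 2 (%w. L (snd (snd (snd w))) (fst (fst w)) (snd (fst w))) N"
    using K' by (simp add: image_subset_iff split_beta' mem_Times_iff)
  have lam: "Ck_on 2 (%w. lam (snd (snd (snd w)))) N"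
    by (rule Ck_on_compose[OF o _ lam_C2 c(1)]) (use K' in auto)
  show ?thesis
    unfolding Fred_def[abs_def] Let_def
    by (intro Ck_on_Pair Ck_on_add Ck_on_diff Ck_on_scaleR Ck_on_inner Ck_on_const d z fz L lam c o)
qed

lemma Fred_zero:
  "Fred ((\<xi>, T), \<eta>, s, kp) = 0 \<longleftrightarrow>
    displacement ((\<xi>, T), \<eta>, s, kp) = (displacement ((\<xi>, T), \<eta>, s, kp) \<bullet> a') *\<^sub>R a \<and>
    (\<xi> - Z kp s) \<bullet> f kp (Z kp s) = 0 \<and> L kp \<xi> T = lam kp"
proof -
  have "v - (v \<bullet> a') *\<^sub>R a + c *\<^sub>R a = 0 \<longleftrightarrow> v = (v \<bullet> a') *\<^sub>R a \<and> c = 0" for v c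
  proof
    assume h: "v - (v \<bullet> a') *\<^sub>R a + c *\<^sub>R a = 0"
    have "(v - (v \<bullet> a') *\<^sub>R a + c *\<^sub>R a) \<bullet> a' = c"
      using a'_a by (simp add: inner_diff_left inner_add_left inner_commute[of a a'])
    then have "c = 0" using h by simp
    then show "v = (v \<bullet> a') *\<^sub>R a \<and> c = 0" using h by simp
  qed simp
  then show ?thesis unfolding Fred_def Let_def zero_prod_def prod.inject fst_conv snd_conv right_minus_eq by blast
qed

lemma Fred_even:
  assumes "((\<xi>, T), \<eta>, s, kp) \<in> N"
  shows "((\<xi>, T), - \<eta>, s, kp) \<in> N \<and> Fred ((\<xi>, T), - \<eta>, s, kp) = Fred ((\<xi>, T), \<eta>, s, kp)"
proof -
  have r: "(kp, \<eta>, T, \<xi>) \<in> Ret" using assms by (simp add: N_def)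
  show ?thesis using Ret_return(3)[OF r] Ret_return(4)[OF r] by (simp add: N_def Fred_def displacement_def Let_def)
qed

lemma Fred_orbit:
  assumes "kp \<in> K"
  shows "((Z kp s, real m * \<tau> kp), 0, s, kp) \<in> N" and "Fred ((Z kp s, real m * \<tau> kp), 0, s, kp) = 0"
proof -
  have T: "0 < real m * \<tau> kp" using m \<tau>_pos[OF assms] by simp
  note r = orbit_return(1,2)[OF assms T Z[OF assms], of s]
  show "((Z kp s, real m * \<tau> kp), 0, s, kp) \<in> N" using r(1) by (simp add: N_def)
  have "Z kp (s + real m * \<tau> kp) = Z kp s" by (rule periodic_multiple[of "Z kp"]) (rule Z_periodic[OF assms])
  then have "displacement ((Z kp s, real m * \<tau> kp), 0, s, kp) = 0" using r(2) by (simp add: displacement_def)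
  then show "Fred ((Z kp s, real m * \<tau> kp), 0, s, kp) = 0" unfolding Fred_zero by (simp add: L_orbit[OF assms])
qed

text \<open>Conservation of energy makes the displacement orthogonal to the gradient to first order, so
  that no information is lost by the projection.\<close>

lemma Fred_injective:
  assumes "frechet_derivative Fred (at ((z0, T0), 0, s0, kp0)) (w, 0) = 0"
  shows "w = 0"
proof -
  obtain h k where w: "w = (h, k)" by (cases w)
  have T: "0 < T0" using m \<tau>_pos[OF kp0] by simp
  let ?R = "%u :: 'a \<times> real. return_map (kp0, 0, snd u, fst u)"
  let ?U = "(%u :: 'a \<times> real. (kp0, 0 :: real, snd u, fst u)) -` Ret"
  have U: "open ?U" by (rule open_vimage[OF open_Ret]) (intro continuous_intros)
  have in_U: "(z0, T0) \<in> ?U" using Fred_orbit(1)[OF kp0, of s0] by (simp add: N_def)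
  have in_\<Omega>0: "(kp0, T0, z0) \<in> \<Omega>" using orbit_traj[OF kp0 Z[OF kp0]] by blast
  have "((%u :: 'a \<times> real. (snd u, fst u)) has_derivative (%v. (snd v, fst v))) (at (z0, T0))"
    by (auto intro!: derivative_eq_intros)
  from has_derivative_compose[OF this, of "%(t, x). traj (f kp0) D x t"] dtraj[OF in_\<Omega>0]
  have 1: "((%u. traj (f kp0) D (fst u) (snd u)) has_derivative (%v. dtraj kp0 T0 z0 (snd v, fst v))) (at (z0, T0))" by simp
  have dR: "(?R has_derivative (%v. dtraj kp0 T0 z0 (snd v, fst v))) (at (z0, T0))"
    by (rule has_derivative_transform_within_open[OF 1 U in_U]) (simp add: unperturbed_return)
  have df: "((%u :: 'a \<times> real. fst u) has_derivative (%v. fst v)) (at (z0, T0))"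
    by (rule has_derivative_fst[OF has_derivative_ident])
  have R0: "return_map (kp0, 0, T0, z0) = z0"
    using orbit_return(2)[OF kp0 T Z[OF kp0], of s0] periodic_multiple[of "Z kp0", OF Z_periodic[OF kp0], of s0 m] by simp
  have HR: "(H kp0 has_derivative (%h. a \<bullet> h)) (at (?R (z0, T0)))"
    and Hf: "(H kp0 has_derivative (%h. a \<bullet> h)) (at (fst (z0, T0)))"
    by (simp_all add: R0 a_def H_der[OF kp0 Z_in[OF kp0]])
  have 2: "((%u. H kp0 (?R u)) has_derivative (%v. a \<bullet> dtraj kp0 T0 z0 (snd v, fst v))) (at (z0, T0))"
    by (rule has_derivative_compose[OF dR HR])
  have "((%u :: 'a \<times> real. H kp0 (fst u)) has_derivative (%v. a \<bullet> dtraj kp0 T0 z0 (snd v, fst v))) (at (z0, T0))"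
  proof (rule has_derivative_transform_within_open[OF 2 U in_U])
    fix u assume "u \<in> ?U"
    then show "H kp0 (?R u) = H kp0 (fst u)" using Ret_return(2)[of kp0 0 "snd u" "fst u"] by simp
  qed
  from fun_cong[OF has_derivative_unique[OF this has_derivative_compose[OF df Hf]], of "(h, k)"]
  have energy: "a \<bullet> (dtraj kp0 T0 z0 (k, h) - h) = 0" by (simp add: inner_diff_right)
  have L1: "Ck_on (Suc 0) (%(kp, \<xi>, T). L kp \<xi> T) (K \<times> D \<times> {0<..})"
    using L_C2 unfolding numeral_2_eq_2 by (rule Ck_on_SucD)
  have oL: "open (K \<times> D \<times> {0 :: real<..})" using K D by (intro open_Times) auto
  have dL0: "((%(kp, \<xi>, T). L kp \<xi> T) has_derivative frechet_derivative (%(kp, \<xi>, T). L kp \<xi> T) (at (kp0, z0, T0))) (at (kp0, z0, T0))"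
    by (rule Ck_on_has_derivative_open[OF L1 oL]) (use kp0 T Z_in[OF kp0] in simp)
  have "((%u :: 'a \<times> real. (kp0, fst u, snd u)) has_derivative (%v. (0, fst v, snd v))) (at (z0, T0))"
    by (auto intro!: derivative_eq_intros)
  from has_derivative_compose[OF this, of "%(kp, \<xi>, T). L kp \<xi> T"] dL0
  have "\<exists>Lf'. ((%u. L kp0 (fst u) (snd u)) has_derivative Lf') (at (z0, T0))" by (auto simp: split_beta')
  then obtain Lf' where dL: "((%u. L kp0 (fst u) (snd u)) has_derivative Lf') (at (z0, T0))" ..
  let ?E = "%u :: 'a \<times> real. ?R u - fst u"
  have dE: "(?E has_derivative (%v. dtraj kp0 T0 z0 (snd v, fst v) - fst v)) (at (z0, T0))"
    by (rule has_derivative_diff[OF dR df])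
  note sl = bounded_linear.has_derivative[OF bounded_linear_scaleR_left]
  note il = bounded_linear.has_derivative[OF bounded_linear_inner_left]
  have dz: "((%u :: 'a \<times> real. fst u - z0) has_derivative (%v. fst v - 0)) (at (z0, T0))"
    by (rule has_derivative_diff[OF df has_derivative_const])
  have dlam: "((%u. L kp0 (fst u) (snd u) - lam kp0) has_derivative (%v. Lf' v - 0)) (at (z0, T0))"
    by (rule has_derivative_diff[OF dL has_derivative_const])
  from has_derivative_Pair[OF has_derivative_add[OF has_derivative_diff[OF dE sl[OF il[OF dE, of a'], of a]]
      sl[OF il[OF dz, of "f kp0 z0"], of a]] dlam]
  have d1: "((%u. Fred (u, 0, s0, kp0)) has_derivative (%v. (dtraj kp0 T0 z0 (snd v, fst v) - fst v -
      ((dtraj kp0 T0 z0 (snd v, fst v) - fst v) \<bullet> a') *\<^sub>R a + (fst v \<bullet> f kp0 z0) *\<^sub>R a, Lf' v))) (at (z0, T0))"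
    by (simp add: Fred_def displacement_def Let_def)
  have "(Fred has_derivative frechet_derivative Fred (at ((z0, T0), 0, s0, kp0))) (at ((z0, T0), 0, s0, kp0))"
    using Fred_C2 unfolding numeral_2_eq_2 by (rule Ck_on_has_derivative_open[OF _ open_N Fred_orbit(1)[OF kp0]])
  moreover have "((%u :: 'a \<times> real. (u, 0 :: real, s0, kp0)) has_derivative (%v. (v, 0))) (at (z0, T0))"
    by (auto intro!: derivative_eq_intros simp: zero_prod_def)
  ultimately have d2: "((%u. Fred (u, 0, s0, kp0)) has_derivative
      (%v. frechet_derivative Fred (at ((z0, T0), 0, s0, kp0)) (v, 0))) (at (z0, T0))"
    using has_derivative_compose[of "%u. (u, 0, s0, kp0)" "%v. (v, 0)" "(z0, T0)" UNIV Fred] by simp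
  let ?v = "dtraj kp0 T0 z0 (k, h) - h"
  have "(?v - (?v \<bullet> a') *\<^sub>R a + (h \<bullet> f kp0 z0) *\<^sub>R a, Lf' (h, k)) = 0"
    using fun_cong[OF has_derivative_unique[OF d1 d2], of "(h, k)"] assms w by simp
  then have 0: "?v - (?v \<bullet> a') *\<^sub>R a + (h \<bullet> f kp0 z0) *\<^sub>R a = 0" "Lf' (h, k) = 0" by (simp_all add: zero_prod_def)
  have va: "?v \<bullet> a' = 0" using energy by (simp add: a'_def inner_commute)
  have "(?v - (?v \<bullet> a') *\<^sub>R a + (h \<bullet> f kp0 z0) *\<^sub>R a) \<bullet> a' = 0" using 0(1) by simp
  then have hf: "h \<bullet> f kp0 z0 = 0" using a'_a va by (simp only: inner_add_left inner_diff_left inner_scaleR_left inner_commute[of a a'])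
  then have "dtraj kp0 T0 z0 (k, h) = h" using 0(1) va by simp
  from nondegenerate[OF dL this 0(2) hf] show ?thesis by (simp add: w zero_prod_def)
qed

text \<open>Energy is strictly monotone along the direction that the projection leaves free.\<close>

lemma energy_injective:
  assumes "kp \<in> K" and grad: "\<And>x. x \<in> ball z r ==> x \<in> D \<and> 0 < grad (H kp) x \<bullet> a"
    and x: "x \<in> ball z r" "x + c *\<^sub>R a \<in> ball z r" and eq: "H kp (x + c *\<^sub>R a) = H kp x"
  shows "c = 0"
proof -
  have in_ball: "x + (t * c) *\<^sub>R a \<in> ball z r" if t: "0 \<le> t" "t \<le> 1" for t
  proof -
    have "(1 - t) *\<^sub>R x + t *\<^sub>R (x + c *\<^sub>R a) \<in> ball z r" by (rule convexD_alt[OF convex_ball x t])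
    then show ?thesis by (simp add: algebra_simps)
  qed
  have "DERIV (%t. H kp (x + (t * c) *\<^sub>R a)) t :> c * (grad (H kp) (x + (t * c) *\<^sub>R a) \<bullet> a)" if t: "0 \<le> t" "t \<le> 1" for t
  proof -
    have "((%t. x + (t * c) *\<^sub>R a) has_derivative (%h. (h * c) *\<^sub>R a)) (at t)" by (auto intro!: derivative_eq_intros)
    from has_derivative_compose[OF this H_der[OF assms(1)]] grad[OF in_ball[OF t]]
    have "((%t. H kp (x + (t * c) *\<^sub>R a)) has_derivative (%h. grad (H kp) (x + (t * c) *\<^sub>R a) \<bullet> ((h * c) *\<^sub>R a))) (at t)" by blast
    moreover have "(%h. grad (H kp) (x + (t * c) *\<^sub>R a) \<bullet> ((h * c) *\<^sub>R a)) = (*) (c * (grad (H kp) (x + (t * c) *\<^sub>R a) \<bullet> a))"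
      by (rule ext) simp
    ultimately show ?thesis by (simp only: has_field_derivative_def)
  qed
  from MVT2[of 0 1 "%t. H kp (x + (t * c) *\<^sub>R a)", OF _ this]
  obtain t where t: "0 < t" "t < 1" "H kp (x + c *\<^sub>R a) - H kp x = c * (grad (H kp) (x + (t * c) *\<^sub>R a) \<bullet> a)" by auto
  have "0 < grad (H kp) (x + (t * c) *\<^sub>R a) \<bullet> a" using grad[OF in_ball[of t]] t by simp
  then show ?thesis using t(3) eq by simp
qed

lemma gradient_positive:
  obtains r where "0 < r" "\<And>kp x. \<bar>kp - kp0\<bar> < r ==> x \<in> ball z0 r ==> x \<in> D \<and> 0 < grad (H kp) x \<bullet> a"
proof -
  have o: "open (K \<times> D)" using K D by (rule open_Times)
  have "Ck_on 2 (%w. (case w of (kp, x) => grad (H kp) x) \<bullet> a) (K \<times> D)"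
    by (rule Ck_on_inner[OF o gradH_C2 Ck_on_const[OF o]])
  then have c: "continuous_on (K \<times> D) (%w. (case w of (kp, x) => grad (H kp) x) \<bullet> a)" by (rule Ck_on_imp_continuous_on)
  have in_KD: "(kp0, z0) \<in> K \<times> D" using kp0 Z_in by simp
  have "eventually (%v. v \<in> {0<..}) (nhds ((case (kp0, z0) of (kp, x) => grad (H kp) x) \<bullet> a))"
    by (rule eventually_nhds_in_open) (use a_nz in \<open>simp_all add: a_def\<close>)
  from eventually_nhds_curve[OF o in_KD c this] eventually_nhds_in_open[OF o in_KD]
  have "eventually (%w. w \<in> K \<times> D \<and> (case w of (kp, x) => grad (H kp) x) \<bullet> a \<in> {0<..}) (nhds (kp0, z0))"
    by (rule eventually_conj[rotated])
  then obtain e where e: "0 < e" "\<And>w. dist w (kp0, z0) < e ==> w \<in> K \<times> D \<and> (case w of (kp, x) => grad (H kp) x) \<bullet> a \<in> {0<..}"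
    unfolding eventually_nhds_metric by blast
  show thesis
  proof (rule that[of "e / 2"])
    fix kp x assume "\<bar>kp - kp0\<bar> < e / 2" "x \<in> ball z0 (e / 2)"
    moreover have "dist (kp, x) (kp0, z0) \<le> dist kp kp0 + dist x z0"
      unfolding dist_Pair_Pair by (rule sqrt_sum_squares_le_sum) simp_all
    ultimately have "dist (kp, x) (kp0, z0) < e" by (simp add: dist_real_def dist_commute)
    from e(2)[OF this] show "x \<in> D \<and> 0 < grad (H kp) x \<bullet> a" by simp
  qed (use e(1) in simp)
qed

text \<open>The implicit function theorem solves all equations but energy balance. What remains is the
  scalar equation that the energy transferred over the return time vanishes, and on unperturbed orbits
  this transfer is the Melnikov function.\<close>

theorem melnikov_reduction:
  shows "\<exists>R C0 B \<phi>. 0 < R \<and> Ck_on 2 B (box3 R s0 kp0) \<and> Ck_on 2 \<phi> (box3 R s0 kp0) \<and>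
    (\<forall>\<eta> s kp. (\<eta>, s, kp) \<in> box3 R s0 kp0 --> kp \<in> K \<and> \<bar>B (\<eta>, s, kp) - B (0, s, kp)\<bar> \<le> C0 * \<eta>\<^sup>2 \<and>
       B (0, s, kp) = melnikov (f kp) (g kp) (H kp) D (p kp) (\<tau> kp) m l s) \<and>
    (\<forall>\<eta> s s' kp. (\<eta>, s, kp) \<in> box3 R s0 kp0 --> (\<eta>, s', kp) \<in> box3 R s0 kp0 --> s < s' --> fst (\<phi> (\<eta>, s, kp)) \<noteq> fst (\<phi> (\<eta>, s', kp))) \<and>
    (\<forall>C\<ge>C0. \<exists>e>0. \<forall>\<eta> s kp. (\<eta>, s, kp) \<in> box3 R s0 kp0 --> 0 < \<eta> --> \<eta> < e -->
       perturbed_solutions (f kp) (g kp) (L kp) D (p kp) (\<tau> kp) (lam kp) m l C (\<eta>\<^sup>2) s =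
       (if B (\<eta>, s, kp) = 0 then {(fst (\<phi> (\<eta>, s, kp)), snd (\<phi> (\<eta>, s, kp)) / real l)} else {}))"
proof -
  let ?y0 = "(0 :: real, s0, kp0)" and ?u0 = "(z0, T0)"
  obtain Nu Ny \<phi> where imp: "open Nu" "open Ny" "?u0 \<in> Nu" "?y0 \<in> Ny" "Nu \<times> Ny \<subseteq> N" "Ck_on 2 \<phi> Ny"
      "\<And>y. y \<in> Ny ==> \<phi> y \<in> Nu" "\<And>u y. u \<in> Nu ==> y \<in> Ny ==> Fred (u, y) = 0 \<longleftrightarrow> u = \<phi> y"
    by (rule Ck_on_implicit_function[OF open_N Fred_C2 Fred_orbit(1)[OF kp0, of s0] Fred_orbit(2)[OF kp0, of s0] Fred_injective], assumption, (rule that; (assumption | simp)))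
  have \<phi>2: "Ck_on (Suc (Suc 0)) \<phi> Ny" using imp(6) by (simp only: numeral_2_eq_2)
  have \<phi>c: "continuous_on Ny \<phi>" using imp(6) by (rule Ck_on_imp_continuous_on)
  have \<phi>0: "\<phi> ?y0 = ?u0" using imp(8)[OF imp(3,4)] Fred_orbit(2)[OF kp0, of s0] by simp
  have \<phi>_sol: "Fred (\<phi> y, y) = 0" "(\<phi> y, y) \<in> N" if "y \<in> Ny" for y
  proof -
    show "Fred (\<phi> y, y) = 0" using imp(8)[OF imp(7)[OF that] that] by simp
    show "(\<phi> y, y) \<in> N" by (rule subsetD[OF imp(5)]) (use imp(7)[OF that] that in simp)
  qed
  obtain e1 where e1: "0 < e1" "ball ?u0 e1 \<subseteq> Nu" using imp(1,3) open_contains_ball by blast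
  define \<rho> where "\<rho> = e1 / 2"
  have \<rho>: "0 < \<rho>" "ball ?u0 (2 * \<rho>) \<subseteq> Nu" using e1 by (simp_all add: \<rho>_def)
  obtain r where r: "0 < r" "\<And>kp x. \<bar>kp - kp0\<bar> < r ==> x \<in> ball z0 r ==> x \<in> D \<and> 0 < grad (H kp) x \<bullet> a"
    by (rule gradient_positive) blast
  let ?U = "UNIV \<times> UNIV \<times> K :: (real \<times> real \<times> real) set"
  let ?ub = "%y :: real \<times> real \<times> real. (Z (snd (snd y)) (fst (snd y)), real m * \<tau> (snd (snd y)))"
  have oU: "open ?U" using K by (intro open_Times open_UNIV)
  have in_U: "?y0 \<in> ?U" using kp0 by simp
  have ubc: "continuous_on ?U ?ub"
  proof (rule continuous_on_Pair)
    have "continuous_on ?U (%y. (fst (snd y), snd (snd y)))" by (intro continuous_intros)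
    from continuous_on_compose2[OF Ck_on_imp_continuous_on[OF Z_C2] this]
    show "continuous_on ?U (%y. Z (snd (snd y)) (fst (snd y)))" by (simp add: image_subset_iff split_beta' mem_Times_iff)
    have "continuous_on ?U (%y. snd (snd y))" by (intro continuous_intros)
    from continuous_on_compose2[OF Ck_on_imp_continuous_on[OF \<tau>_C2] this]
    show "continuous_on ?U (%y. real m * \<tau> (snd (snd y)))" by (intro continuous_on_mult_left) (auto simp: image_subset_iff)
  qed
  have E2: "eventually (%y. ?ub y \<in> ball ?u0 \<rho>) (nhds ?y0)"
    by (rule eventually_nhds_curve[OF oU in_U ubc], rule eventually_nhds_in_open) (use \<rho>(1) in simp_all)
  have okp: "open {y :: real \<times> real \<times> real. \<bar>snd (snd y) - kp0\<bar> < r}"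
    by (intro open_Collect_less continuous_intros)
  have E3: "eventually (%y. y \<in> {y. \<bar>snd (snd y) - kp0\<bar> < r}) (nhds ?y0)"
    by (rule eventually_nhds_in_open[OF okp]) (use r(1) in simp)
  have "eventually (%y. y \<in> Ny \<and> y \<in> ?U \<and> ?ub y \<in> ball ?u0 \<rho>) (nhds ?y0)"
    by (intro eventually_conj eventually_nhds_in_open[OF imp(2,4)] eventually_nhds_in_open[OF oU in_U] E2)
  from eventually_box3[OF this] obtain R1 where R1: "0 < R1"
    "\<And>y. y \<in> box3 R1 s0 kp0 ==> y \<in> Ny \<and> y \<in> ?U \<and> ?ub y \<in> ball ?u0 \<rho>" by blast
  let ?B1 = "box3 R1 s0 kp0"
  have B1: "open ?B1" "?y0 \<in> ?B1" "?B1 \<subseteq> Ny" using open_box3 R1 by (auto simp: box3_iff)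
  define q where "q y = (snd (snd y), fst y, snd (\<phi> y), fst (\<phi> y))" for y
  define B where "B y = transfer (q y)" for y
  have q2: "Ck_on 2 q Ny" unfolding q_def[abs_def]
    by (intro Ck_on_Pair Ck_on_fst Ck_on_snd Ck_on_ident imp(2,6))
  have qRet: "q y \<in> Ret" if "y \<in> Ny" for y using \<phi>_sol(2)[OF that] by (simp add: q_def N_def)
  then have qRet': "q ` Ny \<subseteq> Ret" by blast
  have B2: "Ck_on 2 B Ny" unfolding B_def[abs_def] by (rule Ck_on_compose[OF imp(2) qRet' return_C2(2) q2])
  have Rc: "continuous_on Ny (%y. return_map (q y))"
    using Ck_on_compose[OF imp(2) qRet' return_C2(1) q2] by (rule Ck_on_imp_continuous_on)
  have \<phi>_even: "\<phi> (- \<eta>, s, kp) = \<phi> (\<eta>, s, kp)" if y: "(\<eta>, s, kp) \<in> ?B1" for \<eta> s kp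
  proof -
    have y': "(- \<eta>, s, kp) \<in> Ny" "(\<eta>, s, kp) \<in> Ny" using y B1(3) by (auto simp: box3_iff)
    have "Fred (\<phi> (\<eta>, s, kp), - \<eta>, s, kp) = 0"
      using Fred_even[of "fst (\<phi> (\<eta>, s, kp))" "snd (\<phi> (\<eta>, s, kp))" \<eta> s kp] \<phi>_sol[OF y'(2)] by simp
    then show ?thesis using imp(8)[OF imp(7)[OF y'(2)] y'(1)] by simp
  qed
  have B_even: "B (- \<eta>, s, kp) = B (\<eta>, s, kp)" if y: "(\<eta>, s, kp) \<in> ?B1" for \<eta> s kp
  proof -
    have "(kp, \<eta>, snd (\<phi> (\<eta>, s, kp)), fst (\<phi> (\<eta>, s, kp))) \<in> Ret"
      using qRet[OF subsetD[OF B1(3) y]] by (simp add: q_def)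
    from Ret_return(5)[OF this] show ?thesis by (simp add: B_def q_def \<phi>_even[OF y])
  qed
  obtain C1 where C1: "0 \<le> C1" "eventually (%(\<eta>, y). norm (\<phi> (\<eta>, y) - \<phi> (0, y)) \<le> C1 * \<eta>\<^sup>2) (nhds (0, s0, kp0))"
    using even_C2_bound[OF B1(1,2) Ck_on_open_subset[OF imp(6) B1(1,3)]] \<phi>_even by (auto simp: split_paired_all)
  obtain C2 where C2: "0 \<le> C2" "eventually (%(\<eta>, y). norm (B (\<eta>, y) - B (0, y)) \<le> C2 * \<eta>\<^sup>2) (nhds (0, s0, kp0))"
    using even_C2_bound[OF B1(1,2) Ck_on_open_subset[OF B2 B1(1,3)]] B_even by (auto simp: split_paired_all)
  have \<phi>_base: "\<phi> (0, s, kp) = (Z kp s, real m * \<tau> kp)" if y: "(0, s, kp) \<in> ?B1" for s kp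
  proof -
    have kp: "kp \<in> K" and "(Z kp s, real m * \<tau> kp) \<in> ball ?u0 \<rho>" using R1(2)[OF y] by auto
    then have "(Z kp s, real m * \<tau> kp) \<in> Nu" using \<rho> by (intro subsetD[OF \<rho>(2)]) simp
    then show ?thesis using imp(8)[of "(Z kp s, real m * \<tau> kp)" "(0, s, kp)"] Fred_orbit(2)[OF kp] R1(2)[OF y] by simp
  qed
  define d where "d y = fst (frechet_derivative \<phi> (at y) (0, 1, 0)) \<bullet> f kp0 z0" for y
  have \<phi>_der: "((%r. fst (\<phi> (\<eta>, r, kp))) has_derivative (%h. fst (frechet_derivative \<phi> (at (\<eta>, s, kp)) (0, h, 0)))) (at s)"
    if y: "(\<eta>, s, kp) \<in> Ny" for \<eta> s kp
  proof -
    have "((%r. (\<eta>, r, kp)) has_derivative (%h. (0, h, 0))) (at s)" by (auto intro!: derivative_eq_intros)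
    from has_derivative_compose[OF this Ck_on_has_derivative_open[OF \<phi>2 imp(2) y]] show ?thesis by (rule has_derivative_fst)
  qed
  have "d ?y0 = f kp0 z0 \<bullet> f kp0 z0"
  proof -
    have zd: "(Z kp0 has_derivative (%h. h *\<^sub>R f kp0 z0)) (at s0)"
      using Z[OF kp0] unfolding orbit_curve_def has_vector_derivative_def by blast
    have "(Z kp0 has_derivative (%h. fst (frechet_derivative \<phi> (at ?y0) (0, h, 0)))) (at s0)"
    proof (rule has_derivative_transform_within_open[OF \<phi>_der[OF imp(4)]])
      show "open {s0-R1<..<s0+R1}" "s0 \<in> {s0-R1<..<s0+R1}" using R1(1) by auto
      show "fst (\<phi> (0, s, kp0)) = Z kp0 s" if "s \<in> {s0-R1<..<s0+R1}" for s
      proof -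
        have "(0, s, kp0) \<in> ?B1" using that R1(1) by (auto simp: box3_iff)
        then show ?thesis by (simp add: \<phi>_base)
      qed
    qed
    from fun_cong[OF has_derivative_unique[OF this zd], of 1] show ?thesis by (simp add: d_def)
  qed
  moreover have "0 < f kp0 z0 \<bullet> f kp0 z0" using f_nz by simp
  ultimately have d0: "0 < d ?y0" by simp
  have "continuous_on Ny (%y. frechet_derivative \<phi> (at y) (0, 1, 0))"
    using Ck_on_derivative_open[OF \<phi>2 imp(2)] by (rule Ck_on_imp_continuous_on)
  then have dc: "continuous_on Ny d" unfolding d_def[abs_def] by (intro continuous_intros)
  have E5: "eventually (%y. d y \<in> {0<..}) (nhds ?y0)"
    by (rule eventually_nhds_curve[OF imp(2,4) dc], rule eventually_nhds_in_open) (use d0 in simp_all)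
  have R0: "return_map (q ?y0) = z0"
    using orbit_return(2)[OF kp0 _ Z[OF kp0], of T0 s0] periodic_multiple[of "Z kp0", OF Z_periodic[OF kp0], of s0 m]
      m \<tau>_pos[OF kp0] by (simp add: q_def \<phi>0)
  have E4: "eventually (%y. return_map (q y) \<in> ball z0 r) (nhds ?y0)"
    by (rule eventually_nhds_curve[OF imp(2,4) Rc], rule eventually_nhds_in_open) (use r(1) R0 in simp_all)
  have E4': "eventually (%y. fst (\<phi> y) \<in> ball z0 r) (nhds ?y0)"
    by (rule eventually_nhds_curve[OF imp(2,4) continuous_on_fst[OF \<phi>c]], rule eventually_nhds_in_open) (use r(1) \<phi>0 in simp_all)
  from eventually_box3[OF eventually_conj[OF eventually_nhds_in_open[OF B1(1,2)] eventually_conj[OF E3 eventually_conj[OF E5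
      eventually_conj[OF E4 eventually_conj[OF E4' eventually_conj[OF C1(2) C2(2)]]]]]]]
  obtain R where R: "0 < R" and box: "\<forall>y\<in>box3 R s0 kp0. y \<in> ?B1 \<and> y \<in> {y. \<bar>snd (snd y) - kp0\<bar> < r} \<and> d y \<in> {0<..} \<and>
      return_map (q y) \<in> ball z0 r \<and> fst (\<phi> y) \<in> ball z0 r \<and> (case y of (\<eta>, y) => norm (\<phi> (\<eta>, y) - \<phi> (0, y)) \<le> C1 * \<eta>\<^sup>2) \<and>
      (case y of (\<eta>, y) => norm (B (\<eta>, y) - B (0, y)) \<le> C2 * \<eta>\<^sup>2)"
    by (elim exE conjE) (rule that)
  let ?B = "box3 R s0 kp0" and ?C0 = "max C1 C2"
  have box': "(\<eta>, s, kp) \<in> ?B1" "kp \<in> K" "(\<eta>, s, kp) \<in> Ny" "(0, s, kp) \<in> ?B1" "\<bar>kp - kp0\<bar> < r" "0 < d (\<eta>, s, kp)"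
      "return_map (q (\<eta>, s, kp)) \<in> ball z0 r" "fst (\<phi> (\<eta>, s, kp)) \<in> ball z0 r"
      "norm (\<phi> (\<eta>, s, kp) - \<phi> (0, s, kp)) \<le> C1 * \<eta>\<^sup>2" "\<bar>B (\<eta>, s, kp) - B (0, s, kp)\<bar> \<le> C2 * \<eta>\<^sup>2"
    if y: "(\<eta>, s, kp) \<in> ?B" for \<eta> s kp
  proof -
    note b = bspec[OF box y]
    show B1': "(\<eta>, s, kp) \<in> ?B1" using b by blast
    show "kp \<in> K" "(\<eta>, s, kp) \<in> Ny" using R1(2)[OF B1'] by simp_all
    show "(0, s, kp) \<in> ?B1" using B1' R1(1) by (simp add: box3_iff)
    show "\<bar>kp - kp0\<bar> < r" "0 < d (\<eta>, s, kp)" "return_map (q (\<eta>, s, kp)) \<in> ball z0 r" "fst (\<phi> (\<eta>, s, kp)) \<in> ball z0 r"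
      "norm (\<phi> (\<eta>, s, kp) - \<phi> (0, s, kp)) \<le> C1 * \<eta>\<^sup>2" "\<bar>B (\<eta>, s, kp) - B (0, s, kp)\<bar> \<le> C2 * \<eta>\<^sup>2"
      using b by simp_all
  qed
  have BNy: "?B \<subseteq> Ny" using box'(3) by auto
  have close: "\<bar>B (\<eta>, s, kp) - B (0, s, kp)\<bar> \<le> ?C0 * \<eta>\<^sup>2" if "(\<eta>, s, kp) \<in> ?B" for \<eta> s kp
    using box'(10)[OF that] mult_right_mono[of C2 ?C0 "\<eta>\<^sup>2"] by simp
  have mel: "B (0, s, kp) = melnikov (f kp) (g kp) (H kp) D (p kp) (\<tau> kp) m l s" if y: "(\<eta>, s, kp) \<in> ?B" for \<eta> s kp
  proof -
    have kp: "kp \<in> K" by (rule box'(2)[OF y])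
    have "0 < real m * \<tau> kp" using m \<tau>_pos[OF kp] by simp
    from orbit_return(3)[OF kp this Z[OF kp], of s] show ?thesis
      by (simp add: B_def q_def \<phi>_base[OF box'(4)[OF y]] melnikov_def traj_Z[OF kp] add.commute mult.commute)
  qed
  have inj: "fst (\<phi> (\<eta>, s, kp)) \<noteq> fst (\<phi> (\<eta>, s', kp))"
    if y: "(\<eta>, s, kp) \<in> ?B" "(\<eta>, s', kp) \<in> ?B" "s < s'" for \<eta> s s' kp
  proof -
    have "fst (\<phi> (\<eta>, s, kp)) \<bullet> f kp0 z0 < fst (\<phi> (\<eta>, s', kp)) \<bullet> f kp0 z0"
    proof (rule DERIV_pos_imp_increasing[OF y(3)])
      fix t assume t: "s \<le> t" "t \<le> s'"
      then have yt: "(\<eta>, t, kp) \<in> ?B" using y(1,2) unfolding box3_iff by linarith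
      note D1 = bounded_linear.has_derivative[OF bounded_linear_inner_left \<phi>_der[OF box'(3)[OF yt]], of "f kp0 z0"]
      have lin: "linear (frechet_derivative \<phi> (at (\<eta>, t, kp)))"
        using Ck_on_has_derivative_open[OF \<phi>2 imp(2) box'(3)[OF yt]] by (rule has_derivative_linear)
      have "fst (frechet_derivative \<phi> (at (\<eta>, t, kp)) (0, h, 0)) \<bullet> f kp0 z0 = d (\<eta>, t, kp) * h" for h
        using linear_cmul[OF lin, of h "(0, 1, 0)"] by (simp add: d_def)
      with D1 have "DERIV (%r. fst (\<phi> (\<eta>, r, kp)) \<bullet> f kp0 z0) t :> d (\<eta>, t, kp)"
        by (simp add: has_field_derivative_def)
      then show "\<exists>v. DERIV (%r. fst (\<phi> (\<eta>, r, kp)) \<bullet> f kp0 z0) t :> v \<and> 0 < v" using box'(6)[OF yt] by blast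
    qed
    then show ?thesis by auto
  qed
  have sol: "\<exists>e>0. \<forall>\<eta> s kp. (\<eta>, s, kp) \<in> ?B --> 0 < \<eta> --> \<eta> < e -->
       perturbed_solutions (f kp) (g kp) (L kp) D (p kp) (\<tau> kp) (lam kp) m l C (\<eta>\<^sup>2) s =
       (if B (\<eta>, s, kp) = 0 then {(fst (\<phi> (\<eta>, s, kp)), snd (\<phi> (\<eta>, s, kp)) / real l)} else {})" if C: "?C0 \<le> C" for C
  proof -
    have C0: "0 \<le> C" "C1 \<le> C" using C C1(1) by auto
    \<comment> \<open>Below this bound every solution with constant \<open>C\<close> lies in the neighbourhood in which the implicit
      function is the only zero.\<close>
    define e where "e = min 1 (\<rho> / (C + 1))"
    have e: "0 < e" using \<rho>(1) C0 by (simp add: e_def)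
    have small: "\<eta>\<^sup>2 * C < \<rho>" if "0 < \<eta>" "\<eta> < e" for \<eta>
    proof -
      have "\<eta> * (C + 1) < \<rho>" using that C0 by (simp add: e_def pos_less_divide_eq)
      moreover have "\<eta>\<^sup>2 * C \<le> \<eta> * (C + 1)"
        using that C0 by (intro mult_mono) (simp_all add: e_def power2_eq_square mult_le_one mult_left_le)
      ultimately show ?thesis by simp
    qed
    have "perturbed_solutions (f kp) (g kp) (L kp) D (p kp) (\<tau> kp) (lam kp) m l C (\<eta>\<^sup>2) s =
       (if B (\<eta>, s, kp) = 0 then {(fst (\<phi> (\<eta>, s, kp)), snd (\<phi> (\<eta>, s, kp)) / real l)} else {})"
      if y: "(\<eta>, s, kp) \<in> ?B" and \<eta>: "0 < \<eta>" "\<eta> < e" for \<eta> s kp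
    proof -
      let ?y = "(\<eta>, s, kp)" and ?S = "perturbed_solutions (f kp) (g kp) (L kp) D (p kp) (\<tau> kp) (lam kp) m l C (\<eta>\<^sup>2) s"
      have kp: "kp \<in> K" by (rule box'(2)[OF y])
      have lpos: "real l \<noteq> 0" using l by simp
      have qy: "(kp, \<eta>, snd (\<phi> ?y), fst (\<phi> ?y)) \<in> Ret" using qRet[OF box'(3)[OF y]] by (simp add: q_def)
      have in_I: "\<eta> \<in> I" and Tpos: "0 < snd (\<phi> ?y)" using Ret_flows[OF qy] by auto
      have only: "B ?y = 0 \<and> w = (fst (\<phi> ?y), snd (\<phi> ?y) / real l)" if "w \<in> ?S" for w
      proof -
        obtain \<xi> T \<delta> \<sigma> where w: "w = (\<xi>, T)" and T: "0 < T"
          and fl: "flows_to (%t x. f kp x + \<eta>\<^sup>2 *\<^sub>R g kp x t T (\<eta>\<^sup>2)) D \<xi> (real l * T) \<xi>" and LT: "L kp \<xi> (real l * T) = lam kp"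
          and \<delta>: "\<xi> = Z kp s + \<eta>\<^sup>2 *\<^sub>R \<delta>" "\<delta> \<bullet> f kp (Z kp s) = 0" "real l * T = real m * \<tau> kp + \<eta>\<^sup>2 * \<sigma>" "norm (\<delta>, \<sigma>) \<le> C"
          using \<open>w \<in> ?S\<close> unfolding perturbed_solutions_def traj_Z[OF kp] by blast
        define T' where "T' = real l * T"
        have T': "0 < T'" "T' / real l = T" using T l by (simp_all add: T'_def)
        have fl': "flows_to (pfield kp \<eta> T') D \<xi> T' \<xi>" using fl by (simp add: T'(2) flip: T'_def)
        note fr = flows_return[OF kp in_I T'(1) fl']
        have "(\<xi>, T') - ?ub ?y = \<eta>\<^sup>2 *\<^sub>R (\<delta>, \<sigma>)" using \<delta>(1,3) by (simp add: T'_def)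
        then have "norm ((\<xi>, T') - ?ub ?y) = \<eta>\<^sup>2 * norm (\<delta>, \<sigma>)" by (simp only: norm_scaleR) simp
        also have "\<dots> \<le> \<eta>\<^sup>2 * C" using \<delta>(4) by (rule mult_left_mono) simp
        also have "\<dots> < \<rho>" by (rule small[OF \<eta>])
        finally have "dist (\<xi>, T') (?ub ?y) < \<rho>" by (simp only: dist_norm)
        moreover have "dist (?ub ?y) ?u0 < \<rho>" using R1(2)[OF box'(1)[OF y]] by (simp add: dist_commute)
        ultimately have "dist (\<xi>, T') ?u0 < 2 * \<rho>" using dist_triangle[of "(\<xi>, T')" ?u0 "?ub ?y"] by linarith
        then have "(\<xi>, T') \<in> Nu" using \<rho>(2) by (intro subsetD[OF \<rho>(2)]) (simp add: dist_commute)
        moreover have "Fred ((\<xi>, T'), ?y) = 0"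
          unfolding Fred_zero using fr(2) \<delta>(1,2) LT by (simp add: displacement_def T'_def)
        ultimately have \<phi>: "\<phi> ?y = (\<xi>, T')" using imp(8)[OF _ box'(3)[OF y]] by simp
        have "B ?y = 0" using fr(3) \<eta>(1) by (simp add: B_def q_def \<phi>)
        then show ?thesis using T'(2) by (simp add: w \<phi>)
      qed
      have exists: "(fst (\<phi> ?y), snd (\<phi> ?y) / real l) \<in> ?S" if B0: "B ?y = 0"
      proof -
        obtain \<xi> T where \<phi>: "\<phi> ?y = (\<xi>, T)" by (cases "\<phi> ?y")
        have qy': "(kp, \<eta>, T, \<xi>) \<in> Ret" using qy by (simp add: \<phi>)
        have F0: "Fred ((\<xi>, T), ?y) = 0" using \<phi>_sol(1)[OF box'(3)[OF y]] by (simp add: \<phi>)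
        define c where "c = displacement ((\<xi>, T), ?y) \<bullet> a'"
        have "displacement ((\<xi>, T), ?y) = c *\<^sub>R a" "(\<xi> - Z kp s) \<bullet> f kp (Z kp s) = 0" "L kp \<xi> T = lam kp"
          using F0 unfolding Fred_zero c_def by blast+
        then have F: "return_map (kp, \<eta>, T, \<xi>) = \<xi> + c *\<^sub>R a" "(\<xi> - Z kp s) \<bullet> f kp (Z kp s) = 0" "L kp \<xi> T = lam kp"
          by (simp_all add: displacement_def algebra_simps)
        have "H kp (\<xi> + c *\<^sub>R a) = H kp \<xi>" using Ret_return(2)[OF qy'] B0 by (simp add: B_def q_def \<phi> F(1))
        moreover have "\<xi> \<in> ball z0 r" "\<xi> + c *\<^sub>R a \<in> ball z0 r" using box'(7,8)[OF y] by (simp_all add: q_def \<phi> F(1))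
        ultimately have "c = 0" by (intro energy_injective[OF kp r(2)[OF box'(5)[OF y]]])
        then have fl: "flows_to (pfield kp \<eta> T) D \<xi> T \<xi>" using Ret_return(1)[OF qy'] F(1) by simp
        define \<delta> \<sigma> where "\<delta> = (1 / \<eta>\<^sup>2) *\<^sub>R (\<xi> - Z kp s)" and "\<sigma> = (T - real m * \<tau> kp) / \<eta>\<^sup>2"
        have "(\<delta>, \<sigma>) = (1 / \<eta>\<^sup>2) *\<^sub>R (\<phi> ?y - \<phi> (0, s, kp))"
          by (simp add: \<delta>_def \<sigma>_def \<phi> \<phi>_base[OF box'(4)[OF y]])
        then have "norm (\<delta>, \<sigma>) = (1 / \<eta>\<^sup>2) * norm (\<phi> ?y - \<phi> (0, s, kp))" by (simp only: norm_scaleR) simp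
        also have "\<dots> \<le> C1" using box'(9)[OF y] \<eta>(1) by (simp add: pos_divide_le_eq)
        finally have "norm (\<delta>, \<sigma>) \<le> C" using C0(2) by simp
        moreover have "\<xi> = Z kp s + \<eta>\<^sup>2 *\<^sub>R \<delta>" "\<delta> \<bullet> f kp (Z kp s) = 0" "T = real m * \<tau> kp + \<eta>\<^sup>2 * \<sigma>"
          using \<eta>(1) F(2) by (simp_all add: \<delta>_def \<sigma>_def)
        moreover have "0 < T / real l" "real l * (T / real l) = T" using Tpos l by (simp_all add: \<phi>)
        ultimately show ?thesis
          unfolding perturbed_solutions_def traj_Z[OF kp] \<phi> using fl F(3) by auto
      qed
      show ?thesis
      proof (cases "B ?y = 0")
        case True
        have "?S = {(fst (\<phi> ?y), snd (\<phi> ?y) / real l)}" using only exists[OF True] by blast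
        then show ?thesis using True by simp
      next
        case False
        have "?S = {}" using only False by blast
        then show ?thesis using False by simp
      qed
    qed
    then show ?thesis using e by (intro exI[of _ e]) simp
  qed
  have B_C2: "Ck_on 2 B ?B" by (rule Ck_on_open_subset[OF B2 open_box3 BNy])
  have \<phi>_C2: "Ck_on 2 \<phi> ?B" by (rule Ck_on_open_subset[OF imp(6) open_box3 BNy])
  show ?thesis
    by (rule exI[of _ R], rule exI[of _ ?C0], rule exI[of _ B], rule exI[of _ \<phi>], intro conjI allI impI)
      (use R B_C2 \<phi>_C2 box'(2) close mel inj sol in \<open>assumption | blast\<close>)+
qed

end

section \<open>Bifurcations of the reduced problem\<close>

text \<open>Both mixed derivatives are limits of the same second difference quotient.\<close>

lemma mixed_partials_eq:
  fixes \<phi> \<phi>s \<phi>k \<phi>sk \<phi>ks :: "real => real => real"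
  assumes R: "0 < R"
    and ds: "\<And>s kp. \<bar>s - s0\<bar> < R ==> \<bar>kp - k0\<bar> < R ==> DERIV (%s. \<phi> s kp) s :> \<phi>s s kp"
    and dk: "\<And>s kp. \<bar>s - s0\<bar> < R ==> \<bar>kp - k0\<bar> < R ==> DERIV (%kp. \<phi> s kp) kp :> \<phi>k s kp"
    and dsk: "\<And>s kp. \<bar>s - s0\<bar> < R ==> \<bar>kp - k0\<bar> < R ==> DERIV (%kp. \<phi>s s kp) kp :> \<phi>sk s kp"
    and dks: "\<And>s kp. \<bar>s - s0\<bar> < R ==> \<bar>kp - k0\<bar> < R ==> DERIV (%s. \<phi>k s kp) s :> \<phi>ks s kp"
    and c: "isCont (%(s, kp). \<phi>sk s kp) (s0, k0)" "isCont (%(s, kp). \<phi>ks s kp) (s0, k0)"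
  shows "\<phi>sk s0 k0 = \<phi>ks s0 k0"
proof (rule ccontr)
  assume ne: "\<phi>sk s0 k0 \<noteq> \<phi>ks s0 k0"
  define e where "e = \<bar>\<phi>sk s0 k0 - \<phi>ks s0 k0\<bar> / 2"
  have e: "0 < e" using ne by (simp add: e_def)
  obtain d1 where d1: "0 < d1" "\<And>x. dist x (s0, k0) < d1 ==> dist ((%(s, kp). \<phi>sk s kp) x) (\<phi>sk s0 k0) < e"
    using c(1) e unfolding continuous_at_eps_delta by auto
  obtain d2 where d2: "0 < d2" "\<And>x. dist x (s0, k0) < d2 ==> dist ((%(s, kp). \<phi>ks s kp) x) (\<phi>ks s0 k0) < e"
    using c(2) e unfolding continuous_at_eps_delta by auto
  define h where "h = min (min d1 d2 / 3) (R / 2)"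
  have h: "0 < h" "h < R" "2 * h < d1" "2 * h < d2" using R d1(1) d2(1) by (auto simp: h_def)
  have near: "dist (s, kp) (s0, k0) < 2 * h + (d - 2 * h)" if "s0 < s" "s < s0 + h" "k0 < kp" "kp < k0 + h" "2 * h < d" for s kp d
  proof -
    have "dist (s, kp) (s0, k0) \<le> dist s s0 + dist kp k0"
      unfolding dist_Pair_Pair by (rule sqrt_sum_squares_le_sum) simp_all
    then show ?thesis using that by (simp add: dist_real_def)
  qed
  let ?\<Delta> = "\<phi> (s0 + h) (k0 + h) - \<phi> (s0 + h) k0 - (\<phi> s0 (k0 + h) - \<phi> s0 k0)"
  have "\<exists>z>s0. z < s0 + h \<and> (\<phi> (s0 + h) (k0 + h) - \<phi> (s0 + h) k0) - (\<phi> s0 (k0 + h) - \<phi> s0 k0) =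
      (s0 + h - s0) * (\<phi>s z (k0 + h) - \<phi>s z k0)"
    by (rule MVT2) (use h in \<open>auto intro!: DERIV_diff ds\<close>)
  then obtain s1 where s1: "s0 < s1" "s1 < s0 + h" "?\<Delta> = h * (\<phi>s s1 (k0 + h) - \<phi>s s1 k0)" by auto
  have "\<exists>z>k0. z < k0 + h \<and> \<phi>s s1 (k0 + h) - \<phi>s s1 k0 = (k0 + h - k0) * \<phi>sk s1 z"
    by (rule MVT2) (use h s1 in \<open>auto intro!: dsk\<close>)
  then obtain k1 where k1: "k0 < k1" "k1 < k0 + h" "\<phi>s s1 (k0 + h) - \<phi>s s1 k0 = h * \<phi>sk s1 k1" by auto
  have "\<exists>z>k0. z < k0 + h \<and> (\<phi> (s0 + h) (k0 + h) - \<phi> s0 (k0 + h)) - (\<phi> (s0 + h) k0 - \<phi> s0 k0) =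
      (k0 + h - k0) * (\<phi>k (s0 + h) z - \<phi>k s0 z)"
    by (rule MVT2) (use h in \<open>auto intro!: DERIV_diff dk\<close>)
  then obtain k2 where k2: "k0 < k2" "k2 < k0 + h" "?\<Delta> = h * (\<phi>k (s0 + h) k2 - \<phi>k s0 k2)" by auto
  have "\<exists>z>s0. z < s0 + h \<and> \<phi>k (s0 + h) k2 - \<phi>k s0 k2 = (s0 + h - s0) * \<phi>ks z k2"
    by (rule MVT2) (use h k2 in \<open>auto intro!: dks\<close>)
  then obtain s2 where s2: "s0 < s2" "s2 < s0 + h" "\<phi>k (s0 + h) k2 - \<phi>k s0 k2 = h * \<phi>ks s2 k2" by auto
  have "?\<Delta> = h * (h * \<phi>sk s1 k1)" using s1(3) unfolding k1(3) .
  moreover have "?\<Delta> = h * (h * \<phi>ks s2 k2)" using k2(3) unfolding s2(3) .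
  ultimately have "h * (h * \<phi>sk s1 k1) = h * (h * \<phi>ks s2 k2)" by (rule trans[OF sym])
  then have eq: "\<phi>sk s1 k1 = \<phi>ks s2 k2" using h(1) by simp
  have "dist (\<phi>sk s1 k1) (\<phi>sk s0 k0) < e" using d1(2)[of "(s1, k1)"] near[OF s1(1,2) k1(1,2) h(3)] by simp
  moreover have "dist (\<phi>ks s2 k2) (\<phi>ks s0 k0) < e" using d2(2)[of "(s2, k2)"] near[OF s2(1,2) k2(1,2) h(4)] by simp
  ultimately have "\<bar>\<phi>sk s0 k0 - \<phi>ks s0 k0\<bar> < e + e" unfolding eq dist_real_def by linarith
  then show False by (simp add: e_def)
qed

lemma slice_derivative:
  fixes F :: "real \<times> real \<times> real => real"
  assumes F: "Ck_on (Suc n) F (box3 R s0 k0)" and y: "(\<eta>, s, kp) \<in> box3 R s0 k0"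
  shows "((%(s, kp). F (\<eta>, s, kp)) has_derivative (%(h, k). frechet_derivative F (at (\<eta>, s, kp)) (0, 1, 0) * h +
      frechet_derivative F (at (\<eta>, s, kp)) (0, 0, 1) * k)) (at (s, kp))"
proof -
  let ?F' = "frechet_derivative F (at (\<eta>, s, kp))"
  have d: "(F has_derivative ?F') (at (\<eta>, s, kp))" by (rule Ck_on_has_derivative_open[OF F open_box3 y])
  have "((%q. (\<eta>, q)) has_derivative (%q. (0, q))) (at (s, kp))" by (auto intro!: derivative_eq_intros)
  from has_derivative_compose[OF this d] have 1: "((%q. F (\<eta>, q)) has_derivative (%q. ?F' (0, q))) (at (s, kp))" .
  have lin: "linear ?F'" by (rule has_derivative_linear[OF d])
  have eq: "?F' (0, h, k) = ?F' (0, 1, 0) * h + ?F' (0, 0, 1) * k" for h k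
  proof -
    have "?F' (0, h, k) = ?F' (h *\<^sub>R (0, 1, 0) + k *\<^sub>R (0, 0, 1))" by simp
    also have "\<dots> = h *\<^sub>R ?F' (0, 1, 0) + k *\<^sub>R ?F' (0, 0, 1)" by (simp only: linear_add[OF lin] linear_cmul[OF lin])
    finally show ?thesis by simp
  qed
  have "(%q. ?F' (0, q)) = (%(h, k). ?F' (0, 1, 0) * h + ?F' (0, 0, 1) * k)"
  proof
    fix q
    show "?F' (0, q) = (case q of (h, k) => ?F' (0, 1, 0) * h + ?F' (0, 0, 1) * k)"
      using eq[of "fst q" "snd q"] by (simp add: split_beta')
  qed
  moreover have "(%q. F (\<eta>, q)) = (%(s, kp). F (\<eta>, s, kp))" by (simp add: split_beta')
  ultimately show ?thesis using 1 by (simp only:)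
qed

lemma partial_derivatives:
  fixes F :: "real \<times> real \<times> real => real"
  assumes F: "Ck_on (Suc n) F (box3 R s0 k0)" and y: "(\<eta>, s, kp) \<in> box3 R s0 k0"
  shows "DERIV (%s. F (\<eta>, s, kp)) s :> frechet_derivative F (at (\<eta>, s, kp)) (0, 1, 0)"
    and "DERIV (%kp. F (\<eta>, s, kp)) kp :> frechet_derivative F (at (\<eta>, s, kp)) (0, 0, 1)"
proof -
  have 1: "((%s. (s, kp)) has_derivative (%h. (h, 0))) (at s)" by (auto intro!: derivative_eq_intros)
  from has_derivative_compose[OF 1 slice_derivative[OF F y]]
  show "DERIV (%s. F (\<eta>, s, kp)) s :> frechet_derivative F (at (\<eta>, s, kp)) (0, 1, 0)"
    by (simp add: has_field_derivative_def)
  have 2: "((%kp. (s, kp)) has_derivative (%k. (0, k))) (at kp)" by (auto intro!: derivative_eq_intros)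
  from has_derivative_compose[OF 2 slice_derivative[OF F y]]
  show "DERIV (%kp. F (\<eta>, s, kp)) kp :> frechet_derivative F (at (\<eta>, s, kp)) (0, 0, 1)"
    by (simp add: has_field_derivative_def)
qed

lemma D1_D2_slice:
  fixes F :: "real \<times> real \<times> real => real"
  assumes F: "Ck_on (Suc n) F (box3 R s0 k0)" and y: "\<bar>s - s0\<bar> < R" "\<bar>kp - k0\<bar> < R"
    and G: "\<And>s kp. \<bar>s - s0\<bar> < R ==> \<bar>kp - k0\<bar> < R ==> G s kp = c * F (0, s, kp)"
  shows "D1 G s kp = c * frechet_derivative F (at (0, s, kp)) (0, 1, 0)"
    and "D2 G s kp = c * frechet_derivative F (at (0, s, kp)) (0, 0, 1)"
proof -
  have y0: "(0, s, kp) \<in> box3 R s0 k0" using y by (simp add: box3_iff)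
  have "DERIV (%s. G s kp) s :> c * frechet_derivative F (at (0, s, kp)) (0, 1, 0)"
  proof (rule has_field_derivative_transform_within_open[OF DERIV_cmult[OF partial_derivatives(1)[OF F y0]]])
    show "open {s0-R<..<s0+R}" "s \<in> {s0-R<..<s0+R}" using y(1) by auto
    show "c * F (0, r, kp) = G r kp" if "r \<in> {s0-R<..<s0+R}" for r using G[of r kp] y that by auto
  qed
  then show "D1 G s kp = c * frechet_derivative F (at (0, s, kp)) (0, 1, 0)" unfolding D1_def by (rule DERIV_imp_deriv)
  have "DERIV (%kp. G s kp) kp :> c * frechet_derivative F (at (0, s, kp)) (0, 0, 1)"
  proof (rule has_field_derivative_transform_within_open[OF DERIV_cmult[OF partial_derivatives(2)[OF F y0]]])
    show "open {k0-R<..<k0+R}" "kp \<in> {k0-R<..<k0+R}" using y(2) by auto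
    show "c * F (0, s, r) = G s r" if "r \<in> {k0-R<..<k0+R}" for r using G[of s r] y that by auto
  qed
  then show "D2 G s kp = c * frechet_derivative F (at (0, s, kp)) (0, 0, 1)" unfolding D2_def by (rule DERIV_imp_deriv)
qed

lemma eventually_at_right_range: "0 < (R :: real) ==> eventually (%a. 0 < a \<and> a < R) (at_right 0)"
  unfolding eventually_at_right_field by auto

lemma eventually_sqrt:
  assumes "eventually P (at_right (0 :: real))"
  shows "eventually (%\<epsilon>. P (sqrt \<epsilon>)) (at_right 0)"
proof -
  obtain b where b: "0 < b" "\<And>y. 0 < y ==> y < b ==> P y" using assms unfolding eventually_at_right_field by auto
  have "P (sqrt \<epsilon>)" if "0 < \<epsilon>" "\<epsilon> < b\<^sup>2" for \<epsilon>
    using that b(1) by (intro b(2)) (auto intro: real_less_lsqrt)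
  then show ?thesis unfolding eventually_at_right_field using b(1) by (intro exI[of _ "b\<^sup>2"]) simp
qed

lemma eventually_nested_sqrt:
  fixes P Q :: "real => real => real => bool"
  assumes "\<forall>\<^sub>F a in at_right 0. \<forall>\<^sub>F \<beta> in at_right 0. \<forall>\<^sub>F \<eta> in at_right 0. P a \<beta> \<eta>"
    and R: "0 < R" "0 < e" and step: "\<And>a \<beta> \<eta>. 0 < a ==> a < R ==> 0 < \<beta> ==> \<beta> < R ==> 0 < \<eta> ==> \<eta> < e ==>
      P a \<beta> \<eta> ==> Q a \<beta> (\<eta>\<^sup>2)"
  shows "\<forall>\<^sub>F a in at_right 0. \<forall>\<^sub>F \<beta> in at_right 0. \<forall>\<^sub>F \<epsilon> in at_right 0. Q a \<beta> \<epsilon>"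
  using assms(1) eventually_at_right_range[OF R(1)]
proof eventually_elim
  case (elim a)
  from elim(1) eventually_at_right_range[OF R(1)] show ?case
  proof eventually_elim
    case e2: (elim \<beta>)
    have "0 < e\<^sup>2" using R(2) by simp
    from eventually_sqrt[OF e2(1)] eventually_at_right_range[OF this] show ?case
    proof eventually_elim
      case e3: (elim \<epsilon>)
      have "sqrt \<epsilon> < e" using e3(2) R(2) by (auto intro: real_less_lsqrt)
      then have "Q a \<beta> ((sqrt \<epsilon>)\<^sup>2)" using e3 e2(2) elim(2) by (intro step) auto
      then show ?case using e3(2) by simp
    qed
  qed
qed

text \<open>A saddle-node of phases is one of solutions, as the solution depends continuously and injectively
  on the phase.\<close>

lemma saddle_node_image:
  fixes E :: "real \<times> real => 'c::topological_space"
  assumes sn: "saddle_node Q J ksn" and Q: "\<And>kp. kp \<in> J ==> Q kp \<subseteq> A"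
    and P: "\<And>kp. kp \<in> J ==> P kp = (%s. E (s, kp)) ` Q kp"
    and E: "continuous_on (A \<times> J) E" and inj: "\<And>kp s s'. kp \<in> J ==> s \<in> A ==> s' \<in> A ==> s \<noteq> s' ==> E (s, kp) \<noteq> E (s', kp)"
  shows "saddle_node P J ksn"
proof -
  obtain d x1 x2 where int: "ksn \<in> interior J" and d: "d \<in> {1, -1}"
    and c: "continuous_on {kp\<in>J. 0 \<le> d * (kp - ksn)} x1" "continuous_on {kp\<in>J. 0 \<le> d * (kp - ksn)} x2"
    and pos: "\<And>kp. kp \<in> J ==> 0 < d * (kp - ksn) ==> x1 kp \<noteq> x2 kp \<and> Q kp = {x1 kp, x2 kp}"
    and at: "x1 ksn = x2 ksn" "Q ksn = {x1 ksn}" and neg: "\<And>kp. kp \<in> J ==> d * (kp - ksn) < 0 ==> Q kp = {}"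
    using sn unfolding saddle_node_def by blast
  have ksn: "ksn \<in> J" using int interior_subset by blast
  have in_A: "x1 kp \<in> A \<and> x2 kp \<in> A" if "kp \<in> {kp\<in>J. 0 \<le> d * (kp - ksn)}" for kp
  proof (cases "kp = ksn")
    case True
    then show ?thesis using at Q[OF ksn] by auto
  next
    case False
    then have "0 < d * (kp - ksn)" using that d by auto
    then show ?thesis using pos[of kp] Q[of kp] that by auto
  qed
  have cont: "continuous_on {kp\<in>J. 0 \<le> d * (kp - ksn)} (%kp. E (x kp, kp))"
    if "continuous_on {kp\<in>J. 0 \<le> d * (kp - ksn)} x" "\<And>kp. kp \<in> {kp\<in>J. 0 \<le> d * (kp - ksn)} ==> x kp \<in> A" for x
  proof (rule continuous_on_compose2[OF E])
    show "continuous_on {kp\<in>J. 0 \<le> d * (kp - ksn)} (%kp. (x kp, kp))" by (intro continuous_on_Pair that(1) continuous_on_id)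
    show "(%kp. (x kp, kp)) ` {kp\<in>J. 0 \<le> d * (kp - ksn)} \<subseteq> A \<times> J" using that(2) by auto
  qed
  have c1: "continuous_on {kp\<in>J. 0 \<le> d * (kp - ksn)} (%kp. E (x1 kp, kp))"
    and c2: "continuous_on {kp\<in>J. 0 \<le> d * (kp - ksn)} (%kp. E (x2 kp, kp))"
    by (rule cont[OF c(1)], use in_A in blast, rule cont[OF c(2)], use in_A in blast)
  have pos': "\<forall>kp\<in>J. 0 < d * (kp - ksn) --> E (x1 kp, kp) \<noteq> E (x2 kp, kp) \<and> P kp = {E (x1 kp, kp), E (x2 kp, kp)}"
  proof (intro ballI impI)
    fix kp assume k: "kp \<in> J" "0 < d * (kp - ksn)"
    then have "x1 kp \<in> A \<and> x2 kp \<in> A" by (intro in_A) simp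
    then show "E (x1 kp, kp) \<noteq> E (x2 kp, kp) \<and> P kp = {E (x1 kp, kp), E (x2 kp, kp)}"
      using pos[OF k] inj[OF k(1)] P[OF k(1)] by simp
  qed
  have at': "E (x1 ksn, ksn) = E (x2 ksn, ksn)" "P ksn = {E (x1 ksn, ksn)}" using at P[OF ksn] by simp_all
  have neg': "\<forall>kp\<in>J. d * (kp - ksn) < 0 --> P kp = {}" using neg P by simp
  show ?thesis
    unfolding saddle_node_def
    by (rule conjI[OF int], rule bexI[OF _ d], rule exI[of _ "%kp. E (x1 kp, kp)"], rule exI[of _ "%kp. E (x2 kp, kp)"],
        intro conjI c1 c2 pos' at' neg')
qed

text \<open>\<open>E\<close> sends a zero of \<open>B\<close> to the solution with this phase.\<close>

locale reduced_problem =
  fixes B :: "real \<times> real \<times> real => real" and E :: "real \<times> real \<times> real => 'c::topological_space"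
    and Mel :: "real => real => real" and Sol :: "real => real => real => real => 'c set" and R C0 s0 k0 :: real
  assumes R: "0 < R" and B_C2: "Ck_on 2 B (box3 R s0 k0)" and E_cont: "continuous_on (box3 R s0 k0) E"
    and close: "\<And>\<eta> s kp. (\<eta>, s, kp) \<in> box3 R s0 k0 ==> \<bar>B (\<eta>, s, kp) - B (0, s, kp)\<bar> \<le> C0 * \<eta>\<^sup>2"
    and mel: "\<And>s kp. \<bar>s - s0\<bar> < R ==> \<bar>kp - k0\<bar> < R ==> Mel s kp = B (0, s, kp)"
    and E_inj: "\<And>\<eta> s s' kp. (\<eta>, s, kp) \<in> box3 R s0 k0 ==> (\<eta>, s', kp) \<in> box3 R s0 k0 ==> s \<noteq> s' ==> E (\<eta>, s, kp) \<noteq> E (\<eta>, s', kp)"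
    and sol: "\<And>C. C0 \<le> C ==> \<exists>e>0. \<forall>\<eta> s kp. (\<eta>, s, kp) \<in> box3 R s0 k0 --> 0 < \<eta> --> \<eta> < e -->
      Sol C (\<eta>\<^sup>2) kp s = (if B (\<eta>, s, kp) = 0 then {E (\<eta>, s, kp)} else {})"
    and quadratic_zero: "Mel s0 k0 = 0" "D1 Mel s0 k0 = 0" "D1 (D1 Mel) s0 k0 \<noteq> 0"
begin

text \<open>Multiplication by this sign makes \<open>B\<close> convex in \<open>s\<close>.\<close>

definition sg :: real where "sg = sgn (D1 (D1 Mel) s0 k0)"

lemma sg: "sg * sg = 1" "0 < sg * D1 (D1 Mel) s0 k0" "sg \<noteq> 0" "\<bar>sg\<bar> = 1"
  using quadratic_zero(3) by (auto simp: sg_def sgn_if)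

definition "b y = sg * B y"
definition "bs y = frechet_derivative b (at y) (0, 1, 0)"
definition "bk y = frechet_derivative b (at y) (0, 0, 1)"
definition "bss y = frechet_derivative bs (at y) (0, 1, 0)"
definition "bsk y = frechet_derivative bs (at y) (0, 0, 1)"
definition "bks y = frechet_derivative bk (at y) (0, 1, 0)"
definition "bkk y = frechet_derivative bk (at y) (0, 0, 1)"

lemma b_C2: "Ck_on (Suc (Suc 0)) b (box3 R s0 k0)"
proof -
  have "Ck_on (Suc (Suc 0)) B (box3 R s0 k0)" using B_C2 by (simp only: numeral_2_eq_2)
  then show ?thesis unfolding b_def[abs_def] by (intro Ck_on_mult Ck_on_const open_box3)
qed

lemma bs_C1: "Ck_on (Suc 0) bs (box3 R s0 k0)" and bk_C1: "Ck_on (Suc 0) bk (box3 R s0 k0)"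
  unfolding bs_def[abs_def] bk_def[abs_def] by (rule Ck_on_derivative_open[OF b_C2 open_box3])+

lemma second_continuous: "continuous_on (box3 R s0 k0) bss" "continuous_on (box3 R s0 k0) bsk"
    "continuous_on (box3 R s0 k0) bks" "continuous_on (box3 R s0 k0) bkk"
  unfolding bss_def[abs_def] bsk_def[abs_def] bks_def[abs_def] bkk_def[abs_def]
  by (rule Ck_on_imp_continuous_on[OF Ck_on_derivative_open[OF bs_C1 open_box3]]
      Ck_on_imp_continuous_on[OF Ck_on_derivative_open[OF bk_C1 open_box3]])+

lemma bks_eq:
  assumes y: "(\<eta>, s, kp) \<in> box3 R s0 k0"
  shows "bks (\<eta>, s, kp) = bsk (\<eta>, s, kp)"
proof -
  define \<rho> where "\<rho> = min (R - \<bar>s - s0\<bar>) (R - \<bar>kp - k0\<bar>)"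
  have \<rho>: "0 < \<rho>" using y by (simp add: \<rho>_def box3_iff)
  have in_box: "(\<eta>, s', kp') \<in> box3 R s0 k0" if "\<bar>s' - s\<bar> < \<rho>" "\<bar>kp' - kp\<bar> < \<rho>" for s' kp'
    using that y unfolding box3_iff \<rho>_def by linarith
  have cont: "isCont (%(s, kp). F (\<eta>, s, kp)) (s, kp)" if "continuous_on (box3 R s0 k0) F" for F :: "real \<times> real \<times> real => real"
  proof -
    have 1: "isCont (%q. (\<eta>, q)) (s, kp)" by (intro continuous_intros)
    have 2: "isCont F (\<eta>, s, kp)" using that y by (simp add: continuous_on_eq_continuous_at open_box3)
    from isCont_o2[OF 1 2] show ?thesis by (simp add: split_beta')
  qed
  have "bsk (\<eta>, s, kp) = bks (\<eta>, s, kp)"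
  proof (rule mixed_partials_eq[of \<rho> s kp "%s kp. b (\<eta>, s, kp)" "%s kp. bs (\<eta>, s, kp)" "%s kp. bk (\<eta>, s, kp)"
        "%s kp. bsk (\<eta>, s, kp)" "%s kp. bks (\<eta>, s, kp)"])
    fix s' kp' assume "\<bar>s' - s\<bar> < \<rho>" "\<bar>kp' - kp\<bar> < \<rho>"
    note p = in_box[OF this]
    show "DERIV (%s. b (\<eta>, s, kp')) s' :> bs (\<eta>, s', kp')" unfolding bs_def by (rule partial_derivatives(1)[OF b_C2 p])
    show "DERIV (%kp. b (\<eta>, s', kp)) kp' :> bk (\<eta>, s', kp')" unfolding bk_def by (rule partial_derivatives(2)[OF b_C2 p])
    show "DERIV (%kp. bs (\<eta>, s', kp)) kp' :> bsk (\<eta>, s', kp')" unfolding bsk_def by (rule partial_derivatives(2)[OF bs_C1 p])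
    show "DERIV (%s. bk (\<eta>, s, kp')) s' :> bks (\<eta>, s', kp')" unfolding bks_def by (rule partial_derivatives(1)[OF bk_C1 p])
  qed (use \<rho> cont second_continuous in simp_all)
  then show ?thesis ..
qed

lemma base_values:
  "b (0, s0, k0) = 0" "bs (0, s0, k0) = 0" "0 < bss (0, s0, k0)" "D2 Mel s0 k0 = sg * bk (0, s0, k0)"
  "det (hessian Mel s0 k0) = bss (0, s0, k0) * bkk (0, s0, k0) - (bsk (0, s0, k0))\<^sup>2"
proof -
  have z: "\<bar>s0 - s0\<bar> < R" "\<bar>k0 - k0\<bar> < R" using R by simp_all
  have M: "Mel s kp = sg * b (0, s, kp)" if "\<bar>s - s0\<bar> < R" "\<bar>kp - k0\<bar> < R" for s kp
    using mel[OF that] sg(1) by (simp add: b_def flip: mult.assoc)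
  note M1 = D1_D2_slice[OF b_C2 _ _ M, folded bs_def bk_def]
  note M11 = D1_D2_slice[OF bs_C1 z M1(1), folded bss_def bsk_def]
  note M22 = D1_D2_slice[OF bk_C1 z M1(2), folded bks_def bkk_def]
  show "b (0, s0, k0) = 0" using M[OF z] quadratic_zero(1) sg(3) by simp
  show "bs (0, s0, k0) = 0" using M1(1)[OF z] quadratic_zero(2) sg(3) by simp
  show "0 < bss (0, s0, k0)" using M11(1) sg(1,2) by (simp flip: mult.assoc)
  show "D2 Mel s0 k0 = sg * bk (0, s0, k0)" by (rule M1(2)[OF z])
  have y0: "(0, s0, k0) \<in> box3 R s0 k0" using R by (simp add: box3_iff)
  have "det (hessian Mel s0 k0) = (sg * bss (0, s0, k0)) * (sg * bkk (0, s0, k0)) - (sg * bsk (0, s0, k0)) * (sg * bsk (0, s0, k0))"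
    unfolding det_2 hessian_def using M11 M22 bks_eq[OF y0] by simp
  also have "\<dots> = (sg * sg) * (bss (0, s0, k0) * bkk (0, s0, k0) - (bsk (0, s0, k0))\<^sup>2)"
    by (simp add: algebra_simps power2_eq_square)
  finally show "det (hessian Mel s0 k0) = bss (0, s0, k0) * bkk (0, s0, k0) - (bsk (0, s0, k0))\<^sup>2" by (simp add: sg(1))
qed

lemma positive_nearby:
  fixes F :: "real \<times> real \<times> real => real"
  assumes "continuous_on (box3 R s0 k0) F" "0 < F (0, s0, k0)"
  obtains r where "0 < r" "r \<le> R" "\<And>\<eta> s kp. \<bar>\<eta>\<bar> < r ==> \<bar>s - s0\<bar> < r ==> \<bar>kp - k0\<bar> < r ==> 0 < F (\<eta>, s, kp) \<and> 0 < bss (\<eta>, s, kp)"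
proof -
  have y0: "(0, s0, k0) \<in> box3 R s0 k0" using R by (simp add: box3_iff)
  have 1: "eventually (%y. F y \<in> {0<..}) (nhds (0, s0, k0))"
    by (rule eventually_nhds_curve[OF open_box3 y0 assms(1)], rule eventually_nhds_in_open) (use assms(2) in simp_all)
  have 2: "eventually (%y. bss y \<in> {0<..}) (nhds (0, s0, k0))"
    by (rule eventually_nhds_curve[OF open_box3 y0 second_continuous(1)], rule eventually_nhds_in_open) (use base_values(3) in simp_all)
  obtain r where r: "0 < r" "\<forall>y\<in>box3 r s0 k0. F y \<in> {0<..} \<and> bss y \<in> {0<..}"
    using eventually_box3[OF eventually_conj[OF 1 2]] by blast
  show thesis
  proof (rule that[of "min r R"])
    fix \<eta> s kp assume "\<bar>\<eta>\<bar> < min r R" "\<bar>s - s0\<bar> < min r R" "\<bar>kp - k0\<bar> < min r R"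
    then have "(\<eta>, s, kp) \<in> box3 r s0 k0" by (simp add: box3_iff)
    then show "0 < F (\<eta>, s, kp) \<and> 0 < bss (\<eta>, s, kp)" using r(2) by auto
  qed (use r(1) R in auto)
qed

lemma germ:
  assumes r: "0 < r" "r \<le> R" and pos: "\<And>\<eta> s kp. \<bar>\<eta>\<bar> < r ==> \<bar>s - s0\<bar> < r ==> \<bar>kp - k0\<bar> < r ==> 0 < bss (\<eta>, s, kp)"
  shows "convex_germ (%\<eta> s kp. b (\<eta>, s, kp)) (%\<eta> s kp. bs (\<eta>, s, kp)) (%\<eta> s kp. bk (\<eta>, s, kp))
    (%\<eta> s kp. bss (\<eta>, s, kp)) (%\<eta> s kp. bsk (\<eta>, s, kp)) (%\<eta> s kp. bkk (\<eta>, s, kp)) s0 k0 r"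
proof
  have sub: "{-r<..<r} \<times> {s0-r<..<s0+r} \<times> {k0-r<..<k0+r} \<subseteq> box3 R s0 k0"
    using box3_mono[OF r(2)] unfolding box3_def .
  have c: "continuous_on ({-r<..<r} \<times> {s0-r<..<s0+r} \<times> {k0-r<..<k0+r}) (%(\<eta>, s, kp). F (\<eta>, s, kp))"
    if "Ck_on k F (box3 R s0 k0)" for F :: "real \<times> real \<times> real => real" and k
    using continuous_on_subset[OF Ck_on_imp_continuous_on[OF that] sub] by (simp add: split_beta')
  show "continuous_on ({-r<..<r} \<times> {s0-r<..<s0+r} \<times> {k0-r<..<k0+r}) (%(\<eta>, s, kp). b (\<eta>, s, kp))"
    "continuous_on ({-r<..<r} \<times> {s0-r<..<s0+r} \<times> {k0-r<..<k0+r}) (%(\<eta>, s, kp). bs (\<eta>, s, kp))"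
    "continuous_on ({-r<..<r} \<times> {s0-r<..<s0+r} \<times> {k0-r<..<k0+r}) (%(\<eta>, s, kp). bk (\<eta>, s, kp))"
    by (rule c[OF b_C2] c[OF bs_C1] c[OF bk_C1])+
  fix \<eta> s kp assume h: "\<bar>\<eta>\<bar> < r" "\<bar>s - s0\<bar> < r" "\<bar>kp - k0\<bar> < r"
  then have y: "(\<eta>, s, kp) \<in> box3 R s0 k0" using r(2) by (simp add: box3_iff)
  show "((%(s, kp). b (\<eta>, s, kp)) has_derivative (%(h, k). bs (\<eta>, s, kp) * h + bk (\<eta>, s, kp) * k)) (at (s, kp))"
    unfolding bs_def bk_def by (rule slice_derivative[OF b_C2 y])
  show "((%(s, kp). bs (\<eta>, s, kp)) has_derivative (%(h, k). bss (\<eta>, s, kp) * h + bsk (\<eta>, s, kp) * k)) (at (s, kp))"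
    unfolding bss_def bsk_def by (rule slice_derivative[OF bs_C1 y])
  show "((%(s, kp). bk (\<eta>, s, kp)) has_derivative (%(h, k). bsk (\<eta>, s, kp) * h + bkk (\<eta>, s, kp) * k)) (at (s, kp))"
    unfolding bks_eq[OF y, symmetric] bks_def bkk_def by (rule slice_derivative[OF bk_C1 y])
  show "0 < bss (\<eta>, s, kp)" by (rule pos[OF h])
qed (use r base_values in simp_all)

lemma b_zero: "b y = 0 \<longleftrightarrow> B y = 0"
  using sg(3) by (simp add: b_def)

theorem saddle_node_solutions:
  assumes "D2 Mel s0 k0 \<noteq> 0"
  shows "\<exists>ksn. (%\<epsilon>. ksn \<epsilon> - k0) \<in> O[at_right 0](%\<epsilon>. \<epsilon>) \<and>
    (\<forall>\<^sub>F C in at_top. \<forall>\<^sub>F a in at_right 0. \<forall>\<^sub>F \<beta> in at_right 0. \<forall>\<^sub>F \<epsilon> in at_right 0.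
       saddle_node (%kp. \<Union>s\<in>{s0 - a..s0 + a}. Sol C \<epsilon> kp s) {k0 - \<beta>..k0 + \<beta>} (ksn \<epsilon>))"
proof -
  define d where "d = - sgn (bk (0, s0, k0))"
  have bk0: "bk (0, s0, k0) \<noteq> 0" using assms base_values(4) by auto
  have d: "d \<in> {1, -1}" "0 < - d * bk (0, s0, k0)" using bk0 by (auto simp: d_def sgn_if)
  have "continuous_on (box3 R s0 k0) (%y. - d * bk y)"
    by (intro continuous_on_mult_left Ck_on_imp_continuous_on[OF bk_C1])
  from positive_nearby[OF this d(2)] obtain r where r: "0 < r" "r \<le> R"
    "\<And>\<eta> s kp. \<bar>\<eta>\<bar> < r ==> \<bar>s - s0\<bar> < r ==> \<bar>kp - k0\<bar> < r ==> 0 < - d * bk (\<eta>, s, kp) \<and> 0 < bss (\<eta>, s, kp)" by blast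
  interpret cg: convex_germ "%\<eta> s kp. b (\<eta>, s, kp)" "%\<eta> s kp. bs (\<eta>, s, kp)" "%\<eta> s kp. bk (\<eta>, s, kp)"
    "%\<eta> s kp. bss (\<eta>, s, kp)" "%\<eta> s kp. bsk (\<eta>, s, kp)" "%\<eta> s kp. bkk (\<eta>, s, kp)" s0 k0 r
    by (rule germ[OF r(1,2)]) (use r(3) in blast)
  have neg: "d * bk (\<eta>, s, kp) < 0" if "\<bar>\<eta>\<bar> < r" "\<bar>s - s0\<bar> < r" "\<bar>kp - k0\<bar> < r" for \<eta> s kp
    using r(3)[OF that] by simp
  have cl: "\<bar>b (\<eta>, s, kp) - b (0, s, kp)\<bar> \<le> C0 * \<eta>\<^sup>2" if "\<bar>\<eta>\<bar> < r" "\<bar>s - s0\<bar> < r" "\<bar>kp - k0\<bar> < r" for \<eta> s kp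
  proof -
    have "(\<eta>, s, kp) \<in> box3 R s0 k0" using that r(2) by (simp add: box3_iff)
    moreover have "\<bar>b (\<eta>, s, kp) - b (0, s, kp)\<bar> = \<bar>sg\<bar> * \<bar>B (\<eta>, s, kp) - B (0, s, kp)\<bar>"
      by (simp add: b_def flip: right_diff_distrib abs_mult)
    ultimately show ?thesis using close sg(4) by simp
  qed
  obtain ks A where ks: "\<forall>\<^sub>F \<eta> in at_right 0. \<bar>ks \<eta> - k0\<bar> \<le> A * \<eta>\<^sup>2"
    and sn: "\<forall>\<^sub>F a in at_right 0. \<forall>\<^sub>F \<beta> in at_right 0. \<forall>\<^sub>F \<eta> in at_right 0.
      saddle_node (%kp. {s\<in>{s0-a..s0+a}. b (\<eta>, s, kp) = 0}) {k0-\<beta>..k0+\<beta>} (ks \<eta>)"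
    by (rule cg.saddle_node_zeros[OF d(1) neg cl]) blast+
  have "\<forall>\<^sub>F \<epsilon> in at_right 0. norm (ks (sqrt \<epsilon>) - k0) \<le> A * norm \<epsilon>"
    using eventually_sqrt[OF ks] eventually_at_right_range[OF R] by eventually_elim simp
  then have "(%\<epsilon>. ks (sqrt \<epsilon>) - k0) \<in> O[at_right 0](%\<epsilon>. \<epsilon>)" by (rule bigoI)
  moreover have "\<forall>\<^sub>F C in at_top. \<forall>\<^sub>F a in at_right 0. \<forall>\<^sub>F \<beta> in at_right 0. \<forall>\<^sub>F \<epsilon> in at_right 0.
       saddle_node (%kp. \<Union>s\<in>{s0 - a..s0 + a}. Sol C \<epsilon> kp s) {k0 - \<beta>..k0 + \<beta>} (ks (sqrt \<epsilon>))"
    using eventually_ge_at_top[of C0]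
  proof eventually_elim
    case (elim C)
    obtain e where e: "0 < e" "\<And>\<eta> s kp. (\<eta>, s, kp) \<in> box3 R s0 k0 ==> 0 < \<eta> ==> \<eta> < e ==>
      Sol C (\<eta>\<^sup>2) kp s = (if B (\<eta>, s, kp) = 0 then {E (\<eta>, s, kp)} else {})"
      using sol[OF elim] by blast
    have "0 < min e R" using e(1) R by simp
    show ?case
    proof (rule eventually_nested_sqrt[OF sn R \<open>0 < min e R\<close>])
      fix a \<beta> \<eta> assume a: "0 < a" "a < R" "0 < \<beta>" "\<beta> < R" and \<eta>: "0 < \<eta>" "\<eta> < min e R"
        and s: "saddle_node (%kp. {s\<in>{s0-a..s0+a}. b (\<eta>, s, kp) = 0}) {k0-\<beta>..k0+\<beta>} (ks \<eta>)"
      have box: "(\<eta>, s, kp) \<in> box3 R s0 k0" if "s \<in> {s0-a..s0+a}" "kp \<in> {k0-\<beta>..k0+\<beta>}" for s kp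
        using that a \<eta> unfolding box3_iff atLeastAtMost_iff by linarith
      have "saddle_node (%kp. \<Union>s\<in>{s0 - a..s0 + a}. Sol C (\<eta>\<^sup>2) kp s) {k0 - \<beta>..k0 + \<beta>} (ks \<eta>)"
      proof (rule saddle_node_image[OF s, where E = "%p. E (\<eta>, p)" and A = "{s0-a..s0+a}"])
        show "continuous_on ({s0-a..s0+a} \<times> {k0-\<beta>..k0+\<beta>}) (%p. E (\<eta>, p))"
          by (rule continuous_on_compose2[OF E_cont]) (use box in \<open>auto intro!: continuous_intros\<close>)
        fix kp assume k: "kp \<in> {k0-\<beta>..k0+\<beta>}"
        have "Sol C (\<eta>\<^sup>2) kp s = (if b (\<eta>, s, kp) = 0 then {E (\<eta>, s, kp)} else {})" if "s \<in> {s0-a..s0+a}" for s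
          using e(2)[OF box[OF that k]] \<eta> by (simp add: b_zero)
        then show "(\<Union>s\<in>{s0 - a..s0 + a}. Sol C (\<eta>\<^sup>2) kp s) = (%s. E (\<eta>, s, kp)) ` {s\<in>{s0-a..s0+a}. b (\<eta>, s, kp) = 0}"
          by (auto split: if_splits)
        show "E (\<eta>, s, kp) \<noteq> E (\<eta>, s', kp)" if "s \<in> {s0-a..s0+a}" "s' \<in> {s0-a..s0+a}" "s \<noteq> s'" for s s'
          by (rule E_inj[OF box[OF that(1) k] box[OF that(2) k] that(3)])
      qed blast
      then show "saddle_node (%kp. \<Union>s\<in>{s0 - a..s0 + a}. Sol C (\<eta>\<^sup>2) kp s) {k0 - \<beta>..k0 + \<beta>} (ks (sqrt (\<eta>\<^sup>2)))"
        using \<eta>(1) by simp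
    qed
  qed
  ultimately show ?thesis by (intro exI[of _ "%\<epsilon>. ks (sqrt \<epsilon>)"] conjI)
qed

text \<open>For small \<open>\<epsilon>\<close> and all large \<open>C\<close> the solution set and the zero set coincide.\<close>

lemma solution_set_transfer:
  assumes "\<forall>\<^sub>F a in at_right 0. \<forall>\<^sub>F \<beta> in at_right 0. \<forall>\<^sub>F \<eta> in at_right 0.
    P \<beta> {(s, kp). s \<in> {s0-a..s0+a} \<and> kp \<in> {k0-\<beta>..k0+\<beta>} \<and> b (\<eta>, s, kp) = 0}"
  shows "\<forall>\<^sub>F C in at_top. \<forall>\<^sub>F a in at_right 0. \<forall>\<^sub>F \<beta> in at_right 0. \<forall>\<^sub>F \<epsilon> in at_right 0.
    P \<beta> {(s, kp). s \<in> {s0-a..s0+a} \<and> kp \<in> {k0-\<beta>..k0+\<beta>} \<and> Sol C \<epsilon> kp s \<noteq> {}}"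
  using eventually_ge_at_top[of C0]
proof eventually_elim
  case (elim C)
  obtain e where e: "0 < e" "\<And>\<eta> s kp. (\<eta>, s, kp) \<in> box3 R s0 k0 ==> 0 < \<eta> ==> \<eta> < e ==>
    Sol C (\<eta>\<^sup>2) kp s = (if B (\<eta>, s, kp) = 0 then {E (\<eta>, s, kp)} else {})"
    using sol[OF elim] by blast
  have "0 < min e R" using e(1) R by simp
  show ?case
  proof (rule eventually_nested_sqrt[OF assms R \<open>0 < min e R\<close>])
    fix a \<beta> \<eta> assume a: "0 < a" "a < R" "0 < \<beta>" "\<beta> < R" and \<eta>: "0 < \<eta>" "\<eta> < min e R"
      and s: "P \<beta> {(s, kp). s \<in> {s0-a..s0+a} \<and> kp \<in> {k0-\<beta>..k0+\<beta>} \<and> b (\<eta>, s, kp) = 0}"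
    have "b (\<eta>, s, kp) = 0 \<longleftrightarrow> Sol C (\<eta>\<^sup>2) kp s \<noteq> {}" if "s \<in> {s0-a..s0+a}" "kp \<in> {k0-\<beta>..k0+\<beta>}" for s kp
    proof -
      have "(\<eta>, s, kp) \<in> box3 R s0 k0" using that a \<eta> unfolding box3_iff atLeastAtMost_iff by linarith
      then show ?thesis using e(2)[of \<eta> s kp] \<eta> by (simp add: b_zero)
    qed
    then have "{(s, kp). s \<in> {s0-a..s0+a} \<and> kp \<in> {k0-\<beta>..k0+\<beta>} \<and> b (\<eta>, s, kp) = 0} =
        {(s, kp). s \<in> {s0-a..s0+a} \<and> kp \<in> {k0-\<beta>..k0+\<beta>} \<and> Sol C (\<eta>\<^sup>2) kp s \<noteq> {}}" by blast
    then show "P \<beta> {(s, kp). s \<in> {s0-a..s0+a} \<and> kp \<in> {k0-\<beta>..k0+\<beta>} \<and> Sol C (\<eta>\<^sup>2) kp s \<noteq> {}}"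
      using s by simp
  qed
qed

theorem isola_birth_solutions:
  assumes "D2 Mel s0 k0 = 0" "0 < det (hessian Mel s0 k0)"
  shows "\<forall>\<^sub>F C in at_top. \<forall>\<^sub>F a in at_right 0. \<forall>\<^sub>F \<beta> in at_right 0. \<forall>\<^sub>F \<epsilon> in at_right 0.
    isola_birth {(s, kp). s \<in> {s0-a..s0+a} \<and> kp \<in> {k0-\<beta>..k0+\<beta>} \<and> Sol C \<epsilon> kp s \<noteq> {}}"
proof (rule solution_set_transfer)
  have bk0: "bk (0, s0, k0) = 0" using assms(1) base_values(4) sg(3) by simp
  have c: "continuous_on (box3 R s0 k0) (%y. bss y * bkk y - (bsk y)\<^sup>2)" by (intro continuous_intros second_continuous)
  have "0 < bss (0, s0, k0) * bkk (0, s0, k0) - (bsk (0, s0, k0))\<^sup>2" using assms(2) base_values(5) by simp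
  from positive_nearby[OF c this] obtain r where r: "0 < r" "r \<le> R"
    "\<And>\<eta> s kp. \<bar>\<eta>\<bar> < r ==> \<bar>s - s0\<bar> < r ==> \<bar>kp - k0\<bar> < r ==>
      0 < bss (\<eta>, s, kp) * bkk (\<eta>, s, kp) - (bsk (\<eta>, s, kp))\<^sup>2 \<and> 0 < bss (\<eta>, s, kp)" by blast
  interpret cg: convex_germ "%\<eta> s kp. b (\<eta>, s, kp)" "%\<eta> s kp. bs (\<eta>, s, kp)" "%\<eta> s kp. bk (\<eta>, s, kp)"
    "%\<eta> s kp. bss (\<eta>, s, kp)" "%\<eta> s kp. bsk (\<eta>, s, kp)" "%\<eta> s kp. bkk (\<eta>, s, kp)" s0 k0 r
    by (rule germ[OF r(1,2)]) (use r(3) in blast)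
  show "\<forall>\<^sub>F a in at_right 0. \<forall>\<^sub>F \<beta> in at_right 0. \<forall>\<^sub>F \<eta> in at_right 0.
    isola_birth {(s, kp). s \<in> {s0-a..s0+a} \<and> kp \<in> {k0-\<beta>..k0+\<beta>} \<and> b (\<eta>, s, kp) = 0}"
    by (rule cg.isola_birth_zeros[OF bk0]) (use r(3) in fastforce)
qed

theorem simple_bifurcation_solutions:
  assumes "D2 Mel s0 k0 = 0" "det (hessian Mel s0 k0) < 0"
  shows "\<forall>\<^sub>F C in at_top. \<forall>\<^sub>F a in at_right 0. \<forall>\<^sub>F \<beta> in at_right 0. \<forall>\<^sub>F \<epsilon> in at_right 0.
    simple_bifurcation (k0 - \<beta>) (k0 + \<beta>) {(s, kp). s \<in> {s0-a..s0+a} \<and> kp \<in> {k0-\<beta>..k0+\<beta>} \<and> Sol C \<epsilon> kp s \<noteq> {}}"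
proof (rule solution_set_transfer[where P = "%\<beta>. simple_bifurcation (k0 - \<beta>) (k0 + \<beta>)"])
  have bk0: "bk (0, s0, k0) = 0" using assms(1) base_values(4) sg(3) by simp
  let ?y = "(0, s0, k0)"
  define \<rho> where "\<rho> = - bsk ?y / bss ?y"
  have c: "continuous_on (box3 R s0 k0) (%y. - (bss y * \<rho>\<^sup>2 + 2 * bsk y * \<rho> + bkk y))"
    by (intro continuous_intros second_continuous)
  have "bss ?y * \<rho>\<^sup>2 + 2 * bsk ?y * \<rho> + bkk ?y = (bss ?y * bkk ?y - (bsk ?y)\<^sup>2) / bss ?y"
    using base_values(3) by (simp add: \<rho>_def power2_eq_square field_simps)
  also have "\<dots> < 0" using assms(2) base_values(3,5) by (simp add: divide_neg_pos)
  finally have "0 < - (bss ?y * \<rho>\<^sup>2 + 2 * bsk ?y * \<rho> + bkk ?y)" by simp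
  from positive_nearby[OF c this] obtain r where r: "0 < r" "r \<le> R"
    "\<And>\<eta> s kp. \<bar>\<eta>\<bar> < r ==> \<bar>s - s0\<bar> < r ==> \<bar>kp - k0\<bar> < r ==>
      0 < - (bss (\<eta>, s, kp) * \<rho>\<^sup>2 + 2 * bsk (\<eta>, s, kp) * \<rho> + bkk (\<eta>, s, kp)) \<and> 0 < bss (\<eta>, s, kp)" by blast
  interpret cg: convex_germ "%\<eta> s kp. b (\<eta>, s, kp)" "%\<eta> s kp. bs (\<eta>, s, kp)" "%\<eta> s kp. bk (\<eta>, s, kp)"
    "%\<eta> s kp. bss (\<eta>, s, kp)" "%\<eta> s kp. bsk (\<eta>, s, kp)" "%\<eta> s kp. bkk (\<eta>, s, kp)" s0 k0 r
    by (rule germ[OF r(1,2)]) (use r(3) in blast)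
  have neg: "cg.quadratic \<eta> s kp \<rho> 1 < 0" if "\<bar>\<eta>\<bar> < r" "\<bar>s - s0\<bar> < r" "\<bar>kp - k0\<bar> < r" for \<eta> s kp
  proof -
    have "cg.quadratic \<eta> s kp \<rho> 1 = bss (\<eta>, s, kp) * \<rho>\<^sup>2 + 2 * bsk (\<eta>, s, kp) * \<rho> + bkk (\<eta>, s, kp)"
      by (simp add: cg.quadratic_def power2_eq_square algebra_simps)
    then show ?thesis using r(3)[OF that] by linarith
  qed
  show "\<forall>\<^sub>F a in at_right 0. \<forall>\<^sub>F \<beta> in at_right 0. \<forall>\<^sub>F \<eta> in at_right 0.
    simple_bifurcation (k0 - \<beta>) (k0 + \<beta>) {(s, kp). s \<in> {s0-a..s0+a} \<and> kp \<in> {k0-\<beta>..k0+\<beta>} \<and> b (\<eta>, s, kp) = 0}"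
    by (rule cg.simple_bifurcation_zeros[OF bk0 neg])
qed

end

section \<open>Mechanical systems\<close>

lemma bounded_bilinear_matrix_vector: "bounded_bilinear (%(A :: real^'n^'m) x. A *v x)"
  unfolding bilinear_conv_bounded_bilinear[symmetric] bilinear_def
proof (intro conjI allI)
  show "linear (%x. A *v x)" for A :: "real^'n^'m" by (rule matrix_vector_mul_linear)
  show "linear (%A :: real^'n^'m. A *v x)" for x
    by (rule linearI) (simp_all add: matrix_vector_mult_add_rdistrib scaleR_matrix_vector_assoc)
qed

lemma positive_definite_inverse:
  fixes A :: "real^'n^'n"
  assumes "\<And>v. v \<noteq> 0 ==> 0 < v \<bullet> (A *v v)"
  shows "A *v (matrix_inv A *v w) = w"
proof -
  have "x = 0" if "A *v x = 0" for x using assms[of x] that by (cases "x = 0") simp_all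
  then have "\<exists>B. B ** A = mat 1" by (simp add: matrix_left_invertible_ker)
  then have "invertible A" by (simp add: invertible_left_inverse)
  then have "A ** matrix_inv A = mat 1 \<and> matrix_inv A ** A = mat 1"
    unfolding invertible_def matrix_inv_def by (rule someI_ex)
  then show ?thesis by (simp add: matrix_vector_mul_assoc)
qed

lemma symmetric_inner:
  fixes A :: "real^'n^'n"
  assumes "transpose A = A"
  shows "v \<bullet> (A *v b) = b \<bullet> (A *v v)"
proof -
  have "v \<bullet> (A *v b) = (v v* A) \<bullet> b" by (rule dot_lmul_matrix[symmetric])
  also have "v v* A = A *v v" using transpose_matrix_vector[of A v] assms by simp
  finally show ?thesis by (simp add: inner_commute)
qed

lemma grad_inner:
  assumes "(h has_derivative h') (at x)"
  shows "grad h x \<bullet> v = h' v"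
proof -
  have "grad h x = (\<Sum>b\<in>Basis. h' b *\<^sub>R b)" unfolding grad_def frechet_derivative_at[OF assms, symmetric] ..
  then have "grad h x \<bullet> v = (\<Sum>b\<in>Basis. h' b * (b \<bullet> v))" by (simp add: inner_sum_left)
  also have "\<dots> = (\<Sum>b\<in>Basis. (v \<bullet> b) *\<^sub>R h' b)" by (rule sum.cong) (simp_all add: inner_commute mult.commute)
  also have "\<dots> = h' v" by (rule linear_eq_sum_Basis[OF has_derivative_linear[OF assms], symmetric])
  finally show ?thesis .
qed

lemma slice_has_derivative:
  fixes F :: "real => 'a::euclidean_space => 'b::real_normed_vector"
  assumes K: "open K" and D: "open D" and F: "Ck_on (Suc k) (%(kp, x). F kp x) (K \<times> D)" and y: "kp \<in> K" "x \<in> D"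
  shows "(F kp has_derivative (%v. frechet_derivative (%(kp, x). F kp x) (at (kp, x)) (0, v))) (at x)"
proof -
  have d: "((%(kp, x). F kp x) has_derivative frechet_derivative (%(kp, x). F kp x) (at (kp, x))) (at (kp, x))"
    by (rule Ck_on_has_derivative_open[OF F open_Times[OF K D]]) (use y in simp)
  have "((%x. (kp, x)) has_derivative (%v. (0, v))) (at x)" by (auto intro!: derivative_eq_intros)
  from has_derivative_compose[OF this d] show ?thesis by simp
qed

lemma parametrised_gradient:
  fixes h :: "real => 'a::euclidean_space => real"
  assumes K: "open K" and D: "open D" and h: "Ck_on (Suc k) (%(kp, x). h kp x) (K \<times> D)"
  shows "\<And>kp x. kp \<in> K ==> x \<in> D ==> (h kp has_derivative (%v. grad (h kp) x \<bullet> v)) (at x)"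
    and "Ck_on k (%(kp, x). grad (h kp) x) (K \<times> D)"
proof -
  have o: "open (K \<times> D)" using K D by (rule open_Times)
  note d = slice_has_derivative[OF K D h]
  show "(h kp has_derivative (%v. grad (h kp) x \<bullet> v)) (at x)" if "kp \<in> K" "x \<in> D" for kp x
    using d[OF that] unfolding grad_inner[OF d[OF that]] .
  let ?G = "%w. \<Sum>b\<in>Basis. frechet_derivative (%(kp, x). h kp x) (at w) (0, b) *\<^sub>R b"
  have G: "Ck_on k ?G (K \<times> D)"
    by (intro Ck_on_sum Ck_on_scaleR Ck_on_const o Ck_on_derivative_open[OF h o])
  have "grad (h kp) x = ?G (kp, x)" if "kp \<in> K" "x \<in> D" for kp x
    unfolding grad_def frechet_derivative_at[OF d[OF that], symmetric] ..
  then show "Ck_on k (%(kp, x). grad (h kp) x) (K \<times> D)"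
    using G by (subst Ck_on_cong[where g = ?G]) auto
qed

context
  fixes M :: "real^'n => real^'n^'n" and V :: "real^'n => real" and q :: "real^'n" and DM DV
  assumes M: "(M has_derivative DM) (at q)" and V: "(V has_derivative DV) (at q)" and sym: "transpose (M q) = M q"
begin

lemma energy_has_derivative:
  "(energy M V has_derivative (%(a, b). 1 / 2 * (v \<bullet> (DM a *v v)) + b \<bullet> (M q *v v) + DV a)) (at (q, v))"
proof -
  have f: "((%x :: 'n state. fst x) has_derivative (%h. fst h)) (at (q, v))" by (rule has_derivative_fst[OF has_derivative_ident])
  have s: "((%x :: 'n state. snd x) has_derivative (%h. snd h)) (at (q, v))" by (rule has_derivative_snd[OF has_derivative_ident])
  have Mq: "((%x :: 'n state. M (fst x)) has_derivative (%h. DM (fst h))) (at (q, v))"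
    by (rule has_derivative_compose[OF f]) (simp add: M)
  have Vq: "((%x :: 'n state. V (fst x)) has_derivative (%h. DV (fst h))) (at (q, v))"
    by (rule has_derivative_compose[OF f]) (simp add: V)
  note mv = bounded_bilinear.FDERIV[OF bounded_bilinear_matrix_vector Mq s]
  have 1: "((%x. 1 / 2 * (snd x \<bullet> (M (fst x) *v snd x)) + V (fst x)) has_derivative
      (%h. 1 / 2 * (snd (q, v) \<bullet> (M (fst (q, v)) *v snd h + DM (fst h) *v snd (q, v)) + snd h \<bullet> (M (fst (q, v)) *v snd (q, v))) + DV (fst h))) (at (q, v))"
    by (rule has_derivative_add[OF has_derivative_mult_right[OF bounded_bilinear.FDERIV[OF bounded_bilinear_inner s mv]] Vq])
  have e: "energy M V = (%x. 1 / 2 * (snd x \<bullet> (M (fst x) *v snd x)) + V (fst x))"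
    by (simp add: energy_def kinetic_def split_beta')
  have "(%h. 1 / 2 * (snd (q, v) \<bullet> (M (fst (q, v)) *v snd h + DM (fst h) *v snd (q, v)) + snd h \<bullet> (M (fst (q, v)) *v snd (q, v))) + DV (fst h)) =
      (%(a, b). 1 / 2 * (v \<bullet> (DM a *v v)) + b \<bullet> (M q *v v) + DV a)"
    by (rule ext) (simp add: split_beta' inner_add_right symmetric_inner[OF sym, of v])
  then show ?thesis unfolding e using 1 by simp
qed

text \<open>The inertial force does the work \<open>v \<bullet> DM(q)[v] v / 2\<close>, which cancels the change of kinetic energy due
  to the change of the mass matrix.\<close>

lemma energy_conserved:
  assumes pd: "\<And>v. v \<noteq> 0 ==> 0 < v \<bullet> (M q *v v)"
  shows "grad (energy M V) (q, v) \<bullet> conservative_field M V (q, v) = 0"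
proof -
  define w where "w = grad V q + inertial M (q, v)"
  have "((%q'. kinetic M (q', v)) has_derivative (%a. 1 / 2 * (v \<bullet> (DM a *v v)))) (at q)"
    unfolding kinetic_def prod.case
    by (rule has_derivative_mult_right[OF bounded_linear.has_derivative[OF bounded_linear_inner_right
            bounded_linear.has_derivative[OF bounded_bilinear.bounded_linear_left[OF bounded_bilinear_matrix_vector] M]]])
  from grad_inner[OF this] have kin: "grad (%q'. kinetic M (q', v)) q \<bullet> v = 1 / 2 * (v \<bullet> (DM v *v v))" .
  have inert: "v \<bullet> inertial M (q, v) = 1 / 2 * (v \<bullet> (DM v *v v))"
    using kin by (simp add: inertial_def frechet_derivative_at[OF M, symmetric] inner_diff_right inner_commute)
  have field: "conservative_field M V (q, v) = (v, - (matrix_inv (M q) *v w))"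
    by (simp add: conservative_field_def w_def)
  have "(matrix_inv (M q) *v w) \<bullet> (M q *v v) = v \<bullet> (M q *v (matrix_inv (M q) *v w))"
    by (rule symmetric_inner[OF sym])
  also have "\<dots> = v \<bullet> w" by (simp add: positive_definite_inverse[OF pd])
  also have "\<dots> = DV v + 1 / 2 * (v \<bullet> (DM v *v v))"
    using grad_inner[OF V, of v] inert by (simp add: w_def inner_add_right inner_commute)
  finally show ?thesis unfolding grad_inner[OF energy_has_derivative] field by simp
qed

text \<open>Consequently the gradient of the energy does not vanish on periodic orbits.\<close>

lemma energy_critical:
  assumes pd: "\<And>v. v \<noteq> 0 ==> 0 < v \<bullet> (M q *v v)" and zero: "grad (energy M V) (q, v) = 0"
  shows "conservative_field M V (q, v) = 0"
proof -
  have z: "1 / 2 * (v \<bullet> (DM a *v v)) + b \<bullet> (M q *v v) + DV a = 0" for a b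
    using grad_inner[OF energy_has_derivative, of v "(a, b)"] zero by simp
  have "DM 0 = 0" "DV 0 = 0" using linear_0[OF has_derivative_linear[OF M]] linear_0[OF has_derivative_linear[OF V]] by auto
  then have "v \<bullet> (M q *v v) = 0" using z[of 0 v] by simp
  then have v: "v = 0" using pd[of v] by (cases "v = 0") auto
  have "DV a = 0" for a using z[of a 0] v by simp
  then have "grad V q \<bullet> grad V q = 0" using grad_inner[OF V] by simp
  then have gV: "grad V q = 0" by simp
  have k0: "(%q'. kinetic M (q', 0)) = (%q'. 0)" by (simp add: kinetic_def)
  have "grad (%q' :: real^'n. 0) q \<bullet> w = 0" for w
    using grad_inner[OF has_derivative_const, of "0 :: real" q w] by simp
  from this[of "grad (%q' :: real^'n. 0) q"] have "grad (%q' :: real^'n. 0 :: real) q = 0" by simp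
  then show ?thesis by (simp add: conservative_field_def inertial_def v gV k0 zero_prod_def)
qed

end

text \<open>Composition with \<open>\<eta> \<mapsto> \<eta>\<^sup>2\<close> turns the one-sided smoothness at \<open>\<epsilon> = 0\<close> into smoothness on both
  sides of \<open>\<eta> = 0\<close>.\<close>

lemma mechanical_perturbed_flow:
  fixes U :: "(real^'n) set"
  assumes sys: "mechanical_system r K U \<epsilon>m M V Q" and r: "3 \<le> r" and l: "0 < l"
  shows "perturbed_flow K (U \<times> UNIV) (%kp. conservative_field (M kp) (V kp)) (%kp. perturbation_field (M kp) (Q kp))
      (%kp. energy (M kp) (V kp)) {- sqrt \<epsilon>m<..<sqrt \<epsilon>m} l"
    and "\<And>kp x. kp \<in> K ==> x \<in> U \<times> UNIV ==> grad (energy (M kp) (V kp)) x = 0 ==> conservative_field (M kp) (V kp) x = 0"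
proof -
  have K: "open K" and U: "open U" and \<epsilon>m: "0 < \<epsilon>m"
    and sym: "\<And>kp q. kp \<in> K ==> q \<in> U ==> transpose (M kp q) = M kp q"
    and pd: "\<And>kp q v. kp \<in> K ==> q \<in> U ==> v \<noteq> 0 ==> 0 < v \<bullet> (M kp q *v v)"
    and Mr: "Ck_on r (%(kp, q). M kp q) (K \<times> U)" and Vr: "Ck_on r (%(kp, q). V kp q) (K \<times> U)"
    and fr: "Ck_on r (%(kp, x). conservative_field (M kp) (V kp) x) (K \<times> (U \<times> UNIV))"
    and gr: "Ck_on (r - 1) (%((kp, x, T, \<epsilon>), t). perturbation_field (M kp) (Q kp) x t T \<epsilon>)
       ((K \<times> (U \<times> UNIV) \<times> {0<..} \<times> {0..<\<epsilon>m}) \<times> UNIV)"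
    using sys unfolding mechanical_system_def by blast+
  let ?D = "U \<times> UNIV :: 'n state set" and ?I = "{- sqrt \<epsilon>m<..<sqrt \<epsilon>m}"
  have D: "open ?D" using U by (simp add: open_Times)
  have M3: "Ck_on (Suc 2) (%(kp, q). M kp q) (K \<times> U)" and V3: "Ck_on (Suc 2) (%(kp, q). V kp q) (K \<times> U)"
    by (rule Ck_on_mono[OF Mr] Ck_on_mono[OF Vr]; use r in simp)+
  note dM = slice_has_derivative[OF K U M3] and dV = slice_has_derivative[OF K U V3]
  let ?W = "K \<times> ?D"
  have o: "open ?W" using K D by (rule open_Times)
  have pr: "Ck_on (Suc 2) (%w. (fst w, fst (snd w))) ?W" by (intro Ck_on_Pair Ck_on_fst Ck_on_snd Ck_on_ident o)
  have im: "(%w. (fst w, fst (snd w))) ` ?W \<subseteq> K \<times> U" by auto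
  have MW: "Ck_on (Suc 2) (%w. M (fst w) (fst (snd w))) ?W" using Ck_on_compose[OF o im M3 pr] by simp
  have VW: "Ck_on (Suc 2) (%w. V (fst w) (fst (snd w))) ?W" using Ck_on_compose[OF o im V3 pr] by simp
  have vW: "Ck_on (Suc 2) (%w. snd (snd w)) ?W" by (intro Ck_on_snd Ck_on_ident o)
  have "Ck_on (Suc 2) (%w. 1 / 2 * (snd (snd w) \<bullet> (M (fst w) (fst (snd w)) *v snd (snd w))) + V (fst w) (fst (snd w))) ?W"
    by (intro Ck_on_add Ck_on_mult Ck_on_const Ck_on_inner vW VW o
        bounded_bilinear.Ck_on_prod[OF bounded_bilinear_matrix_vector o MW vW])
  moreover have "(%w. 1 / 2 * (snd (snd w) \<bullet> (M (fst w) (fst (snd w)) *v snd (snd w))) + V (fst w) (fst (snd w))) =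
      (%(kp, x). energy (M kp) (V kp) x)" by (simp add: energy_def kinetic_def split_beta')
  ultimately have e3: "Ck_on (Suc 2) (%(kp, x). energy (M kp) (V kp) x) ?W" by (simp only:)
  have f2: "Ck_on 2 (%(kp, x). conservative_field (M kp) (V kp) x) ?W" by (rule Ck_on_mono[OF fr]) (use r in simp)
  have sq: "\<eta>\<^sup>2 < \<epsilon>m" if "\<eta> \<in> ?I" for \<eta>
  proof -
    have "\<bar>\<eta>\<bar> < sqrt \<epsilon>m" using that by auto
    then have "\<bar>\<eta>\<bar>\<^sup>2 < (sqrt \<epsilon>m)\<^sup>2" by (intro power_strict_mono) auto
    then show ?thesis using \<epsilon>m by simp
  qed
  let ?G = "K \<times> ?D \<times> {0 :: real<..} \<times> ?I \<times> (UNIV :: real set)"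
  have oG: "open ?G" by (intro open_Times K D open_greaterThan open_greaterThanLessThan open_UNIV)
  have g2: "Ck_on 2 (%((kp, x, T, \<epsilon>), t). perturbation_field (M kp) (Q kp) x t T \<epsilon>) ((K \<times> ?D \<times> {0<..} \<times> {0..<\<epsilon>m}) \<times> UNIV)"
    by (rule Ck_on_mono[OF gr]) (use r in simp)
  let ?q = "%w :: real \<times> 'n state \<times> real \<times> real \<times> real. ((fst w, fst (snd w), fst (snd (snd w)),
      fst (snd (snd (snd w))) * fst (snd (snd (snd w)))), snd (snd (snd (snd w))))"
  have qG: "Ck_on 2 ?q ?G" by (intro Ck_on_Pair Ck_on_mult Ck_on_fst Ck_on_snd Ck_on_ident oG)
  have imG: "?q ` ?G \<subseteq> (K \<times> ?D \<times> {0<..} \<times> {0..<\<epsilon>m}) \<times> UNIV"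
  proof
    fix z assume "z \<in> ?q ` ?G"
    then obtain kp x T \<eta> t where w: "z = ?q (kp, x, T, \<eta>, t)" "kp \<in> K" "x \<in> ?D" "0 < T" "\<eta> \<in> ?I" by blast
    have "\<eta> * \<eta> < \<epsilon>m" using sq[OF w(5)] by (simp add: power2_eq_square)
    then show "z \<in> (K \<times> ?D \<times> {0<..} \<times> {0..<\<epsilon>m}) \<times> UNIV" using w(2-4) unfolding w(1) by simp
  qed
  from Ck_on_compose[OF oG imG g2 qG] have g: "Ck_on 2 (%(kp, x, T, \<eta>, t). perturbation_field (M kp) (Q kp) x t T (\<eta>\<^sup>2)) ?G"
    by (simp add: split_beta' power2_eq_square)
  show "perturbed_flow K ?D (%kp. conservative_field (M kp) (V kp)) (%kp. perturbation_field (M kp) (Q kp))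
      (%kp. energy (M kp) (V kp)) ?I l"
  proof
    show "open K" "open ?D" "open ?I" "0 < l" by (rule K D open_greaterThanLessThan l)+
    show "Ck_on 2 (%(kp, x). conservative_field (M kp) (V kp) x) ?W" by (rule f2)
    show "0 \<in> ?I" using \<epsilon>m by simp
    show "- \<eta> \<in> ?I" if "\<eta> \<in> ?I" for \<eta> using that by auto
    show "Ck_on 2 (%(kp, x, T, \<eta>, t). perturbation_field (M kp) (Q kp) x t T (\<eta>\<^sup>2)) ?G" by (rule g)
    show "(energy (M kp) (V kp) has_derivative (\<bullet>) (grad (energy (M kp) (V kp)) x)) (at x)" if "kp \<in> K" "x \<in> ?D" for kp x
      by (rule parametrised_gradient(1)[OF K D e3 that])
    show "Ck_on 2 (%(kp, x). grad (energy (M kp) (V kp)) x) ?W" by (rule parametrised_gradient(2)[OF K D e3])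
    fix kp x assume k: "kp \<in> K" and x: "x \<in> ?D"
    obtain q v where qv: "x = (q, v)" "q \<in> U" using x by auto
    show "grad (energy (M kp) (V kp)) x \<bullet> conservative_field (M kp) (V kp) x = 0"
      unfolding qv(1) by (rule energy_conserved[OF dM[OF k qv(2)] dV[OF k qv(2)] sym[OF k qv(2)] pd[OF k qv(2)]])
  qed
  fix kp x assume k: "kp \<in> K" and x: "x \<in> ?D" and zero: "grad (energy (M kp) (V kp)) x = 0"
  obtain q v where qv: "x = (q, v)" "q \<in> U" using x by auto
  show "conservative_field (M kp) (V kp) x = 0"
    unfolding qv(1) by (rule energy_critical[OF dM[OF k qv(2)] dV[OF k qv(2)] sym[OF k qv(2)] pd[OF k qv(2)]]) (use zero qv in simp_all)
qed

section \<open>The orbits under consideration\<close>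

lemma equilibrium_flows_to: "f x = 0 ==> x \<in> D ==> flows_to (%_. f) D x s x"
  unfolding flows_to_def by (intro exI[of _ "%_. x"]) simp

context perturbed_flow
begin

lemma periodic_orbit_no_equilibrium:
  assumes kp: "kp \<in> K" and Y: "orbit_curve (f kp) D Y" and po: "periodic_orbit (f kp) D (Y 0) \<tau>"
  shows "f kp (Y t) \<noteq> 0"
proof
  assume z: "f kp (Y t) = 0"
  have YD: "Y t \<in> D" using Y by (simp add: orbit_curve_def)
  have "flows_to (%_. f kp) D (Y t) (- t) (Y (t + - t))" by (rule orbit_curve_flows_to[OF Y])
  from flows_to_unique[OF D f_slice_C1[OF kp] this equilibrium_flows_to[of "f kp" "Y t" D, OF z YD]] have "Y 0 = Y t" by simp
  then have "flows_to (%_. f kp) D (Y 0) (\<tau> / 2) (Y 0)" using equilibrium_flows_to[of "f kp" "Y t" D, OF z YD] by simp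
  then show False using po by (auto simp: periodic_orbit_def dest!: bspec[of _ _ "\<tau> / 2"])
qed

text \<open>m-normality is given at the base point on the section. The point with phase \<open>s0\<close> is reached from there
  at a time that may be taken nonnegative after adding periods.\<close>

theorem selected_orbit_melnikov_problem:
  assumes fam: "orbit_family r m K f D L \<Lambda> \<theta> Per" and sel: "selected_orbit r K f D \<Lambda> \<theta> Per p \<tau> lam"
    and r: "2 \<le> r" and m: "0 < m" and kp0: "kp0 \<in> K" and crit: "\<And>x. x \<in> D ==> grad (H kp0) x = 0 ==> f kp0 x = 0"
  shows "\<exists>Z. melnikov_problem K D f g H I l m L p \<tau> lam Z s0 kp0"
proof -
  have \<Lambda>: "open \<Lambda>" and Lr: "Ck_on r (%(kp, \<xi>, T). L kp \<xi> T) (K \<times> D \<times> {0<..})"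
    and \<theta>r: "\<And>kp. kp \<in> K ==> Ck_on r (\<theta> kp) \<Lambda>" and Perr: "\<And>kp. kp \<in> K ==> Ck_on r (Per kp) \<Lambda>"
    and po: "\<And>kp \<mu>. kp \<in> K ==> \<mu> \<in> \<Lambda> ==> periodic_orbit (f kp) D (\<theta> kp \<mu>) (Per kp \<mu>)"
    and normal: "\<And>kp \<mu>. kp \<in> K ==> \<mu> \<in> \<Lambda> ==> m_normal m (f kp) D (\<theta> kp \<mu>) (Per kp \<mu>)"
    and L\<mu>: "\<And>kp \<mu> t. kp \<in> K ==> \<mu> \<in> \<Lambda> ==> L kp (traj (f kp) D (\<theta> kp \<mu>) t) (real m * Per kp \<mu>) = \<mu>"
    using fam unfolding orbit_family_def by blast+
  have pr: "Ck_on r p K" and \<tau>r: "Ck_on r \<tau> K" and lamr: "Ck_on r lam K"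
    and lam: "\<And>kp. kp \<in> K ==> lam kp \<in> \<Lambda>" and \<tau>: "\<And>kp. kp \<in> K ==> \<tau> kp = Per kp (lam kp)"
    and to_p: "\<And>kp. kp \<in> K ==> \<exists>t. flows_to (%_. f kp) D (\<theta> kp (lam kp)) t (p kp)"
    using sel unfolding selected_orbit_def by blast+
  have curve: "\<exists>Y. orbit_curve (f kp) D Y \<and> Y 0 = \<theta> kp \<mu> \<and> (\<forall>t. Y (t + Per kp \<mu>) = Y t)" if h: "kp \<in> K" "\<mu> \<in> \<Lambda>" for kp \<mu>
  proof (rule periodic_orbit_curve[OF po[OF h]])
    fix Y assume "orbit_curve (f kp) D Y" "Y 0 = \<theta> kp \<mu>" "\<And>t. Y (t + Per kp \<mu>) = Y t"
    then show "\<exists>Y. orbit_curve (f kp) D Y \<and> Y 0 = \<theta> kp \<mu> \<and> (\<forall>t. Y (t + Per kp \<mu>) = Y t)"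
      by (intro exI[of _ Y]) simp
  qed
  have "\<forall>kp\<in>K. \<exists>Z. orbit_curve (f kp) D Z \<and> Z 0 = p kp \<and> (\<forall>t. Z (t + \<tau> kp) = Z t) \<and> (\<exists>t0. Z (- t0) = \<theta> kp (lam kp))"
  proof
    fix kp assume k: "kp \<in> K"
    obtain Y where Y: "orbit_curve (f kp) D Y" "Y 0 = \<theta> kp (lam kp)" "\<forall>t. Y (t + Per kp (lam kp)) = Y t"
      using curve[OF k lam[OF k]] by blast
    obtain t0 where "flows_to (%_. f kp) D (Y 0) t0 (p kp)" using to_p[OF k] Y(2) by auto
    from conjunct1[OF flows_traj[OF k this]] have p: "p kp = Y t0" using orbit_traj[OF k Y(1), of 0 t0] by simp
    have "Y (t0 + (t + \<tau> kp)) = Y (t0 + t)" for t using Y(3) \<tau>[OF k] by (simp flip: add.assoc)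
    then show "\<exists>Z. orbit_curve (f kp) D Z \<and> Z 0 = p kp \<and> (\<forall>t. Z (t + \<tau> kp) = Z t) \<and> (\<exists>t0. Z (- t0) = \<theta> kp (lam kp))"
      using orbit_curve_shift[OF Y(1), of t0] Y(2) p by (intro exI[of _ "%t. Y (t0 + t)"] conjI exI[of _ t0]) simp_all
  qed
  from bchoice[OF this] obtain Z where Z: "\<forall>kp\<in>K. orbit_curve (f kp) D (Z kp) \<and> Z kp 0 = p kp \<and>
      (\<forall>t. Z kp (t + \<tau> kp) = Z kp t) \<and> (\<exists>t0. Z kp (- t0) = \<theta> kp (lam kp))" ..
  have Zo: "orbit_curve (f kp) D (Z kp)" and Zp: "Z kp 0 = p kp" and Zt: "\<And>t. Z kp (t + \<tau> kp) = Z kp t"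
    and Z\<theta>: "\<exists>t0. Z kp (- t0) = \<theta> kp (lam kp)" if "kp \<in> K" for kp using bspec[OF Z that] by auto
  have \<tau>pos: "0 < \<tau> kp" if "kp \<in> K" for kp using po[OF that lam[OF that]] \<tau>[OF that] by (simp add: periodic_orbit_def)
  have LZ: "L kp (Z kp t) (real m * \<tau> kp) = lam kp" if k: "kp \<in> K" for kp t
  proof -
    obtain t0 where t0: "Z kp (- t0) = \<theta> kp (lam kp)" using Z\<theta>[OF k] ..
    have "traj (f kp) D (\<theta> kp (lam kp)) (t + t0) = Z kp t" using orbit_traj[OF k Zo[OF k], of "- t0" "t + t0"] t0 by simp
    then show ?thesis using L\<mu>[OF k lam[OF k], of "t + t0"] \<tau>[OF k] by simp
  qed
  obtain t0 where t0: "Z kp0 (- t0) = \<theta> kp0 (lam kp0)" using Z\<theta>[OF kp0] ..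
  define Y where "Y t = Z kp0 (- t0 + t)" for t
  have Yo: "orbit_curve (f kp0) D Y" unfolding Y_def[abs_def] by (rule orbit_curve_shift[OF Zo[OF kp0]])
  have Y0: "Y 0 = \<theta> kp0 (lam kp0)" using t0 by (simp add: Y_def)
  have Yt: "Y (t + \<tau> kp0) = Y t" for t using Zt[OF kp0, of "- t0 + t"] unfolding Y_def add.assoc .
  have poY: "periodic_orbit (f kp0) D (Y 0) (\<tau> kp0)" using po[OF kp0 lam[OF kp0]] by (simp add: Y0 \<tau>[OF kp0])
  obtain j :: nat where j: "- (t0 + s0) / \<tau> kp0 < real j" using reals_Archimedean2 by blast
  define T where "T = t0 + s0 + real j * \<tau> kp0"
  have T: "0 \<le> T" using j \<tau>pos[OF kp0] by (simp add: T_def pos_divide_less_eq)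
  have YT: "Y T = Z kp0 s0" using periodic_multiple[of "Z kp0", OF Zt[OF kp0], of s0 j] by (simp add: Y_def T_def add.assoc)
  have nz: "f kp0 (Y t) \<noteq> 0" for t by (rule periodic_orbit_no_equilibrium[OF kp0 Yo poY])
  have nondeg: "h = 0 \<and> k = 0"
    if dL: "((%u. L kp0 (fst u) (snd u)) has_derivative Lf') (at (Z kp0 s0, real m * \<tau> kp0))"
      and ker: "dtraj kp0 (real m * \<tau> kp0) (Z kp0 s0) (k, h) = h" "Lf' (h, k) = 0" "h \<bullet> f kp0 (Z kp0 s0) = 0" for Lf' h k
  proof -
    define Lf where "Lf u = L kp0 (fst u) (snd u)" for u
    have n: "m_normal m (f kp0) D (Y 0) (\<tau> kp0)" using normal[OF kp0 lam[OF kp0]] by (simp add: Y0 \<tau>[OF kp0])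
    have "Ck_on (Suc 0) (\<theta> kp0) \<Lambda>" "Ck_on (Suc 0) (Per kp0) \<Lambda>"
      by (rule Ck_on_mono[OF \<theta>r[OF kp0]] Ck_on_mono[OF Perr[OF kp0]]; use r in simp)+
    then have "\<theta> kp0 differentiable at (lam kp0)" "Per kp0 differentiable at (lam kp0)"
      using Ck_on_has_derivative_open[OF _ \<Lambda> lam[OF kp0]] by (blast intro: differentiableI)+
    then have d\<theta>: "(\<theta> kp0 has_vector_derivative vector_derivative (\<theta> kp0) (at (lam kp0))) (at (lam kp0))"
      and dP: "(Per kp0 has_vector_derivative vector_derivative (Per kp0) (at (lam kp0))) (at (lam kp0))"
      by (simp_all add: vector_derivative_works)
    have per: "traj (f kp0) D (\<theta> kp0 \<mu>) (real m * Per kp0 \<mu>) = \<theta> kp0 \<mu>" if "\<mu> \<in> \<Lambda>" for \<mu>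
    proof -
      obtain Y' where Y': "orbit_curve (f kp0) D Y'" "Y' 0 = \<theta> kp0 \<mu>" "\<And>t. Y' (t + Per kp0 \<mu>) = Y' t"
        using curve[OF kp0 \<open>\<mu> \<in> \<Lambda>\<close>] by blast
      show ?thesis
        using orbit_traj[OF kp0 Y'(1), of 0 "real m * Per kp0 \<mu>"] periodic_multiple[of Y', OF Y'(3), of 0 m] Y'(2) by simp
    qed
    have dLf: "(Lf has_derivative Lf') (at (Y T, real m * \<tau> kp0))" using dL by (simp add: Lf_def[abs_def] YT)
    have L\<mu>f: "Lf (traj (f kp0) D (\<theta> kp0 \<mu>) T, real m * Per kp0 \<mu>) = \<mu>" if "\<mu> \<in> \<Lambda>" for \<mu>
      using L\<mu>[OF kp0 that] by (simp add: Lf_def)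
    have LY: "Lf (Y t, real m * \<tau> kp0) = lam kp0" for t using LZ[OF kp0] by (simp add: Lf_def Y_def)
    have ker': "dtraj kp0 (real m * \<tau> kp0) (Y T) (k, h) = h" "h \<bullet> f kp0 (Y T) = 0" using ker(1,3) by (simp_all add: YT)
    show ?thesis
      by (rule m_normal_nondegenerate[OF kp0 Yo \<tau>pos[OF kp0] Yt nz n T \<Lambda> lam[OF kp0] d\<theta> dP Y0[symmetric] \<tau>[OF kp0, symmetric]
            per dLf L\<mu>f LY ker'(1) ker(2) ker'(2)])
  qed
  have "melnikov_problem K D f g H I l m L p \<tau> lam Z s0 kp0"
  proof
    show "0 < m" "kp0 \<in> K" by (rule m kp0)+
    show "Ck_on 2 (%(kp, \<xi>, T). L kp \<xi> T) (K \<times> D \<times> {0<..})" "Ck_on 2 p K" "Ck_on 2 \<tau> K" "Ck_on 2 lam K"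
      by (rule Ck_on_mono[OF Lr r] Ck_on_mono[OF pr r] Ck_on_mono[OF \<tau>r r] Ck_on_mono[OF lamr r])+
    show "f kp0 (Z kp0 s0) \<noteq> 0" using nz[of T] by (simp add: YT)
  qed (rule \<tau>pos Zo Zp Zt LZ crit nondeg; assumption)+
  then show ?thesis by (rule exI[of "%Z. melnikov_problem K D f g H I l m L p \<tau> lam Z s0 kp0" Z])
qed

end


theorem theorem3p2:
  fixes U :: "(real^'n) set"
    and M :: "real \<Rightarrow> real^'n \<Rightarrow> real^'n^'n"
    and V :: "real \<Rightarrow> real^'n \<Rightarrow> real"
    and Q :: "real \<Rightarrow> 'n state \<Rightarrow> real \<Rightarrow> real \<Rightarrow> real \<Rightarrow> real^'n"
    and L :: "real \<Rightarrow> 'n state \<Rightarrow> real \<Rightarrow> real"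
    and \<theta> :: "real \<Rightarrow> real \<Rightarrow> 'n state" and Per :: "real \<Rightarrow> real \<Rightarrow> real"
    and p :: "real \<Rightarrow> 'n state" and \<tau> lam :: "real \<Rightarrow> real"
    and K \<Lambda> :: "real set" and \<epsilon>\<^sub>m s\<^sub>0 \<kappa>\<^sub>0 :: real and r l m :: nat
    and D :: "'n state set"
    and f :: "real \<Rightarrow> 'n state \<Rightarrow> 'n state"
    and g :: "real \<Rightarrow> 'n state \<Rightarrow> real \<Rightarrow> real \<Rightarrow> real \<Rightarrow> 'n state"
    and Mel :: "real \<Rightarrow> real \<Rightarrow> real"
    and Sol :: "real \<Rightarrow> real \<Rightarrow> real \<Rightarrow> real \<Rightarrow> ('n state \<times> real) set"
    and S :: "real \<Rightarrow> real \<Rightarrow> real \<Rightarrow> real \<Rightarrow> (real \<times> real) set"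
  defines "D \<equiv> U \<times> UNIV"
    and "f \<equiv> \<lambda>\<kappa>. conservative_field (M \<kappa>) (V \<kappa>)"
    and "g \<equiv> \<lambda>\<kappa>. perturbation_field (M \<kappa>) (Q \<kappa>)"
    and "Mel \<equiv> \<lambda>s \<kappa>. melnikov (f \<kappa>) (g \<kappa>) (energy (M \<kappa>) (V \<kappa>)) D (p \<kappa>) (\<tau> \<kappa>) m l s"
    and "Sol \<equiv> \<lambda>C \<epsilon> \<kappa> s. perturbed_solutions (f \<kappa>) (g \<kappa>) (L \<kappa>) D (p \<kappa>) (\<tau> \<kappa>) (lam \<kappa>) m l C \<epsilon> s"
    and "S \<equiv> \<lambda>C a b \<epsilon>. {(s, \<kappa>). s \<in> {s\<^sub>0 - a..s\<^sub>0 + a} \<and> \<kappa> \<in> {\<kappa>\<^sub>0 - b..\<kappa>\<^sub>0 + b} \<and> Sol C \<epsilon> \<kappa> s \<noteq> {}}"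
  assumes "3 \<le> r" and "0 < l" and "0 < m" and "coprime l m" and "\<kappa>\<^sub>0 \<in> K"
    and system: "mechanical_system r K U \<epsilon>\<^sub>m M V Q"
    and family: "orbit_family r m K f D L \<Lambda> \<theta> Per"
    and orbit: "selected_orbit r K f D \<Lambda> \<theta> Per p \<tau> lam"
    and parameter: "(\<forall>\<kappa>\<in>K. lam \<kappa> = \<kappa> \<and> M \<kappa> = M \<kappa>\<^sub>0 \<and> V \<kappa> = V \<kappa>\<^sub>0 \<and> Q \<kappa> = Q \<kappa>\<^sub>0 \<and> L \<kappa> = L \<kappa>\<^sub>0
                        \<and> \<theta> \<kappa> = \<theta> \<kappa>\<^sub>0 \<and> Per \<kappa> = Per \<kappa>\<^sub>0)
                    \<or> (\<forall>\<kappa>\<in>K. lam \<kappa> = lam \<kappa>\<^sub>0)"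
    and quadratic_zero: "Mel s\<^sub>0 \<kappa>\<^sub>0 = 0" "D1 Mel s\<^sub>0 \<kappa>\<^sub>0 = 0" "D1 (D1 Mel) s\<^sub>0 \<kappa>\<^sub>0 \<noteq> 0"
  shows "(D2 Mel s\<^sub>0 \<kappa>\<^sub>0 \<noteq> 0 \<longrightarrow>
           (\<exists>\<kappa>\<^sub>s\<^sub>n. (\<lambda>\<epsilon>. \<kappa>\<^sub>s\<^sub>n \<epsilon> - \<kappa>\<^sub>0) \<in> O[at_right 0](\<lambda>\<epsilon>. \<epsilon>) \<and>
             (\<forall>\<^sub>F C in at_top. \<forall>\<^sub>F a in at_right 0. \<forall>\<^sub>F b in at_right 0. \<forall>\<^sub>F \<epsilon> in at_right 0.
                saddle_node (\<lambda>\<kappa>. \<Union>s\<in>{s\<^sub>0 - a..s\<^sub>0 + a}. Sol C \<epsilon> \<kappa> s) {\<kappa>\<^sub>0 - b..\<kappa>\<^sub>0 + b} (\<kappa>\<^sub>s\<^sub>n \<epsilon>)))) \<and>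
         (D2 Mel s\<^sub>0 \<kappa>\<^sub>0 = 0 \<and> det (hessian Mel s\<^sub>0 \<kappa>\<^sub>0) > 0 \<longrightarrow>
           (\<forall>\<^sub>F C in at_top. \<forall>\<^sub>F a in at_right 0. \<forall>\<^sub>F b in at_right 0. \<forall>\<^sub>F \<epsilon> in at_right 0.
             isola_birth (S C a b \<epsilon>))) \<and>
         (D2 Mel s\<^sub>0 \<kappa>\<^sub>0 = 0 \<and> det (hessian Mel s\<^sub>0 \<kappa>\<^sub>0) < 0 \<longrightarrow>
           (\<forall>\<^sub>F C in at_top. \<forall>\<^sub>F a in at_right 0. \<forall>\<^sub>F b in at_right 0. \<forall>\<^sub>F \<epsilon> in at_right 0.
             simple_bifurcation (\<kappa>\<^sub>0 - b) (\<kappa>\<^sub>0 + b) (S C a b \<epsilon>)))"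
proof -
  have r2: "2 \<le> r" using \<open>3 \<le> r\<close> by simp
  let ?H = "\<lambda>\<kappa>. energy (M \<kappa>) (V \<kappa>)" and ?I = "{- sqrt \<epsilon>\<^sub>m<..<sqrt \<epsilon>\<^sub>m}"
  have pf: "perturbed_flow K D f g ?H ?I l"
    unfolding D_def f_def g_def by (rule mechanical_perturbed_flow(1)[OF system \<open>3 \<le> r\<close> \<open>0 < l\<close>])
  have critical: "f \<kappa>\<^sub>0 x = 0" if "x \<in> D" "grad (?H \<kappa>\<^sub>0) x = 0" for x
    using mechanical_perturbed_flow(2)[OF system \<open>3 \<le> r\<close> \<open>0 < l\<close> \<open>\<kappa>\<^sub>0 \<in> K\<close>] that unfolding D_def f_def by blast
  have "\<exists>Z. melnikov_problem K D f g ?H ?I l m L p \<tau> lam Z s\<^sub>0 \<kappa>\<^sub>0"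
    by (rule perturbed_flow.selected_orbit_melnikov_problem[OF pf family orbit r2 \<open>0 < m\<close> \<open>\<kappa>\<^sub>0 \<in> K\<close> critical])
  then obtain Z where mp: "melnikov_problem K D f g ?H ?I l m L p \<tau> lam Z s\<^sub>0 \<kappa>\<^sub>0" by (rule exE)
  from melnikov_problem.melnikov_reduction[OF mp]
  obtain R C0 B \<phi> where R: "0 < R" and B: "Ck_on 2 B (box3 R s\<^sub>0 \<kappa>\<^sub>0)" and \<phi>: "Ck_on 2 \<phi> (box3 R s\<^sub>0 \<kappa>\<^sub>0)"
    and box: "\<forall>\<eta> s \<kappa>. (\<eta>, s, \<kappa>) \<in> box3 R s\<^sub>0 \<kappa>\<^sub>0 \<longrightarrow> \<kappa> \<in> K \<and> \<bar>B (\<eta>, s, \<kappa>) - B (0, s, \<kappa>)\<bar> \<le> C0 * \<eta>\<^sup>2 \<and>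
       B (0, s, \<kappa>) = melnikov (f \<kappa>) (g \<kappa>) (?H \<kappa>) D (p \<kappa>) (\<tau> \<kappa>) m l s"
    and inj: "\<forall>\<eta> s s' \<kappa>. (\<eta>, s, \<kappa>) \<in> box3 R s\<^sub>0 \<kappa>\<^sub>0 \<longrightarrow> (\<eta>, s', \<kappa>) \<in> box3 R s\<^sub>0 \<kappa>\<^sub>0 \<longrightarrow> s < s' \<longrightarrow>
       fst (\<phi> (\<eta>, s, \<kappa>)) \<noteq> fst (\<phi> (\<eta>, s', \<kappa>))"
    and sol: "\<forall>C\<ge>C0. \<exists>e>0. \<forall>\<eta> s \<kappa>. (\<eta>, s, \<kappa>) \<in> box3 R s\<^sub>0 \<kappa>\<^sub>0 \<longrightarrow> 0 < \<eta> \<longrightarrow> \<eta> < e \<longrightarrow>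
       perturbed_solutions (f \<kappa>) (g \<kappa>) (L \<kappa>) D (p \<kappa>) (\<tau> \<kappa>) (lam \<kappa>) m l C (\<eta>\<^sup>2) s =
       (if B (\<eta>, s, \<kappa>) = 0 then {(fst (\<phi> (\<eta>, s, \<kappa>)), snd (\<phi> (\<eta>, s, \<kappa>)) / real l)} else {})"
    by (elim exE conjE) (rule that)
  define E where "E y = (fst (\<phi> y), snd (\<phi> y) / real l)" for y
  interpret rp: reduced_problem B E Mel Sol R C0 s\<^sub>0 \<kappa>\<^sub>0
  proof
    show "0 < R" "Ck_on 2 B (box3 R s\<^sub>0 \<kappa>\<^sub>0)" by (rule R B)+
    show "continuous_on (box3 R s\<^sub>0 \<kappa>\<^sub>0) E"
      unfolding E_def[abs_def] using \<open>0 < l\<close> by (intro continuous_intros Ck_on_imp_continuous_on[OF \<phi>]) simp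
    show "\<bar>B (\<eta>, s, \<kappa>) - B (0, s, \<kappa>)\<bar> \<le> C0 * \<eta>\<^sup>2" if "(\<eta>, s, \<kappa>) \<in> box3 R s\<^sub>0 \<kappa>\<^sub>0" for \<eta> s \<kappa>
      using box that by blast
    show "Mel s \<kappa> = B (0, s, \<kappa>)" if "\<bar>s - s\<^sub>0\<bar> < R" "\<bar>\<kappa> - \<kappa>\<^sub>0\<bar> < R" for s \<kappa>
    proof -
      have "(0, s, \<kappa>) \<in> box3 R s\<^sub>0 \<kappa>\<^sub>0" using that R by (simp add: box3_iff)
      then show ?thesis using box unfolding Mel_def by simp
    qed
    show "E (\<eta>, s, \<kappa>) \<noteq> E (\<eta>, s', \<kappa>)"
      if h: "(\<eta>, s, \<kappa>) \<in> box3 R s\<^sub>0 \<kappa>\<^sub>0" "(\<eta>, s', \<kappa>) \<in> box3 R s\<^sub>0 \<kappa>\<^sub>0" "s \<noteq> s'" for \<eta> s s' \<kappa>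
    proof (cases "s < s'")
      case True
      then have "fst (\<phi> (\<eta>, s, \<kappa>)) \<noteq> fst (\<phi> (\<eta>, s', \<kappa>))" using inj h by blast
      then show ?thesis by (simp add: E_def)
    next
      case False
      then have "s' < s" using h(3) by simp
      then have "fst (\<phi> (\<eta>, s', \<kappa>)) \<noteq> fst (\<phi> (\<eta>, s, \<kappa>))" using inj h by blast
      then show ?thesis by (simp add: E_def)
    qed
    show "\<exists>e>0. \<forall>\<eta> s \<kappa>. (\<eta>, s, \<kappa>) \<in> box3 R s\<^sub>0 \<kappa>\<^sub>0 \<longrightarrow> 0 < \<eta> \<longrightarrow> \<eta> < e \<longrightarrow>
      Sol C (\<eta>\<^sup>2) \<kappa> s = (if B (\<eta>, s, \<kappa>) = 0 then {E (\<eta>, s, \<kappa>)} else {})" if "C0 \<le> C" for C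
      unfolding Sol_def E_def using sol that by blast
    show "Mel s\<^sub>0 \<kappa>\<^sub>0 = 0" "D1 Mel s\<^sub>0 \<kappa>\<^sub>0 = 0" "D1 (D1 Mel) s\<^sub>0 \<kappa>\<^sub>0 \<noteq> 0" by (rule quadratic_zero)+
  qed
  show ?thesis
  proof (intro conjI impI)
    assume "D2 Mel s\<^sub>0 \<kappa>\<^sub>0 \<noteq> 0"
    then show "\<exists>\<kappa>\<^sub>s\<^sub>n. (\<lambda>\<epsilon>. \<kappa>\<^sub>s\<^sub>n \<epsilon> - \<kappa>\<^sub>0) \<in> O[at_right 0](\<lambda>\<epsilon>. \<epsilon>) \<and>
        (\<forall>\<^sub>F C in at_top. \<forall>\<^sub>F a in at_right 0. \<forall>\<^sub>F b in at_right 0. \<forall>\<^sub>F \<epsilon> in at_right 0.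
           saddle_node (\<lambda>\<kappa>. \<Union>s\<in>{s\<^sub>0 - a..s\<^sub>0 + a}. Sol C \<epsilon> \<kappa> s) {\<kappa>\<^sub>0 - b..\<kappa>\<^sub>0 + b} (\<kappa>\<^sub>s\<^sub>n \<epsilon>))"
      by (rule rp.saddle_node_solutions)
  next
    assume "D2 Mel s\<^sub>0 \<kappa>\<^sub>0 = 0 \<and> 0 < det (hessian Mel s\<^sub>0 \<kappa>\<^sub>0)"
    then show "\<forall>\<^sub>F C in at_top. \<forall>\<^sub>F a in at_right 0. \<forall>\<^sub>F b in at_right 0. \<forall>\<^sub>F \<epsilon> in at_right 0. isola_birth (S C a b \<epsilon>)"
      unfolding S_def by (elim conjE) (rule rp.isola_birth_solutions)
  next
    assume "D2 Mel s\<^sub>0 \<kappa>\<^sub>0 = 0 \<and> det (hessian Mel s\<^sub>0 \<kappa>\<^sub>0) < 0"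
    then show "\<forall>\<^sub>F C in at_top. \<forall>\<^sub>F a in at_right 0. \<forall>\<^sub>F b in at_right 0. \<forall>\<^sub>F \<epsilon> in at_right 0.
        simple_bifurcation (\<kappa>\<^sub>0 - b) (\<kappa>\<^sub>0 + b) (S C a b \<epsilon>)"
      unfolding S_def by (elim conjE) (rule rp.simple_bifurcation_solutions)
  qed
qed

end
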